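(* Let $1\le p\le\infty$, $\varphi_0\in\mathcal{S}(\mathbb{R}^n)\setminus\{0\}$ and $T>0$. Set $\varphi(t,x)=(e^{\frac12 it\Delta}\varphi_0)(x)$. Let $V\in C^\infty(\mathbb{R}\times\mathbb{R}^n)$ be real valued and suppose that for every multi-index $\alpha$ with $|\alpha|\ge 2$ there exists $C_\alpha>0$ such that $$|\partial_x^\alpha V(t,x)|\le C_\alpha\quad\text{for all }(t,x)\in\mathbb{R}\times\mathbb{R}^n .$$ Then there exists $C_T>0$ such that $$\|u(t,\cdot)\|_{M^{p,p}_{\varphi(t,\cdot)}}\le C_T\,\|u_0\|_{M^{p,p}_{\varphi_0}}$$ for all $u_0\in\mathcal{S}(\mathbb{R}^n)$ and all $t\in[-T,T]$, where $u(t,x)$ denotes the solution in $C(\mathbb{R};L^2(\mathbb{R}^n))$ of $$i\partial_t u(t,x)=-\tfrac12\Delta u(t,x)+V(t,x)u(t,x),\quad (t,x)\in\mathbb{R}\times\mathbb{R}^n,\qquad u(0,x)=u_0(x).$$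
   Context: $\Delta=\sum_{j=1}^n\partial^2/\partial x_j^2$. Fourier transform: $\mathcal{F}f(\xi)=\int_{\mathbb{R}^n}f(x)e^{-ix\cdot\xi}\,dx$ and $\mathcal{F}^{-1}f(x)=(2\pi)^{-n}\int_{\mathbb{R}^n}f(\xi)e^{ix\cdot\xi}\,d\xi$. The free Schrödinger propagator is $(e^{\frac12 it\Delta}f)(x)=\mathcal{F}^{-1}_{\xi\to x}[e^{-\frac12 it|\xi|^2}\mathcal{F}f(\xi)](x)$ for $f\in\mathcal{S}(\mathbb{R}^n)$. For $\varphi\in\mathcal{S}(\mathbb{R}^n)\setminus\{0\}$ (the window function) and $f\in\mathcal{S}'(\mathbb{R}^n)$, the wave packet transform (short-time Fourier transform) is $$W_\varphi f(x,\xi)=\int_{\mathbb{R}^n}\overline{\varphi(y-x)}\,f(y)\,e^{-iy\cdot\xi}\,dy .$$ For $1\le p,q\le\infty$ the modulation space norm with window $\varphi$ is $$\|f\|_{M^{p,q}_\varphi}=\big\|\,\|W_\varphi f(x,\xi)\|_{L^p_x}\big\|_{L^q_\xi}=\Big(\int_{\mathbb{R}^n}\Big(\int_{\mathbb{R}^n}|W_\varphi f(x,\xi)|^p\,dx\Big)^{q/p}d\xi\Big)^{1/q},$$ with the usual modifications if $p=\infty$ or $q=\infty$. In the norm $\|u(t,\cdot)\|_{M^{p,q}_{\varphi(t,\cdot)}}$ the window is the time-dependent function $\varphi(t,\cdot)$. *)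

theory Defs
  imports "HOL-Analysis.Analysis" "HOL-Probability.Essential_Supremum"
begin

section \<open>Smooth functions and partial derivatives\<close>

text \<open>The derivative of a differentiable function in the direction v. It is only ever used for
  smooth functions, so the value of \<^const>\<open>frechet_derivative\<close> at points of
  non-differentiability plays no role.\<close>

definition dir_deriv ::
  "'a::real_normed_vector \<Rightarrow> ('a \<Rightarrow> 'b::real_normed_vector) \<Rightarrow> 'a \<Rightarrow> 'b"
  where "dir_deriv v f x = frechet_derivative f (at x) v"

fun C_k :: "nat \<Rightarrow> ('a::euclidean_space \<Rightarrow> 'b::real_normed_vector) \<Rightarrow> bool"
  where
    "C_k 0 f \<longleftrightarrow> continuous_on UNIV f"
  | "C_k (Suc k) f \<longleftrightarrow> (\<forall>x. f differentiable (at x)) \<and> (\<forall>b\<in>Basis. C_k k (dir_deriv b f))"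

definition smooth :: "('a::euclidean_space \<Rightarrow> 'b::real_normed_vector) \<Rightarrow> bool"
  where "smooth f \<longleftrightarrow> (\<forall>k. C_k k f)"

definition partial ::
  "'n::finite \<Rightarrow> (real^'n \<Rightarrow> 'b::real_normed_vector) \<Rightarrow> real^'n \<Rightarrow> 'b"
  where "partial j = dir_deriv (axis j 1)"

definition laplacian ::
  "(real^'n::finite \<Rightarrow> 'b::real_normed_vector) \<Rightarrow> real^'n \<Rightarrow> 'b"
  where "laplacian f x = (\<Sum>j\<in>UNIV. partial j (partial j f) x)"

text \<open>Multi-indices are functions \<alpha> from the coordinate type to the naturals. The index type
  carries no order, so the order in which the partial derivatives are taken is an arbitrary fixed
  enumeration of the coordinates; it is immaterial for smooth functions.\<close>

type_synonym 'n multi_index = "'n \<Rightarrow> nat"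

definition mi_order :: "'n::finite multi_index \<Rightarrow> nat"
  where "mi_order \<alpha> = (\<Sum>j\<in>UNIV. \<alpha> j)"

definition coordinates :: "'n::finite list"
  where "coordinates = (SOME js. distinct js \<and> set js = UNIV)"

definition mi_deriv ::
  "'n::finite multi_index \<Rightarrow> (real^'n \<Rightarrow> 'b::real_normed_vector) \<Rightarrow> real^'n \<Rightarrow> 'b"
  where "mi_deriv \<alpha> f = foldr (\<lambda>j. partial j ^^ \<alpha> j) coordinates f"

definition mi_power :: "real^'n::finite \<Rightarrow> 'n multi_index \<Rightarrow> real"
  where "mi_power x \<alpha> = (\<Prod>j\<in>UNIV. (x $ j) ^ \<alpha> j)"

definition schwartz :: "(real^'n::finite \<Rightarrow> complex) \<Rightarrow> bool"
  where "schwartz f \<longleftrightarrow> smooth f \<and>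
    (\<forall>\<alpha> \<beta>. \<exists>C. \<forall>x. cmod (mi_power x \<alpha> *\<^sub>R mi_deriv \<beta> f x) \<le> C)"

section \<open>Fourier transform and free propagator\<close>

definition fourier :: "(real^'n::finite \<Rightarrow> complex) \<Rightarrow> real^'n \<Rightarrow> complex"
  where "fourier f \<xi> = (LINT x|lborel. f x * cis (- (x \<bullet> \<xi>)))"

definition inv_fourier :: "(real^'n::finite \<Rightarrow> complex) \<Rightarrow> real^'n \<Rightarrow> complex"
  where "inv_fourier f x =
    complex_of_real (inverse ((2 * pi) ^ CARD('n))) * (LINT \<xi>|lborel. f \<xi> * cis (x \<bullet> \<xi>))"

definition free_propagator ::
  "real \<Rightarrow> (real^'n::finite \<Rightarrow> complex) \<Rightarrow> real^'n \<Rightarrow> complex"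
  where "free_propagator t f = inv_fourier (\<lambda>\<xi>. cis (- (t * (norm \<xi>)\<^sup>2 / 2)) * fourier f \<xi>)"

section \<open>Lebesgue and modulation norms\<close>

text \<open>Norms take values in [0,\<infinity>]. The exponent a below is always positive.\<close>

definition ennreal_powr :: "ennreal \<Rightarrow> real \<Rightarrow> ennreal"
  where "ennreal_powr x a = (if x = \<infinity> then \<infinity> else ennreal (enn2real x powr a))"

definition Lp_norm :: "ennreal \<Rightarrow> ('a::euclidean_space \<Rightarrow> ennreal) \<Rightarrow> ennreal"
  where "Lp_norm p g =
    (if p = \<infinity> then esssup lborel g
     else ennreal_powr (\<integral>\<^sup>+ x. ennreal_powr (g x) (enn2real p) \<partial>lborel) (1 / enn2real p))"

definition wave_packet ::
  "(real^'n::finite \<Rightarrow> complex) \<Rightarrow> (real^'n \<Rightarrow> complex) \<Rightarrow> real^'n \<Rightarrow> real^'n \<Rightarrow> complex"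
  where "wave_packet \<phi> f x \<xi> = (LINT y|lborel. cnj (\<phi> (y - x)) * f y * cis (- (y \<bullet> \<xi>)))"

definition modulation_norm ::
  "ennreal \<Rightarrow> ennreal \<Rightarrow> (real^'n::finite \<Rightarrow> complex) \<Rightarrow> (real^'n \<Rightarrow> complex) \<Rightarrow> ennreal"
  where "modulation_norm p q \<phi> f =
    Lp_norm q (\<lambda>\<xi>. Lp_norm p (\<lambda>x. ennreal (cmod (wave_packet \<phi> f x \<xi>))))"

section \<open>Solutions of the Schroedinger equation\<close>

definition L2_function :: "('a::euclidean_space \<Rightarrow> complex) \<Rightarrow> bool"
  where "L2_function f \<longleftrightarrow>
    f \<in> borel_measurable lborel \<and> Lp_norm 2 (\<lambda>x. ennreal (cmod (f x))) < \<infinity>"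

definition continuous_L2 :: "(real \<Rightarrow> 'a::euclidean_space \<Rightarrow> complex) \<Rightarrow> bool"
  where "continuous_L2 u \<longleftrightarrow>
    (\<forall>t. L2_function (u t)) \<and>
    (\<forall>t. ((\<lambda>s. Lp_norm 2 (\<lambda>x. ennreal (cmod (u s x - u t x)))) \<longlongrightarrow> 0) (at t))"

definition test_function :: "('a::euclidean_space \<Rightarrow> complex) \<Rightarrow> bool"
  where "test_function \<psi> \<longleftrightarrow> smooth \<psi> \<and> compact (closure {z. \<psi> z \<noteq> 0})"

text \<open>A solution u in C(R; L2) of

    i (d/dt) u = - (1/2) Laplacian u + V u,   u(0) = u0,

  where the equation holds in the sense of distributions on R x R^n: all derivatives are moved to
  the test function \<psi>, the sign of the time derivative changing. An element u of C(R; L2) is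
  the distribution sending \<psi> to the integral over t of the pairing of u(t) with \<psi>(t, .);
  writing it as an iterated integral avoids choosing a jointly measurable representative of u.\<close>

definition schroedinger_solution ::
  "(real \<Rightarrow> real^'n::finite \<Rightarrow> real) \<Rightarrow> (real^'n \<Rightarrow> complex) \<Rightarrow> (real \<Rightarrow> real^'n \<Rightarrow> complex) \<Rightarrow> bool"
  where "schroedinger_solution V u0 u \<longleftrightarrow>
    continuous_L2 u \<and>
    (AE x in lborel. u 0 x = u0 x) \<and>
    (\<forall>\<psi> :: real \<times> (real^'n) \<Rightarrow> complex. test_function \<psi> \<longrightarrow>
      (LINT t|lborel. LINT x|lborel. u t x * (- \<i> * dir_deriv (1, 0) \<psi> (t, x))) =
      (LINT t|lborel. LINT x|lborel.
         u t x * (- (1/2) * laplacian (\<lambda>y. \<psi> (t, y)) x + complex_of_real (V t x) * \<psi> (t, x))))"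

end

theory Submission imports Defs "HOL-Probability.Probability" begin

text \<open>Fix a smooth compactly supported window and let W(t, z) be the overlap of u(t) with the wave
  packet centred at the phase space point z. Along a trajectory of the Hamiltonian flow of
  |\<xi>|^2/2 + V the Schroedinger equation turns into an ordinary differential equation for the
  overlap: up to a unimodular phase its derivative is the overlap of u with a packet built from the
  Laplacian of the window and from the window times the second order Taylor remainder of V, because
  the terms of order at most one are absorbed by the motion of the centre and by the phase. As all
  derivatives of V of order at least two are bounded, these modified packets form a bounded family
  of Schwartz functions, so the change of window formula bounds their overlap by the convolution of
  |W(t, .)| with a kernel decaying polynomially in phase space. The flow is bi-Lipschitz, hence
  distorts such kernels by bounded factors only, and Gronwall's inequality gives
  |W(t, z)| \<le> C \<integral> k(z - \<Phi>(t, v)) |W(0, v)| dv. The freely evolved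
  windows, t in [-T, T], are a bounded family of Schwartz functions as well, so the same estimate
  holds with them in place of the fixed window, and Schur's test turns it into the bound for the
  norms.\<close>

section \<open>Polynomially decaying kernels\<close>

text \<open>The solution is only continuous in \<open>L2\<close> and solves the equation in the
  sense of distributions, so it can be paired only with smooth compactly supported functions. Hence
  the flow argument runs with a fixed bump although \<phi>0 is merely Schwartz, and a change of
  window at each end pays for the detour. Gronwall runs on bounds of the form A * (eps + smear),
  because without eps no finite A is available to begin with. A crude \<open>L2\<close> bound
  divided by eps starts the iteration, each pass halves A up to a fixed constant, and eps tends to 0
  at the end. The iteration closes because convolving two kernels of order N reproduces a kernel of
  order N. The order N = 4n is twice the dimension 2n of phase space: at that order the kernel is
  dominated by a product of one-dimensional integrands 1/(1 + t^2).\<close>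

lemma lborel_eq_distr_reflect_translate:
  fixes c :: "'a::euclidean_space"
  assumes "s = 1 \<or> s = -1"
  shows "lborel = distr lborel borel (\<lambda>x. c + s *\<^sub>R x)"
proof -
  have "\<bar>s\<bar> ^ DIM('a) = 1" "s \<noteq> 0" using assms by auto
  then show ?thesis
    using lborel_affine[of s c] by (simp add: density_1 flip: one_ennreal_def)
qed

lemma nn_integral_lborel_translate:
  fixes c :: "'a::euclidean_space"
  assumes [measurable]: "f \<in> borel_measurable borel"
  shows "(\<integral>\<^sup>+x. f (x + c) \<partial>lborel) = (\<integral>\<^sup>+x. f x \<partial>lborel)"
    and "(\<integral>\<^sup>+x. f (c - x) \<partial>lborel) = (\<integral>\<^sup>+x. f x \<partial>lborel)"
    and "(\<integral>\<^sup>+x. f (x - c) \<partial>lborel) = (\<integral>\<^sup>+x. f x \<partial>lborel)"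
proof -
  show "(\<integral>\<^sup>+x. f (x + c) \<partial>lborel) = (\<integral>\<^sup>+x. f x \<partial>lborel)"
    by (subst (2) lborel_eq_distr_reflect_translate[of 1 c])
      (auto simp: nn_integral_distr add.commute)
  show "(\<integral>\<^sup>+x. f (c - x) \<partial>lborel) = (\<integral>\<^sup>+x. f x \<partial>lborel)"
    by (subst (2) lborel_eq_distr_reflect_translate[of "-1" c])
      (auto simp: nn_integral_distr)
  show "(\<integral>\<^sup>+x. f (x - c) \<partial>lborel) = (\<integral>\<^sup>+x. f x \<partial>lborel)"
    by (subst (2) lborel_eq_distr_reflect_translate[of 1 "-c"])
      (auto simp: nn_integral_distr)
qed

lemma integral_lborel_translate:
  fixes c :: "'a::euclidean_space" and f :: "'a \<Rightarrow> 'b::{banach, second_countable_topology}"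
  assumes [measurable]: "f \<in> borel_measurable borel"
  shows "(LINT x|lborel. f (x + c)) = (LINT x|lborel. f x)"
    and "(LINT x|lborel. f (c - x)) = (LINT x|lborel. f x)"
    and "(LINT x|lborel. f (x - c)) = (LINT x|lborel. f x)"
proof -
  show "(LINT x|lborel. f (x + c)) = (LINT x|lborel. f x)"
    by (subst (2) lborel_eq_distr_reflect_translate[of 1 c])
      (auto simp: integral_distr add.commute)
  show "(LINT x|lborel. f (c - x)) = (LINT x|lborel. f x)"
    by (subst (2) lborel_eq_distr_reflect_translate[of "-1" c])
      (auto simp: integral_distr)
  show "(LINT x|lborel. f (x - c)) = (LINT x|lborel. f x)"
    by (subst (2) lborel_eq_distr_reflect_translate[of 1 "-c"])
      (auto simp: integral_distr)
qed

lemma integrable_lborel_translate: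
  fixes c :: "'a::euclidean_space" and f :: "'a \<Rightarrow> 'b::{banach, second_countable_topology}"
  assumes "integrable lborel f"
  shows "integrable lborel (\<lambda>x. f (x + c))"
    and "integrable lborel (\<lambda>x. f (c - x))"
    and "integrable lborel (\<lambda>x. f (x - c))"
proof -
  have [measurable]: "f \<in> borel_measurable borel" using assms by auto
  have *: "integrable lborel (\<lambda>x. f (c + s *\<^sub>R x))" if "s = 1 \<or> s = -1" for c s
  proof -
    have "integrable (distr lborel borel (\<lambda>x. c + s *\<^sub>R x)) f"
      using lborel_eq_distr_reflect_translate[OF that, of c] assms by simp
    then show ?thesis by (simp add: integrable_distr_eq)
  qed
  show "integrable lborel (\<lambda>x. f (x + c))" using *[of 1 c] by (simp add: add.commute)
  show "integrable lborel (\<lambda>x. f (c - x))" using *[of "-1" c] by simp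
  show "integrable lborel (\<lambda>x. f (x - c))" using *[of 1 "-c"] by (simp add: add.commute)
qed

lemma integral_lborel_scale:
  fixes f :: "'a::euclidean_space \<Rightarrow> 'b::{banach, second_countable_topology}"
  assumes [measurable]: "f \<in> borel_measurable borel" and "e > 0"
  shows "(LINT x|lborel. f x) = e ^ DIM('a) *\<^sub>R (LINT x|lborel. f (c + e *\<^sub>R x))"
  by (subst lborel_affine[of e c])
    (use assms in \<open>auto simp: integral_density integral_distr\<close>)

text \<open>The base 1 + |z| is linear in the norm, so the triangle inequality and Lipschitz bounds
  act on it directly.\<close>

definition kern :: "nat \<Rightarrow> 'a::real_normed_vector \<Rightarrow> real"
  where "kern N z = inverse ((1 + norm z) ^ N)"

lemma kern_pos: "kern N z > 0"
  unfolding kern_def by (simp add: add_pos_nonneg)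

lemma kern_nonneg [simp]: "0 \<le> kern N z"
  using kern_pos[of N z] by simp

lemma kern_uminus [simp]: "kern N (- z) = kern N z"
  unfolding kern_def by simp

lemma kern_minus_commute: "kern N (a - b) = kern N (b - a)"
  unfolding kern_def by (simp add: norm_minus_commute)

lemma continuous_on_kern [continuous_intros]:
  "continuous_on S f \<Longrightarrow> continuous_on S (\<lambda>x. kern N (f x))"
  unfolding kern_def
  by (intro continuous_intros) (auto simp: add_nonneg_eq_0_iff)

lemma borel_measurable_kern [measurable]:
  "kern N \<in> borel_measurable (borel :: 'a::{real_normed_vector, second_countable_topology} measure)"
  by (intro borel_measurable_continuous_onI continuous_intros)

text \<open>Every distortion of the kernels by the flow is estimated through this comparison: it
  costs the factor L^N. It reduces to 1 + |b| <= L (1 + |a|), where L >= 1 takes care of the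
  constant 1.\<close>

lemma kern_scale:
  assumes "norm b \<le> L * norm a" "L \<ge> 1"
  shows "kern N a \<le> L ^ N * kern N b"
proof -
  have "1 + norm b \<le> L * (1 + norm a)" using assms by (simp add: algebra_simps)
  then have "(1 + norm b) ^ N \<le> (L * (1 + norm a)) ^ N" by (intro power_mono) auto
  then have "(1 + norm b) ^ N \<le> L ^ N * (1 + norm a) ^ N" by (simp add: power_mult_distrib)
  moreover have "(1 + norm b) ^ N > 0" "(1 + norm a) ^ N > 0" by (simp_all add: add_pos_nonneg)
  ultimately show ?thesis unfolding kern_def by (simp add: field_simps)
qed

lemma kern_antimono: "norm a \<le> norm b \<Longrightarrow> kern N b \<le> kern N a"
  using kern_scale[of a 1 b N] by simp

text \<open>One of the two legs a - w, w - b is at least half as long as a - b. The kernel of that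
  leg is at most 2^N \<open>kern N (a - b)\<close>, while the other factor stays available for
  integration in w.\<close>

lemma kern_prod_le:
  "kern N (a - w) * kern N (w - b) \<le> 2 ^ N * kern N (a - b) * (kern N (a - w) + kern N (w - b))"
proof -
  have "norm (a - b) \<le> norm (a - w) + norm (w - b)"
    using norm_triangle_ineq[of "a - w" "w - b"] by simp
  then consider "norm (a - b) \<le> 2 * norm (a - w)" | "norm (a - b) \<le> 2 * norm (w - b)" by linarith
  then show ?thesis
  proof cases
    case 1
    from kern_scale[OF this, of N] have "kern N (a - w) \<le> 2 ^ N * kern N (a - b)" by simp
    from mult_right_mono[OF this, of "kern N (w - b)"]
    have "kern N (a - w) * kern N (w - b) \<le> 2 ^ N * kern N (a - b) * kern N (w - b)" by simp
    moreover have "0 \<le> 2 ^ N * kern N (a - b) * kern N (a - w)" by simp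
    ultimately show ?thesis unfolding distrib_left by linarith
  next
    case 2
    from kern_scale[OF this, of N] have "kern N (w - b) \<le> 2 ^ N * kern N (a - b)" by simp
    from mult_left_mono[OF this, of "kern N (a - w)"]
    have "kern N (a - w) * kern N (w - b) \<le> 2 ^ N * kern N (a - b) * kern N (a - w)"
      by (simp add: mult.commute)
    moreover have "0 \<le> 2 ^ N * kern N (a - b) * kern N (w - b)" by simp
    ultimately show ?thesis unfolding distrib_left by linarith
  qed
qed

lemma nn_integral_inverse_square: "(\<integral>\<^sup>+t. ennreal (inverse (1 + t\<^sup>2)) \<partial>lborel) < \<infinity>"
proof -
  have "integrable lborel (\<lambda>t::real. inverse (1 + t\<^sup>2))"
    using integrable_inverse_1_plus_square by (simp add: set_integrable_def)
  then show ?thesis unfolding integrable_iff_bounded by simp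
qed

text \<open>Each coordinate satisfies 1 + (z . b)^2 <= (1 + |z|)^2. Spending two powers of the
  kernel per coordinate gives a product of integrable functions of one variable; this is the origin
  of the threshold \<open>2 * DIM('a)\<close>.\<close>

lemma nn_integral_kern_finite:
  assumes "2 * DIM('a) \<le> N"
  shows "(\<integral>\<^sup>+z. ennreal (kern N (z::'a::euclidean_space)) \<partial>lborel) < \<infinity>"
proof -
  have "kern N z \<le> (\<Prod>b\<in>Basis. inverse (1 + (z \<bullet> b)\<^sup>2))" for z :: 'a
  proof -
    have *: "1 + (z \<bullet> b)\<^sup>2 \<le> (1 + norm z)\<^sup>2" if "b \<in> Basis" for b
    proof -
      have "\<bar>z \<bullet> b\<bar> \<le> norm z" using Basis_le_norm[OF that] by simp
      from power_mono[OF this, of 2] have "(z \<bullet> b)\<^sup>2 \<le> (norm z)\<^sup>2" by simp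
      then show ?thesis unfolding power2_sum by (simp add: add_increasing2)
    qed
    have "kern N z \<le> kern (2 * DIM('a)) z"
      unfolding kern_def using assms by (intro le_imp_inverse_le power_increasing) (auto simp: add_pos_nonneg)
    also have "\<dots> = (\<Prod>b\<in>(Basis::'a set). inverse ((1 + norm z)\<^sup>2))"
      unfolding kern_def by (simp add: power_mult power_inverse)
    also have "\<dots> \<le> (\<Prod>b\<in>Basis. inverse (1 + (z \<bullet> b)\<^sup>2))"
      by (intro prod_mono conjI le_imp_inverse_le *) (auto intro: add_pos_nonneg)
    finally show ?thesis .
  qed
  then have "(\<integral>\<^sup>+z. ennreal (kern N (z::'a)) \<partial>lborel)
     \<le> (\<integral>\<^sup>+z. (\<Prod>b\<in>Basis. ennreal (inverse (1 + (z \<bullet> b)\<^sup>2))) \<partial>(lborel::'a measure))"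
    by (intro nn_integral_mono) (auto simp: prod_ennreal intro!: ennreal_leI)
  also have "\<dots> = (\<Prod>b\<in>(Basis::'a set). (\<integral>\<^sup>+t. ennreal (inverse (1 + t\<^sup>2)) \<partial>lborel))"
    by (rule nn_integral_lborel_prod[of "\<lambda>b t. ennreal (inverse (1 + t\<^sup>2))"]) auto
  also have "\<dots> < \<infinity>"
    using nn_integral_inverse_square by (simp add: power_less_top_ennreal)
  finally show ?thesis .
qed

lemma integrable_kern:
  assumes "2 * DIM('a) \<le> N"
  shows "integrable lborel (kern N :: 'a::euclidean_space \<Rightarrow> real)"
  using nn_integral_kern_finite[OF assms] by (simp add: integrable_iff_bounded)

definition kern_mass :: "nat \<Rightarrow> 'a::euclidean_space itself \<Rightarrow> real"
  where "kern_mass N _ = (LINT z|lborel. kern N (z::'a))"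

lemma kern_mass_nonneg [simp]: "0 \<le> kern_mass N TYPE('a::euclidean_space)"
  unfolding kern_mass_def by simp

lemma nn_integral_kern:
  assumes "2 * DIM('a) \<le> N"
  shows "(\<integral>\<^sup>+z. ennreal (kern N (z::'a::euclidean_space)) \<partial>lborel) = ennreal (kern_mass N TYPE('a))"
    and "(\<integral>\<^sup>+z. ennreal (kern N (c - z::'a::euclidean_space)) \<partial>lborel) = ennreal (kern_mass N TYPE('a))"
    and "(\<integral>\<^sup>+z. ennreal (kern N (z - c::'a::euclidean_space)) \<partial>lborel) = ennreal (kern_mass N TYPE('a))"
proof -
  show *: "(\<integral>\<^sup>+z. ennreal (kern N (z::'a::euclidean_space)) \<partial>lborel) = ennreal (kern_mass N TYPE('a))"
    unfolding kern_mass_def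
    by (rule nn_integral_eq_integral[OF integrable_kern[OF assms]]) auto
  show "(\<integral>\<^sup>+z. ennreal (kern N (c - z::'a::euclidean_space)) \<partial>lborel) = ennreal (kern_mass N TYPE('a))"
    "(\<integral>\<^sup>+z. ennreal (kern N (z - c::'a::euclidean_space)) \<partial>lborel) = ennreal (kern_mass N TYPE('a))"
    using * by (simp_all add: nn_integral_lborel_translate[of "\<lambda>z. ennreal (kern N z)"])
qed

text \<open>Self-reproduction of the kernel, which lets the Gronwall iteration return to its
  starting form. In 2^(N + 1), the factor 2^N comes from \<open>kern_prod_le\<close> and the last 2
  from its two summands.\<close>

lemma nn_integral_kern_conv:
  assumes "2 * DIM('a) \<le> N"
  shows "(\<integral>\<^sup>+w. ennreal (kern N (a - w)) * ennreal (kern N (w - b)) \<partial>lborel)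
    \<le> ennreal (2 ^ (N + 1) * kern_mass N TYPE('a)) * ennreal (kern N (a - b :: 'a::euclidean_space))"
proof -
  have "(\<integral>\<^sup>+w. ennreal (kern N (a - w)) * ennreal (kern N (w - b)) \<partial>lborel)
    \<le> (\<integral>\<^sup>+w. ennreal (2 ^ N * kern N (a - b)) * (ennreal (kern N (a - w)) + ennreal (kern N (w - b))) \<partial>lborel)"
    using kern_prod_le[of N a _ b]
    by (intro nn_integral_mono)
      (auto simp flip: ennreal_mult ennreal_plus intro!: ennreal_leI)
  also have "\<dots> = ennreal (2 ^ N * kern N (a - b)) * (ennreal (kern_mass N TYPE('a)) + ennreal (kern_mass N TYPE('a)))"
    using nn_integral_kern(2,3)[OF assms] by (simp add: nn_integral_cmult nn_integral_add)
  also have "\<dots> = ennreal (2 ^ (N + 1) * kern_mass N TYPE('a)) * ennreal (kern N (a - b))"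
    by (simp flip: ennreal_mult ennreal_plus add: algebra_simps)
  finally show ?thesis .
qed

lemma norm_Pair_le_add: "norm (a, b) \<le> norm a + norm b"
  using norm_Pair_le by auto

text \<open>Decay in position and decay in frequency are obtained by different arguments; since |(x,
  \<xi>)| is at most twice the larger of the two norms, they combine to decay in phase
  space.\<close>

lemma le_kern_Pair:
  assumes 1: "(1 + norm x) ^ N * v \<le> C" and 2: "(1 + norm \<xi>) ^ N * v \<le> C" and v: "0 \<le> v"
  shows "v \<le> C * 2 ^ N * kern N (x, \<xi>)"
proof -
  define m where "m = max (norm x) (norm \<xi>)"
  have m: "(1 + m) ^ N * v \<le> C" using 1 2 unfolding m_def max_def by auto
  have "1 + norm (x, \<xi>) \<le> 2 * (1 + m)"
    using norm_Pair_le_add[of x \<xi>] unfolding m_def by (simp add: max_def)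
  then have "(1 + norm (x, \<xi>)) ^ N \<le> (2 * (1 + m)) ^ N" by (intro power_mono) auto
  then have "(1 + norm (x, \<xi>)) ^ N * v \<le> (2 * (1 + m)) ^ N * v" using v by (rule mult_right_mono)
  also have "\<dots> \<le> 2 ^ N * C" using m by (simp only: power_mult_distrib mult.assoc) simp
  finally have "(1 + norm (x, \<xi>)) ^ N * v \<le> 2 ^ N * C" .
  moreover have "(1 + norm (x, \<xi>)) ^ N > 0" by (simp add: add_pos_nonneg)
  ultimately show ?thesis unfolding kern_def by (simp add: field_simps)
qed

lemma kern_Pair_le_snd: "kern N (x, \<xi>) \<le> kern N \<xi>"
  by (rule kern_antimono) (rule norm_snd_le)

section \<open>Fourier transforms of families of rapidly decreasing functions\<close>

text \<open>A derivative along lines, given as a relation between f and f'. Its calculus is that of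
  functions of one real variable, and the derivative can be carried as explicit data.\<close>

definition pd :: "'n::finite \<Rightarrow> (real^'n \<Rightarrow> complex) \<Rightarrow> (real^'n \<Rightarrow> complex) \<Rightarrow> bool"
  where "pd j f f' \<longleftrightarrow> (\<forall>y. ((\<lambda>s. f (y + s *\<^sub>R axis j 1)) has_vector_derivative f' y) (at 0))"

text \<open>The constant may depend on N but not on the index p. Indices range over times, over
  centres of packets, or over \<open>unit\<close> for a single function, so one calculus delivers
  all uniform bounds.\<close>

definition decays :: "'p set \<Rightarrow> ('p \<Rightarrow> real^'n::finite \<Rightarrow> complex) \<Rightarrow> bool"
  where "decays P f \<longleftrightarrow> (\<forall>p\<in>P. continuous_on UNIV (f p)) \<and>
    (\<forall>N. \<exists>C. \<forall>p\<in>P. \<forall>y. (1 + norm y) ^ N * cmod (f p y) \<le> C)"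

definition grows :: "'p set \<Rightarrow> ('p \<Rightarrow> real^'n::finite \<Rightarrow> complex) \<Rightarrow> bool"
  where "grows P f \<longleftrightarrow> (\<forall>p\<in>P. continuous_on UNIV (f p)) \<and>
    (\<exists>N C. \<forall>p\<in>P. \<forall>y. cmod (f p y) \<le> C * (1 + norm y) ^ N)"

text \<open>Only pure derivatives in one coordinate direction are recorded: integration by parts in each
  coordinate separately is enough for the decay of a Fourier transform.\<close>

fun RD :: "nat \<Rightarrow> 'n::finite \<Rightarrow> 'p set \<Rightarrow> ('p \<Rightarrow> real^'n \<Rightarrow> complex) \<Rightarrow> bool"
  where
    "RD 0 j P f \<longleftrightarrow> decays P f"
  | "RD (Suc k) j P f \<longleftrightarrow> decays P f \<and> (\<exists>f'. (\<forall>p\<in>P. pd j (f p) (f' p)) \<and> RD k j P f')"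

fun PG :: "nat \<Rightarrow> 'n::finite \<Rightarrow> 'p set \<Rightarrow> ('p \<Rightarrow> real^'n \<Rightarrow> complex) \<Rightarrow> bool"
  where
    "PG 0 j P f \<longleftrightarrow> grows P f"
  | "PG (Suc k) j P f \<longleftrightarrow> grows P f \<and> (\<exists>f'. (\<forall>p\<in>P. pd j (f p) (f' p)) \<and> PG k j P f')"

section \<open>Closure properties of the decaying and the growing classes\<close>

lemma pd_add: "pd j f f' \<Longrightarrow> pd j g g' \<Longrightarrow> pd j (\<lambda>y. f y + g y) (\<lambda>y. f' y + g' y)"
  unfolding pd_def by (auto intro!: derivative_eq_intros)

lemma pd_mult: "pd j f f' \<Longrightarrow> pd j g g' \<Longrightarrow> pd j (\<lambda>y. f y * g y) (\<lambda>y. f y * g' y + f' y * g y)"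
  unfolding pd_def by (fastforce intro!: derivative_eq_intros)

lemma pd_cnj: "pd j f f' \<Longrightarrow> pd j (\<lambda>y. cnj (f y)) (\<lambda>y. cnj (f' y))"
  unfolding pd_def by (auto intro!: derivative_eq_intros)

lemma pd_const: "pd j (\<lambda>y. c) (\<lambda>y. 0)"
  unfolding pd_def by (auto intro!: derivative_eq_intros)

lemma pd_coord: "pd j (\<lambda>y. complex_of_real (y $ i)) (\<lambda>y. if i = j then 1 else 0)"
  unfolding pd_def by (auto intro!: derivative_eq_intros has_vector_derivative_of_real simp: axis_def)

lemma pd_translate: "pd j f f' \<Longrightarrow> pd j (\<lambda>y. f (y - x)) (\<lambda>y. f' (y - x))"
  unfolding pd_def
proof
  fix y assume "\<forall>y. ((\<lambda>s. f (y + s *\<^sub>R axis j 1)) has_vector_derivative f' y) (at 0)"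
  then have "((\<lambda>s. f (y - x + s *\<^sub>R axis j 1)) has_vector_derivative f' (y - x)) (at 0)" by blast
  then show "((\<lambda>s. f (y + s *\<^sub>R axis j 1 - x)) has_vector_derivative f' (y - x)) (at 0)"
    by (simp add: diff_add_eq)
qed

lemma pd_uminus:
  assumes "pd j f f'"
  shows "pd j (\<lambda>y. f (- y)) (\<lambda>y. - f' (- y))"
  unfolding pd_def
proof
  fix y
  have "((\<lambda>s. f (- y + s *\<^sub>R axis j 1)) has_vector_derivative f' (- y)) (at (- 0))"
    using assms unfolding pd_def by (metis minus_zero)
  then have "((\<lambda>s. f (- y + s *\<^sub>R axis j 1)) \<circ> uminus has_vector_derivative (-1) *\<^sub>R f' (- y)) (at 0)"
    by (intro vector_diff_chain_at) (auto intro!: derivative_eq_intros)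
  moreover have "(\<lambda>s. f (- y + s *\<^sub>R axis j 1)) \<circ> uminus = (\<lambda>s. f (- (y + s *\<^sub>R axis j 1)))"
    by (auto simp: fun_eq_iff intro!: arg_cong[of _ _ f])
  ultimately show "((\<lambda>s. f (- (y + s *\<^sub>R axis j 1))) has_vector_derivative - f' (- y)) (at 0)"
    by simp
qed

lemma decaysD:
  assumes "decays P f" obtains C where "C > 0" "\<And>p y. p \<in> P \<Longrightarrow> (1 + norm y) ^ N * cmod (f p y) \<le> C"
proof -
  from assms obtain C where "\<And>p y. p \<in> P \<Longrightarrow> (1 + norm y) ^ N * cmod (f p y) \<le> C"
    unfolding decays_def by blast
  then show ?thesis using that[of "max C 1"] by (auto simp: le_max_iff_disj)
qed

lemma growsD:
  assumes "grows P f" obtains N C where "C > 0" "\<And>p y. p \<in> P \<Longrightarrow> cmod (f p y) \<le> C * (1 + norm y) ^ N"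
proof -
  from assms obtain N C where C: "\<And>p y. p \<in> P \<Longrightarrow> cmod (f p y) \<le> C * (1 + norm y) ^ N"
    unfolding grows_def by blast
  have "cmod (f p y) \<le> max C 1 * (1 + norm y) ^ N" if "p \<in> P" for p y
    using C[OF that, of y] mult_right_mono[of C "max C 1" "(1 + norm y) ^ N"] by auto
  then show ?thesis using that[of "max C 1" N] by auto
qed

lemma decays_cont: "decays P f \<Longrightarrow> p \<in> P \<Longrightarrow> continuous_on UNIV (f p)"
  unfolding decays_def by blast

lemma grows_cont: "grows P f \<Longrightarrow> p \<in> P \<Longrightarrow> continuous_on UNIV (f p)"
  unfolding grows_def by blast

lemma decays_add:
  assumes "decays P f" "decays P g" shows "decays P (\<lambda>p y. f p y + g p y)"
  unfolding decays_def
proof (intro conjI allI ballI)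
  show "continuous_on UNIV (\<lambda>y. f p y + g p y)" if "p \<in> P" for p
    using assms that by (auto intro!: continuous_intros dest: decays_cont)
  fix N
  obtain C where C: "\<And>p y. p \<in> P \<Longrightarrow> (1 + norm y) ^ N * cmod (f p y) \<le> C" using decaysD[OF assms(1)] by metis
  obtain D where D: "\<And>p y. p \<in> P \<Longrightarrow> (1 + norm y) ^ N * cmod (g p y) \<le> D" using decaysD[OF assms(2)] by metis
  have "(1 + norm y) ^ N * cmod (f p y + g p y) \<le> C + D" if "p \<in> P" for p y
  proof -
    have "(1 + norm y) ^ N * cmod (f p y + g p y) \<le> (1 + norm y) ^ N * (cmod (f p y) + cmod (g p y))"
      by (intro mult_left_mono norm_triangle_ineq) auto
    then show ?thesis using C[OF that, of y] D[OF that, of y] by (simp add: distrib_left)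
  qed
  then show "\<exists>C. \<forall>p\<in>P. \<forall>y. (1 + norm y) ^ N * cmod (f p y + g p y) \<le> C" by blast
qed

lemma grows_add:
  assumes "grows P f" "grows P g" shows "grows P (\<lambda>p y. f p y + g p y)"
  unfolding grows_def
proof (intro conjI ballI)
  show "continuous_on UNIV (\<lambda>y. f p y + g p y)" if "p \<in> P" for p
    using assms that by (auto intro!: continuous_intros dest: grows_cont)
  obtain N C where C: "C > 0" "\<And>p y. p \<in> P \<Longrightarrow> cmod (f p y) \<le> C * (1 + norm y) ^ N" using growsD[OF assms(1)] by metis
  obtain M D where D: "D > 0" "\<And>p y. p \<in> P \<Longrightarrow> cmod (g p y) \<le> D * (1 + norm y) ^ M" using growsD[OF assms(2)] by metis
  have "cmod (f p y + g p y) \<le> (C + D) * (1 + norm y) ^ (N + M)" if "p \<in> P" for p y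
  proof -
    have "(1 + norm y) ^ N \<le> (1 + norm y) ^ (N + M)" "(1 + norm y) ^ M \<le> (1 + norm y) ^ (N + M)"
      by (auto intro!: power_increasing)
    then have "C * (1 + norm y) ^ N \<le> C * (1 + norm y) ^ (N + M)" "D * (1 + norm y) ^ M \<le> D * (1 + norm y) ^ (N + M)"
      using C(1) D(1) by auto
    then show ?thesis
      using C(2)[OF that, of y] D(2)[OF that, of y] norm_triangle_ineq[of "f p y" "g p y"]
      unfolding distrib_right by linarith
  qed
  then show "\<exists>N C. \<forall>p\<in>P. \<forall>y. cmod (f p y + g p y) \<le> C * (1 + norm y) ^ N" by blast
qed

lemma decays_mult:
  assumes "decays P f" "grows P g" shows "decays P (\<lambda>p y. f p y * g p y)"
  unfolding decays_def
proof (intro conjI allI ballI)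
  show "continuous_on UNIV (\<lambda>y. f p y * g p y)" if "p \<in> P" for p
    using assms that by (auto intro!: continuous_intros dest: grows_cont decays_cont)
  fix N
  obtain M D where D: "D > 0" "\<And>p y. p \<in> P \<Longrightarrow> cmod (g p y) \<le> D * (1 + norm y) ^ M" using growsD[OF assms(2)] by metis
  obtain C where C: "C > 0" "\<And>p y. p \<in> P \<Longrightarrow> (1 + norm y) ^ (N + M) * cmod (f p y) \<le> C"
    using decaysD[OF assms(1)] by metis
  have "(1 + norm y) ^ N * cmod (f p y * g p y) \<le> C * D" if "p \<in> P" for p y
  proof -
    have "(1 + norm y) ^ N * cmod (f p y * g p y) \<le> (1 + norm y) ^ N * (cmod (f p y) * (D * (1 + norm y) ^ M))"
      unfolding norm_mult using D(2)[OF that, of y] by (intro mult_left_mono) auto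
    also have "\<dots> = ((1 + norm y) ^ (N + M) * cmod (f p y)) * D" by (simp add: power_add)
    also have "\<dots> \<le> C * D" using C(2)[OF that, of y] D(1) by (intro mult_right_mono) auto
    finally show ?thesis .
  qed
  then show "\<exists>C. \<forall>p\<in>P. \<forall>y. (1 + norm y) ^ N * cmod (f p y * g p y) \<le> C" by blast
qed

lemma grows_mult:
  assumes "grows P f" "grows P g" shows "grows P (\<lambda>p y. f p y * g p y)"
  unfolding grows_def
proof (intro conjI ballI)
  show "continuous_on UNIV (\<lambda>y. f p y * g p y)" if "p \<in> P" for p
    using assms that by (auto intro!: continuous_intros dest: grows_cont)
  obtain N C where C: "C > 0" "\<And>p y. p \<in> P \<Longrightarrow> cmod (f p y) \<le> C * (1 + norm y) ^ N" using growsD[OF assms(1)] by metis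
  obtain M D where D: "D > 0" "\<And>p y. p \<in> P \<Longrightarrow> cmod (g p y) \<le> D * (1 + norm y) ^ M" using growsD[OF assms(2)] by metis
  have "cmod (f p y * g p y) \<le> (C * D) * (1 + norm y) ^ (N + M)" if "p \<in> P" for p y
    using mult_mono[OF C(2)[OF that, of y] D(2)[OF that, of y]] C(1)
    by (simp add: norm_mult power_add mult_ac)
  then show "\<exists>N C. \<forall>p\<in>P. \<forall>y. cmod (f p y * g p y) \<le> C * (1 + norm y) ^ N" by blast
qed

lemma RD_SucI:
  "decays P f \<Longrightarrow> (\<And>p. p \<in> P \<Longrightarrow> pd j (f p) (f' p)) \<Longrightarrow> RD k j P f' \<Longrightarrow> RD (Suc k) j P f"
  by auto

lemma PG_SucI:
  "grows P f \<Longrightarrow> (\<And>p. p \<in> P \<Longrightarrow> pd j (f p) (f' p)) \<Longrightarrow> PG k j P f' \<Longrightarrow> PG (Suc k) j P f"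
  by auto

lemma RD_decays: "RD k j P f \<Longrightarrow> decays P f" by (cases k) auto
lemma PG_grows: "PG k j P f \<Longrightarrow> grows P f" by (cases k) auto

lemma RD_Suc: "RD (Suc k) j P f \<Longrightarrow> RD k j P f"
  by (induction k arbitrary: f) (auto intro: RD_decays)

lemma PG_Suc: "PG (Suc k) j P f \<Longrightarrow> PG k j P f"
  by (induction k arbitrary: f) (auto intro: PG_grows)

lemma RD_add: "RD k j P f \<Longrightarrow> RD k j P g \<Longrightarrow> RD k j P (\<lambda>p y. f p y + g p y)"
proof (induction k arbitrary: f g)
  case (Suc k)
  from Suc.prems obtain f' g' where f': "\<And>p. p \<in> P \<Longrightarrow> pd j (f p) (f' p)" "RD k j P f'"
    and g': "\<And>p. p \<in> P \<Longrightarrow> pd j (g p) (g' p)" "RD k j P g'" by auto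
  have "\<forall>p\<in>P. pd j (\<lambda>y. f p y + g p y) (\<lambda>y. f' p y + g' p y)" using f' g' by (blast intro: pd_add)
  then show ?case
    using Suc.IH[OF f'(2) g'(2)] decays_add[OF RD_decays[OF Suc.prems(1)] RD_decays[OF Suc.prems(2)]]
    by (intro RD_SucI[where f' = "\<lambda>p y. f' p y + g' p y"]) auto
qed (auto intro: decays_add)

lemma PG_add: "PG k j P f \<Longrightarrow> PG k j P g \<Longrightarrow> PG k j P (\<lambda>p y. f p y + g p y)"
proof (induction k arbitrary: f g)
  case (Suc k)
  from Suc.prems obtain f' g' where f': "\<And>p. p \<in> P \<Longrightarrow> pd j (f p) (f' p)" "PG k j P f'"
    and g': "\<And>p. p \<in> P \<Longrightarrow> pd j (g p) (g' p)" "PG k j P g'" by auto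
  have "\<forall>p\<in>P. pd j (\<lambda>y. f p y + g p y) (\<lambda>y. f' p y + g' p y)" using f' g' by (blast intro: pd_add)
  then show ?case
    using Suc.IH[OF f'(2) g'(2)] grows_add[OF PG_grows[OF Suc.prems(1)] PG_grows[OF Suc.prems(2)]]
    by (intro PG_SucI[where f' = "\<lambda>p y. f' p y + g' p y"]) auto
qed (auto intro: grows_add)

text \<open>The decaying class is a module over the growing one. In the product rule f g' + f' g one
  factor keeps order k + 1, which implies order k, so the induction generalises over both
  factors.\<close>

lemma RD_mult: "RD k j P f \<Longrightarrow> PG k j P g \<Longrightarrow> RD k j P (\<lambda>p y. f p y * g p y)"
proof (induction k arbitrary: f g)
  case (Suc k)
  from Suc.prems obtain f' g' where f': "\<And>p. p \<in> P \<Longrightarrow> pd j (f p) (f' p)" "RD k j P f'"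
    and g': "\<And>p. p \<in> P \<Longrightarrow> pd j (g p) (g' p)" "PG k j P g'" by auto
  have "RD k j P (\<lambda>p y. f p y * g' p y + f' p y * g p y)"
    using Suc.prems f' g' by (intro RD_add Suc.IH) (auto intro: RD_Suc PG_Suc simp del: RD.simps PG.simps)
  moreover have "\<forall>p\<in>P. pd j (\<lambda>y. f p y * g p y) (\<lambda>y. f p y * g' p y + f' p y * g p y)"
    using f' g' by (blast intro: pd_mult)
  ultimately show ?case
    using decays_mult[OF RD_decays[OF Suc.prems(1)] PG_grows[OF Suc.prems(2)]]
    by (intro RD_SucI[where f' = "\<lambda>p y. f p y * g' p y + f' p y * g p y"]) auto
qed (auto intro: decays_mult)

lemma PG_mult: "PG k j P f \<Longrightarrow> PG k j P g \<Longrightarrow> PG k j P (\<lambda>p y. f p y * g p y)"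
proof (induction k arbitrary: f g)
  case (Suc k)
  from Suc.prems obtain f' g' where f': "\<And>p. p \<in> P \<Longrightarrow> pd j (f p) (f' p)" "PG k j P f'"
    and g': "\<And>p. p \<in> P \<Longrightarrow> pd j (g p) (g' p)" "PG k j P g'" by auto
  have "PG k j P (\<lambda>p y. f p y * g' p y + f' p y * g p y)"
    using Suc.prems f' g' by (intro PG_add Suc.IH) (auto intro: PG_Suc simp del: PG.simps)
  moreover have "\<forall>p\<in>P. pd j (\<lambda>y. f p y * g p y) (\<lambda>y. f p y * g' p y + f' p y * g p y)"
    using f' g' by (blast intro: pd_mult)
  ultimately show ?case
    using grows_mult[OF PG_grows[OF Suc.prems(1)] PG_grows[OF Suc.prems(2)]]
    by (intro PG_SucI[where f' = "\<lambda>p y. f p y * g' p y + f' p y * g p y"]) auto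
qed (auto intro: grows_mult)

lemma decays_reindex: "decays P f \<Longrightarrow> h ` Q \<subseteq> P \<Longrightarrow> decays Q (\<lambda>q. f (h q))"
  by (fastforce simp: decays_def)

lemma grows_reindex: "grows P f \<Longrightarrow> h ` Q \<subseteq> P \<Longrightarrow> grows Q (\<lambda>q. f (h q))"
  by (fastforce simp: grows_def)

lemma RD_reindex: "RD k j P f \<Longrightarrow> h ` Q \<subseteq> P \<Longrightarrow> RD k j Q (\<lambda>q. f (h q))"
proof (induction k arbitrary: f)
  case (Suc k)
  from Suc.prems(1) obtain f' where f': "\<And>p. p \<in> P \<Longrightarrow> pd j (f p) (f' p)" "RD k j P f'" by auto
  show ?case
    by (rule RD_SucI[where f' = "\<lambda>q. f' (h q)"])
      (use decays_reindex[OF RD_decays[OF Suc.prems(1)]] f' Suc.IH[OF f'(2)] Suc.prems(2) in auto)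
qed (auto intro: decays_reindex)

lemma PG_reindex: "PG k j P f \<Longrightarrow> h ` Q \<subseteq> P \<Longrightarrow> PG k j Q (\<lambda>q. f (h q))"
proof (induction k arbitrary: f)
  case (Suc k)
  from Suc.prems(1) obtain f' where f': "\<And>p. p \<in> P \<Longrightarrow> pd j (f p) (f' p)" "PG k j P f'" by auto
  show ?case
    by (rule PG_SucI[where f' = "\<lambda>q. f' (h q)"])
      (use grows_reindex[OF PG_grows[OF Suc.prems(1)]] f' Suc.IH[OF f'(2)] Suc.prems(2) in auto)
qed (auto intro: grows_reindex)

lemma decays_cnj: "decays P f \<Longrightarrow> decays P (\<lambda>p y. cnj (f p y))"
  by (auto simp: decays_def intro!: continuous_intros)

lemma RD_cnj: "RD k j P f \<Longrightarrow> RD k j P (\<lambda>p y. cnj (f p y))"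
proof (induction k arbitrary: f)
  case (Suc k)
  then obtain f' where f': "\<And>p. p \<in> P \<Longrightarrow> pd j (f p) (f' p)" "RD k j P f'" by auto
  show ?case
    by (rule RD_SucI[where f' = "\<lambda>p y. cnj (f' p y)"])
      (use decays_cnj[OF RD_decays[OF Suc.prems]] pd_cnj[OF f'(1)] Suc.IH[OF f'(2)] in auto)
qed (auto intro: decays_cnj)

lemma grows_const: "grows P (\<lambda>p y. c)"
  by (auto simp: grows_def intro!: exI[of _ 0] exI[of _ "cmod c"])

lemma PG_const: "PG k j P (\<lambda>p y. c)"
proof (induction k arbitrary: c)
  case (Suc k)
  show ?case
    by (rule PG_SucI[where f' = "\<lambda>p y. 0"]) (use pd_const grows_const Suc.IH in auto)
qed (auto intro: grows_const)

lemma PG_coord: "PG k j P (\<lambda>p y. complex_of_real (y $ i))"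
proof -
  have "grows P (\<lambda>p y. complex_of_real (y $ i))"
    unfolding grows_def
    by (intro conjI ballI exI[of _ 1] allI continuous_intros)
      (auto intro!: order_trans[OF component_le_norm_cart])
  then show ?thesis
    by (cases k) (auto intro!: exI[of _ "\<lambda>p y. if i = j then 1 else 0"] pd_coord PG_const)
qed

lemma decays_uminus:
  assumes "decays P f" shows "decays P (\<lambda>p y. f p (- y))"
  unfolding decays_def
proof (intro conjI ballI allI)
  fix p assume "p \<in> P"
  then show "continuous_on UNIV (\<lambda>y. f p (- y))"
    by (intro continuous_on_compose2[OF decays_cont[OF assms]] continuous_intros) auto
next
  fix N
  obtain C where C: "\<And>p y. p \<in> P \<Longrightarrow> (1 + norm y) ^ N * cmod (f p y) \<le> C"
    using decaysD[OF assms] by metis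
  have "(1 + norm y) ^ N * cmod (f p (- y)) \<le> C" if "p \<in> P" for p y
    using C[OF that, of "- y"] by simp
  then show "\<exists>C. \<forall>p\<in>P. \<forall>y. (1 + norm y) ^ N * cmod (f p (- y)) \<le> C" by blast
qed

lemma RD_uminus: "RD k j P f \<Longrightarrow> RD k j P (\<lambda>p y. f p (- y))"
proof (induction k arbitrary: f)
  case (Suc k)
  then obtain f' where f': "\<And>p. p \<in> P \<Longrightarrow> pd j (f p) (f' p)" "RD k j P f'" by auto
  have "RD k j P (\<lambda>p y. f' p (- y) * (- 1))"
    by (rule RD_mult[OF Suc.IH[OF f'(2)] PG_const])
  then show ?case
    using decays_uminus[OF RD_decays[OF Suc.prems]] pd_uminus[OF f'(1)]
    by (intro RD_SucI[where f' = "\<lambda>p y. f' p (- y) * (- 1)"]) auto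
qed (auto intro: decays_uminus)

lemma grows_translates:
  assumes "decays P f"
  shows "grows (P \<times> UNIV) (\<lambda>(p, x) y. f p (y - x))"
proof -
  have "continuous_on UNIV (\<lambda>y. f p (y - x))" if "p \<in> P" for p x
    by (intro continuous_on_compose2[OF decays_cont[OF assms that]] continuous_intros) auto
  moreover obtain C where "\<And>p y. p \<in> P \<Longrightarrow> (1 + norm y) ^ 0 * cmod (f p y) \<le> C"
    using decaysD[OF assms, of 0] by metis
  then have "\<exists>N C. \<forall>p\<in>P. \<forall>b y. cmod (f p (y - b)) \<le> C * (1 + norm y) ^ N"
    by (intro exI[of _ 0] exI[of _ C]) auto
  ultimately show ?thesis unfolding grows_def by auto
qed

text \<open>Translates by arbitrary x do not decay uniformly, but they and their derivatives stay
  uniformly bounded. They therefore serve as multipliers, with x added to the index set.\<close>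

lemma PG_translates:
  "RD k j P f \<Longrightarrow> PG k j (P \<times> UNIV) (\<lambda>(p, x) y. f p (y - x))"
proof (induction k arbitrary: f)
  case (Suc k)
  then obtain f' where f': "\<And>p. p \<in> P \<Longrightarrow> pd j (f p) (f' p)" "RD k j P f'" by auto
  show ?case
    by (rule PG_SucI[where f' = "\<lambda>(p, x) y. f' p (y - x)"])
      (use Suc.IH[OF f'(2)] f'(1) grows_translates[OF RD_decays[OF Suc.prems]]
       in \<open>auto intro: pd_translate\<close>)
qed (auto intro: grows_translates)

lemma decays_integrable:
  fixes f :: "'p \<Rightarrow> real^'n::finite \<Rightarrow> complex"
  assumes "decays P f"
  obtains C where "C > 0" "\<And>p. p \<in> P \<Longrightarrow> integrable lborel (\<lambda>y. (1 + norm y) ^ N *\<^sub>R f p y)"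
    "\<And>p. p \<in> P \<Longrightarrow> (LINT y|lborel. (1 + norm y) ^ N * cmod (f p y)) \<le> C"
proof -
  let ?M = "2 * DIM(real^'n)"
  obtain C where C: "C > 0" "\<And>p y. p \<in> P \<Longrightarrow> (1 + norm y) ^ (N + ?M) * cmod (f p y) \<le> C"
    using decaysD[OF assms] by metis
  have le: "(1 + norm y) ^ N * cmod (f p y) \<le> C * kern ?M y" if "p \<in> P" for p y
  proof -
    have "(1 + norm y) ^ ?M > 0" by (simp add: add_pos_nonneg)
    then show ?thesis using C(2)[OF that, of y] unfolding kern_def power_add
      by (simp add: field_simps)
  qed
  have int: "integrable lborel (\<lambda>y. C * kern ?M (y::real^'n))"
    by (intro integrable_mult_right integrable_kern) simp
  have fint: "integrable lborel (\<lambda>y. (1 + norm y) ^ N *\<^sub>R f p y)" if "p \<in> P" for p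
  proof (rule Bochner_Integration.integrable_bound[OF int])
    have "f p \<in> borel_measurable borel"
      using decays_cont[OF assms that] by (rule borel_measurable_continuous_onI)
    then show "(\<lambda>y. (1 + norm y) ^ N *\<^sub>R f p y) \<in> borel_measurable lborel" by simp
    show "AE y in lborel. norm ((1 + norm y) ^ N *\<^sub>R f p y) \<le> norm (C * kern ?M y)"
      using le[OF that] C(1) by (auto simp: abs_mult)
  qed
  have "(LINT y|lborel. (1 + norm y) ^ N * cmod (f p y)) \<le> C * kern_mass ?M TYPE(real^'n)" if "p \<in> P" for p
  proof -
    have "(LINT y|lborel. (1 + norm y) ^ N * cmod (f p y)) \<le> (LINT y|lborel. C * kern ?M (y::real^'n))"
      using integrable_norm[OF fint[OF that]] le[OF that]
      by (intro integral_mono int) auto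
    then show ?thesis by (simp add: kern_mass_def)
  qed
  \<comment> \<open>Adding 1 makes the bound strictly positive, as the kernel mass is only known to
    be nonnegative.\<close>
  moreover have "C * kern_mass ?M TYPE(real^'n) \<le> C * kern_mass ?M TYPE(real^'n) + 1" by simp
  ultimately show ?thesis
    using that[of "C * kern_mass ?M TYPE(real^'n) + 1"] fint C(1)
    by (smt (verit) kern_mass_nonneg mult_nonneg_nonneg)
qed

lemma decays_integrable0:
  assumes "decays P f" "p \<in> P"
  shows "integrable lborel (f p)"
  using decays_integrable[OF assms(1), of 0] assms(2) by force

text \<open>Along the segment from y to y + e the fundamental theorem gives f(y + e) - f(y).
  Integrated over y the right side vanishes by translation invariance, while Fubini turns the left
  side into the integral of f', averaged over s in [0, 1].\<close>

lemma integral_pd_eq_0: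
  fixes f :: "real^'n::finite \<Rightarrow> complex"
  assumes "pd j f f'" and cf: "continuous_on UNIV f" and cont: "continuous_on UNIV f'"
    and f: "integrable lborel f" and f': "integrable lborel f'"
  shows "(LINT y|lborel. f' y) = 0"
proof -
  let ?e = "axis j 1 :: real^'n"
  have [measurable]: "f' \<in> borel_measurable borel" "f \<in> borel_measurable borel"
    using cont cf by (auto intro: borel_measurable_continuous_onI)
  have der: "((\<lambda>s. f (y + s *\<^sub>R ?e)) has_vector_derivative f' (y + s *\<^sub>R ?e)) (at s)" for y s
  proof -
    have "((\<lambda>r. f ((y + s *\<^sub>R ?e) + r *\<^sub>R ?e)) has_vector_derivative f' (y + s *\<^sub>R ?e)) (at (s - s))"
      using assms(1) unfolding pd_def by simp
    then have "((\<lambda>r. f ((y + s *\<^sub>R ?e) + r *\<^sub>R ?e)) \<circ> (\<lambda>r. r - s) has_vector_derivative 1 *\<^sub>R f' (y + s *\<^sub>R ?e)) (at s)"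
      by (intro vector_diff_chain_at) (auto intro!: derivative_eq_intros)
    then show ?thesis by (simp add: o_def scaleR_diff_left algebra_simps)
  qed
  have ftc: "(LINT s|lborel. indicator {0..1} s *\<^sub>R f' (y + s *\<^sub>R ?e)) = f (y + ?e) - f y" for y
  proof -
    have "continuous_on {0..1} (\<lambda>s. f' (y + s *\<^sub>R ?e))"
      by (intro continuous_on_compose2[OF cont] continuous_intros) auto
    then show ?thesis
      using integral_FTC_Icc[of 0 1 "\<lambda>s. f (y + s *\<^sub>R ?e)" "\<lambda>s. f' (y + s *\<^sub>R ?e)"]
        has_vector_derivative_at_within[OF der] by simp
  qed
  have int: "integrable (lborel \<Otimes>\<^sub>M lborel) (\<lambda>(s, y). indicator {0..1::real} s *\<^sub>R f' (y + s *\<^sub>R ?e))"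
  proof (rule lborel_pair.Fubini_integrable)
    show "(\<lambda>(s, y). indicator {0..1::real} s *\<^sub>R f' (y + s *\<^sub>R ?e)) \<in> borel_measurable (lborel \<Otimes>\<^sub>M lborel)"
      by measurable
    have "(LINT y|lborel. norm (f' (y + s *\<^sub>R ?e))) = (LINT y|lborel. norm (f' y))" for s
      by (rule integral_lborel_translate) measurable
    then show "integrable lborel (\<lambda>s. LINT y|lborel. norm (case (s, y) of (s, y) \<Rightarrow> indicator {0..1::real} s *\<^sub>R f' (y + s *\<^sub>R ?e)))"
      by (simp add: integrable_real_indicator)
    show "AE s in lborel. integrable lborel (\<lambda>y. case (s, y) of (s, y) \<Rightarrow> indicator {0..1::real} s *\<^sub>R f' (y + s *\<^sub>R ?e))"
      using f' by (auto intro!: integrable_lborel_translate integrable_scaleR_right)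
  qed
  have "(LINT s|lborel. LINT y|lborel. indicator {0..1} s *\<^sub>R f' (y + s *\<^sub>R ?e)) =
     (LINT y|lborel. LINT s|lborel. indicator {0..1} s *\<^sub>R f' (y + s *\<^sub>R ?e))"
    using lborel_pair.Fubini_integral[of "\<lambda>s y. indicator {0..1} s *\<^sub>R f' (y + s *\<^sub>R ?e)"] int
    by (simp add: case_prod_unfold)
  also have "\<dots> = (LINT y|lborel. f (y + ?e) - f y)" by (simp add: ftc)
  also have "\<dots> = 0"
    using f by (subst Bochner_Integration.integral_diff) (auto intro: integrable_lborel_translate simp: integral_lborel_translate)
  finally have "(LINT s|lborel. LINT y|lborel. indicator {0..1} s *\<^sub>R f' (y + s *\<^sub>R ?e)) = 0" .
  moreover have "(LINT y|lborel. f' (y + s *\<^sub>R ?e)) = (LINT y|lborel. f' y)" for s :: real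
    by (rule integral_lborel_translate) measurable
  ultimately show ?thesis by simp
qed

section \<open>Characters and the uniform decay and smoothness of Fourier transforms\<close>

lemma cis_has_vector_derivative:
  "((\<lambda>s. cis (a + b * s)) has_vector_derivative (\<i> * complex_of_real b * cis (a + b * s))) (at s)"
proof -
  have "((\<lambda>z. exp (\<i> * (complex_of_real a + complex_of_real b * z))) has_field_derivative
      (\<i> * complex_of_real b * exp (\<i> * (complex_of_real a + complex_of_real b * of_real s)))) (at (of_real s))"
    by (auto intro!: derivative_eq_intros)
  from has_vector_derivative_real_field[OF this] show ?thesis
    by (simp add: cis_conv_exp)
qed

lemma pd_cis: "pd j (\<lambda>y. cis (- (y \<bullet> \<xi>))) (\<lambda>y. - \<i> * complex_of_real (\<xi> $ j) * cis (- (y \<bullet> \<xi>)))"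
proof -
  have "(\<lambda>s. cis (- ((y + s *\<^sub>R axis j 1) \<bullet> \<xi>))) = (\<lambda>s. cis (- (y \<bullet> \<xi>) + (- (\<xi> $ j)) * s))" for y
    by (simp add: inner_add_left inner_axis' algebra_simps)
  then show ?thesis
    using cis_has_vector_derivative[of "- (y \<bullet> \<xi>)" "- (\<xi> $ j)" 0 for y]
    unfolding pd_def by simp
qed

lemma continuous_on_cis_inner [continuous_intros]:
  "continuous_on S f \<Longrightarrow> continuous_on S (\<lambda>x. cis (f x))"
  by (auto simp: cis_conv_exp intro!: continuous_intros)

lemma borel_measurable_cis [measurable]: "cis \<in> borel_measurable borel"
  by (intro borel_measurable_continuous_onI continuous_intros)

lemma integrable_mult_cis:
  fixes f :: "'a::euclidean_space \<Rightarrow> complex"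
  assumes "integrable lborel f" "h \<in> borel_measurable borel"
  shows "integrable lborel (\<lambda>y. f y * cis (h y))"
  using assms by (auto intro!: Bochner_Integration.integrable_bound[OF assms(1)] simp: norm_mult)

text \<open>\<open>integral_pd_eq_0\<close> applied to f times the character; the derivative falling
  on the character yields the factor - i \<xi>_j.\<close>

lemma fourier_pd:
  assumes f: "decays P f" "decays P f'" "p \<in> P" and pd: "pd j (f p) (f' p)"
  shows "fourier (f' p) \<xi> = \<i> * complex_of_real (\<xi> $ j) * fourier (f p) \<xi>"
proof -
  let ?c = "\<lambda>y. cis (- (y \<bullet> \<xi>))"
  have i: "integrable lborel (f p)" "integrable lborel (f' p)" using f by (auto intro: decays_integrable0)
  have ic: "integrable lborel (\<lambda>y. f p y * ?c y)" "integrable lborel (\<lambda>y. f' p y * ?c y)"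
    using i by (auto intro!: integrable_mult_cis)
  have "(LINT y|lborel. f p y * (- \<i> * complex_of_real (\<xi> $ j) * ?c y) + f' p y * ?c y) = 0"
  proof (rule integral_pd_eq_0[OF pd_mult[OF pd pd_cis]])
    show "continuous_on UNIV (\<lambda>y. f p y * ?c y)"
      "continuous_on UNIV (\<lambda>y. f p y * (- \<i> * complex_of_real (\<xi> $ j) * ?c y) + f' p y * ?c y)"
      using decays_cont[OF f(1,3)] decays_cont[OF f(2,3)] by (auto intro!: continuous_intros)
    have "integrable lborel (\<lambda>y. (- \<i> * complex_of_real (\<xi> $ j)) * (f p y * ?c y) + f' p y * ?c y)"
      using ic by (intro Bochner_Integration.integrable_add integrable_mult_right) auto
    then show "integrable lborel (\<lambda>y. f p y * (- \<i> * complex_of_real (\<xi> $ j) * ?c y) + f' p y * ?c y)"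
      by (simp add: mult_ac)
  qed (use ic in auto)
  moreover have "(LINT y|lborel. f p y * (- \<i> * complex_of_real (\<xi> $ j) * ?c y) + f' p y * ?c y)
    = (LINT y|lborel. (- \<i> * complex_of_real (\<xi> $ j)) * (f p y * ?c y) + f' p y * ?c y)"
    by (simp add: mult_ac)
  moreover have "\<dots> = (- \<i> * complex_of_real (\<xi> $ j)) * fourier (f p) \<xi> + fourier (f' p) \<xi>"
    unfolding fourier_def using ic
    by (subst Bochner_Integration.integral_add) (auto intro!: integrable_mult_right simp del: mult_minus_left mult_minus_right)
  ultimately show ?thesis by (simp add: add_eq_0_iff)
qed

lemma cmod_fourier_le: "cmod (fourier f \<xi>) \<le> (LINT y|lborel. cmod (f y))"
  unfolding fourier_def by (rule order_trans[OF integral_norm_bound]) (simp add: norm_mult)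

lemma fourier_coord_decay:
  assumes "RD k j P f"
  obtains C where "C > 0" "\<And>p \<xi>. p \<in> P \<Longrightarrow> \<bar>\<xi> $ j\<bar> ^ k * cmod (fourier (f p) \<xi>) \<le> C"
  using assms
proof (induction k arbitrary: f thesis)
  case 0
  then have "decays P f" by simp
  from decays_integrable[OF this, of 0] obtain C where
    C: "C > 0" "\<And>p. p \<in> P \<Longrightarrow> (LINT y|lborel. (1 + norm y) ^ 0 * cmod (f p y)) \<le> C" by metis
  show ?case
  proof (rule "0.prems"(1)[OF C(1)])
    fix p and \<xi> :: "real^'a" assume p: "p \<in> P"
    show "\<bar>\<xi> $ j\<bar> ^ 0 * cmod (fourier (f p) \<xi>) \<le> C"
      using cmod_fourier_le[of "f p" \<xi>] C(2)[OF p] by simp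
  qed
next
  case (Suc k)
  then obtain f' where f': "\<And>p. p \<in> P \<Longrightarrow> pd j (f p) (f' p)" "RD k j P f'" by auto
  from Suc.IH[OF _ f'(2)] obtain C where C: "C > 0" "\<And>p \<xi>. p \<in> P \<Longrightarrow> \<bar>\<xi> $ j\<bar> ^ k * cmod (fourier (f' p) \<xi>) \<le> C"
    by metis
  show ?case
  proof (rule Suc.prems(1)[OF C(1)])
    fix p \<xi> assume p: "p \<in> P"
    have "fourier (f' p) \<xi> = \<i> * complex_of_real (\<xi> $ j) * fourier (f p) \<xi>"
      by (rule fourier_pd[OF RD_decays[OF Suc.prems(2)] RD_decays[OF f'(2)] p f'(1)[OF p]])
    then show "\<bar>\<xi> $ j\<bar> ^ Suc k * cmod (fourier (f p) \<xi>) \<le> C"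
      using C(2)[OF p, of \<xi>] by (simp add: norm_mult mult_ac)
  qed
qed

text \<open>Everything is compared with the largest coordinate m, since |\<xi>| <= n m; max 1 m
  absorbs the constant 1. The lemma converts decay in each coordinate into decay in the
  norm.\<close>

lemma norm_power_le_coords:
  fixes \<xi> :: "real^'n::finite"
  shows "(1 + norm \<xi>) ^ N \<le> (1 + real CARD('n)) ^ N * (1 + (\<Sum>j\<in>UNIV. \<bar>\<xi> $ j\<bar> ^ N))"
proof -
  define m where "m = Max (range (\<lambda>j. \<bar>\<xi> $ j\<bar>))"
  have mj: "\<bar>\<xi> $ j\<bar> \<le> m" for j unfolding m_def by (rule Max_ge) auto
  have m0: "0 \<le> m" using mj[of undefined] abs_ge_zero order_trans by blast
  obtain i where i: "m = \<bar>\<xi> $ i\<bar>" using Max_in[of "range (\<lambda>j. \<bar>\<xi> $ j\<bar>)"] unfolding m_def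
    by (metis (mono_tags, lifting) finite finite_imageI image_iff image_is_empty UNIV_not_empty)
  have "norm \<xi> \<le> (\<Sum>j\<in>UNIV. \<bar>\<xi> $ j\<bar>)" by (rule norm_le_l1_cart)
  also have "\<dots> \<le> real CARD('n) * m" using sum_bounded_above[of UNIV "\<lambda>j. \<bar>\<xi> $ j\<bar>" m] mj by simp
  finally have "norm \<xi> \<le> real CARD('n) * m" .
  also have "\<dots> \<le> real CARD('n) * max 1 m" by (intro mult_left_mono) auto
  finally have "1 + norm \<xi> \<le> (1 + real CARD('n)) * max 1 m" by (simp add: distrib_right add_mono)
  then have "(1 + norm \<xi>) ^ N \<le> ((1 + real CARD('n)) * max 1 m) ^ N" by (intro power_mono) auto
  also have "\<dots> = (1 + real CARD('n)) ^ N * (max 1 m) ^ N" by (rule power_mult_distrib)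
  also have "(max 1 m) ^ N \<le> 1 + m ^ N" using m0 by (simp add: max_def)
  also have "m ^ N \<le> (\<Sum>j\<in>UNIV. \<bar>\<xi> $ j\<bar> ^ N)" unfolding i
    by (rule member_le_sum) auto
  finally show ?thesis by (simp add: mult_left_mono)
qed

lemma fourier_decay:
  fixes f :: "'p \<Rightarrow> real^'n::finite \<Rightarrow> complex"
  assumes "\<And>k j. RD k j P f"
  obtains C where "C > 0" "\<And>p \<xi>. p \<in> P \<Longrightarrow> (1 + norm \<xi>) ^ N * cmod (fourier (f p) \<xi>) \<le> C"
proof -
  have "\<exists>C>0. \<forall>p\<in>P. \<forall>\<xi>. \<bar>\<xi> $ j\<bar> ^ k * cmod (fourier (f p) \<xi>) \<le> C" for k and j :: 'n
    using fourier_coord_decay[OF assms[of k j]] by metis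
  then have "\<exists>C. \<forall>k j. 0 < C k j \<and> (\<forall>p\<in>P. \<forall>\<xi>. \<bar>\<xi> $ j\<bar> ^ k * cmod (fourier (f p) \<xi>) \<le> C k j)"
    by (intro choice allI) blast
  then obtain C where C: "\<And>k j. 0 < C k j"
    "\<And>k j p \<xi>. p \<in> P \<Longrightarrow> \<bar>\<xi> $ j\<bar> ^ k * cmod (fourier (f p) \<xi>) \<le> C k j" by blast
  \<comment> \<open>\<open>C 0 undefined\<close> bounds the transform itself: with exponent 0 any
    coordinate serves, so the index is left unspecified.\<close>
  define D where "D = (1 + real CARD('n)) ^ N * (C 0 undefined + (\<Sum>j\<in>UNIV. C N j))"
  have "D > 0" unfolding D_def
    by (intro mult_pos_pos add_pos_nonneg C sum_nonneg zero_less_power) (auto intro: less_imp_le C)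
  moreover have "(1 + norm \<xi>) ^ N * cmod (fourier (f p) \<xi>) \<le> D" if "p \<in> P" for p \<xi>
  proof -
    have "(1 + norm \<xi>) ^ N * cmod (fourier (f p) \<xi>) \<le>
       ((1 + real CARD('n)) ^ N * (1 + (\<Sum>j\<in>UNIV. \<bar>\<xi> $ j\<bar> ^ N))) * cmod (fourier (f p) \<xi>)"
      by (intro mult_right_mono norm_power_le_coords) auto
    also have "\<dots> = (1 + real CARD('n)) ^ N * (cmod (fourier (f p) \<xi>) +
       (\<Sum>j\<in>UNIV. \<bar>\<xi> $ j\<bar> ^ N * cmod (fourier (f p) \<xi>)))"
      by (simp add: distrib_right sum_distrib_right mult.assoc)
    also have "\<dots> \<le> D" unfolding D_def
      using C(2)[OF that, of \<xi> undefined 0]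
      by (intro mult_left_mono add_mono sum_mono C that) auto
    finally show ?thesis .
  qed
  ultimately show ?thesis using that by blast
qed

lemma cis_diff_le: "cmod (cis a - cis b) \<le> \<bar>a - b\<bar>"
proof -
  have "cis a - cis b = cis b * (cis (a - b) - 1)" by (simp add: algebra_simps cis_mult)
  then have "cmod (cis a - cis b) = cmod (cis (a - b) - 1)" by (simp add: norm_mult)
  also have "\<dots> \<le> \<bar>a - b\<bar>" using iexp_approx1[of "a - b" 0] by (simp add: cis_conv_exp)
  finally show ?thesis .
qed

lemma cis_taylor_le: "cmod (cis a - 1 - \<i> * a) \<le> a\<^sup>2"
proof -
  have "cmod (cis a - (1 + \<i> * a)) \<le> a\<^sup>2 / 2"
    using iexp_approx1[of a 1] by (simp add: cis_conv_exp eval_nat_numeral)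
  also have "\<dots> \<le> a\<^sup>2" by simp
  finally show ?thesis by (simp add: diff_diff_eq)
qed

lemma decays_integrable_weighted:
  assumes "decays P f" "p \<in> P"
  shows "integrable lborel (\<lambda>y. (1 + norm y) ^ N *\<^sub>R f p y)"
  by (rule decays_integrable[OF assms(1), of N]) (use assms(2) in blast)

text \<open>One power of the weight gives even a Lipschitz bound, because two characters differ at y
  by at most |y| |\<xi> - \<eta>|.\<close>

lemma continuous_on_fourier:
  assumes "decays P f" "p \<in> P"
  shows "continuous_on UNIV (fourier (f p))"
proof -
  define C where "C = (LINT y|lborel. (1 + norm y) ^ 1 * cmod (f p y))"
  then have C: "(LINT y|lborel. (1 + norm y) ^ 1 * cmod (f p y)) \<le> C" by simp
  have i1: "integrable lborel (\<lambda>y. (1 + norm y) ^ 1 *\<^sub>R f p y)"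
    using assms by (rule decays_integrable_weighted)
  have i: "integrable lborel (f p)" using assms by (rule decays_integrable0)
  have "cmod (fourier (f p) \<xi> - fourier (f p) \<eta>) \<le> C * norm (\<xi> - \<eta>)" for \<xi> \<eta>
  proof -
    have "fourier (f p) \<xi> - fourier (f p) \<eta> = (LINT y|lborel. f p y * (cis (- (y \<bullet> \<xi>)) - cis (- (y \<bullet> \<eta>))))"
      unfolding fourier_def right_diff_distrib
      by (rule Bochner_Integration.integral_diff[symmetric]) (auto intro!: integrable_mult_cis i)
    also have "cmod \<dots> \<le> (LINT y|lborel. ((1 + norm y) ^ 1 * cmod (f p y)) * norm (\<xi> - \<eta>))"
    proof (rule Bochner_Integration.integral_norm_bound_integral)
      show "integrable lborel (\<lambda>y. f p y * (cis (- (y \<bullet> \<xi>)) - cis (- (y \<bullet> \<eta>))))"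
        unfolding right_diff_distrib
        by (rule Bochner_Integration.integrable_diff) (auto intro!: integrable_mult_cis i)
      show "integrable lborel (\<lambda>y. ((1 + norm y) ^ 1 * cmod (f p y)) * norm (\<xi> - \<eta>))"
        using integrable_norm[OF i1] by (intro integrable_mult_left) simp
      fix y
      have "cmod (cis (- (y \<bullet> \<xi>)) - cis (- (y \<bullet> \<eta>))) \<le> \<bar>y \<bullet> (\<xi> - \<eta>)\<bar>"
        using cis_diff_le[of "- (y \<bullet> \<xi>)" "- (y \<bullet> \<eta>)"] by (simp add: inner_diff_right)
      also have "\<dots> \<le> norm y * norm (\<xi> - \<eta>)" by (rule Cauchy_Schwarz_ineq2)
      also have "\<dots> \<le> (1 + norm y) * norm (\<xi> - \<eta>)" by (intro mult_right_mono) auto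
      finally have "cmod (f p y) * cmod (cis (- (y \<bullet> \<xi>)) - cis (- (y \<bullet> \<eta>))) \<le> cmod (f p y) * ((1 + norm y) * norm (\<xi> - \<eta>))"
        by (intro mult_left_mono) auto
      then show "cmod (f p y * (cis (- (y \<bullet> \<xi>)) - cis (- (y \<bullet> \<eta>)))) \<le> ((1 + norm y) ^ 1 * cmod (f p y)) * norm (\<xi> - \<eta>)"
        by (simp add: norm_mult mult_ac)
    qed
    also have "\<dots> = (LINT y|lborel. ((1 + norm y) ^ 1 * cmod (f p y))) * norm (\<xi> - \<eta>)" by simp
    also have "\<dots> \<le> C * norm (\<xi> - \<eta>)" using C by (intro mult_right_mono) auto
    finally show ?thesis .
  qed
  then have "C-lipschitz_on UNIV (fourier (f p))"
    using order_trans[OF integral_nonneg_AE C]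
    by (intro lipschitz_onI) (auto simp: dist_norm)
  then show ?thesis by (rule lipschitz_on_continuous_on)
qed

text \<open>An explicit quadratic remainder stands in for a limit argument, both when
  differentiating under the Fourier integral and at the flat point of \<open>expinv\<close>.\<close>

lemma has_vector_derivative_quadratic_remainder:
  assumes "\<And>s. norm (F s - F 0 - s *\<^sub>R D) \<le> C * s\<^sup>2"
  shows "(F has_vector_derivative D) (at (0::real))"
  unfolding has_vector_derivative_def has_derivative_iff_norm
proof
  show "bounded_linear (\<lambda>s. s *\<^sub>R D)" by (rule bounded_linear_scaleR_left)
  have "((\<lambda>y. C * \<bar>y\<bar>) \<longlongrightarrow> C * \<bar>0\<bar>) (at (0::real))" by (intro tendsto_intros)
  then have "((\<lambda>y. C * \<bar>y\<bar>) \<longlongrightarrow> 0) (at (0::real))" by simp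
  then show "((\<lambda>y. norm (F y - F 0 - (y - 0) *\<^sub>R D) / norm (y - 0)) \<longlongrightarrow> 0) (at 0)"
  proof (rule Lim_null_comparison[rotated])
    show "\<forall>\<^sub>F y in at 0. norm (norm (F y - F 0 - (y - 0) *\<^sub>R D) / norm (y - 0)) \<le> C * \<bar>y\<bar>"
      unfolding eventually_at_filter
    proof (rule always_eventually, intro allI impI)
      fix y :: real assume "y \<noteq> 0"
      have "y\<^sup>2 = \<bar>y\<bar> * \<bar>y\<bar>" by (simp add: power2_eq_square)
      then show "norm (norm (F y - F 0 - (y - 0) *\<^sub>R D) / norm (y - 0)) \<le> C * \<bar>y\<bar>"
        using assms[of y] \<open>y \<noteq> 0\<close> by (simp add: divide_le_eq mult.assoc)
    qed
  qed
qed

text \<open>The second order Taylor remainder of the character is at most s^2 (1 + |y|)^2. Two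
  powers of decay make it integrable, which leaves an error C s^2 with C independent of s.\<close>

lemma pd_fourier:
  assumes "decays P f" "p \<in> P"
  shows "pd i (fourier (f p)) (fourier (\<lambda>y. f p y * (- \<i> * complex_of_real (y $ i))))"
  unfolding pd_def
proof
  fix \<xi>
  define C where "C = (LINT y|lborel. (1 + norm y) ^ 2 * cmod (f p y))"
  then have C: "(LINT y|lborel. (1 + norm y) ^ 2 * cmod (f p y)) \<le> C" by simp
  have i2: "integrable lborel (\<lambda>y. (1 + norm y) ^ 2 *\<^sub>R f p y)"
    using assms by (rule decays_integrable_weighted)
  have i: "integrable lborel (f p)" using assms by (rule decays_integrable0)
  have [measurable]: "f p \<in> borel_measurable borel"
    using decays_cont[OF assms] by (rule borel_measurable_continuous_onI)
  have i': "integrable lborel (\<lambda>y. f p y * (- \<i> * complex_of_real (y $ i)))"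
  proof (rule Bochner_Integration.integrable_bound[OF i2])
    have "\<bar>y $ i\<bar> \<le> (1 + norm y)\<^sup>2" for y
      using component_le_norm_cart[of y i] power_increasing[of 1 2 "1 + norm y"] by simp
    from mult_right_mono[OF this, of "cmod (f p _)"]
    show "AE y in lborel. norm (f p y * (- \<i> * complex_of_real (y $ i))) \<le> norm ((1 + norm y)\<^sup>2 *\<^sub>R f p y)"
      by (auto simp: norm_mult mult.commute)
  qed measurable
  let ?F = "\<lambda>s. fourier (f p) (\<xi> + s *\<^sub>R axis i 1)"
  let ?D = "fourier (\<lambda>y. f p y * (- \<i> * complex_of_real (y $ i))) \<xi>"
  show "(?F has_vector_derivative ?D) (at 0)"
  proof (rule has_vector_derivative_quadratic_remainder)
    fix s
    have "?F s - ?F 0 - s *\<^sub>R ?D = (LINT y|lborel. f p y * cis (- (y \<bullet> (\<xi> + s *\<^sub>R axis i 1)))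
       - f p y * cis (- (y \<bullet> \<xi>)) - s *\<^sub>R ((f p y * (- \<i> * complex_of_real (y $ i))) * cis (- (y \<bullet> \<xi>))))"
      unfolding fourier_def
      using integrable_mult_cis[OF i, of "\<lambda>y. - (y \<bullet> (\<xi> + s *\<^sub>R axis i 1))"]
        integrable_mult_cis[OF i, of "\<lambda>y. - (y \<bullet> \<xi>)"] integrable_mult_cis[OF i', of "\<lambda>y. - (y \<bullet> \<xi>)"]
      by (simp del: mult_minus_left mult_minus_right)
    also have "\<dots> = (LINT y|lborel. f p y * cis (- (y \<bullet> \<xi>)) * (cis (- (s * y $ i)) - 1 - \<i> * (- (s * y $ i))))"
    proof -
      have "cis (- (y \<bullet> (\<xi> + s *\<^sub>R axis i 1))) = cis (- (y \<bullet> \<xi>)) * cis (- (s * y $ i))" for y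
        by (simp add: cis_mult inner_add_right inner_axis)
      then show ?thesis by (simp add: algebra_simps scaleR_conv_of_real)
    qed
    also have "cmod \<dots> \<le> (LINT y|lborel. ((1 + norm y) ^ 2 * cmod (f p y)) * s\<^sup>2)"
    proof (rule Bochner_Integration.integral_norm_bound_integral)
      have "integrable lborel (\<lambda>y. f p y * cis (- (y \<bullet> \<xi>)) * cis (- (s * y $ i)) - f p y * cis (- (y \<bullet> \<xi>))
         - (- complex_of_real s) * (f p y * (\<i> * complex_of_real (y $ i)) * cis (- (y \<bullet> \<xi>))))"
        using i' by (intro Bochner_Integration.integrable_diff integrable_mult_right integrable_mult_cis i) auto
      then show "integrable lborel (\<lambda>y. f p y * cis (- (y \<bullet> \<xi>)) * (cis (- (s * y $ i)) - 1 - \<i> * complex_of_real (- (s * y $ i))))"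
        by (simp add: algebra_simps)
      show "integrable lborel (\<lambda>y. ((1 + norm y) ^ 2 * cmod (f p y)) * s\<^sup>2)"
        using integrable_norm[OF i2] by (intro integrable_mult_left) simp
      fix y
      have "cmod (cis (- (s * y $ i)) - 1 - \<i> * complex_of_real (- (s * y $ i))) \<le> (- (s * y $ i))\<^sup>2"
        by (rule cis_taylor_le)
      also have "\<dots> = s\<^sup>2 * (y $ i)\<^sup>2" by (simp add: power_mult_distrib)
      also have "\<dots> \<le> s\<^sup>2 * (1 + norm y)\<^sup>2"
        using component_le_norm_cart[of y i]
        by (intro mult_left_mono) (auto simp: abs_le_square_iff[symmetric])
      finally have "cmod (f p y) * cmod (cis (- (s * y $ i)) - 1 - \<i> * complex_of_real (- (s * y $ i))) \<le> cmod (f p y) * (s\<^sup>2 * (1 + norm y)\<^sup>2)"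
        by (intro mult_left_mono) auto
      then show "cmod (f p y * cis (- (y \<bullet> \<xi>)) * (cis (- (s * y $ i)) - 1 - \<i> * complex_of_real (- (s * y $ i)))) \<le> ((1 + norm y) ^ 2 * cmod (f p y)) * s\<^sup>2"
        by (simp add: norm_mult mult_ac)
    qed
    also have "\<dots> = (LINT y|lborel. ((1 + norm y) ^ 2 * cmod (f p y))) * s\<^sup>2" by simp
    also have "\<dots> \<le> C * s\<^sup>2" using C by (intro mult_right_mono) auto
    finally show "norm (?F s - ?F 0 - s *\<^sub>R ?D) \<le> C * s\<^sup>2" .
  qed
qed

lemma decays_fourier:
  assumes "\<And>k j. RD k j P f"
  shows "decays P (\<lambda>p. fourier (f p))"
  unfolding decays_def
proof (intro conjI ballI allI)
  fix p assume "p \<in> P"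
  then show "continuous_on UNIV (fourier (f p))"
    using continuous_on_fourier[OF RD_decays[OF assms]] by blast
next
  fix N
  show "\<exists>C. \<forall>p\<in>P. \<forall>y. (1 + norm y) ^ N * cmod (fourier (f p) y) \<le> C"
    using fourier_decay[OF assms, of N] by metis
qed

text \<open>A derivative of the transform is the transform of - i y_i f, which again has all orders
  of decay. For this reason the induction on m generalises over f.\<close>

lemma RD_fourier:
  assumes "\<And>k j. RD k j P f"
  shows "RD m i P (\<lambda>p. fourier (f p))"
  using assms
proof (induction m arbitrary: f)
  case (Suc m)
  have "RD k j P (\<lambda>p y. f p y * (- \<i> * complex_of_real (y $ i)))" for k j
    by (rule RD_mult[OF Suc.prems PG_mult[OF PG_const PG_coord]])
  from Suc.IH[OF this] show ?case
    by (rule RD_SucI[OF decays_fourier[OF Suc.prems] pd_fourier[OF RD_decays[OF Suc.prems]], rotated])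
qed (auto intro: decays_fourier)

section \<open>Gaussian integrals and Fourier inversion\<close>

lemma lborel_prod_integral:
  fixes f :: "'a::euclidean_space \<Rightarrow> real \<Rightarrow> complex"
  assumes f: "\<And>b. b \<in> Basis \<Longrightarrow> integrable lborel (f b)"
  shows "integrable lborel (\<lambda>x::'a. \<Prod>b\<in>Basis. f b (x \<bullet> b))"
    and "(LINT x|lborel. (\<Prod>b\<in>Basis. f b (x \<bullet> b))) = (\<Prod>b\<in>Basis. (LINT t|lborel. f b t))"
proof -
  interpret product_sigma_finite "\<lambda>_::'a. lborel :: real measure" ..
  have [measurable]: "\<And>b. b \<in> Basis \<Longrightarrow> f b \<in> borel_measurable borel"
    using f by (auto dest: borel_measurable_integrable)
  have T[measurable]: "(\<lambda>g. \<Sum>b\<in>(Basis::'a set). g b *\<^sub>R b) \<in> (\<Pi>\<^sub>M b\<in>Basis. lborel) \<rightarrow>\<^sub>M borel"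
    by measurable
  have F[measurable]: "(\<lambda>x::'a. \<Prod>b\<in>Basis. f b (x \<bullet> b)) \<in> borel_measurable borel" by measurable
  have eq: "(\<Prod>b\<in>Basis. f b ((\<Sum>b\<in>Basis. g b *\<^sub>R b) \<bullet> b)) = (\<Prod>b\<in>(Basis::'a set). f b (g b))" for g
    by (intro prod.cong refl) simp
  show "integrable lborel (\<lambda>x::'a. \<Prod>b\<in>Basis. f b (x \<bullet> b))"
    unfolding lborel_eq[where ?'a='a] by (subst integrable_distr_eq) (auto simp: eq intro!: product_integrable_prod f)
  show "(LINT x|lborel. (\<Prod>b\<in>Basis. f b (x \<bullet> b))) = (\<Prod>b\<in>(Basis::'a set). (LINT t|lborel. f b t))"
    unfolding lborel_eq[where ?'a='a]
    by (subst integral_distr) (auto simp: eq intro!: product_integral_prod f)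
qed

text \<open>With variance one the Gaussian is its own transform up to (2 pi)^(n/2), so the same
  function damps the frequencies and averages in position.\<close>

definition gauss :: "'a::euclidean_space \<Rightarrow> complex"
  where "gauss x = complex_of_real (exp (- (norm x)\<^sup>2 / 2))"

lemma gauss_prod: "gauss x = (\<Prod>b\<in>Basis. complex_of_real (exp (- (x \<bullet> b)\<^sup>2 / 2)))"
proof -
  have "(norm x)\<^sup>2 = (\<Sum>b\<in>Basis. (x \<bullet> b)\<^sup>2)"
    by (subst power2_norm_eq_inner, subst euclidean_inner) (simp add: power2_eq_square)
  then show ?thesis
    unfolding gauss_def of_real_prod[symmetric]
    by (subst exp_sum[symmetric]) (auto simp: sum_negf sum_divide_distrib)
qed

lemma cis_inner_prod: "cis (- (x \<bullet> s)) = (\<Prod>b\<in>Basis. cis (- ((x \<bullet> b) * (s \<bullet> b))))"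
  unfolding cis_conv_exp
  by (subst exp_sum[symmetric]) (auto simp: euclidean_inner[of x s] sum_negf sum_distrib_left)

text \<open>Read off from the characteristic function of the standard normal distribution, after its
  normalisation by sqrt (2 pi) is undone.\<close>

lemma gauss_1:
  fixes s :: real
  shows "integrable lborel (\<lambda>t::real. complex_of_real (exp (- t\<^sup>2 / 2)) * cis (- (t * s)))"
    and "(LINT t|lborel. complex_of_real (exp (- t\<^sup>2 / 2)) * cis (- (t * s))) = complex_of_real (sqrt (2 * pi) * exp (- s\<^sup>2 / 2))"
proof -
  have sn: "complex_of_real (exp (- t\<^sup>2 / 2)) = complex_of_real (sqrt (2 * pi)) * complex_of_real (std_normal_density t)" for t
    unfolding std_normal_density_def of_real_mult[symmetric] by simp
  have i: "integrable lborel (\<lambda>t. complex_of_real (std_normal_density t))"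
    by (intro integrable_of_real) (rule integrable_normal_density, simp)
  show "integrable lborel (\<lambda>t::real. complex_of_real (exp (- t\<^sup>2 / 2)) * cis (- (t * s)))"
    unfolding sn by (intro integrable_mult_cis integrable_mult_right i) measurable
  have "char std_normal_distribution (- s) = (LINT t|lborel. complex_of_real (std_normal_density t) * cis (- (t * s)))"
    unfolding char_def by (subst integral_density) (auto simp: cis_conv_exp scaleR_conv_of_real[where 'a=complex] mult.commute)
  then have c: "(LINT t|lborel. complex_of_real (std_normal_density t) * cis (- (t * s))) = complex_of_real (exp (- s\<^sup>2 / 2))"
    unfolding char_std_normal_distribution by simp
  have "(LINT t|lborel. complex_of_real (exp (- t\<^sup>2 / 2)) * cis (- (t * s))) = complex_of_real (sqrt (2 * pi)) * (LINT t|lborel. complex_of_real (std_normal_density t) * cis (- (t * s)))"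
    by (simp only: sn mult.assoc integral_mult_right_zero)
  then show "(LINT t|lborel. complex_of_real (exp (- t\<^sup>2 / 2)) * cis (- (t * s))) = complex_of_real (sqrt (2 * pi) * exp (- s\<^sup>2 / 2))"
    unfolding c of_real_mult .
qed

lemma integrable_gauss: "integrable lborel (gauss :: 'a::euclidean_space \<Rightarrow> complex)"
  unfolding gauss_prod[abs_def] using gauss_1(1)[of 0]
  by (intro lborel_prod_integral) simp

lemma integrable_gauss_scale:
  assumes "e > 0" shows "integrable lborel (\<lambda>x::'a::euclidean_space. gauss (e *\<^sub>R x))"
proof -
  have "integrable lborel (\<lambda>t. complex_of_real (exp (- (0 + e * t)\<^sup>2 / 2)))"
    using gauss_1(1)[of 0] assms by (intro lborel_integrable_real_affine) auto
  then show ?thesis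
    using lborel_prod_integral(1)[of "\<lambda>_::'a. \<lambda>t. complex_of_real (exp (- (0 + e * t)\<^sup>2 / 2))"]
    unfolding gauss_prod by simp
qed

lemma fourier_gauss: "fourier gauss s = complex_of_real (sqrt (2 * pi) ^ CARD('n)) * gauss (s :: real^'n::finite)"
proof -
  have "fourier gauss s = (LINT x|lborel. (\<Prod>b\<in>Basis. complex_of_real (exp (- (x \<bullet> b)\<^sup>2 / 2)) * cis (- ((x \<bullet> b) * (s \<bullet> b)))))"
    unfolding fourier_def gauss_prod cis_inner_prod prod.distrib ..
  also have "\<dots> = (\<Prod>b\<in>(Basis::(real^'n) set). (LINT t|lborel. complex_of_real (exp (- t\<^sup>2 / 2)) * cis (- (t * (s \<bullet> b)))))"
    by (rule lborel_prod_integral(2)) (rule gauss_1)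
  also have "\<dots> = (\<Prod>b\<in>(Basis::(real^'n) set). complex_of_real (sqrt (2 * pi)) * complex_of_real (exp (- (s \<bullet> b)\<^sup>2 / 2)))"
    unfolding gauss_1(2) by simp
  also have "\<dots> = complex_of_real (sqrt (2 * pi) ^ CARD('n)) * gauss s"
    unfolding prod.distrib gauss_prod by simp
  finally show ?thesis .
qed

lemma borel_measurable_gauss [measurable]: "gauss \<in> borel_measurable borel"
  unfolding gauss_def[abs_def] by measurable

lemma cmod_gauss: "cmod (gauss x) = exp (- (norm x)\<^sup>2 / 2)"
  unfolding gauss_def norm_of_real by simp

lemma cmod_gauss_le_1: "cmod (gauss x) \<le> 1"
  unfolding cmod_gauss by simp

text \<open>This is (2 pi)^n. One factor comes from the transform of the Gaussian, the other from
  its integral.\<close>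

definition inv_const :: "'n::finite itself \<Rightarrow> real"
  where "inv_const _ = sqrt (2 * pi) ^ CARD('n) * sqrt (2 * pi) ^ CARD('n)"

lemma inv_const_pos: "inv_const TYPE('n::finite) > 0"
  unfolding inv_const_def by simp

lemma integral_gauss: "(LINT x|lborel. gauss (x::real^'n::finite)) = complex_of_real (sqrt (2 * pi) ^ CARD('n))"
proof -
  have "(LINT x|lborel. gauss (x::real^'n::finite)) = fourier gauss (0::real^'n)" by (simp add: fourier_def)
  also have "\<dots> = complex_of_real (sqrt (2 * pi) ^ CARD('n))" unfolding fourier_gauss by (simp add: gauss_def)
  finally show ?thesis .
qed

text \<open>The frequency integral is damped by \<open>gauss (e k *\<^sub>R \<xi>)\<close> and the
  damping is removed by dominated convergence. Integrability of the transform dominates one side;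
  boundedness and continuity of h handle the other.\<close>

lemma fourier_inversion:
  fixes h :: "real^'n::finite \<Rightarrow> complex"
  assumes cont: "continuous_on UNIV h" and bnd: "\<And>x. cmod (h x) \<le> B"
    and h: "integrable lborel h" and fh: "integrable lborel (fourier h)"
  shows "(LINT \<xi>|lborel. fourier h \<xi> * cis (y \<bullet> \<xi>)) = complex_of_real (inv_const TYPE('n)) * h y"
proof -
  let ?a = "complex_of_real (sqrt (2 * pi) ^ CARD('n))"
  have [measurable]: "h \<in> borel_measurable borel" using cont by (rule borel_measurable_continuous_onI)
  have [measurable]: "fourier h \<in> borel_measurable borel" using fh by auto
  define e where "e k = inverse (real (Suc k))" for k
  have e: "e k > 0" for k unfolding e_def by simp
  have e0: "e \<longlonglongrightarrow> 0" unfolding e_def by (rule LIMSEQ_inverse_real_of_nat)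
  \<comment> \<open>Damping makes the double integral absolutely convergent. After Fubini the inner
    integral is the transform of a dilated Gaussian, and x = y + e_k w turns the whole into an
    average of h near y.\<close>
  have eq: "(LINT \<xi>|lborel. fourier h \<xi> * cis (y \<bullet> \<xi>) * gauss (e k *\<^sub>R \<xi>)) =
      (LINT w|lborel. h (y + e k *\<^sub>R w) * (?a * gauss w))" for k
  proof -
    let ?G = "\<lambda>v. LINT \<xi>|lborel. gauss (e k *\<^sub>R \<xi>) * cis (- (\<xi> \<bullet> v))"
    have G: "complex_of_real (e k ^ CARD('n)) * ?G (e k *\<^sub>R w) = ?a * gauss w" for w :: "real^'n"
    proof -
      have "?a * gauss w = fourier gauss w" by (rule fourier_gauss[symmetric])
      also have "\<dots> = e k ^ DIM(real^'n) *\<^sub>R (LINT \<xi>|lborel. gauss (0 + e k *\<^sub>R \<xi>) * cis (- ((0 + e k *\<^sub>R \<xi>) \<bullet> w)))"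
        unfolding fourier_def by (rule integral_lborel_scale) (use e in measurable)
      finally show ?thesis by (simp add: scaleR_conv_of_real[where 'a=complex])
    qed
    define \<Phi> where "\<Phi> = (\<lambda>\<xi> x. h x * cis (- (x \<bullet> \<xi>)) * cis (y \<bullet> \<xi>) * gauss (e k *\<^sub>R \<xi>))"
    have [measurable]: "(\<lambda>(\<xi>, x). \<Phi> \<xi> x) \<in> borel_measurable (borel \<Otimes>\<^sub>M borel)"
      unfolding \<Phi>_def by measurable
    have int: "integrable (lborel \<Otimes>\<^sub>M lborel) (\<lambda>(\<xi>, x). \<Phi> \<xi> x)"
    proof (rule lborel_pair.Fubini_integrable)
      show "(\<lambda>(\<xi>, x). \<Phi> \<xi> x) \<in> borel_measurable (lborel \<Otimes>\<^sub>M lborel)" by measurable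
      show "integrable lborel (\<lambda>\<xi>. LINT x|lborel. norm (case (\<xi>, x) of (\<xi>, x) \<Rightarrow> \<Phi> \<xi> x))"
        unfolding \<Phi>_def using integrable_norm[OF integrable_gauss_scale[OF e[of k], where ?'a="real^'n"]]
        by (simp add: norm_mult integrable_mult_right)
      show "AE \<xi> in lborel. integrable lborel (\<lambda>x. case (\<xi>, x) of (\<xi>, x) \<Rightarrow> \<Phi> \<xi> x)"
        unfolding \<Phi>_def prod.case
        by (intro AE_I2 integrable_mult_left integrable_mult_cis h) measurable
    qed
    have "(LINT \<xi>|lborel. fourier h \<xi> * cis (y \<bullet> \<xi>) * gauss (e k *\<^sub>R \<xi>)) = (LINT \<xi>|lborel. LINT x|lborel. \<Phi> \<xi> x)"
      unfolding fourier_def \<Phi>_def by simp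
    also have "\<dots> = (LINT x|lborel. LINT \<xi>|lborel. \<Phi> \<xi> x)"
      using lborel_pair.Fubini_integral[OF int] by simp
    also have "\<dots> = (LINT x|lborel. h x * ?G (x - y))"
    proof (rule Bochner_Integration.integral_cong[OF refl])
      fix x
      have "\<Phi> \<xi> x = h x * (gauss (e k *\<^sub>R \<xi>) * cis (- (\<xi> \<bullet> (x - y))))" for \<xi>
      proof -
        have "cis (- (x \<bullet> \<xi>)) * cis (y \<bullet> \<xi>) = cis (- (\<xi> \<bullet> (x - y)))"
          by (simp add: cis_mult inner_diff_right inner_commute)
        then show ?thesis unfolding \<Phi>_def by (simp add: mult_ac)
      qed
      then show "(LINT \<xi>|lborel. \<Phi> \<xi> x) = h x * ?G (x - y)" by simp
    qed
    also have "\<dots> = e k ^ DIM(real^'n) *\<^sub>R (LINT w|lborel. h (y + e k *\<^sub>R w) * ?G (y + e k *\<^sub>R w - y))"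
      by (rule integral_lborel_scale) (use e in measurable)
    also have "\<dots> = (LINT w|lborel. h (y + e k *\<^sub>R w) * (complex_of_real (e k ^ CARD('n)) * ?G (e k *\<^sub>R w)))"
      by (simp add: scaleR_conv_of_real[where 'a=complex] mult_ac flip: integral_mult_right_zero)
    finally show ?thesis unfolding G .
  qed
  have lim1: "(\<lambda>k. LINT \<xi>|lborel. fourier h \<xi> * cis (y \<bullet> \<xi>) * gauss (e k *\<^sub>R \<xi>)) \<longlonglongrightarrow> (LINT \<xi>|lborel. fourier h \<xi> * cis (y \<bullet> \<xi>))"
  proof (rule integral_dominated_convergence)
    show "integrable lborel (\<lambda>\<xi>. cmod (fourier h \<xi>))" using fh by simp
    show "AE \<xi> in lborel. norm (fourier h \<xi> * cis (y \<bullet> \<xi>) * gauss (e k *\<^sub>R \<xi>)) \<le> cmod (fourier h \<xi>)" for k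
      using mult_left_mono[OF cmod_gauss_le_1 norm_ge_zero] by (auto simp: norm_mult)
    show "AE \<xi> in lborel. (\<lambda>k. fourier h \<xi> * cis (y \<bullet> \<xi>) * gauss (e k *\<^sub>R \<xi>)) \<longlonglongrightarrow> fourier h \<xi> * cis (y \<bullet> \<xi>)"
    proof (rule AE_I2)
      fix \<xi> :: "real^'n"
      have "(\<lambda>k. gauss (e k *\<^sub>R \<xi>)) \<longlonglongrightarrow> complex_of_real (exp (- (norm (0 *\<^sub>R \<xi>))\<^sup>2 / 2))"
        unfolding gauss_def by (intro tendsto_intros e0) simp
      then have "(\<lambda>k. gauss (e k *\<^sub>R \<xi>)) \<longlonglongrightarrow> 1" by simp
      from tendsto_mult[OF tendsto_const this]
      show "(\<lambda>k. fourier h \<xi> * cis (y \<bullet> \<xi>) * gauss (e k *\<^sub>R \<xi>)) \<longlonglongrightarrow> fourier h \<xi> * cis (y \<bullet> \<xi>)"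
        by simp
    qed
  qed measurable
  have lim2: "(\<lambda>k. LINT w|lborel. h (y + e k *\<^sub>R w) * (?a * gauss w)) \<longlonglongrightarrow> (LINT w|lborel. h y * (?a * gauss (w::real^'n)))"
  proof (rule integral_dominated_convergence)
    show "integrable lborel (\<lambda>w::real^'n. B * cmod (?a * gauss w))"
      by (intro integrable_mult_right integrable_norm integrable_gauss)
    show "AE w in lborel. norm (h (y + e k *\<^sub>R w) * (?a * gauss w)) \<le> B * cmod (?a * gauss w)" for k
      unfolding norm_mult[of "h _"] by (intro AE_I2 mult_right_mono bnd) auto
    show "AE w in lborel. (\<lambda>k. h (y + e k *\<^sub>R w) * (?a * gauss w)) \<longlonglongrightarrow> h y * (?a * gauss w)"
    proof (rule AE_I2)
      fix w
      have "(\<lambda>k. y + e k *\<^sub>R w) \<longlonglongrightarrow> y + 0 *\<^sub>R w" by (intro tendsto_intros e0)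
      then have "(\<lambda>k. h (y + e k *\<^sub>R w)) \<longlonglongrightarrow> h (y + 0 *\<^sub>R w)"
        by (rule continuous_on_tendsto_compose[OF cont]) auto
      then show "(\<lambda>k. h (y + e k *\<^sub>R w) * (?a * gauss w)) \<longlonglongrightarrow> h y * (?a * gauss w)"
        by (intro tendsto_intros) simp
    qed
  qed measurable
  have "(LINT \<xi>|lborel. fourier h \<xi> * cis (y \<bullet> \<xi>)) = (LINT w|lborel. h y * (?a * gauss (w::real^'n)))"
    using LIMSEQ_unique[OF lim1[unfolded eq] lim2] .
  also have "\<dots> = complex_of_real (inv_const TYPE('n)) * h y"
    by (simp add: integral_gauss inv_const_def mult_ac)
  finally show ?thesis .
qed

section \<open>Wave packet transform and change of window\<close>

lemma wave_packet_eq_fourier: "wave_packet \<psi> f x \<xi> = fourier (\<lambda>y. cnj (\<psi> (y - x)) * f y) \<xi>"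
  unfolding wave_packet_def fourier_def ..

lemma borel_measurable_cnj [measurable]: "cnj \<in> borel_measurable borel"
  by (intro borel_measurable_continuous_onI continuous_intros)

lemma borel_measurable_fst_snd [measurable]:
  "(fst :: 'a::second_countable_topology \<times> 'b::second_countable_topology \<Rightarrow> 'a) \<in> borel_measurable borel"
  "(snd :: 'a::second_countable_topology \<times> 'b::second_countable_topology \<Rightarrow> 'b) \<in> borel_measurable borel"
  by (auto intro!: borel_measurable_continuous_onI continuous_intros)

lemma borel_measurable_wave_packet [measurable]:
  assumes [measurable]: "\<psi> \<in> borel_measurable borel" "u \<in> borel_measurable borel"
    and [measurable]: "f \<in> M \<rightarrow>\<^sub>M borel" "g \<in> M \<rightarrow>\<^sub>M borel"
  shows "(\<lambda>w. wave_packet \<psi> u (f w) (g w)) \<in> borel_measurable M"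
  unfolding wave_packet_def by measurable

lemma decays_bound:
  fixes \<psi> :: "real^'n::finite \<Rightarrow> complex"
  assumes "decays UNIV (\<lambda>_::unit. \<psi>)"
  shows "\<exists>D>0. \<forall>y. (1 + norm y) ^ N * cmod (\<psi> y) \<le> D"
  by (rule decaysD[OF assms, of N]) auto

lemma decays_integrable_ex:
  assumes "decays P f"
  shows "\<exists>C>0. \<forall>p\<in>P. integrable lborel (\<lambda>y. (1 + norm y) ^ N *\<^sub>R f p y) \<and>
    (LINT y|lborel. (1 + norm y) ^ N * cmod (f p y)) \<le> C"
  by (rule decays_integrable[OF assms, of N]) auto

text \<open>Frequency decay comes from integration by parts, uniformly in x because translates of
  the window are admissible multipliers; position decay comes from the decay of both
  factors.\<close>

lemma wave_packet_decay:
  fixes \<psi> :: "real^'n::finite \<Rightarrow> complex" and r :: "'p \<Rightarrow> real^'n \<Rightarrow> complex"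
  assumes \<psi>: "\<And>k j. RD k j UNIV (\<lambda>_::unit. \<psi>)" and r: "\<And>k j. RD k j P r"
  obtains C where "C > 0" "\<And>p x \<xi>. p \<in> P \<Longrightarrow> cmod (wave_packet \<psi> (r p) x \<xi>) \<le> C * kern N (x, \<xi>)"
proof -
  let ?f = "\<lambda>(p, x) y. r p y * cnj (\<psi> (y - x))"
  have "PG k j (UNIV \<times> UNIV) (\<lambda>(_::unit, x) y. cnj (\<psi> (y - x)))" for k j
    by (rule PG_translates[OF RD_cnj[OF \<psi>]])
  from PG_reindex[OF this, of "\<lambda>q. ((), snd q)" "P \<times> UNIV"]
  have "PG k j (P \<times> UNIV) (\<lambda>q y. cnj (\<psi> (y - snd q)))" for k j by simp
  moreover have "RD k j (P \<times> UNIV) (\<lambda>q. r (fst q))" for k j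
    by (rule RD_reindex[OF r]) auto
  ultimately have "RD k j (P \<times> UNIV) (\<lambda>q y. r (fst q) y * cnj (\<psi> (y - snd q)))" for k j
    by (intro RD_mult)
  from fourier_decay[OF this, of N] obtain C1 where C1: "C1 > 0"
    "\<And>q \<xi>. q \<in> P \<times> UNIV \<Longrightarrow> (1 + norm \<xi>) ^ N * cmod (fourier (\<lambda>y. r (fst q) y * cnj (\<psi> (y - snd q))) \<xi>) \<le> C1"
    by blast
  from decays_bound[OF RD_decays[OF \<psi>[of 0 undefined]], of N] obtain D where D: "D > 0"
    "\<And>y. (1 + norm y) ^ N * cmod (\<psi> y) \<le> D" by blast
  from decays_integrable_ex[OF RD_decays[OF r[of 0 undefined]], of N] obtain E where E: "E > 0"
    "\<And>p. p \<in> P \<Longrightarrow> integrable lborel (\<lambda>y. (1 + norm y) ^ N *\<^sub>R r p y)"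
    "\<And>p. p \<in> P \<Longrightarrow> (LINT y|lborel. (1 + norm y) ^ N * cmod (r p y)) \<le> E" by blast
  show ?thesis
  proof (rule that[of "max C1 (D * E) * 2 ^ N"])
    show "max C1 (D * E) * 2 ^ N > 0" using C1(1) by (simp add: max_def)
    fix p x \<xi> assume p: "p \<in> P"
    let ?v = "cmod (wave_packet \<psi> (r p) x \<xi>)"
    have "(1 + norm \<xi>) ^ N * ?v \<le> C1"
      using C1(2)[of "(p, x)" \<xi>] p unfolding wave_packet_eq_fourier by (simp add: mult.commute)
    then have 1: "(1 + norm \<xi>) ^ N * ?v \<le> max C1 (D * E)" by simp
    have pt: "(1 + norm x) ^ N * (cmod (\<psi> (y - x)) * cmod (r p y)) \<le> D * ((1 + norm y) ^ N * cmod (r p y))" for y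
    proof -
      \<comment> \<open>A Peetre-type inequality: it distributes the weight in x over the window at
        y - x and the function at y.\<close>
      have "1 + norm x \<le> (1 + norm (y - x)) * (1 + norm y)"
      proof -
        have "(1 + norm (y - x)) * (1 + norm y) = 1 + norm (y - x) + norm y + norm (y - x) * norm y"
          by (simp add: algebra_simps)
        moreover have "0 \<le> norm (y - x) * norm y" "norm x \<le> norm y + norm (y - x)"
          using norm_triangle_ineq4[of y "y - x"] by simp_all
        ultimately show ?thesis by linarith
      qed
      then have "(1 + norm x) ^ N \<le> (1 + norm (y - x)) ^ N * (1 + norm y) ^ N"
        unfolding power_mult_distrib[symmetric] by (intro power_mono) auto
      then have "(1 + norm x) ^ N * (cmod (\<psi> (y - x)) * cmod (r p y)) \<le>
         ((1 + norm (y - x)) ^ N * (1 + norm y) ^ N) * (cmod (\<psi> (y - x)) * cmod (r p y))"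
        by (intro mult_right_mono) auto
      also have "\<dots> = ((1 + norm (y - x)) ^ N * cmod (\<psi> (y - x))) * ((1 + norm y) ^ N * cmod (r p y))"
        by (simp add: mult_ac)
      also have "\<dots> \<le> D * ((1 + norm y) ^ N * cmod (r p y))" by (intro mult_right_mono D) auto
      finally show ?thesis .
    qed
    have "(1 + norm x) ^ N * ?v \<le> (1 + norm x) ^ N * (LINT y|lborel. cmod (\<psi> (y - x)) * cmod (r p y))"
      using cmod_fourier_le[of "\<lambda>y. cnj (\<psi> (y - x)) * r p y" \<xi>]
      unfolding wave_packet_eq_fourier by (intro mult_left_mono) (auto simp: norm_mult)
    also have "\<dots> = (LINT y|lborel. (1 + norm x) ^ N * (cmod (\<psi> (y - x)) * cmod (r p y)))" by simp
    also have "\<dots> \<le> (LINT y|lborel. D * ((1 + norm y) ^ N * cmod (r p y)))"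
      using integrable_norm[OF E(2)[OF p]] D(1) pt
      by (intro integral_mono' integrable_mult_right) auto
    also have "\<dots> \<le> D * E" using E(3)[OF p] D(1) by simp
    finally have 2: "(1 + norm x) ^ N * ?v \<le> max C1 (D * E)" by simp
    show "?v \<le> max C1 (D * E) * 2 ^ N * kern N (x, \<xi>)"
      by (rule le_kern_Pair[OF 2 1]) simp
  qed
qed

lemma ennreal_power2_le_imp_le:
  assumes "x\<^sup>2 \<le> ennreal c" "c \<ge> 0" shows "x \<le> ennreal (sqrt c)"
proof (cases x)
  case (real r)
  then have "r\<^sup>2 \<le> c" using assms by (simp add: ennreal_power)
  then have "r \<le> sqrt c" using real_le_rsqrt by blast
  then show ?thesis using real assms by (simp add: ennreal_leI)
next
  case top
  then show ?thesis using assms by (simp add: power2_eq_square ennreal_top_mult top_unique)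
qed

lemma L2_Cauchy_Schwarz:
  fixes f g :: "'a::euclidean_space \<Rightarrow> complex"
  assumes [measurable]: "f \<in> borel_measurable borel" "g \<in> borel_measurable borel"
    and A: "(\<integral>\<^sup>+y. ennreal (cmod (f y)) ^ 2 \<partial>lborel) \<le> ennreal A" "0 \<le> A"
    and B: "(\<integral>\<^sup>+y. ennreal (cmod (g y)) ^ 2 \<partial>lborel) \<le> ennreal B" "0 \<le> B"
  shows "(\<integral>\<^sup>+y. ennreal (cmod (f y) * cmod (g y)) \<partial>lborel) \<le> ennreal (sqrt (A * B))"
    and "integrable lborel (\<lambda>y. f y * g y)"
    and "cmod (LINT y|lborel. f y * g y) \<le> sqrt (A * B)"
proof -
  have "(\<integral>\<^sup>+y. ennreal (cmod (f y)) * ennreal (cmod (g y)) \<partial>lborel)\<^sup>2 \<le> ennreal A * ennreal B"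
    by (rule order_trans[OF Cauchy_Schwarz_nn_integral mult_mono[OF A(1) B(1)]]) auto
  then show *: "(\<integral>\<^sup>+y. ennreal (cmod (f y) * cmod (g y)) \<partial>lborel) \<le> ennreal (sqrt (A * B))"
    using A(2) B(2) by (intro ennreal_power2_le_imp_le) (auto simp: ennreal_mult)
  show i: "integrable lborel (\<lambda>y. f y * g y)"
    by (rule integrableI_bounded) (use * in \<open>auto simp: norm_mult intro: le_less_trans\<close>)
  have "ennreal (cmod (LINT y|lborel. f y * g y)) \<le> (\<integral>\<^sup>+y. ennreal (cmod (f y * g y)) \<partial>lborel)"
    by (rule integral_norm_bound_ennreal[OF i])
  also have "\<dots> \<le> ennreal (sqrt (A * B))" using * by (simp add: norm_mult)
  finally show "cmod (LINT y|lborel. f y * g y) \<le> sqrt (A * B)"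
    using A(2) B(2) by (simp add: ennreal_le_iff)
qed

text \<open>For fixed x, inversion in the frequency recovers the product of the conjugated window
  and r at y. Multiplying by \<psi> (y - x) and integrating over x leaves the squared norm of
  \<psi>. The bound on N makes the transform integrable on phase space, whose dimension is twice
  that of position space.\<close>

lemma reproducing:
  fixes \<psi> r :: "real^'n::finite \<Rightarrow> complex"
  assumes \<psi>: "decays UNIV (\<lambda>_::unit. \<psi>)"
    and r: "continuous_on UNIV r" "\<And>y. cmod (r y) \<le> B"
    and W: "\<And>x \<xi>. cmod (wave_packet \<psi> r x \<xi>) \<le> C * kern N (x, \<xi>)" and N: "4 * CARD('n) \<le> N"
  shows "complex_of_real (inv_const TYPE('n) * (LINT y|lborel. (cmod (\<psi> y))\<^sup>2)) * r y =
    (LINT w|lborel. wave_packet \<psi> r (fst w) (snd w) * cis (y \<bullet> snd w) * \<psi> (y - fst w))"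
proof -
  have c\<psi>: "continuous_on UNIV \<psi>" using decays_cont[OF \<psi>] by auto
  have i\<psi>: "integrable lborel \<psi>" using decays_integrable0[OF \<psi>, of "()"] by simp
  from decays_bound[OF \<psi>, of 0] obtain D where D: "D > 0" "\<And>y. cmod (\<psi> y) \<le> D" by auto
  have [measurable]: "\<psi> \<in> borel_measurable borel" "r \<in> borel_measurable borel"
    using c\<psi> r(1) by (auto intro: borel_measurable_continuous_onI)
  have C0: "0 \<le> C" using order_trans[OF norm_ge_zero W[of 0 0]] kern_pos[of N "(0, 0)"]
    by (smt (verit) mult_neg_pos)
  have kN: "integrable lborel (kern N :: (real^'n) \<times> (real^'n) \<Rightarrow> real)" "integrable lborel (kern N :: (real^'n) \<Rightarrow> real)"
    using N by (auto intro!: integrable_kern)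
  have inv: "(LINT \<xi>|lborel. wave_packet \<psi> r x \<xi> * cis (y \<bullet> \<xi>)) =
     complex_of_real (inv_const TYPE('n)) * (cnj (\<psi> (y - x)) * r y)" for x
    unfolding wave_packet_eq_fourier
  proof (rule fourier_inversion)
    show "continuous_on UNIV (\<lambda>y. cnj (\<psi> (y - x)) * r y)"
      by (intro continuous_intros r continuous_on_compose2[OF c\<psi>]) auto
    show "cmod (cnj (\<psi> (y - x)) * r y) \<le> D * B" for y
      using mult_mono[OF D(2)[of "y - x"] r(2)[of y]] D(1) by (simp add: norm_mult)
    have "integrable lborel (\<lambda>y. B * cmod (\<psi> (y - x)))"
      by (intro integrable_mult_right integrable_norm integrable_lborel_translate i\<psi>)
    then show "integrable lborel (\<lambda>y. cnj (\<psi> (y - x)) * r y)"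
    proof (rule Bochner_Integration.integrable_bound)
      have "cmod (cnj (\<psi> (y - x)) * r y) \<le> B * cmod (\<psi> (y - x))" for y
        using mult_right_mono[OF r(2)[of y], of "cmod (\<psi> (y - x))"] by (simp add: norm_mult mult.commute)
      then show "AE y in lborel. norm (cnj (\<psi> (y - x)) * r y) \<le> norm (B * cmod (\<psi> (y - x)))"
        using order_trans[OF norm_ge_zero r(2)] by (simp add: abs_mult)
    qed measurable
    have "integrable lborel (\<lambda>\<xi>::real^'n. C * kern N \<xi>)" by (intro integrable_mult_right kN)
    then show "integrable lborel (fourier (\<lambda>y. cnj (\<psi> (y - x)) * r y))"
    proof (rule Bochner_Integration.integrable_bound)
      show "fourier (\<lambda>y. cnj (\<psi> (y - x)) * r y) \<in> borel_measurable lborel"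
        unfolding fourier_def[abs_def] by measurable
      show "AE \<xi> in lborel. norm (fourier (\<lambda>y. cnj (\<psi> (y - x)) * r y) \<xi>) \<le> norm (C * kern N \<xi>)"
      proof (rule AE_I2)
        fix \<xi>
        have "norm (fourier (\<lambda>y. cnj (\<psi> (y - x)) * r y) \<xi>) \<le> C * kern N (x, \<xi>)"
          using W[of x \<xi>] unfolding wave_packet_eq_fourier .
        also have "\<dots> \<le> C * kern N \<xi>" using C0 by (intro mult_left_mono kern_Pair_le_snd)
        finally show "norm (fourier (\<lambda>y. cnj (\<psi> (y - x)) * r y) \<xi>) \<le> norm (C * kern N \<xi>)" by simp
      qed
    qed
  qed
  let ?\<Phi> = "\<lambda>x \<xi>. wave_packet \<psi> r x \<xi> * cis (y \<bullet> \<xi>) * \<psi> (y - x)"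
  have int: "integrable (lborel \<Otimes>\<^sub>M lborel) (\<lambda>(x, \<xi>). ?\<Phi> x \<xi>)"
    unfolding lborel_prod
  proof (rule Bochner_Integration.integrable_bound[OF integrable_mult_right[OF kN(1), of "C * D"]])
    show "(\<lambda>(x, \<xi>). ?\<Phi> x \<xi>) \<in> borel_measurable lborel" by measurable
    have "cmod (?\<Phi> x \<xi>) \<le> C * D * kern N (x, \<xi>)" for x \<xi>
      using mult_mono[OF W[of x \<xi>] D(2)[of "y - x"]] C0 by (simp add: norm_mult mult_ac)
    then show "AE w in lborel. norm (case w of (x, \<xi>) \<Rightarrow> ?\<Phi> x \<xi>) \<le> norm (C * D * kern N w)"
      using C0 D(1) by (auto simp: abs_mult)
  qed
  have "(LINT w|lborel. wave_packet \<psi> r (fst w) (snd w) * cis (y \<bullet> snd w) * \<psi> (y - fst w))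
     = (LINT x|lborel. LINT \<xi>|lborel. ?\<Phi> x \<xi>)"
    using lborel_pair.integral_fst[OF int] by (simp add: lborel_prod case_prod_unfold)
  also have "\<dots> = (LINT x|lborel. complex_of_real (inv_const TYPE('n)) * r y * complex_of_real ((cmod (\<psi> (y - x)))\<^sup>2))"
  proof (rule Bochner_Integration.integral_cong[OF refl])
    fix x
    have "(LINT \<xi>|lborel. ?\<Phi> x \<xi>) = (LINT \<xi>|lborel. wave_packet \<psi> r x \<xi> * cis (y \<bullet> \<xi>)) * \<psi> (y - x)"
      by (rule integral_mult_left_zero)
    also have "\<dots> = complex_of_real (inv_const TYPE('n)) * r y * (\<psi> (y - x) * cnj (\<psi> (y - x)))"
      unfolding inv by (simp add: mult_ac)
    finally show "(LINT \<xi>|lborel. ?\<Phi> x \<xi>) = complex_of_real (inv_const TYPE('n)) * r y * complex_of_real ((cmod (\<psi> (y - x)))\<^sup>2)"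
      unfolding complex_norm_square .
  qed
  also have "\<dots> = complex_of_real (inv_const TYPE('n)) * r y * complex_of_real (LINT x|lborel. (cmod (\<psi> (y - x)))\<^sup>2)"
    by (simp del: of_real_power)
  also have "(LINT x|lborel. (cmod (\<psi> (y - x)))\<^sup>2) = (LINT x|lborel. (cmod (\<psi> x))\<^sup>2)"
    by (rule integral_lborel_translate) measurable
  finally show ?thesis by (simp add: mult_ac)
qed

lemma decays_square:
  fixes \<psi> :: "real^'n::finite \<Rightarrow> complex"
  assumes "decays UNIV (\<lambda>_::unit. \<psi>)"
  shows "integrable lborel (\<lambda>y. (cmod (\<psi> y))\<^sup>2)"
    and "(\<integral>\<^sup>+y. ennreal (cmod (\<psi> (y - x))) ^ 2 \<partial>lborel) \<le> ennreal (LINT y|lborel. (cmod (\<psi> y))\<^sup>2)"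
proof -
  have c\<psi>: "continuous_on UNIV \<psi>" using decays_cont[OF assms] by auto
  then have [measurable]: "\<psi> \<in> borel_measurable borel" by (auto intro: borel_measurable_continuous_onI)
  have i\<psi>: "integrable lborel \<psi>" using decays_integrable0[OF assms, of "()"] by simp
  from decays_bound[OF assms, of 0] obtain D where D: "D > 0" "\<And>y. cmod (\<psi> y) \<le> D" by auto
  show i: "integrable lborel (\<lambda>y. (cmod (\<psi> y))\<^sup>2)"
    by (rule Bochner_Integration.integrable_bound[OF integrable_mult_right[OF integrable_norm[OF i\<psi>], of D]])
      (use D in \<open>auto simp: power2_eq_square intro!: mult_right_mono\<close>)
  have "(\<integral>\<^sup>+y. ennreal (cmod (\<psi> (y - x))) ^ 2 \<partial>lborel) = (\<integral>\<^sup>+y. ennreal ((cmod (\<psi> y))\<^sup>2) \<partial>lborel)"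
    by (subst nn_integral_lborel_translate(3)[of "\<lambda>y. ennreal (cmod (\<psi> y)) ^ 2"]) (auto simp: ennreal_power)
  also have "\<dots> = ennreal (LINT y|lborel. (cmod (\<psi> y))\<^sup>2)"
    by (rule nn_integral_eq_integral[OF i]) auto
  finally show "(\<integral>\<^sup>+y. ennreal (cmod (\<psi> (y - x))) ^ 2 \<partial>lborel) \<le> ennreal (LINT y|lborel. (cmod (\<psi> y))\<^sup>2)" by simp
qed

text \<open>The window r is expanded in packets of \<psi> by \<open>reproducing\<close>. After
  exchanging the integrals, the y-integral is the transform of u with window \<psi> at a shifted
  phase space point, up to a unimodular factor; the coefficients decay like the kernel.\<close>

lemma wave_packet_change_window:
  fixes \<psi> r u :: "real^'n::finite \<Rightarrow> complex"
  assumes \<psi>: "decays UNIV (\<lambda>_::unit. \<psi>)"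
    and r: "continuous_on UNIV r" "\<And>y. cmod (r y) \<le> B"
    and W: "\<And>x \<xi>. cmod (wave_packet \<psi> r x \<xi>) \<le> C * kern N (x, \<xi>)" and N: "4 * CARD('n) \<le> N"
    and u: "u \<in> borel_measurable borel" "(\<integral>\<^sup>+y. ennreal (cmod (u y)) ^ 2 \<partial>lborel) < \<infinity>"
  shows "ennreal (inv_const TYPE('n) * (LINT y|lborel. (cmod (\<psi> y))\<^sup>2) * cmod (wave_packet r u x \<xi>))
    \<le> ennreal C * (\<integral>\<^sup>+w. ennreal (kern N ((x, \<xi>) - w)) * ennreal (cmod (wave_packet \<psi> u (fst w) (snd w))) \<partial>lborel)"
proof -
  define K where "K = inv_const TYPE('n) * (LINT y|lborel. (cmod (\<psi> y))\<^sup>2)"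
  have K0: "0 \<le> K" unfolding K_def using inv_const_pos[where 'n='n] by simp
  have c\<psi>: "continuous_on UNIV \<psi>" using decays_cont[OF \<psi>] by auto
  have [measurable]: "\<psi> \<in> borel_measurable borel" "r \<in> borel_measurable borel" "u \<in> borel_measurable borel"
    using c\<psi> r(1) u(1) by (auto intro: borel_measurable_continuous_onI)
  have C0: "0 \<le> C" using order_trans[OF norm_ge_zero W[of 0 0]] kern_pos[of N "(0, 0)"]
    by (smt (verit) mult_neg_pos)
  have kN: "(\<integral>\<^sup>+w. ennreal (kern N (w :: (real^'n) \<times> (real^'n))) \<partial>lborel) < \<infinity>"
    using N by (intro nn_integral_kern_finite) simp
  let ?W = "\<lambda>w. wave_packet \<psi> u (fst w) (snd w)"
  let ?a = "\<lambda>w. wave_packet \<psi> r (fst w) (snd w)"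
  let ?N\<psi> = "LINT y|lborel. (cmod (\<psi> y))\<^sup>2"
  obtain Au where Au: "Au \<ge> 0" "(\<integral>\<^sup>+y. ennreal (cmod (u y)) ^ 2 \<partial>lborel) = ennreal Au"
    using u(2) by (cases "\<integral>\<^sup>+y. ennreal (cmod (u y)) ^ 2 \<partial>lborel") auto
  have CS: "(\<integral>\<^sup>+y. ennreal (cmod (\<psi> (y - c)) * cmod (u y)) \<partial>lborel) \<le> ennreal (sqrt (?N\<psi> * Au))" for c
    using Au decays_square[OF \<psi>] by (intro L2_Cauchy_Schwarz) auto
  have [measurable]: "?a \<in> borel_measurable borel"
    by (intro borel_measurable_wave_packet borel_measurable_fst_snd) measurable
  \<comment> \<open>The integrand with the conjugated window already expanded; w is the phase space
    variable of the expansion. Integrating out w gives back the window r, integrating out y gives an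
    overlap with \<psi>.\<close>
  define \<Phi> where "\<Phi> w y = cnj (?a w) * cis (- ((y - x) \<bullet> snd w)) * cnj (\<psi> (y - x - fst w)) * u y * cis (- (y \<bullet> \<xi>))"
    for w :: "(real^'n) \<times> (real^'n)" and y
  have \<Phi>[measurable]: "(\<lambda>(w, y). \<Phi> w y) \<in> borel_measurable (lborel \<Otimes>\<^sub>M lborel)" unfolding \<Phi>_def by measurable
  have int: "integrable (lborel \<Otimes>\<^sub>M lborel) (\<lambda>(w, y). \<Phi> w y)"
  proof (rule integrableI_bounded)
    have "(\<integral>\<^sup>+z. ennreal (norm (case z of (w, y) \<Rightarrow> \<Phi> w y)) \<partial>(lborel \<Otimes>\<^sub>M lborel)) =
      (\<integral>\<^sup>+w. \<integral>\<^sup>+y. ennreal (norm (\<Phi> w y)) \<partial>lborel \<partial>lborel)"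
      by (subst lborel.nn_integral_fst[symmetric]) auto
    also have "\<dots> \<le> (\<integral>\<^sup>+w. ennreal (C * kern N (w :: (real^'n) \<times> (real^'n))) * ennreal (sqrt (?N\<psi> * Au)) \<partial>lborel)"
    proof (rule nn_integral_mono)
      fix w :: "(real^'n) \<times> (real^'n)"
      have "(\<integral>\<^sup>+y. ennreal (norm (\<Phi> w y)) \<partial>lborel) = (\<integral>\<^sup>+y. ennreal (cmod (?a w)) * ennreal (cmod (\<psi> (y - (x + fst w))) * cmod (u y)) \<partial>lborel)"
        unfolding \<Phi>_def by (simp add: norm_mult ennreal_mult[symmetric] mult_ac diff_diff_eq)
      also have "\<dots> = ennreal (cmod (?a w)) * (\<integral>\<^sup>+y. ennreal (cmod (\<psi> (y - (x + fst w))) * cmod (u y)) \<partial>lborel)"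
        by (rule nn_integral_cmult) measurable
      also have "\<dots> \<le> ennreal (C * kern N w) * ennreal (sqrt (?N\<psi> * Au))"
        using W[of "fst w" "snd w"] by (intro mult_mono CS ennreal_leI) auto
      finally show "(\<integral>\<^sup>+y. ennreal (norm (\<Phi> w y)) \<partial>lborel) \<le> ennreal (C * kern N w) * ennreal (sqrt (?N\<psi> * Au))" .
    qed
    also have "\<dots> = ennreal C * (\<integral>\<^sup>+w. ennreal (kern N (w :: (real^'n) \<times> (real^'n))) \<partial>lborel) * ennreal (sqrt (?N\<psi> * Au))"
      using C0 by (simp add: nn_integral_multc nn_integral_cmult ennreal_mult)
    also have "\<dots> < \<infinity>" using kN by (simp add: ennreal_mult_less_top)
    finally show "(\<integral>\<^sup>+z. ennreal (norm (case z of (w, y) \<Rightarrow> \<Phi> w y)) \<partial>(lborel \<Otimes>\<^sub>M lborel)) < \<infinity>" .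
  qed (rule \<Phi>)
  have "complex_of_real K * wave_packet r u x \<xi> = (LINT y|lborel. LINT w|lborel. \<Phi> w y)"
  proof -
    have "complex_of_real K * (cnj (r (y - x)) * u y * cis (- (y \<bullet> \<xi>))) = (LINT w|lborel. \<Phi> w y)" for y
    proof -
      have "complex_of_real K * cnj (r (y - x)) = cnj (complex_of_real K * r (y - x))" by simp
      also have "\<dots> = cnj (LINT w|lborel. ?a w * cis ((y - x) \<bullet> snd w) * \<psi> (y - x - fst w))"
        using reproducing[OF \<psi> r W N, of "y - x"] unfolding K_def by simp
      also have "\<dots> = (LINT w|lborel. cnj (?a w) * cis (- ((y - x) \<bullet> snd w)) * cnj (\<psi> (y - x - fst w)))"
        by (simp add: cis_cnj flip: Bochner_Integration.integral_cnj)
      finally have "complex_of_real K * cnj (r (y - x)) = (LINT w|lborel. cnj (?a w) * cis (- ((y - x) \<bullet> snd w)) * cnj (\<psi> (y - x - fst w)))" .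
      then show ?thesis unfolding \<Phi>_def by (simp add: mult.assoc[symmetric])
    qed
    then show ?thesis unfolding wave_packet_def by (subst integral_mult_right_zero[symmetric]) simp
  qed
  also have "\<dots> = (LINT w|lborel. LINT y|lborel. \<Phi> w y)"
    by (rule lborel_pair.Fubini_integral[OF int])
  also have "\<dots> = (LINT w|lborel. cnj (?a w) * cis (x \<bullet> snd w) * ?W ((x, \<xi>) + w))"
  proof (rule Bochner_Integration.integral_cong[OF refl])
    fix w :: "(real^'n) \<times> (real^'n)"
    have "\<Phi> w y = cnj (?a w) * cis (x \<bullet> snd w) * (cnj (\<psi> (y - (x + fst w))) * u y * cis (- (y \<bullet> (\<xi> + snd w))))" for y
    proof -
      have "cis (- ((y - x) \<bullet> snd w)) * cis (- (y \<bullet> \<xi>)) = cis (x \<bullet> snd w) * cis (- (y \<bullet> (\<xi> + snd w)))"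
        by (simp add: cis_mult inner_diff_left inner_add_right algebra_simps)
      then show ?thesis unfolding \<Phi>_def by (simp add: mult_ac diff_diff_eq)
    qed
    then show "(LINT y|lborel. \<Phi> w y) = cnj (?a w) * cis (x \<bullet> snd w) * ?W ((x, \<xi>) + w)"
      unfolding wave_packet_def[of \<psi> u] by simp
  qed
  finally have "ennreal (cmod (complex_of_real K * wave_packet r u x \<xi>)) \<le>
     ennreal (cmod (LINT w|lborel. cnj (?a w) * cis (x \<bullet> snd w) * ?W ((x, \<xi>) + w)))" by simp
  also have "\<dots> \<le> (\<integral>\<^sup>+w. ennreal (cmod (cnj (?a w) * cis (x \<bullet> snd w) * ?W ((x, \<xi>) + w))) \<partial>lborel)"
  \<comment> \<open>A Bochner integral of a non-integrable function is 0 by convention, so in that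
    case the bound is trivial.\<close>
  proof (cases "integrable lborel (\<lambda>w. cnj (?a w) * cis (x \<bullet> snd w) * ?W ((x, \<xi>) + w))")
    case True then show ?thesis by (rule integral_norm_bound_ennreal)
  next
    case False then show ?thesis by (simp add: not_integrable_integral_eq)
  qed
  also have "\<dots> \<le> (\<integral>\<^sup>+w. ennreal C * (ennreal (kern N w) * ennreal (cmod (?W (w + (x, \<xi>))))) \<partial>lborel)"
    using W C0 by (intro nn_integral_mono)
      (auto simp: norm_mult add.commute mult.assoc[symmetric] ennreal_mult[symmetric] intro!: ennreal_leI mult_right_mono)
  also have "\<dots> = ennreal C * (\<integral>\<^sup>+w. ennreal (kern N w) * ennreal (cmod (?W (w + (x, \<xi>)))) \<partial>lborel)"
    by (rule nn_integral_cmult) measurable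
  also have "(\<integral>\<^sup>+w. ennreal (kern N w) * ennreal (cmod (?W (w + (x, \<xi>)))) \<partial>lborel)
    = (\<integral>\<^sup>+w. ennreal (kern N ((x, \<xi>) - w)) * ennreal (cmod (?W w)) \<partial>lborel)"
    by (subst (2) nn_integral_lborel_translate(1)[of _ "(x, \<xi>)", symmetric])
      (auto simp: kern_minus_commute[of N "(x, \<xi>)"])
  finally show ?thesis using K0 unfolding K_def[symmetric] by (simp add: norm_mult)
qed

section \<open>A compactly supported window\<close>

lemma dir_deriv_eq: "(f has_derivative D) (at x) \<Longrightarrow> dir_deriv v f x = D v"
  unfolding dir_deriv_def using frechet_derivative_at by metis

lemma C_k_SucI:
  assumes "\<And>x. (f has_derivative D x) (at x)" "\<And>b. b \<in> Basis \<Longrightarrow> C_k k (\<lambda>x. D x b)"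
  shows "C_k (Suc k) f"
proof -
  have "dir_deriv b f = (\<lambda>x. D x b)" for b
    using dir_deriv_eq[OF assms(1)] by (auto simp: fun_eq_iff)
  then show ?thesis using assms by (auto simp: differentiable_def)
qed

lemma C_k_has_derivative:
  assumes "C_k (Suc k) f" shows "(f has_derivative (\<lambda>v. dir_deriv v f x)) (at x)"
  using assms unfolding dir_deriv_def by (auto simp: frechet_derivative_works)

lemma C_k_SucD: "C_k (Suc k) f \<Longrightarrow> C_k k f"
proof (induction k arbitrary: f)
  case 0
  then show ?case by (auto simp: continuous_at_imp_continuous_on differentiable_imp_continuous_within)
qed auto

lemma C_k_continuous: "C_k k f \<Longrightarrow> continuous_on UNIV f"
  by (induction k) (auto simp: continuous_at_imp_continuous_on differentiable_imp_continuous_within)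

lemma C_k_const: "C_k k (\<lambda>x. c)"
proof (induction k arbitrary: c)
  case (Suc k)
  show ?case by (rule C_k_SucI[where D = "\<lambda>x v. 0"]) (auto intro: Suc)
qed simp

lemma C_k_add: "C_k k f \<Longrightarrow> C_k k g \<Longrightarrow> C_k k (\<lambda>x. f x + g x)"
proof (induction k arbitrary: f g)
  case (Suc k)
  show ?case
    by (rule C_k_SucI[OF has_derivative_add[OF C_k_has_derivative[OF Suc.prems(1)] C_k_has_derivative[OF Suc.prems(2)]]])
      (use Suc in auto)
qed (auto intro: continuous_intros)

lemma C_k_scaleR:
  fixes f :: "'a::euclidean_space \<Rightarrow> real"
  shows "C_k k f \<Longrightarrow> C_k k g \<Longrightarrow> C_k k (\<lambda>x. f x *\<^sub>R g x)"
proof (induction k arbitrary: f g)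
  case (Suc k)
  have "C_k k (\<lambda>x. f x *\<^sub>R dir_deriv b g x)" "C_k k (\<lambda>x. dir_deriv b f x *\<^sub>R g x)" if "b \<in> Basis" for b
    using Suc.prems that by (auto intro!: Suc.IH intro: C_k_SucD simp del: C_k.simps(2)) auto
  then show ?case
    by (intro C_k_SucI[OF has_derivative_scaleR[OF C_k_has_derivative[OF Suc.prems(1)] C_k_has_derivative[OF Suc.prems(2)]]] C_k_add)
qed (auto intro: continuous_intros)

lemma C_k_linear:
  assumes "bounded_linear f" shows "C_k k f"
proof (cases k)
  case (Suc l)
  show ?thesis unfolding Suc
    by (rule C_k_SucI[OF bounded_linear_imp_has_derivative[OF assms] C_k_const])
qed (use assms in \<open>auto simp: linear_continuous_on\<close>)

text \<open>With an outer function of one real variable the chain rule has a single term, the scalar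
  \<open>dir_deriv b f x\<close> times \<open>dir_deriv 1 h (f x)\<close>, so the induction needs
  only h to vary.\<close>

lemma C_k_compose_real:
  fixes h :: "real \<Rightarrow> 'b::real_normed_vector"
  shows "C_k k h \<Longrightarrow> C_k k f \<Longrightarrow> C_k k (\<lambda>x. h (f x))"
proof (induction k arbitrary: h)
  case 0
  then show ?case by (auto intro: continuous_on_compose2)
next
  case (Suc k)
  have lin: "dir_deriv v h s = v *\<^sub>R dir_deriv 1 h s" for v s
  proof -
    have "linear (\<lambda>v. dir_deriv v h s)"
      using C_k_has_derivative[OF Suc.prems(1)] has_derivative_linear by blast
    from linear_scale[OF this, of v 1] show ?thesis by simp
  qed
  have 1: "C_k k (dir_deriv 1 h)" using Suc.prems(1) by simp
  have "C_k k (\<lambda>x. dir_deriv b f x *\<^sub>R dir_deriv 1 h (f x))" if "b \<in> Basis" for b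
    using Suc.prems(2) that by (intro C_k_scaleR Suc.IH[OF 1] C_k_SucD[OF Suc.prems(2)]) auto
  then have *: "C_k k (\<lambda>x. dir_deriv (dir_deriv b f x) h (f x))" if "b \<in> Basis" for b
    using that by (subst lin)
  show ?case
    by (rule C_k_SucI[OF has_derivative_compose[OF C_k_has_derivative[OF Suc.prems(2)] C_k_has_derivative[OF Suc.prems(1)]]])
      (rule *)
qed

lemma C_k_translate: "C_k k f \<Longrightarrow> C_k k (\<lambda>x. f (x - c))"
proof (induction k arbitrary: f)
  case 0
  then show ?case by (auto intro!: continuous_on_compose2[of UNIV f] continuous_intros)
next
  case (Suc k)
  have "((\<lambda>x. x - c) has_derivative (\<lambda>v. v)) (at x)" for x by (auto intro!: derivative_eq_intros)
  from has_derivative_compose[OF this C_k_has_derivative[OF Suc.prems]]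
  show ?case by (rule C_k_SucI) (use Suc in auto)
qed

lemma C_k_cis: "C_k k (\<lambda>t. c * cis t)"
proof (induction k arbitrary: c)
  case 0
  show ?case by (auto intro!: continuous_intros)
next
  case (Suc k)
  have "((\<lambda>t. c * cis t) has_derivative (\<lambda>v. v *\<^sub>R (c * \<i> * cis t))) (at t)" for t
    using has_vector_derivative_mult_right[OF cis_has_vector_derivative[of 0 1 t], of c]
    unfolding has_vector_derivative_def by (simp add: mult.assoc)
  then show ?case by (rule C_k_SucI) (auto intro: Suc)
qed

lemma C_k_dist_sq: "C_k k (\<lambda>x::'a::euclidean_space. a + b * (norm x)\<^sup>2)"
proof (cases k)
  case (Suc l)
  have *: "((\<lambda>x. a + b * (norm x)\<^sup>2) has_derivative (\<lambda>v. b * (2 * (v \<bullet> x)))) (at x)" for x :: 'a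
    unfolding power2_norm_eq_inner by (auto intro!: derivative_eq_intros simp: inner_commute)
  have "bounded_linear (\<lambda>x. b * (2 * (v \<bullet> x)))" for v :: 'a
    by (intro bounded_linear_intros)
  then show ?thesis unfolding Suc by (intro C_k_SucI[OF *] C_k_linear)
qed (auto intro!: continuous_intros)

text \<open>The classical flat function is m = 0. The extra power makes the family closed under
  differentiation up to linear combinations, which reduces smoothness to an induction.\<close>

definition expinv :: "nat \<Rightarrow> real \<Rightarrow> real"
  where "expinv m x = (if x > 0 then inverse x ^ m * exp (- inverse x) else 0)"

lemma expinv_nonneg: "0 \<le> expinv m x"
  unfolding expinv_def by simp

text \<open>The exponential series at 1/x dominates its term of degree m + 2, and two of these
  powers become x^2. The bound shows that all members are flat at 0.\<close>

lemma expinv_quadratic: "expinv m x \<le> fact (m + 2) * x\<^sup>2"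
proof (cases "x > 0")
  case True
  let ?y = "inverse x"
  have y: "?y > 0" using True by simp
  have "?y ^ (m + 2) / fact (m + 2) \<le> exp ?y"
  proof -
    have "(\<Sum>n\<in>{m+2}. inverse (fact n) * ?y ^ n) \<le> (\<Sum>n. inverse (fact n) * ?y ^ n)"
      using y by (intro sum_le_suminf summable_exp) auto
    then show ?thesis by (simp add: exp_def field_simps)
  qed
  then have "?y ^ (m + 2) \<le> exp ?y * fact (m + 2)" by (simp only: pos_divide_le_eq fact_gt_zero)
  then have "?y ^ (m + 2) * exp (- ?y) \<le> exp ?y * fact (m + 2) * exp (- ?y)" by (intro mult_right_mono) auto
  also have "\<dots> = fact (m + 2) * (exp ?y * exp (- ?y))" by (simp only: mult_ac)
  also have "exp ?y * exp (- ?y) = 1" by (rule exp_minus_inverse)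
  finally have "?y ^ m * (?y\<^sup>2 * exp (- ?y)) \<le> fact (m + 2)"
    by (simp only: power_add mult.assoc mult_1_right)
  then show ?thesis using True unfolding expinv_def
    by (simp add: field_simps power2_eq_square)
qed (auto simp: expinv_def)

lemma expinv_has_derivative:
  "(expinv m has_real_derivative (- real m * expinv (m + 1) x + expinv (m + 2) x)) (at x)"
proof -
  consider "x > 0" | "x < 0" | "x = 0" by linarith
  then show ?thesis
  proof cases
    case 1
    have "((\<lambda>x. inverse x ^ m * exp (- inverse x)) has_real_derivative (- real m * expinv (m + 1) x + expinv (m + 2) x)) (at x)"
      using 1 by (cases m) (auto intro!: derivative_eq_intros simp: expinv_def algebra_simps power2_eq_square,
          metis One_nat_def power_eq_if)
    moreover have ev: "\<forall>\<^sub>F y in nhds x. expinv m y = inverse y ^ m * exp (- inverse y)"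
      using eventually_nhds_in_open[of "{0<..}" x] 1 by (auto elim!: eventually_mono simp: expinv_def)
    ultimately show ?thesis using DERIV_cong_ev[OF refl ev refl] by blast
  next
    case 2
    have "((\<lambda>x. 0) has_real_derivative (- real m * expinv (m + 1) x + expinv (m + 2) x)) (at x)"
      using 2 by (auto simp: expinv_def)
    moreover have ev: "\<forall>\<^sub>F y in nhds x. expinv m y = 0"
      using eventually_nhds_in_open[of "{..<0}" x] 2 by (auto elim!: eventually_mono simp: expinv_def)
    ultimately show ?thesis using DERIV_cong_ev[OF refl ev refl] by blast
  next
    case 3
    have "(expinv m has_vector_derivative 0) (at 0)"
      by (rule has_vector_derivative_quadratic_remainder[where C = "fact (m + 2)"])
        (use expinv_nonneg expinv_quadratic in \<open>auto simp: expinv_def[of _ 0]\<close>)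
    then show ?thesis using 3 by (simp add: has_real_derivative_iff_has_vector_derivative expinv_def[of _ 0])
  qed
qed

lemma C_k_expinv: "C_k k (expinv m)"
proof (induction k arbitrary: m)
  case 0
  then show ?case
    using DERIV_isCont[OF expinv_has_derivative] by (auto intro!: continuous_at_imp_continuous_on)
next
  case (Suc k)
  have "(expinv m has_derivative (\<lambda>v. (- real m * expinv (m + 1) x + expinv (m + 2) x) * v)) (at x)" for x
    using expinv_has_derivative[of m x] unfolding has_field_derivative_def .
  moreover have "C_k k (\<lambda>x. (- real m) *\<^sub>R expinv (m + 1) x + expinv (m + 2) x)"
    by (intro C_k_add C_k_scaleR C_k_const Suc)
  ultimately show ?case
    by (intro C_k_SucI[where D = "\<lambda>x v. (- real m * expinv (m + 1) x + expinv (m + 2) x) * v"]) auto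
qed

text \<open>Through 1 - |y|^2 the norm enters only squared, so smoothness at the origin is not
  disturbed.\<close>

definition bump :: "real^'n::finite \<Rightarrow> real"
  where "bump y = expinv 0 (1 - (norm y)\<^sup>2)"

definition bumpc :: "real^'n::finite \<Rightarrow> complex"
  where "bumpc y = complex_of_real (bump y)"

lemma C_k_bump: "C_k k bump"
  unfolding bump_def using C_k_compose_real[OF C_k_expinv C_k_dist_sq[of k 1 "-1"]] by simp

lemma C_k_of_real: "C_k k f \<Longrightarrow> C_k k (\<lambda>x. complex_of_real (f x))"
  using C_k_scaleR[OF _ C_k_const[of k "1::complex"], of f] by (simp add: scaleR_conv_of_real)

lemma C_k_bumpc: "C_k k bumpc"
  unfolding bumpc_def[abs_def] by (intro C_k_of_real C_k_bump)

lemma bump_eq_0: "norm y \<ge> 1 \<Longrightarrow> bump y = 0"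
proof -
  assume "norm y \<ge> 1"
  then have "1 \<le> (norm y)\<^sup>2" by (rule one_le_power)
  then have "\<not> 1 - (norm y)\<^sup>2 > 0" by linarith
  then show ?thesis unfolding bump_def expinv_def by simp
qed

lemma bump_0: "bump 0 > 0"
  unfolding bump_def expinv_def by simp

lemma cnj_bumpc [simp]: "cnj (bumpc y) = bumpc y"
  unfolding bumpc_def by simp

lemma pd_partial:
  assumes "\<And>x. f differentiable (at x)"
  shows "pd j f (partial j f)"
  unfolding pd_def
proof
  fix y
  let ?e = "axis j 1 :: real^'a"
  have "((\<lambda>s. y + s *\<^sub>R ?e) has_vector_derivative ?e) (at 0)"
    by (auto intro!: derivative_eq_intros)
  moreover have "(f has_derivative frechet_derivative f (at y)) (at (y + 0 *\<^sub>R ?e))"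
    using frechet_derivative_works[THEN iffD1, OF assms] by simp
  ultimately have "((f \<circ> (\<lambda>s. y + s *\<^sub>R ?e)) has_vector_derivative frechet_derivative f (at y) ?e) (at 0)"
    by (rule vector_derivative_diff_chain_within[OF _ has_derivative_at_withinI])
  then show "((\<lambda>s. f (y + s *\<^sub>R ?e)) has_vector_derivative partial j f y) (at 0)"
    unfolding partial_def dir_deriv_def o_def .
qed

lemma C_k_partial: "C_k (Suc k) f \<Longrightarrow> C_k k (partial j f)"
  unfolding partial_def by (auto simp: axis_in_Basis_iff)

lemma smooth_partial: "smooth f \<Longrightarrow> smooth (partial j f)"
  unfolding smooth_def by (auto intro: C_k_partial simp del: C_k.simps)

lemma smooth_partial_pow: "smooth f \<Longrightarrow> smooth ((partial j ^^ m) f)"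
  by (induction m) (auto intro: smooth_partial)

lemma smooth_differentiable: "smooth f \<Longrightarrow> f differentiable (at x)"
  unfolding smooth_def by (drule spec[of _ 1]) simp

lemma partial_zero_outside:
  fixes f :: "real^'n::finite \<Rightarrow> 'b::real_normed_vector"
  assumes "\<And>y. norm y > \<rho> \<Longrightarrow> f y = 0" "norm y > \<rho>"
  shows "partial j f y = 0"
proof -
  have "open {y::real^'n. norm y > \<rho>}" by (intro open_Collect_less continuous_intros)
  have "((\<lambda>_. 0) has_derivative (\<lambda>_. 0)) (at y)" by simp
  then have "(f has_derivative (\<lambda>_. 0)) (at y)"
    by (rule has_derivative_transform_within_open[OF _ \<open>open _\<close>]) (use assms in auto)
  then show ?thesis unfolding partial_def by (rule dir_deriv_eq)
qed

lemma decays_compact_support: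
  fixes f :: "real^'n::finite \<Rightarrow> complex"
  assumes "continuous_on UNIV f" "\<And>y. norm y > 1 \<Longrightarrow> f y = 0"
  shows "decays P (\<lambda>_. f)"
proof -
  have "compact (f ` cball 0 1)"
    using assms(1) by (intro compact_continuous_image) (auto intro: continuous_on_subset)
  then have "bounded (f ` cball 0 1)" by (rule compact_imp_bounded)
  then obtain B where B: "B > 0" "\<And>y. norm y \<le> 1 \<Longrightarrow> cmod (f y) \<le> B" unfolding bounded_pos by auto
  have "(1 + norm y) ^ N * cmod (f y) \<le> 2 ^ N * B" for N y
  proof (cases "norm y \<le> 1")
    case True
    then show ?thesis using B by (intro mult_mono power_mono) auto
  qed (use assms(2) B(1) in auto)
  then show ?thesis unfolding decays_def using assms(1) by blast
qed

lemma RD_compact_support: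
  fixes f :: "real^'n::finite \<Rightarrow> complex"
  assumes "C_k k f" "\<And>y. norm y > 1 \<Longrightarrow> f y = 0"
  shows "RD k j P (\<lambda>_. f)"
  using assms
proof (induction k arbitrary: f)
  case 0
  then show ?case unfolding RD.simps C_k.simps by (intro decays_compact_support)
next
  case (Suc k)
  have "RD k j P (\<lambda>_. partial j f)"
    by (rule Suc.IH[OF C_k_partial[OF Suc.prems(1)] partial_zero_outside[OF Suc.prems(2)]])
  moreover have "pd j f (partial j f)" using Suc.prems(1) by (intro pd_partial) auto
  ultimately show ?case
    using decays_compact_support[OF C_k_continuous[OF Suc.prems(1)] Suc.prems(2)]
    by (intro RD_SucI[where f' = "\<lambda>_. partial j f"]) auto
qed

lemma RD_bumpc: "RD k j P (\<lambda>_. bumpc)"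
  by (intro RD_compact_support C_k_bumpc) (simp add: bumpc_def bump_eq_0)

section \<open>From multi-indices to pure derivatives and mixed second derivatives\<close>

lemma coordinates: "distinct (coordinates :: 'n::finite list)" "set (coordinates :: 'n list) = UNIV"
proof -
  have "\<exists>js :: 'n list. distinct js \<and> set js = UNIV"
    using finite_distinct_list[of "UNIV :: 'n set"] by auto
  from someI_ex[OF this] show "distinct (coordinates :: 'n::finite list)" "set (coordinates :: 'n list) = UNIV"
    unfolding coordinates_def by auto
qed

lemma foldr_partial_none: "(\<And>i. i \<in> set xs \<Longrightarrow> \<alpha> i = 0) \<Longrightarrow> foldr (\<lambda>i. partial i ^^ \<alpha> i) xs f = f"
  by (induction xs) auto

lemma foldr_partial_single:
  "distinct xs \<Longrightarrow> j \<in> set xs \<Longrightarrow> (\<And>i. i \<in> set xs \<Longrightarrow> i \<noteq> j \<Longrightarrow> \<alpha> i = 0) \<Longrightarrow>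
    foldr (\<lambda>i. partial i ^^ \<alpha> i) xs f = (partial j ^^ \<alpha> j) f"
proof (induction xs)
  case (Cons x xs)
  show ?case
  proof (cases "x = j")
    case True
    then have "foldr (\<lambda>i. partial i ^^ \<alpha> i) xs f = f" using Cons.prems by (intro foldr_partial_none) auto
    then show ?thesis using True by simp
  next
    case False
    then show ?thesis using Cons by auto
  qed
qed simp

lemma mi_deriv_single: "mi_deriv (\<lambda>i. if i = j then m else 0) f = (partial j ^^ m) f"
  unfolding mi_deriv_def
  by (subst foldr_partial_single[where j = j]) (use coordinates in auto)

text \<open>The enumeration of coordinates is unspecified, so it is undecided which of the two
  derivatives is applied last; both orders have to be allowed until symmetry is available.\<close>

lemma foldr_partial_pair:
  "distinct xs \<Longrightarrow> i \<in> set xs \<Longrightarrow> j \<in> set xs \<Longrightarrow> i \<noteq> j \<Longrightarrow> \<alpha> i = 1 \<Longrightarrow> \<alpha> j = 1 \<Longrightarrow>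
    (\<And>l. l \<in> set xs \<Longrightarrow> l \<noteq> i \<Longrightarrow> l \<noteq> j \<Longrightarrow> \<alpha> l = 0) \<Longrightarrow>
    foldr (\<lambda>i. partial i ^^ \<alpha> i) xs f \<in> {partial i (partial j f), partial j (partial i f)}"
proof (induction xs)
  case (Cons x xs)
  consider "x = i" | "x = j" | "x \<noteq> i" "x \<noteq> j" by blast
  then show ?case
  proof cases
    case 1
    then have "foldr (\<lambda>i. partial i ^^ \<alpha> i) xs f = (partial j ^^ \<alpha> j) f"
      using Cons.prems by (intro foldr_partial_single) auto
    then show ?thesis using 1 Cons.prems by simp
  next
    case 2
    then have "foldr (\<lambda>i. partial i ^^ \<alpha> i) xs f = (partial i ^^ \<alpha> i) f"
      using Cons.prems by (intro foldr_partial_single) auto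
    then show ?thesis using 2 Cons.prems by simp
  next
    case 3
    then have "\<alpha> x = 0" using Cons.prems by auto
    moreover have "foldr (\<lambda>i. partial i ^^ \<alpha> i) xs f \<in> {partial i (partial j f), partial j (partial i f)}"
      using Cons 3 by (intro Cons.IH) auto
    ultimately show ?thesis by simp
  qed
qed simp

lemma mi_deriv_pair:
  assumes "i \<noteq> j"
  shows "mi_deriv (\<lambda>l. if l = i \<or> l = j then 1 else 0) f \<in> {partial i (partial j f), partial j (partial i f)}"
  unfolding mi_deriv_def by (rule foldr_partial_pair) (use coordinates assms in auto)

text \<open>Only seminorms with a power of one coordinate and derivatives in one direction enter;
  \<open>norm_power_le_coords\<close> assembles the full weight from them.\<close>

lemma RD_schwartz:
  assumes "schwartz f"
  shows "RD k j UNIV (\<lambda>_::unit. f)"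
proof -
  have sm: "smooth f" using assms unfolding schwartz_def by blast
  have dec: "decays UNIV (\<lambda>_::unit. (partial j ^^ m) f)" for m
    unfolding decays_def
  proof (intro conjI ballI allI)
    show "continuous_on UNIV ((partial j ^^ m) f)"
      using smooth_partial_pow[OF sm, where j = j and m = m] unfolding smooth_def by (blast intro: C_k_continuous)
    fix N
    have *: "\<exists>C. \<forall>x. \<bar>x $ i\<bar> ^ M * cmod ((partial j ^^ m) f x) \<le> C" for i M
    proof -
      obtain C where C: "\<And>x. cmod (mi_power x (\<lambda>l. if l = i then M else 0) *\<^sub>R mi_deriv (\<lambda>i. if i = j then m else 0) f x) \<le> C"
        using assms unfolding schwartz_def by blast
      have "mi_power x (\<lambda>l. if l = i then M else 0) = (x $ i) ^ M" for x
        unfolding mi_power_def by (simp add: if_distrib prod.If_cases cong: if_cong)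
      then show ?thesis using C unfolding mi_deriv_single by (auto simp: power_abs)
    qed
    obtain C where C: "\<And>i x. \<bar>x $ i\<bar> ^ N * cmod ((partial j ^^ m) f x) \<le> C i"
      using *[where M = N] by metis
    obtain D where D: "\<And>x. cmod ((partial j ^^ m) f x) \<le> D"
      using *[where i = undefined and M = 0] by auto
    have "(1 + norm x) ^ N * cmod ((partial j ^^ m) f x) \<le> (1 + real CARD('a)) ^ N * (D + (\<Sum>i\<in>UNIV. C i))" for x
    proof -
      have "(1 + norm x) ^ N * cmod ((partial j ^^ m) f x) \<le>
         ((1 + real CARD('a)) ^ N * (1 + (\<Sum>i\<in>UNIV. \<bar>x $ i\<bar> ^ N))) * cmod ((partial j ^^ m) f x)"
        by (intro mult_right_mono norm_power_le_coords) auto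
      also have "\<dots> = (1 + real CARD('a)) ^ N * (cmod ((partial j ^^ m) f x) + (\<Sum>i\<in>UNIV. \<bar>x $ i\<bar> ^ N * cmod ((partial j ^^ m) f x)))"
        by (simp add: distrib_right sum_distrib_right mult.assoc)
      also have "\<dots> \<le> (1 + real CARD('a)) ^ N * (D + (\<Sum>i\<in>UNIV. C i))"
        by (intro mult_left_mono add_mono sum_mono C D) auto
      finally show ?thesis .
    qed
    then show "\<exists>C. \<forall>p\<in>UNIV. \<forall>y. (1 + norm y) ^ N * cmod ((partial j ^^ m) f y) \<le> C" by blast
  qed
  have "RD k j UNIV (\<lambda>_::unit. (partial j ^^ m) f)" for m
  proof (induction k arbitrary: m)
    case (Suc k)
    show ?case
      by (rule RD_SucI[where f' = "\<lambda>_. (partial j ^^ Suc m) f", OF dec])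
        (use Suc[of "Suc m"] pd_partial[OF smooth_differentiable[OF smooth_partial_pow[OF sm]]] in auto)
  qed (use dec in simp)
  from this[of 0] show ?thesis by simp
qed

section \<open>Differential equations and Gronwall estimates\<close>

text \<open>An arbitrary antiderivative normalised to vanish at 0: one formula for both signs of s.
  It is meaningful for h continuous on the whole line, which explains the clamping of time in later
  proofs.\<close>

definition primitive :: "(real \<Rightarrow> 'a::euclidean_space) \<Rightarrow> real \<Rightarrow> 'a"
  where "primitive h s = (let F = (SOME F. \<forall>x. (F has_vector_derivative h x) (at x)) in F s - F 0)"

lemma primitive_0 [simp]: "primitive h 0 = 0"
  unfolding primitive_def by (simp add: Let_def)

lemma primitive_has_vector_derivative:
  assumes "continuous_on UNIV h"
  shows "(primitive h has_vector_derivative h s) (at s)"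
proof -
  have "\<exists>F. \<forall>x. (F has_vector_derivative h x) (at x)"
    using einterval_antiderivative[of "-\<infinity>" "\<infinity>" h] assms
    by (auto simp: continuous_on_eq_continuous_at)
  from someI_ex[OF this] show ?thesis
    unfolding primitive_def Let_def by (auto intro!: derivative_eq_intros)
qed

text \<open>Integrating K exp(lam r) gains the factor 1/lam. A large lam turns this gain into a
  contraction, for Picard iteration as well as for the Gronwall bootstrap.\<close>

lemma exp_weighted_bound:
  fixes F :: "real \<Rightarrow> 'a::real_normed_vector"
  assumes lam: "lam > 0" and F: "\<And>r. r \<in> closed_segment 0 s \<Longrightarrow> (F has_vector_derivative h r) (at r)"
    and bnd: "\<And>r. r \<in> closed_segment 0 s \<Longrightarrow> norm (h r) \<le> K * exp (lam * \<bar>r\<bar>)"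
  shows "norm (F s - F 0) \<le> K / lam * exp (lam * \<bar>s\<bar>)"
proof -
  have K0: "0 \<le> K" using order_trans[OF norm_ge_zero bnd[of 0]] by simp
  have cont: "continuous_on (closed_segment 0 s) F"
    using F by (meson continuous_at_imp_continuous_on has_vector_derivative_continuous)
  consider "s > 0" | "s < 0" | "s = 0" by linarith
  then show ?thesis
  proof cases
    case 1
    then have seg: "closed_segment 0 s = {0..s}" by (simp add: closed_segment_eq_real_ivl)
    have "norm (F s - F 0) \<le> K / lam * exp (lam * s) - K / lam * exp (lam * 0)"
    proof (rule differentiable_bound_general[where f' = h and \<phi>' = "\<lambda>r. K * exp (lam * r)", OF 1])
      fix r assume r: "0 < r" "r < s"
      show "((\<lambda>r. K / lam * exp (lam * r)) has_vector_derivative K * exp (lam * r)) (at r)"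
        using lam unfolding has_real_derivative_iff_has_vector_derivative[symmetric]
        by (auto intro!: derivative_eq_intros)
      show "(F has_vector_derivative h r) (at r)" using F r seg by simp
      show "norm (h r) \<le> K * exp (lam * r)" using bnd[of r] r seg by simp
    qed (use cont seg lam in \<open>auto intro!: continuous_intros\<close>)
    also have "\<dots> \<le> K / lam * exp (lam * \<bar>s\<bar>)" using 1 K0 lam by simp
    finally show ?thesis .
  next
    case 2
    then have seg: "closed_segment 0 s = {s..0}" by (simp add: closed_segment_eq_real_ivl)
    have "norm (F 0 - F s) \<le> - (K / lam * exp (- lam * 0)) - (- (K / lam * exp (- lam * s)))"
    proof (rule differentiable_bound_general[where f' = h and \<phi> = "\<lambda>r. - (K / lam * exp (- lam * r))" and \<phi>' = "\<lambda>r. K * exp (- lam * r)", OF 2])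
      fix r assume r: "s < r" "r < 0"
      show "((\<lambda>r. - (K / lam * exp (- lam * r))) has_vector_derivative K * exp (- lam * r)) (at r)"
        using lam unfolding has_real_derivative_iff_has_vector_derivative[symmetric]
        by (auto intro!: derivative_eq_intros)
      show "(F has_vector_derivative h r) (at r)" using F r seg by simp
      show "norm (h r) \<le> K * exp (- lam * r)" using bnd[of r] r seg by simp
    qed (use cont seg lam in \<open>auto intro!: continuous_intros\<close>)
    also have "\<dots> \<le> K / lam * exp (lam * \<bar>s\<bar>)" using 2 K0 lam by simp
    finally show ?thesis by (simp add: norm_minus_commute)
  next
    case 3
    then show ?thesis using K0 lam by simp
  qed
qed

lemma primitive_weighted_bound:
  assumes "lam > 0" "continuous_on UNIV h" "\<And>r. norm (h r) \<le> K * exp (lam * \<bar>r\<bar>)"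
  shows "norm (primitive h s) \<le> K / lam * exp (lam * \<bar>s\<bar>)"
  using exp_weighted_bound[OF assms(1) primitive_has_vector_derivative[OF assms(2)] assms(3), of s] by simp

lemma primitive_diff:
  assumes "continuous_on UNIV h" "continuous_on UNIV k"
  shows "primitive h s - primitive k s = primitive (\<lambda>r. h r - k r) s"
proof -
  let ?D = "\<lambda>s. primitive h s - primitive k s - primitive (\<lambda>r. h r - k r) s"
  have "(?D has_derivative (\<lambda>v. 0)) (at r)" for r
  proof -
    have "(?D has_vector_derivative h r - k r - (h r - k r)) (at r)"
      by (intro has_vector_derivative_diff primitive_has_vector_derivative assms continuous_intros)
    then show ?thesis by (simp add: has_vector_derivative_def)
  qed
  then have "?D s = ?D 0"
    by (intro has_derivative_zero_unique[of UNIV ?D, simplified]) auto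
  then show ?thesis by simp
qed

text \<open>Picard iteration in an exponentially weighted supremum norm. Writing the unknown as z +
  exp(lam |s|) \<delta>(s) with \<delta> bounded and continuous makes the integral operator a
  contraction without any restriction to short times.\<close>

lemma ode_exists_0:
  fixes f :: "real \<Rightarrow> 'a::euclidean_space \<Rightarrow> 'a"
  assumes cont: "continuous_on UNIV (\<lambda>(t, x). f t x)"
    and lip: "\<And>t x y. norm (f t x - f t y) \<le> L * norm (x - y)"
  shows "\<exists>\<gamma>. \<gamma> 0 = z \<and> (\<forall>s\<in>{-T..T}. (\<gamma> has_vector_derivative f s (\<gamma> s)) (at s))"
proof -
  \<comment> \<open>Chosen so that \<bar>L\<bar> / lam <= 1/2; the added 1 keeps lam positive when L
    = 0.\<close>
  define lam where "lam = 2 * (\<bar>L\<bar> + 1)"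
  have lam: "lam > 0" unfolding lam_def by simp
  have lip': "norm (f t x - f t y) \<le> \<bar>L\<bar> * norm (x - y)" for t x y
    by (rule order_trans[OF lip mult_right_mono]) auto
  \<comment> \<open>Freezing time outside the interval bounds the field at z for all r, so the
    operator maps bounded functions to bounded functions; on [-T, T] nothing changes.\<close>
  define cl where "cl r = max (- T) (min T r)" for r :: real
  have cl_cont [continuous_intros]: "continuous_on S cl" for S
    unfolding cl_def[abs_def] by (intro continuous_intros)
  define G where "G \<delta> r = f (cl r) (z + exp (lam * \<bar>r\<bar>) *\<^sub>R apply_bcontfun \<delta> r)" for \<delta> :: "real \<Rightarrow>\<^sub>C 'a" and r
  have G_cont: "continuous_on UNIV (G \<delta>)" for \<delta>
  proof -
    have "continuous_on UNIV (\<lambda>r. (\<lambda>(t, x). f t x) (cl r, z + exp (lam * \<bar>r\<bar>) *\<^sub>R apply_bcontfun \<delta> r))"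
      by (rule continuous_on_compose2[OF cont]) (auto intro!: continuous_intros)
    then show ?thesis unfolding G_def[abs_def] by simp
  qed
  have "bounded ((\<lambda>r. f r z) ` {min (-T) T..max (-T) T})"
  proof (intro compact_imp_bounded compact_continuous_image)
    have "continuous_on UNIV (\<lambda>r. (\<lambda>(t, x). f t x) (r, z))"
      by (rule continuous_on_compose2[OF cont]) (auto intro!: continuous_intros)
    then show "continuous_on {min (-T) T..max (-T) T} (\<lambda>r. f r z)" by (auto intro: continuous_on_subset)
  qed simp
  then obtain M where M: "M > 0" "\<And>r. r \<in> {min (-T) T..max (-T) T} \<Longrightarrow> norm (f r z) \<le> M"
    unfolding bounded_pos by auto
  have cl_in: "cl r \<in> {min (-T) T..max (-T) T}" for r unfolding cl_def by auto
  have G_bound: "norm (G \<delta> r) \<le> (M + \<bar>L\<bar> * norm \<delta>) * exp (lam * \<bar>r\<bar>)" for \<delta> r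
  proof -
    have "norm (G \<delta> r) \<le> norm (f (cl r) z) + norm (G \<delta> r - f (cl r) z)"
      using norm_triangle_sub[of "G \<delta> r" "f (cl r) z"] by simp
    also have "\<dots> \<le> M + \<bar>L\<bar> * norm (exp (lam * \<bar>r\<bar>) *\<^sub>R apply_bcontfun \<delta> r)"
      unfolding G_def using lip'[of "cl r" "z + exp (lam * \<bar>r\<bar>) *\<^sub>R apply_bcontfun \<delta> r" z]
      by (intro add_mono M cl_in) auto
    also have "\<dots> \<le> M * exp (lam * \<bar>r\<bar>) + \<bar>L\<bar> * (exp (lam * \<bar>r\<bar>) * norm \<delta>)"
      using M(1) lam norm_bounded[of \<delta> r] by (intro add_mono mult_left_mono) auto
    finally show ?thesis by (simp add: algebra_simps)
  qed
  have exp_cancel: "exp (- (lam * \<bar>s\<bar>)) * (c * exp (lam * \<bar>s\<bar>)) = c" for s c :: real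
    by (simp add: exp_minus)
  define K where "K \<delta> = Bcontfun (\<lambda>s. exp (- (lam * \<bar>s\<bar>)) *\<^sub>R primitive (G \<delta>) s)" for \<delta>
  have K_app: "apply_bcontfun (K \<delta>) s = exp (- (lam * \<bar>s\<bar>)) *\<^sub>R primitive (G \<delta>) s" for \<delta> s
  proof -
    have "(\<lambda>s. exp (- (lam * \<bar>s\<bar>)) *\<^sub>R primitive (G \<delta>) s) \<in> bcontfun"
    proof (rule bcontfun_normI)
      have "continuous_on UNIV (primitive (G \<delta>))"
        using primitive_has_vector_derivative[OF G_cont]
        by (meson continuous_at_imp_continuous_on has_vector_derivative_continuous)
      then show "continuous_on UNIV (\<lambda>s. exp (- (lam * \<bar>s\<bar>)) *\<^sub>R primitive (G \<delta>) s)"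
        by (intro continuous_intros)
      fix s
      have "norm (primitive (G \<delta>) s) \<le> (M + \<bar>L\<bar> * norm \<delta>) / lam * exp (lam * \<bar>s\<bar>)"
        by (rule primitive_weighted_bound[OF lam G_cont G_bound])
      from mult_left_mono[OF this, of "exp (- (lam * \<bar>s\<bar>))"]
      show "norm (exp (- (lam * \<bar>s\<bar>)) *\<^sub>R primitive (G \<delta>) s) \<le> (M + \<bar>L\<bar> * norm \<delta>) / lam"
        unfolding exp_cancel by simp
    qed
    then show ?thesis unfolding K_def by (simp add: Bcontfun_inverse)
  qed
  have "\<exists>!\<delta>. K \<delta> = \<delta>"
  proof (rule banach_fix_type[of "1/2"]; (intro allI)?)
    fix \<delta> \<epsilon>
    show "dist (K \<delta>) (K \<epsilon>) \<le> 1 / 2 * dist \<delta> \<epsilon>"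
    proof (rule dist_bound)
      fix s
      have "norm (primitive (\<lambda>r. G \<delta> r - G \<epsilon> r) s) \<le> (\<bar>L\<bar> * dist \<delta> \<epsilon>) / lam * exp (lam * \<bar>s\<bar>)"
      proof (rule primitive_weighted_bound[OF lam])
        show "continuous_on UNIV (\<lambda>r. G \<delta> r - G \<epsilon> r)" by (intro continuous_intros G_cont)
        fix r
        have "norm (G \<delta> r - G \<epsilon> r) \<le> \<bar>L\<bar> * norm (exp (lam * \<bar>r\<bar>) *\<^sub>R (apply_bcontfun \<delta> r - apply_bcontfun \<epsilon> r))"
          unfolding G_def using lip'[of "cl r" "z + exp (lam * \<bar>r\<bar>) *\<^sub>R apply_bcontfun \<delta> r" "z + exp (lam * \<bar>r\<bar>) *\<^sub>R apply_bcontfun \<epsilon> r"]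
          by (simp add: scaleR_diff_right)
        also have "\<dots> \<le> \<bar>L\<bar> * (exp (lam * \<bar>r\<bar>) * dist \<delta> \<epsilon>)"
          using dist_bounded[of \<delta> r \<epsilon>] by (intro mult_left_mono) (auto simp: dist_norm)
        finally show "norm (G \<delta> r - G \<epsilon> r) \<le> \<bar>L\<bar> * dist \<delta> \<epsilon> * exp (lam * \<bar>r\<bar>)" by (simp add: mult_ac)
      qed
      from mult_left_mono[OF this, of "exp (- (lam * \<bar>s\<bar>))"]
      have "exp (- (lam * \<bar>s\<bar>)) * norm (primitive (\<lambda>r. G \<delta> r - G \<epsilon> r) s) \<le> \<bar>L\<bar> / lam * dist \<delta> \<epsilon>"
        unfolding exp_cancel by simp
      also have "\<dots> \<le> 1 / 2 * dist \<delta> \<epsilon>"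
        unfolding lam_def by (intro mult_right_mono) (auto simp: field_simps)
      finally show "dist (apply_bcontfun (K \<delta>) s) (apply_bcontfun (K \<epsilon>) s) \<le> 1 / 2 * dist \<delta> \<epsilon>"
        unfolding K_app dist_norm scaleR_diff_right[symmetric] primitive_diff[OF G_cont G_cont] by simp
    qed
  qed auto
  then obtain \<delta> where \<delta>: "K \<delta> = \<delta>" by blast
  define \<gamma> where "\<gamma> s = z + primitive (G \<delta>) s" for s
  have \<gamma>: "\<gamma> s = z + exp (lam * \<bar>s\<bar>) *\<^sub>R apply_bcontfun \<delta> s" for s
  proof -
    have "apply_bcontfun \<delta> s = exp (- (lam * \<bar>s\<bar>)) *\<^sub>R primitive (G \<delta>) s" using K_app[of \<delta> s] unfolding \<delta> .
    then show ?thesis unfolding \<gamma>_def by (simp add: exp_minus)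
  qed
  have "(\<gamma> has_vector_derivative f s (\<gamma> s)) (at s)" if "s \<in> {-T..T}" for s
  proof -
    have "cl s = s" using that unfolding cl_def by auto
    then have "G \<delta> s = f s (\<gamma> s)" unfolding G_def \<gamma> by simp
    moreover have "(\<gamma> has_vector_derivative G \<delta> s) (at s)"
      unfolding \<gamma>_def[abs_def] using primitive_has_vector_derivative[OF G_cont, of \<delta> s]
      by (auto intro!: derivative_eq_intros)
    ultimately show ?thesis by simp
  qed
  moreover have "\<gamma> 0 = z" unfolding \<gamma>_def by simp
  ultimately show ?thesis by blast
qed

text \<open>Time is shifted so that the prescribed value sits at 0. Differences of times in [-T, T]
  fill [-2T, 2T], hence the horizon \<open>2 * T\<close> in the proof.\<close>

lemma ode_exists:
  fixes f :: "real \<Rightarrow> 'a::euclidean_space \<Rightarrow> 'a"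
  assumes cont: "continuous_on UNIV (\<lambda>(t, x). f t x)"
    and lip: "\<And>t x y. norm (f t x - f t y) \<le> L * norm (x - y)"
    and t: "t \<in> {-T..T}"
  shows "\<exists>\<gamma>. \<gamma> t = z \<and> (\<forall>s\<in>{-T..T}. (\<gamma> has_vector_derivative f s (\<gamma> s)) (at s))"
proof -
  have "continuous_on UNIV (\<lambda>p. (\<lambda>(t, x). f t x) (fst p + t, snd p))"
    by (rule continuous_on_compose2[OF cont]) (auto intro!: continuous_intros)
  then have "continuous_on UNIV (\<lambda>(s, x). f (s + t) x)" by (simp add: case_prod_unfold)
  from ode_exists_0[OF this lip, of z "2 * T"] obtain \<gamma> where
    \<gamma>: "\<gamma> 0 = z" "\<And>s. s \<in> {-(2*T)..2*T} \<Longrightarrow> (\<gamma> has_vector_derivative f (s + t) (\<gamma> s)) (at s)" by blast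
  have "((\<lambda>s. \<gamma> (s - t)) has_vector_derivative f s (\<gamma> (s - t))) (at s)" if "s \<in> {-T..T}" for s
  proof -
    have "s - t \<in> {-(2*T)..2*T}" using that t by auto
    from \<gamma>(2)[OF this] have "(\<gamma> has_vector_derivative f s (\<gamma> (s - t))) (at (s - t))" by simp
    moreover have "((\<lambda>s. s - t) has_vector_derivative 1) (at s)" by (auto intro!: derivative_eq_intros)
    ultimately have "(\<gamma> \<circ> (\<lambda>s. s - t) has_vector_derivative 1 *\<^sub>R f s (\<gamma> (s - t))) (at s)"
      by (intro vector_diff_chain_at) auto
    then show ?thesis by (simp add: o_def)
  qed
  then show ?thesis using \<gamma>(1) by (intro exI[of _ "\<lambda>s. \<gamma> (s - t)"]) auto
qed

text \<open>The squared distance q is differentiable even where the curves meet, and |q'| <= 2 L q.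
  So exp(-2 L s) q(s) is nonincreasing and exp(2 L s) q(s) is nondecreasing, which covers both
  directions of time; the square root removes the factor 2.\<close>

lemma ode_gronwall:
  fixes f :: "real \<Rightarrow> 'a::euclidean_space \<Rightarrow> 'a"
  assumes lip: "\<And>t x y. norm (f t x - f t y) \<le> L * norm (x - y)"
    and g1: "\<And>s. s \<in> {-T..T} \<Longrightarrow> (\<gamma> has_vector_derivative f s (\<gamma> s)) (at s)"
    and g2: "\<And>s. s \<in> {-T..T} \<Longrightarrow> (\<beta> has_vector_derivative f s (\<beta> s)) (at s)"
    and s: "s \<in> {-T..T}" and t: "t \<in> {-T..T}"
  shows "norm (\<gamma> s - \<beta> s) \<le> exp (L * \<bar>s - t\<bar>) * norm (\<gamma> t - \<beta> t)"
proof -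
  define q where "q s = (\<gamma> s - \<beta> s) \<bullet> (\<gamma> s - \<beta> s)" for s
  define q' where "q' s = 2 * ((\<gamma> s - \<beta> s) \<bullet> (f s (\<gamma> s) - f s (\<beta> s)))" for s
  have q: "(q has_real_derivative q' r) (at r)" if "r \<in> {-T..T}" for r
  proof -
    have "((\<lambda>s. \<gamma> s - \<beta> s) has_derivative (\<lambda>v. v *\<^sub>R (f r (\<gamma> r) - f r (\<beta> r)))) (at r)"
      using has_vector_derivative_diff[OF g1[OF that] g2[OF that]] unfolding has_vector_derivative_def .
    from has_derivative_inner[OF this this] show ?thesis
      unfolding q_def[abs_def] q'_def has_field_derivative_def
      by (rule has_derivative_eq_rhs) (auto simp: fun_eq_iff inner_commute algebra_simps)
  qed
  have q'_le: "\<bar>q' r\<bar> \<le> 2 * L * q r" for r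
  proof -
    have "\<bar>q' r\<bar> \<le> 2 * (norm (\<gamma> r - \<beta> r) * norm (f r (\<gamma> r) - f r (\<beta> r)))"
      unfolding q'_def using Cauchy_Schwarz_ineq2 by (simp add: abs_mult)
    also have "\<dots> \<le> 2 * (norm (\<gamma> r - \<beta> r) * (L * norm (\<gamma> r - \<beta> r)))"
      by (intro mult_left_mono lip) auto
    also have "\<dots> = 2 * L * q r" unfolding q_def by (simp add: dot_square_norm power2_eq_square)
    finally show ?thesis .
  qed
  have mono: "exp (- (2 * L * b)) * q b \<le> exp (- (2 * L * a)) * q a"
    if "a \<le> b" "-T \<le> a" "b \<le> T" for a b
  proof (rule DERIV_nonpos_imp_nonincreasing[OF that(1)])
    fix x assume x: "a \<le> x" "x \<le> b"
    then have "x \<in> {-T..T}" using that by auto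
    from q[OF this] have "((\<lambda>b. exp (- (2 * L * b)) * q b) has_real_derivative exp (- (2 * L * x)) * (q' x - 2 * L * q x)) (at x)"
      by (auto intro!: derivative_eq_intros simp: algebra_simps)
    moreover have "exp (- (2 * L * x)) * (q' x - 2 * L * q x) \<le> 0"
      using q'_le[of x] by (intro mult_nonneg_nonpos) auto
    ultimately show "\<exists>y. ((\<lambda>b. exp (- (2 * L * b)) * q b) has_real_derivative y) (at x) \<and> y \<le> 0" by blast
  qed
  have mono': "exp (2 * L * a) * q a \<le> exp (2 * L * b) * q b"
    if "a \<le> b" "-T \<le> a" "b \<le> T" for a b
  proof (rule DERIV_nonneg_imp_nondecreasing[OF that(1)])
    fix x assume x: "a \<le> x" "x \<le> b"
    then have "x \<in> {-T..T}" using that by auto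
    from q[OF this] have "((\<lambda>b. exp (2 * L * b) * q b) has_real_derivative exp (2 * L * x) * (q' x + 2 * L * q x)) (at x)"
      by (auto intro!: derivative_eq_intros simp: algebra_simps)
    moreover have "exp (2 * L * x) * (q' x + 2 * L * q x) \<ge> 0"
      using q'_le[of x] by (intro mult_nonneg_nonneg) auto
    ultimately show "\<exists>y. ((\<lambda>b. exp (2 * L * b) * q b) has_real_derivative y) (at x) \<and> y \<ge> 0" by blast
  qed
  have "q s \<le> exp (2 * L * \<bar>s - t\<bar>) * q t"
  proof (cases "t \<le> s")
    case True
    have "exp (- (2 * L * s)) * q s \<le> exp (- (2 * L * t)) * q t" using mono[OF True] s t by auto
    from mult_left_mono[OF this, of "exp (2 * L * s)"]
    have "(exp (2 * L * s) * exp (- (2 * L * s))) * q s \<le> (exp (2 * L * s) * exp (- (2 * L * t))) * q t"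
      by (simp add: mult.assoc)
    moreover have "2 * L * s + - (2 * L * t) = 2 * L * \<bar>s - t\<bar>" using True by (simp add: algebra_simps)
    ultimately show ?thesis unfolding exp_add[symmetric] by simp
  next
    case False
    have "exp (2 * L * s) * q s \<le> exp (2 * L * t) * q t" using mono'[of s t] False s t by auto
    from mult_left_mono[OF this, of "exp (- (2 * L * s))"]
    have "(exp (- (2 * L * s)) * exp (2 * L * s)) * q s \<le> (exp (- (2 * L * s)) * exp (2 * L * t)) * q t"
      by (simp add: mult.assoc)
    moreover have "- (2 * L * s) + 2 * L * t = 2 * L * \<bar>s - t\<bar>" using False by (simp add: algebra_simps)
    ultimately show ?thesis unfolding exp_add[symmetric] by simp
  qed
  moreover have "exp (2 * L * \<bar>s - t\<bar>) = (exp (L * \<bar>s - t\<bar>))\<^sup>2"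
    by (simp add: exp_double[symmetric] mult.assoc)
  ultimately have "(norm (\<gamma> s - \<beta> s))\<^sup>2 \<le> (exp (L * \<bar>s - t\<bar>) * norm (\<gamma> t - \<beta> t))\<^sup>2"
    unfolding q_def dot_square_norm power_mult_distrib by simp
  then show ?thesis by (rule power2_le_imp_le) simp
qed

section \<open>Symmetry of second partial derivatives\<close>

lemma directional_has_real_derivative:
  fixes W :: "'a::euclidean_space \<Rightarrow> real"
  assumes "C_k (Suc k) W"
  shows "((\<lambda>s. W (c + s *\<^sub>R v)) has_real_derivative dir_deriv v W (c + s *\<^sub>R v)) (at s)"
proof -
  have "((\<lambda>s. c + s *\<^sub>R v) has_derivative (\<lambda>h. h *\<^sub>R v)) (at s)"
    by (auto intro!: derivative_eq_intros)
  from has_derivative_compose[OF this C_k_has_derivative[OF assms]]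
  have *: "((\<lambda>s. W (c + s *\<^sub>R v)) has_derivative (\<lambda>h. dir_deriv (h *\<^sub>R v) W (c + s *\<^sub>R v))) (at s)" .
  have "linear (\<lambda>u. dir_deriv u W (c + s *\<^sub>R v))"
    using C_k_has_derivative[OF assms] has_derivative_linear by blast
  then have "dir_deriv (h *\<^sub>R v) W (c + s *\<^sub>R v) = h *\<^sub>R dir_deriv v W (c + s *\<^sub>R v)" for h
    by (rule linear_scale)
  then show ?thesis unfolding has_field_derivative_def
    by (intro has_derivative_eq_rhs[OF *]) (auto simp: fun_eq_iff)
qed

text \<open>The mean value theorem is used in direction a on the difference of W along two parallel
  segments, and in direction b on the resulting difference of \<open>dir_deriv a W\<close>.\<close>

lemma second_difference_mean_value:
  fixes W :: "'a::euclidean_space \<Rightarrow> real"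
  assumes W: "C_k 2 W" and ab: "a \<in> Basis" "b \<in> Basis" and h: "h > 0"
  obtains s r where "0 < s" "s < h" "0 < r" "r < h"
    "W (x + h *\<^sub>R a + h *\<^sub>R b) - W (x + h *\<^sub>R a) - W (x + h *\<^sub>R b) + W x
      = h\<^sup>2 * dir_deriv b (dir_deriv a W) (x + s *\<^sub>R a + r *\<^sub>R b)"
proof -
  have W1: "C_k (Suc 1) W" using W by (simp add: numeral_2_eq_2)
  have Wa: "C_k (Suc 0) (dir_deriv a W)" using W1 ab by (simp add: numeral_2_eq_2)
  let ?\<phi> = "\<lambda>s. W (x + h *\<^sub>R b + s *\<^sub>R a) - W (x + s *\<^sub>R a)"
  have "\<exists>s. 0 < s \<and> s < h \<and> ?\<phi> h - ?\<phi> 0 = (h - 0) * (dir_deriv a W (x + h *\<^sub>R b + s *\<^sub>R a) - dir_deriv a W (x + s *\<^sub>R a))"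
    by (rule MVT2[OF h]) (intro DERIV_diff directional_has_real_derivative[OF W1])
  then obtain s where s: "0 < s" "s < h"
    "?\<phi> h - ?\<phi> 0 = h * (dir_deriv a W (x + h *\<^sub>R b + s *\<^sub>R a) - dir_deriv a W (x + s *\<^sub>R a))" by auto
  have "\<exists>r. 0 < r \<and> r < h \<and> dir_deriv a W (x + s *\<^sub>R a + h *\<^sub>R b) - dir_deriv a W (x + s *\<^sub>R a + 0 *\<^sub>R b)
      = (h - 0) * dir_deriv b (dir_deriv a W) (x + s *\<^sub>R a + r *\<^sub>R b)"
    by (rule MVT2[OF h]) (intro directional_has_real_derivative[OF Wa])
  then obtain r where r: "0 < r" "r < h"
    "dir_deriv a W (x + s *\<^sub>R a + h *\<^sub>R b) - dir_deriv a W (x + s *\<^sub>R a) = h * dir_deriv b (dir_deriv a W) (x + s *\<^sub>R a + r *\<^sub>R b)"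
    by auto
  have c: "x + h *\<^sub>R b + t *\<^sub>R a = x + t *\<^sub>R a + h *\<^sub>R b" for t by (simp add: algebra_simps)
  have "W (x + h *\<^sub>R a + h *\<^sub>R b) - W (x + h *\<^sub>R a) - W (x + h *\<^sub>R b) + W x = ?\<phi> h - ?\<phi> 0"
    unfolding c by (simp add: algebra_simps)
  also have "\<dots> = h\<^sup>2 * dir_deriv b (dir_deriv a W) (x + s *\<^sub>R a + r *\<^sub>R b)"
    unfolding s(3) unfolding c r(3) by (simp add: power2_eq_square)
  finally show ?thesis using that s(1,2) r(1,2) by blast
qed

text \<open>The second difference quotient D is symmetric in a and b. By the mean value form and
  continuity it tends to each of the two mixed derivatives, so uniqueness of limits identifies
  them.\<close>

lemma dir_deriv_symmetric:
  fixes W :: "'a::euclidean_space \<Rightarrow> real"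
  assumes W: "C_k 2 W" and ab: "a \<in> Basis" "b \<in> Basis"
  shows "dir_deriv b (dir_deriv a W) x = dir_deriv a (dir_deriv b W) x"
proof -
  define D where "D h = (W (x + h *\<^sub>R a + h *\<^sub>R b) - W (x + h *\<^sub>R a) - W (x + h *\<^sub>R b) + W x) / h\<^sup>2" for h :: real
  have lim: "(E \<longlongrightarrow> dir_deriv b (dir_deriv a W) x) (at_right 0)"
    if ab: "a \<in> Basis" "b \<in> Basis"
      and E: "\<And>h. E h = (W (x + h *\<^sub>R a + h *\<^sub>R b) - W (x + h *\<^sub>R a) - W (x + h *\<^sub>R b) + W x) / h\<^sup>2"
    for a b and E :: "real \<Rightarrow> real"
  proof (rule tendstoI)
    fix e :: real assume e: "e > 0"
    let ?G = "dir_deriv b (dir_deriv a W)"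
    have "continuous_on UNIV ?G" using W ab by (simp add: numeral_2_eq_2)
    then have "isCont ?G x" by (simp add: continuous_on_eq_continuous_at)
    then obtain d where d: "d > 0" "\<And>y. dist y x < d \<Longrightarrow> dist (?G y) (?G x) < e"
      using e unfolding continuous_at_eps_delta by metis
    have "dist (E h) (?G x) < e" if h: "0 < h" "h < d / 2" for h
    proof -
      obtain s r where sr: "0 < s" "s < h" "0 < r" "r < h"
        "W (x + h *\<^sub>R a + h *\<^sub>R b) - W (x + h *\<^sub>R a) - W (x + h *\<^sub>R b) + W x = h\<^sup>2 * ?G (x + s *\<^sub>R a + r *\<^sub>R b)"
        using second_difference_mean_value[OF W ab h(1), of x] by metis
      have "dist (x + s *\<^sub>R a + r *\<^sub>R b) x \<le> norm (s *\<^sub>R a) + norm (r *\<^sub>R b)"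
        using norm_triangle_ineq[of "s *\<^sub>R a" "r *\<^sub>R b"] by (simp add: dist_norm add.assoc)
      also have "\<dots> < d" using sr h ab by simp
      finally have "dist (?G (x + s *\<^sub>R a + r *\<^sub>R b)) (?G x) < e" by (rule d)
      moreover have "E h = ?G (x + s *\<^sub>R a + r *\<^sub>R b)" unfolding E sr(5) using h by simp
      ultimately show ?thesis by simp
    qed
    then show "\<forall>\<^sub>F h in at_right 0. dist (E h) (?G x) < e"
      unfolding eventually_at_right_field using d(1) by (intro exI[of _ "d / 2"]) auto
  qed
  have 1: "(D \<longlongrightarrow> dir_deriv b (dir_deriv a W) x) (at_right 0)" by (rule lim[OF ab]) (simp add: D_def)
  have 2: "(D \<longlongrightarrow> dir_deriv a (dir_deriv b W) x) (at_right 0)"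
    by (rule lim[OF ab(2,1)]) (simp add: D_def algebra_simps)
  show ?thesis by (rule tendsto_unique[OF _ 1 2]) simp
qed

section \<open>Hamiltonian flow of a subquadratic potential\<close>

lemma slice_has_derivative:
  assumes "(F has_derivative D) (at (t, x))"
  shows "((\<lambda>y. F (t, y)) has_derivative (\<lambda>v. D (0, v))) (at x)"
proof -
  have "((\<lambda>y. (t, y)) has_derivative (\<lambda>v. (0, v))) (at x)"
    by (auto intro!: derivative_eq_intros)
  from has_derivative_compose[OF this assms] show ?thesis .
qed

lemma C_k_slice:
  fixes F :: "'a::euclidean_space \<times> 'b::euclidean_space \<Rightarrow> 'c::real_normed_vector"
  shows "C_k k F \<Longrightarrow> C_k k (\<lambda>y. F (t, y))"
proof (induction k arbitrary: F)
  case 0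
  then show ?case by (auto intro!: continuous_on_compose2[of UNIV F] continuous_intros)
next
  case (Suc k)
  show ?case
  proof (rule C_k_SucI[OF slice_has_derivative[OF C_k_has_derivative[OF Suc.prems]]])
    fix b :: 'b assume "b \<in> Basis"
    then have "(0, b) \<in> (Basis :: ('a \<times> 'b) set)" by (simp add: Basis_prod_def)
    then show "C_k k (\<lambda>x. dir_deriv (0, b) F (t, x))" using Suc.prems by (intro Suc.IH) auto
  qed
qed

lemma partial_slice:
  assumes "C_k (Suc k) F"
  shows "partial j (\<lambda>y. F (t, y)) x = dir_deriv (0, axis j 1) F (t, x)"
  unfolding partial_def
  by (rule dir_deriv_eq[OF slice_has_derivative[OF C_k_has_derivative[OF assms]]])

lemma smooth_joint_partial:
  assumes "smooth (\<lambda>(t, x). W t x)"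
  shows "smooth (\<lambda>(t::real, x). partial j (W t) x)"
proof -
  have "C_k k (\<lambda>(t::real, x). partial j (W t) x)" for k
  proof -
    have C: "C_k (Suc k) (\<lambda>(t, x). W t x)" using assms unfolding smooth_def by blast
    have "(\<lambda>(t, x). partial j (W t) x) = dir_deriv (0, axis j 1) (\<lambda>(t, x). W t x)"
      using partial_slice[OF C, of j] by (auto simp: fun_eq_iff)
    moreover have "(0, axis j 1) \<in> (Basis :: (real \<times> (real^'a)) set)"
      by (auto simp: Basis_prod_def axis_in_Basis_iff)
    ultimately show ?thesis using C by simp
  qed
  then show ?thesis unfolding smooth_def by blast
qed

lemma dir_deriv_eq_sum_partial:
  fixes W :: "real^'n::finite \<Rightarrow> 'b::real_normed_vector"
  assumes "C_k (Suc k) W"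
  shows "dir_deriv v W x = (\<Sum>j\<in>UNIV. v $ j *\<^sub>R partial j W x)"
proof -
  have lin: "linear (\<lambda>u. dir_deriv u W x)"
    using C_k_has_derivative[OF assms] has_derivative_linear by blast
  have "dir_deriv v W x = dir_deriv (\<Sum>j\<in>UNIV. v $ j *\<^sub>R axis j 1) W x"
    using basis_expansion[of v] by (simp add: scalar_mult_eq_scaleR)
  also have "\<dots> = (\<Sum>j\<in>UNIV. v $ j *\<^sub>R partial j W x)"
    unfolding partial_def linear_sum[OF lin] linear_scale[OF lin] ..
  finally show ?thesis .
qed

lemma lipschitz_of_partial_bounds:
  fixes W :: "real^'n::finite \<Rightarrow> 'b::real_normed_vector"
  assumes W: "C_k (Suc k) W" and C: "\<And>j x. norm (partial j W x) \<le> C j"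
  shows "norm (W x - W y) \<le> (\<Sum>j\<in>UNIV. C j) * norm (x - y)"
proof (rule differentiable_bound[of UNIV W "\<lambda>x v. dir_deriv v W x"])
  show "(W has_derivative (\<lambda>v. dir_deriv v W x)) (at x within UNIV)" for x
    using C_k_has_derivative[OF W] by simp
  show "onorm (\<lambda>v. dir_deriv v W x) \<le> (\<Sum>j\<in>UNIV. C j)" for x
  proof (rule onorm_le)
    fix v
    have "norm (dir_deriv v W x) \<le> (\<Sum>j\<in>UNIV. norm (v $ j *\<^sub>R partial j W x))"
      unfolding dir_deriv_eq_sum_partial[OF W] by (rule norm_sum)
    also have "\<dots> \<le> (\<Sum>j\<in>UNIV. norm v * C j)"
      unfolding norm_scaleR by (intro sum_mono mult_mono C component_le_norm_cart) auto
    finally show "norm (dir_deriv v W x) \<le> (\<Sum>j\<in>UNIV. C j) * norm v"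
      by (simp add: sum_distrib_left mult.commute)
  qed
qed auto

lemma C_k_sum: "finite I \<Longrightarrow> (\<And>i. i \<in> I \<Longrightarrow> C_k k (f i)) \<Longrightarrow> C_k k (\<lambda>x. \<Sum>i\<in>I. f i x)"
  by (induction I rule: finite_induct) (auto intro: C_k_add C_k_const)

lemma laplacian_zero_outside:
  assumes "\<And>y. norm y > \<rho> \<Longrightarrow> f y = 0" "norm y > \<rho>"
  shows "laplacian f y = 0"
proof -
  have *: "partial i f z = 0" if "norm z > \<rho>" for i z by (rule partial_zero_outside[OF assms(1) that])
  have "partial i (partial i f) y = 0" for i by (rule partial_zero_outside[OF * assms(2)])
  then show ?thesis unfolding laplacian_def by simp
qed

lemma RD_laplacian_bumpc: "RD k j P (\<lambda>_ y. laplacian bumpc y)"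
proof (rule RD_compact_support)
  have "smooth bumpc" unfolding smooth_def using C_k_bumpc by blast
  then have "smooth (partial i (partial i bumpc))" for i by (intro smooth_partial)
  then show "C_k k (\<lambda>y. laplacian bumpc y)"
    unfolding laplacian_def smooth_def by (intro C_k_sum) auto
  fix y :: "real^'a" assume y: "norm y > 1"
  show "laplacian bumpc y = 0"
    by (rule laplacian_zero_outside[OF _ y]) (simp add: bumpc_def bump_eq_0)
qed

lemma pd_of_real:
  assumes "\<And>y. ((\<lambda>s. f (y + s *\<^sub>R axis j 1)) has_real_derivative f' y) (at 0)"
  shows "pd j (\<lambda>y. complex_of_real (f y)) (\<lambda>y. complex_of_real (f' y))"
  unfolding pd_def
  using assms by (auto intro!: has_vector_derivative_of_real simp: has_real_derivative_iff_has_vector_derivative)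

lemma growsI:
  assumes "\<And>p. continuous_on UNIV (f p)" "\<And>p y. cmod (f p y) \<le> C * (1 + norm y) ^ N"
  shows "grows UNIV f"
  unfolding grows_def using assms by blast

locale subquadratic_potential =
  fixes V :: "real \<Rightarrow> real^'n::finite \<Rightarrow> real"
  assumes smooth_V: "smooth (\<lambda>(t, x). V t x)"
    and bounded_V: "\<And>\<alpha> :: 'n multi_index. mi_order \<alpha> \<ge> 2 \<Longrightarrow> \<exists>C>0. \<forall>t x. \<bar>mi_deriv \<alpha> (V t) x\<bar> \<le> C"
begin

lemma C_k_V: "C_k k (V t)"
  using C_k_slice[of k "\<lambda>(t, x). V t x" t] smooth_V unfolding smooth_def by auto

lemma C_k_partial_V: "C_k k (partial j (V t))"
  using C_k_partial[OF C_k_V] .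

lemma C_k_pow_V: "C_k k ((partial j ^^ m) (V t))"
proof (induction m arbitrary: k)
  case (Suc m)
  show ?case using C_k_partial[OF Suc[of "Suc k"]] by simp
qed (use C_k_V in simp)

lemma pow_bound:
  assumes "m \<ge> 2" shows "\<exists>C>0. \<forall>t x. \<bar>(partial j ^^ m) (V t) x\<bar> \<le> C"
proof -
  have "mi_order (\<lambda>i. if i = j then m else 0) = m" unfolding mi_order_def by simp
  then show ?thesis using bounded_V[of "\<lambda>i. if i = j then m else 0"] assms
    unfolding mi_deriv_single by simp
qed

lemma partial_V_symmetric: "partial i (partial j (V t)) x = partial j (partial i (V t)) x"
  unfolding partial_def by (rule dir_deriv_symmetric[OF C_k_V]) (auto simp: axis_in_Basis_iff)

text \<open>The hypothesis bounds a mixed derivative only in the order prescribed by the enumeration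
  of coordinates; \<open>partial_V_symmetric\<close> transfers the bound to the other order.\<close>

lemma second_bound: "\<exists>C>0. \<forall>t x. \<bar>partial i (partial j (V t)) x\<bar> \<le> C"
proof (cases "i = j")
  case True
  then show ?thesis using pow_bound[of 2 j] by (simp add: numeral_2_eq_2)
next
  case False
  have "mi_order (\<lambda>l. if l = i \<or> l = j then 1 else 0) = card {i, j}"
    unfolding mi_order_def card_eq_sum by (rule sum.mono_neutral_cong_right) auto
  then have "mi_order (\<lambda>l. if l = i \<or> l = j then 1 else 0) \<ge> 2" using False by simp
  from bounded_V[OF this] obtain C where C: "C > 0"
    "\<And>t x. \<bar>mi_deriv (\<lambda>l. if l = i \<or> l = j then 1 else 0) (V t) x\<bar> \<le> C" by blast
  have "mi_deriv (\<lambda>l. if l = i \<or> l = j then 1 else 0) (V t) = partial i (partial j (V t))" for t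
    using mi_deriv_pair[OF False, of "V t"] partial_V_symmetric by fastforce
  then show ?thesis using C by auto
qed

definition grad :: "real \<Rightarrow> real^'n \<Rightarrow> real^'n"
  where "grad t x = (\<chi> j. partial j (V t) x)"

text \<open>The mean value inequality for each component of the gradient. The bounds on the second
  derivatives are uniform in time, so L does not depend on t and the Hamiltonian flow is
  global.\<close>

lemma grad_lipschitz: "\<exists>L\<ge>0. \<forall>t x y. norm (grad t x - grad t y) \<le> L * norm (x - y)"
proof -
  have "\<exists>C. \<forall>i j. 0 < C i j \<and> (\<forall>t x. \<bar>partial i (partial j (V t)) x\<bar> \<le> C i j)"
    using second_bound by (intro choice allI) blast
  then obtain C where C: "\<And>i j. 0 < C i j" "\<And>i j t x. \<bar>partial i (partial j (V t)) x\<bar> \<le> C i j" by blast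
  define L where "L = (\<Sum>j\<in>UNIV. \<Sum>i\<in>UNIV. C i j)"
  have "norm (grad t x - grad t y) \<le> L * norm (x - y)" for t x y
  proof -
    have "norm (grad t x - grad t y) \<le> (\<Sum>j\<in>UNIV. \<bar>(grad t x - grad t y) $ j\<bar>)"
      by (rule norm_le_l1_cart)
    also have "\<dots> \<le> (\<Sum>j\<in>UNIV. (\<Sum>i\<in>UNIV. C i j) * norm (x - y))"
    proof (rule sum_mono)
      fix j
      show "\<bar>(grad t x - grad t y) $ j\<bar> \<le> (\<Sum>i\<in>UNIV. C i j) * norm (x - y)"
        using lipschitz_of_partial_bounds[OF C_k_partial_V, of j t "\<lambda>i. C i j" x y] C(2)
        unfolding grad_def by simp
    qed
    finally show ?thesis unfolding L_def by (simp add: sum_distrib_right)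
  qed
  moreover have "L \<ge> 0" unfolding L_def by (intro sum_nonneg) (simp add: C less_imp_le)
  ultimately show ?thesis by blast
qed

lemma V_has_derivative: "(V t has_derivative (\<lambda>v. grad t x \<bullet> v)) (at x)"
proof -
  have "dir_deriv v (V t) x = grad t x \<bullet> v" for v
    unfolding dir_deriv_eq_sum_partial[OF C_k_V] grad_def inner_vec_def
    by (simp add: mult.commute)
  then show ?thesis
    by (intro has_derivative_eq_rhs[OF C_k_has_derivative[OF C_k_V]]) (simp add: fun_eq_iff)
qed

lemma continuous_on_V: "continuous_on UNIV (\<lambda>(t, x). V t x)"
  using smooth_V unfolding smooth_def by (blast intro: C_k_continuous)

lemma continuous_on_grad: "continuous_on UNIV (\<lambda>(t, x). grad t x)"
proof -
  have "continuous_on UNIV (\<lambda>(t, x). partial j (V t) x)" for j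
    using smooth_joint_partial[OF smooth_V, of j] unfolding smooth_def by (blast intro: C_k_continuous)
  then have "continuous_on UNIV (\<lambda>p. \<chi> j. (\<lambda>(t, x). partial j (V t) x) p)"
    by (intro continuous_on_vec_lambda)
  then show ?thesis unfolding grad_def by (simp add: case_prod_unfold)
qed

text \<open>Hamilton's equations x' = \<xi>, \<xi>' = - grad V of |\<xi>|^2/2 + V, with z = (x,
  \<xi>).\<close>

definition field :: "real \<Rightarrow> (real^'n) \<times> (real^'n) \<Rightarrow> (real^'n) \<times> (real^'n)"
  where "field t z = (snd z, - grad t (fst z))"

lemma continuous_on_field: "continuous_on UNIV (\<lambda>(t, z). field t z)"
proof -
  have "continuous_on UNIV (\<lambda>p. (\<lambda>(t, x). grad t x) (fst p, fst (snd p)))"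
    by (rule continuous_on_compose2[OF continuous_on_grad]) (auto intro!: continuous_intros)
  then have "continuous_on UNIV (\<lambda>p. grad (fst p) (fst (snd p)))" by simp
  then show ?thesis unfolding field_def case_prod_unfold by (intro continuous_intros)
qed

lemma field_lipschitz: "\<exists>L\<ge>0. \<forall>t z w. norm (field t z - field t w) \<le> L * norm (z - w)"
proof -
  obtain L where L: "L \<ge> 0" "\<And>t x y. norm (grad t x - grad t y) \<le> L * norm (x - y)"
    using grad_lipschitz by blast
  have "norm (field t z - field t w) \<le> (1 + L) * norm (z - w)" for t z w
  proof -
    have "field t z - field t w = (snd (z - w), grad t (fst w) - grad t (fst z))"
      unfolding field_def by simp
    then have "norm (field t z - field t w) \<le> norm (snd (z - w)) + norm (grad t (fst w) - grad t (fst z))"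
      using norm_Pair_le_add by metis
    also have "\<dots> \<le> norm (z - w) + L * norm (z - w)"
    proof (intro add_mono)
      show "norm (snd (z - w)) \<le> norm (z - w)" by (cases "z - w") (simp add: norm_snd_le)
      have "norm (fst (z - w)) \<le> norm (z - w)" by (cases "z - w") (simp add: norm_fst_le)
      then have "norm (fst w - fst z) \<le> norm (z - w)" by (simp add: norm_minus_commute)
      then show "norm (grad t (fst w) - grad t (fst z)) \<le> L * norm (z - w)"
        using L(2)[of t "fst w" "fst z"] L(1) mult_left_mono order_trans by blast
    qed
    finally show ?thesis by (simp add: distrib_right)
  qed
  then show ?thesis using L(1) by (intro exI[of _ "1 + L"]) auto
qed

definition taylor_rem :: "real \<Rightarrow> real^'n \<Rightarrow> real^'n \<Rightarrow> real"
  where "taylor_rem t x y = V t (x + y) - V t x - grad t x \<bullet> y"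

text \<open>The gradient of the remainder in y is grad V(x + y) - grad V(x), of size at most L |y|
  on the ball of radius |y|; the mean value inequality supplies the second factor |y|.\<close>

lemma taylor_rem_bound: "\<exists>C\<ge>0. \<forall>t x y. \<bar>taylor_rem t x y\<bar> \<le> C * (norm y)\<^sup>2"
proof -
  obtain L where L: "L \<ge> 0" "\<And>t x y. norm (grad t x - grad t y) \<le> L * norm (x - y)"
    using grad_lipschitz by blast
  have "\<bar>taylor_rem t x y\<bar> \<le> L * (norm y)\<^sup>2" for t x y
  proof -
    have "norm (taylor_rem t x y - taylor_rem t x 0) \<le> (L * norm y) * norm (y - 0)"
    proof (rule differentiable_bound[of "cball 0 (norm y)" _ "\<lambda>w v. (grad t (x + w) - grad t x) \<bullet> v"])
      fix w :: "real^'n" assume w: "w \<in> cball 0 (norm y)"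
      have "((\<lambda>w. x + w) has_derivative (\<lambda>v. v)) (at w)" by (auto intro!: derivative_eq_intros)
      from has_derivative_compose[OF this V_has_derivative]
      have "((\<lambda>w. V t (x + w) - V t x - grad t x \<bullet> w) has_derivative (\<lambda>v. grad t (x + w) \<bullet> v - 0 - grad t x \<bullet> v)) (at w)"
        by (intro has_derivative_diff has_derivative_const bounded_linear_imp_has_derivative bounded_linear_inner_right)
      then have "((\<lambda>w. V t (x + w) - V t x - grad t x \<bullet> w) has_derivative (\<lambda>v. (grad t (x + w) - grad t x) \<bullet> v)) (at w)"
        by (simp only: inner_diff_left diff_zero)
      from has_derivative_at_withinI[OF this]
      show "(taylor_rem t x has_derivative (\<lambda>v. (grad t (x + w) - grad t x) \<bullet> v)) (at w within cball 0 (norm y))"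
        unfolding taylor_rem_def[abs_def] .
      show "onorm (\<lambda>v. (grad t (x + w) - grad t x) \<bullet> v) \<le> L * norm y"
      proof (rule onorm_le)
        fix v
        have "norm ((grad t (x + w) - grad t x) \<bullet> v) \<le> norm (grad t (x + w) - grad t x) * norm v"
          unfolding real_norm_def by (rule Cauchy_Schwarz_ineq2)
        also have "norm (grad t (x + w) - grad t x) \<le> L * norm w" using L(2)[of t "x + w" x] by simp
        also have "\<dots> \<le> L * norm y" using w L(1) by (intro mult_left_mono) auto
        finally show "norm ((grad t (x + w) - grad t x) \<bullet> v) \<le> L * norm y * norm v"
          by (simp add: mult_right_mono)
      qed
    qed auto
    then show ?thesis unfolding taylor_rem_def by (simp add: power2_eq_square mult.assoc)
  qed
  then show ?thesis using L(1) by blast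
qed

text \<open>Three regimes: the remainder grows quadratically, its first derivative linearly by
  \<open>grad_lipschitz\<close>, and the higher derivatives are those of V and bounded by
  assumption. No constant depends on the time or on the centre, so the family over all (t, x) is an
  admissible multiplier.\<close>

lemma PG_taylor_rem: "PG k j UNIV (\<lambda>(t, x) y. complex_of_real (taylor_rem t x y))"
proof -
  let ?e = "axis j 1 :: real^'n"
  let ?R = "\<lambda>(t, x) y. complex_of_real (taylor_rem t x y)"
  let ?G = "\<lambda>(t, x) y. complex_of_real (partial j (V t) (x + y) - partial j (V t) x)"
  let ?D = "\<lambda>m (t, x) y. complex_of_real ((partial j ^^ m) (V t) (x + y))"
  have der: "((\<lambda>s. W (x + (y + s *\<^sub>R ?e))) has_real_derivative partial j W (x + y)) (at 0)"
    if "C_k 1 W" for W x y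
    using directional_has_real_derivative[of 0 W "x + y" ?e 0] that by (simp add: partial_def add.assoc)
  have cont: "continuous_on UNIV (\<lambda>y. W (x + y))" if "C_k 1 W" for W :: "real^'n \<Rightarrow> real" and x
    by (rule continuous_on_compose2[OF C_k_continuous[OF that]]) (auto intro!: continuous_intros)
  have g0: "grows UNIV ?R"
  proof -
    obtain C where C: "C \<ge> 0" "\<And>t x y. \<bar>taylor_rem t x y\<bar> \<le> C * (norm y)\<^sup>2" using taylor_rem_bound by blast
    show ?thesis
    proof (rule growsI[where C = C and N = 2])
      fix p :: "real \<times> (real^'n)"
      show "continuous_on UNIV (?R p)"
        unfolding taylor_rem_def case_prod_unfold by (intro continuous_intros cont[OF C_k_V])
      fix y :: "real^'n"
      have "(norm y)\<^sup>2 \<le> (1 + norm y)\<^sup>2" by (intro power_mono) auto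
      then show "cmod (?R p y) \<le> C * (1 + norm y) ^ 2"
        using order_trans[OF C(2) mult_left_mono[OF _ C(1)]] by (simp add: case_prod_unfold)
    qed
  qed
  have g1: "grows UNIV ?G"
  proof -
    obtain L where L: "L \<ge> 0" "\<And>t x y. norm (grad t x - grad t y) \<le> L * norm (x - y)"
      using grad_lipschitz by blast
    have "cmod (complex_of_real (partial j (V t) (x + y) - partial j (V t) x)) \<le> L * (1 + norm y) ^ 1" for t x y
    proof -
      have "\<bar>partial j (V t) (x + y) - partial j (V t) x\<bar> = \<bar>(grad t (x + y) - grad t x) $ j\<bar>"
        unfolding grad_def by simp
      also have "\<dots> \<le> norm (grad t (x + y) - grad t x)" by (rule component_le_norm_cart)
      also have "\<dots> \<le> L * norm y" using L(2)[of t "x + y" x] by simp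
      also have "\<dots> \<le> L * (1 + norm y)" using L(1) by (intro mult_left_mono) auto
      finally show ?thesis by (simp add: norm_of_real del: of_real_diff)
    qed
    then show ?thesis
      unfolding case_prod_unfold
      by (intro growsI[where C = L and N = 1] continuous_intros cont[OF C_k_partial_V])
  qed
  have gm: "grows UNIV (?D m)" if m: "m \<ge> 2" for m
  proof -
    obtain C where "\<And>t x. \<bar>(partial j ^^ m) (V t) x\<bar> \<le> C" using pow_bound[OF m] by blast
    then show ?thesis
      unfolding case_prod_unfold
      by (intro growsI[where C = C and N = 0] continuous_intros cont[OF C_k_pow_V]) simp
  qed
  have pm: "PG k j UNIV (?D m)" if "m \<ge> 2" for k m
    using that
  proof (induction k arbitrary: m)
    case (Suc k)
    have "pd j (?D m p) (?D (Suc m) p)" for p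
      by (cases p) (auto intro!: pd_of_real der C_k_pow_V simp del: C_k.simps)
    moreover have "PG k j UNIV (?D (Suc m))" using Suc.prems by (intro Suc.IH) simp
    ultimately show ?case by (intro PG_SucI[where f' = "?D (Suc m)", OF gm[OF Suc.prems]])
  qed (use gm in simp)
  have p1: "PG k j UNIV ?G" for k
  proof (cases k)
    case (Suc l)
    have "((\<lambda>s. partial j (V t) (x + (y + s *\<^sub>R ?e)) - partial j (V t) x) has_real_derivative (partial j ^^ 2) (V t) (x + y)) (at 0)" for t x y
      using DERIV_diff[OF der[OF C_k_partial_V, of j t x y] DERIV_const] by (simp add: numeral_2_eq_2)
    then have "pd j (?G p) (?D 2 p)" for p
      by (cases p) (auto intro!: pd_of_real simp del: of_real_diff)
    then show ?thesis unfolding Suc using g1 pm[of 2 l] by (intro PG_SucI[where f' = "?D 2"]) auto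
  qed (use g1 in simp)
  show ?thesis
  proof (cases k)
    case (Suc l)
    have "((\<lambda>s. taylor_rem t x (y + s *\<^sub>R ?e)) has_real_derivative partial j (V t) (x + y) - partial j (V t) x) (at 0)" for t x y
    proof -
      have "((\<lambda>s. grad t x \<bullet> (y + s *\<^sub>R ?e)) has_real_derivative partial j (V t) x) (at 0)"
        by (auto intro!: derivative_eq_intros simp: inner_add_right inner_axis grad_def)
      from DERIV_diff[OF DERIV_diff[OF der[OF C_k_V, of t x y] DERIV_const] this]
      show ?thesis unfolding taylor_rem_def by simp
    qed
    then have "pd j (?R p) (?G p)" for p
      by (cases p) (auto intro!: pd_of_real simp del: of_real_diff)
    then show ?thesis unfolding Suc using g0 p1[of l] by (intro PG_SucI[where f' = "?G"]) auto
  qed (use g0 in simp)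
qed

text \<open>The amplitude that remains when the affine part of V at the centre is removed. It serves
  as a window, so the error in the equation for the overlap is again a wave packet
  transform.\<close>

definition packet_rem :: "real \<times> (real^'n) \<Rightarrow> real^'n \<Rightarrow> complex"
  where "packet_rem p y = laplacian bumpc y * (- (1/2)) + bumpc y * complex_of_real (taylor_rem (fst p) (snd p) y)"

lemma RD_packet_rem: "RD k j UNIV packet_rem"
proof -
  have "RD k j UNIV (\<lambda>(p :: real \<times> (real^'n)) y. laplacian bumpc y * (- (1/2)) +
     bumpc y * (case p of (t, x) \<Rightarrow> \<lambda>y. complex_of_real (taylor_rem t x y)) y)"
    by (intro RD_add RD_mult RD_laplacian_bumpc RD_bumpc PG_const PG_taylor_rem)
  then show ?thesis unfolding packet_rem_def[abs_def] by (simp add: case_prod_unfold)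
qed

end

section \<open>Square integrable functions depending on time\<close>

lemma Lp_norm_2_square:
  "(Lp_norm 2 (\<lambda>x. ennreal (cmod (f x))))\<^sup>2 = (\<integral>\<^sup>+x. ennreal (cmod (f x)) ^ 2 \<partial>lborel)"
proof -
  have 1: "ennreal_powr (ennreal c) 2 = ennreal c ^ 2" if "c \<ge> 0" for c
    using that by (cases "c = 0") (auto simp: ennreal_powr_def ennreal_power)
  have 2: "(ennreal_powr I (1 / 2))\<^sup>2 = I" for I
    by (cases I) (auto simp: ennreal_powr_def ennreal_power powr_half_sqrt power2_eq_square ennreal_top_mult ennreal_mult[symmetric])
  have "Lp_norm 2 (\<lambda>x. ennreal (cmod (f x))) = ennreal_powr (\<integral>\<^sup>+x. ennreal (cmod (f x)) ^ 2 \<partial>lborel) (1 / 2)"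
    unfolding Lp_norm_def by (simp add: 1)
  then show ?thesis by (simp add: 2)
qed

lemma L2_functionD:
  assumes "L2_function f"
  shows "f \<in> borel_measurable borel" "(\<integral>\<^sup>+x. ennreal (cmod (f x)) ^ 2 \<partial>lborel) < \<infinity>"
proof -
  show "f \<in> borel_measurable borel" using assms unfolding L2_function_def by simp
  have "Lp_norm 2 (\<lambda>x. ennreal (cmod (f x))) < \<infinity>" using assms unfolding L2_function_def by simp
  then have "(Lp_norm 2 (\<lambda>x. ennreal (cmod (f x))))\<^sup>2 < \<infinity>"
    unfolding power2_eq_square by (simp add: ennreal_mult_less_top)
  then show "(\<integral>\<^sup>+x. ennreal (cmod (f x)) ^ 2 \<partial>lborel) < \<infinity>" unfolding Lp_norm_2_square .
qed

lemma continuous_L2D: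
  assumes "continuous_L2 u" "e > 0"
  shows "\<forall>\<^sub>F s in at t. (\<integral>\<^sup>+x. ennreal (cmod (u s x - u t x)) ^ 2 \<partial>lborel) \<le> ennreal (e\<^sup>2)"
proof -
  have "\<forall>\<^sub>F s in at t. Lp_norm 2 (\<lambda>x. ennreal (cmod (u s x - u t x))) < ennreal e"
    using assms unfolding continuous_L2_def by (intro order_tendstoD(2)[of _ 0]) auto
  then show ?thesis
  proof eventually_elim
    case (elim s)
    have "(Lp_norm 2 (\<lambda>x. ennreal (cmod (u s x - u t x))))\<^sup>2 \<le> (ennreal e)\<^sup>2"
      using elim by (intro power_mono) auto
    then show ?case using assms(2) unfolding Lp_norm_2_square by (simp add: ennreal_power)
  qed
qed

text \<open>Near each t the squared norm is at most 2 + 2c, from (a + b)^2 <= 2 a^2 + 2 b^2 with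
  distance at most 1 to u(t); compactness leaves finitely many such bounds. The point s = t is
  separate since the limit is punctured.\<close>

lemma L2_integral_bound_compact:
  fixes u :: "real \<Rightarrow> 'a::euclidean_space \<Rightarrow> complex"
  assumes "continuous_L2 u"
  obtains A where "A \<ge> 0" "\<And>t. t \<in> {a..b} \<Longrightarrow> (\<integral>\<^sup>+x. ennreal (cmod (u t x)) ^ 2 \<partial>lborel) \<le> ennreal A"
proof -
  let ?I = "\<lambda>t. \<integral>\<^sup>+x. ennreal (cmod (u t x)) ^ 2 \<partial>lborel"
  have um[measurable]: "u t \<in> borel_measurable borel" for t
    using assms L2_functionD(1) unfolding continuous_L2_def by blast
  have fin: "?I t < \<infinity>" for t
    using assms L2_functionD(2) unfolding continuous_L2_def by blast
  have "\<exists>d C. d > 0 \<and> C \<ge> 0 \<and> (\<forall>s\<in>ball t d. ?I s \<le> ennreal C)" for t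
  proof -
    obtain d where d: "d > 0" "\<And>s. s \<noteq> t \<Longrightarrow> dist s t < d \<Longrightarrow> (\<integral>\<^sup>+x. ennreal (cmod (u s x - u t x)) ^ 2 \<partial>lborel) \<le> ennreal (1\<^sup>2)"
      using continuous_L2D[OF assms, of 1 t] unfolding eventually_at by auto
    obtain c where c: "c \<ge> 0" "?I t = ennreal c" using fin[of t] by (cases "?I t") auto
    have "?I s \<le> ennreal (2 + 2 * c)" if s: "s \<in> ball t d" for s
    proof (cases "s = t")
      case False
      have pt: "ennreal (cmod (u s x)) ^ 2 \<le> 2 * ennreal (cmod (u s x - u t x)) ^ 2 + 2 * ennreal (cmod (u t x)) ^ 2" for x
      proof -
        have "cmod (u s x) \<le> cmod (u s x - u t x) + cmod (u t x)"
          using norm_triangle_ineq[of "u s x - u t x" "u t x"] by simp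
        then have "(cmod (u s x))\<^sup>2 \<le> (cmod (u s x - u t x) + cmod (u t x))\<^sup>2" by (intro power_mono) auto
        also have "\<dots> \<le> 2 * (cmod (u s x - u t x))\<^sup>2 + 2 * (cmod (u t x))\<^sup>2"
          using sum_squares_bound[of "cmod (u s x - u t x)" "cmod (u t x)"] by (simp add: power2_sum)
        finally have "ennreal ((cmod (u s x))\<^sup>2) \<le> ennreal (2 * (cmod (u s x - u t x))\<^sup>2 + 2 * (cmod (u t x))\<^sup>2)"
          by (rule ennreal_leI)
        then show ?thesis by (simp add: ennreal_power ennreal_mult)
      qed
      have "?I s \<le> (\<integral>\<^sup>+x. 2 * ennreal (cmod (u s x - u t x)) ^ 2 + 2 * ennreal (cmod (u t x)) ^ 2 \<partial>lborel)"
        by (intro nn_integral_mono pt)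
      also have "\<dots> = 2 * (\<integral>\<^sup>+x. ennreal (cmod (u s x - u t x)) ^ 2 \<partial>lborel) + 2 * ?I t"
        by (simp add: nn_integral_add nn_integral_cmult)
      also have "\<dots> \<le> 2 * ennreal (1\<^sup>2) + 2 * ennreal c"
        unfolding c using d(2)[OF False] s by (intro add_mono mult_left_mono) (auto simp: dist_commute)
      also have "\<dots> = ennreal (2 + 2 * c)" using c(1) by (simp add: ennreal_mult'')
      finally show ?thesis .
    next
      case True
      have "ennreal c \<le> ennreal (2 + 2 * c)" using c(1) by (intro ennreal_leI) simp
      then show ?thesis unfolding True c(2) .
    qed
    then show ?thesis using d(1) c(1) by (intro exI[of _ d] exI[of _ "2 + 2 * c"]) auto
  qed
  then obtain d C where dC: "\<And>t. d t > 0" "\<And>t. C t \<ge> 0" "\<And>t s. s \<in> ball t (d t) \<Longrightarrow> ?I s \<le> ennreal (C t)"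
    by metis
  have "{a..b} \<subseteq> (\<Union>t\<in>{a..b}. ball t (d t))" using dC(1) by auto
  then obtain F where F: "F \<subseteq> {a..b}" "finite F" "{a..b} \<subseteq> (\<Union>t\<in>F. ball t (d t))"
    by (rule compactE_image[OF compact_Icc, rotated]) auto
  show ?thesis
  proof (rule that[of "\<Sum>t\<in>F. C t"])
    show "0 \<le> (\<Sum>t\<in>F. C t)" using dC(2) by (simp add: sum_nonneg)
    fix s assume "s \<in> {a..b}"
    then obtain t where t: "t \<in> F" "s \<in> ball t (d t)" using F(3) by blast
    then have "?I s \<le> ennreal (C t)" using dC(3) by blast
    also have "\<dots> \<le> ennreal (\<Sum>t\<in>F. C t)"
      using t F(2) dC(2) by (intro ennreal_leI member_le_sum) auto
    finally show "?I s \<le> ennreal (\<Sum>t\<in>F. C t)" .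
  qed
qed

lemma indicator_L2:
  fixes \<zeta> :: "'a::euclidean_space \<Rightarrow> complex"
  assumes "\<And>y. cmod (\<zeta> y) \<le> M * indicat_real (cball 0 \<rho>) y"
  shows "(\<integral>\<^sup>+y. ennreal (cmod (\<zeta> y)) ^ 2 \<partial>lborel) \<le> ennreal (M\<^sup>2 * measure lborel (cball (0::'a) \<rho>))"
proof -
  have "(cmod (\<zeta> y))\<^sup>2 \<le> M\<^sup>2 * indicat_real (cball 0 \<rho>) y" for y
    using power_mono[OF assms norm_ge_zero, of y 2] by (auto simp: indicator_def split: if_splits)
  then have "(\<integral>\<^sup>+y. ennreal (cmod (\<zeta> y)) ^ 2 \<partial>lborel) \<le> (\<integral>\<^sup>+(y::'a). ennreal (M\<^sup>2) * indicator (cball 0 \<rho>) y \<partial>lborel)"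
    by (intro nn_integral_mono) (auto simp: ennreal_power ennreal_mult[symmetric] ennreal_indicator[symmetric] intro!: ennreal_leI)
  also have "\<dots> = ennreal (M\<^sup>2) * emeasure lborel (cball (0::'a) \<rho>)"
    by (rule nn_integral_cmult_indicator) simp
  also have "emeasure lborel (cball (0::'a) \<rho>) = ennreal (measure lborel (cball (0::'a) \<rho>))"
    using emeasure_lborel_cball_finite[of "0::'a" \<rho>] by (intro emeasure_eq_ennreal_measure) auto
  finally show ?thesis by (simp add: ennreal_mult)
qed

text \<open>Split the pairing into (u(s) - u(t)) \<zeta>(s) and u(t) \<zeta>(s). Cauchy-Schwarz with
  the common compactly supported majorant treats the former, dominated convergence along sequences
  the latter, so pointwise convergence of \<zeta> is enough.\<close>

lemma weak_L2_limit:
  fixes u :: "real \<Rightarrow> 'a::euclidean_space \<Rightarrow> complex"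
  assumes u: "continuous_L2 u"
    and m[measurable]: "\<And>s. \<zeta> s \<in> borel_measurable borel"
    and b: "\<forall>\<^sub>F s in at t. \<forall>y. cmod (\<zeta> s y) \<le> M * indicat_real (cball 0 \<rho>) y"
    and b0: "\<And>y. cmod (\<zeta> t y) \<le> M * indicat_real (cball 0 \<rho>) y"
    and l: "\<And>y. ((\<lambda>s. \<zeta> s y) \<longlongrightarrow> \<zeta> t y) (at t)"
  shows "((\<lambda>s. LINT y|lborel. u s y * \<zeta> s y) \<longlongrightarrow> (LINT y|lborel. u t y * \<zeta> t y)) (at t)"
proof -
  let ?B = "M\<^sup>2 * measure lborel (cball (0::'a) \<rho>)"
  have um[measurable]: "u s \<in> borel_measurable borel" for s
    using u L2_functionD(1) unfolding continuous_L2_def by blast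
  have fin: "(\<integral>\<^sup>+x. ennreal (cmod (u s x)) ^ 2 \<partial>lborel) < \<infinity>" for s
    using u L2_functionD(2) unfolding continuous_L2_def by blast
  have int: "integrable lborel (\<lambda>y. u s y * \<zeta> r y)"
    if "\<forall>y. cmod (\<zeta> r y) \<le> M * indicat_real (cball 0 \<rho>) y" for s r
  proof -
    obtain A where A: "A \<ge> 0" "(\<integral>\<^sup>+x. ennreal (cmod (u s x)) ^ 2 \<partial>lborel) = ennreal A"
      using fin[of s] by (cases "\<integral>\<^sup>+x. ennreal (cmod (u s x)) ^ 2 \<partial>lborel") auto
    show ?thesis
      by (rule L2_Cauchy_Schwarz(2)[OF um m _ A(1) indicator_L2[OF that[rule_format]]]) (use A in auto)
  qed
  have 1: "((\<lambda>s. LINT y|lborel. u t y * \<zeta> s y) \<longlongrightarrow> (LINT y|lborel. u t y * \<zeta> t y)) (at t)"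
    unfolding tendsto_at_iff_sequentially
  proof (intro allI impI)
    fix X :: "nat \<Rightarrow> real" assume X: "\<forall>i. X i \<in> UNIV - {t}" "X \<longlonglongrightarrow> t"
    then have XF: "filterlim X (at t) sequentially" by (auto simp: filterlim_at)
    \<comment> \<open>The majorant is available only near t, so the argument uses a tail of the
      sequence; \<open>LIMSEQ_offset\<close> removes the shift.\<close>
    from eventually_compose_filterlim[OF b XF] obtain N where
      N: "\<And>n y. n \<ge> N \<Longrightarrow> cmod (\<zeta> (X n) y) \<le> M * indicat_real (cball 0 \<rho>) y"
      unfolding eventually_sequentially by blast
    have intM: "integrable lborel (\<lambda>y. u t y * (complex_of_real (M * indicat_real (cball 0 \<rho>) y)))"
    proof -
      obtain A where A: "A \<ge> 0" "(\<integral>\<^sup>+x. ennreal (cmod (u t x)) ^ 2 \<partial>lborel) = ennreal A"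
        using fin[of t] by (cases "\<integral>\<^sup>+x. ennreal (cmod (u t x)) ^ 2 \<partial>lborel") auto
      have "cmod (complex_of_real (M * indicat_real (cball 0 \<rho>) y)) \<le> \<bar>M\<bar> * indicat_real (cball 0 \<rho>) y" for y :: 'a
        unfolding norm_of_real by (simp add: abs_mult)
      moreover have [measurable]: "indicat_real (cball (0::'a) \<rho>) \<in> borel_measurable borel"
        by (rule borel_measurable_indicator) simp
      have "(\<lambda>y::'a. complex_of_real (M * indicat_real (cball 0 \<rho>) y)) \<in> borel_measurable borel"
        by measurable
      ultimately show ?thesis using A(2)
        by (intro L2_Cauchy_Schwarz(2)[OF um _ _ A(1) indicator_L2[where M = "\<bar>M\<bar>"]]) auto
    qed
    have "(\<lambda>i. LINT y|lborel. u t y * \<zeta> (X (i + N)) y) \<longlonglongrightarrow> (LINT y|lborel. u t y * \<zeta> t y)"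
    proof (rule integral_dominated_convergence[OF _ _ integrable_norm[OF intM]])
      show "AE y in lborel. (\<lambda>i. u t y * \<zeta> (X (i + N)) y) \<longlonglongrightarrow> u t y * \<zeta> t y"
      proof (rule AE_I2)
        fix y
        have "(\<lambda>i. \<zeta> (X i) y) \<longlonglongrightarrow> \<zeta> t y" by (rule filterlim_compose[OF l XF])
        then have "(\<lambda>i. \<zeta> (X (i + N)) y) \<longlonglongrightarrow> \<zeta> t y" by (rule LIMSEQ_ignore_initial_segment)
        then show "(\<lambda>i. u t y * \<zeta> (X (i + N)) y) \<longlonglongrightarrow> u t y * \<zeta> t y" by (intro tendsto_intros)
      qed
      fix i
      show "AE y in lborel. norm (u t y * \<zeta> (X (i + N)) y) \<le> norm (u t y * complex_of_real (M * indicat_real (cball 0 \<rho>) y))"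
      proof (rule AE_I2)
        fix y
        have "cmod (\<zeta> (X (i + N)) y) \<le> cmod (complex_of_real (M * indicat_real (cball 0 \<rho>) y))"
          using N[of "i + N" y] unfolding norm_of_real by simp
        then show "norm (u t y * \<zeta> (X (i + N)) y) \<le> norm (u t y * complex_of_real (M * indicat_real (cball 0 \<rho>) y))"
          unfolding norm_mult[of "u t y"] by (rule mult_left_mono) simp
      qed
    qed measurable
    from LIMSEQ_offset[OF this]
    show "((\<lambda>s. LINT y|lborel. u t y * \<zeta> s y) \<circ> X) \<longlonglongrightarrow> (LINT y|lborel. u t y * \<zeta> t y)"
      by (simp add: o_def)
  qed
  have 2: "((\<lambda>s. LINT y|lborel. (u s y - u t y) * \<zeta> s y) \<longlongrightarrow> 0) (at t)"
  proof (rule tendstoI)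
    fix e :: real assume e: "e > 0"
    have B0: "0 \<le> ?B" by simp
    define \<delta> where "\<delta> = e / (2 * (sqrt ?B + 1))"
    have \<delta>: "\<delta> > 0" unfolding \<delta>_def using e B0 by (intro divide_pos_pos) (auto intro: add_nonneg_pos)
    show "\<forall>\<^sub>F s in at t. dist (LINT y|lborel. (u s y - u t y) * \<zeta> s y) 0 < e"
      using b continuous_L2D[OF u \<delta>, of t]
    proof eventually_elim
      case (elim s)
      have "cmod (LINT y|lborel. (u s y - u t y) * \<zeta> s y) \<le> sqrt (\<delta>\<^sup>2 * ?B)"
        using elim by (intro L2_Cauchy_Schwarz(3) indicator_L2) auto
      also have "\<dots> = \<delta> * sqrt ?B" using \<delta> by (simp add: real_sqrt_mult)
      also have "\<dots> \<le> \<delta> * (sqrt ?B + 1)" using \<delta> by (intro mult_left_mono) auto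
      also have "\<dots> = e / 2"
      proof -
        have "sqrt ?B + 1 > 0" using B0 by (intro add_nonneg_pos) auto
        then show ?thesis unfolding \<delta>_def by (simp add: divide_simps)
      qed
      also have "\<dots> < e" using e by simp
      finally show ?case by simp
    qed
  qed
  have "\<forall>\<^sub>F s in at t. (LINT y|lborel. (u s y - u t y) * \<zeta> s y) + (LINT y|lborel. u t y * \<zeta> s y) = (LINT y|lborel. u s y * \<zeta> s y)"
    using b
  proof eventually_elim
    case (elim s)
    from int[OF elim, of s] int[OF elim, of t] show ?case by (simp add: left_diff_distrib)
  qed
  from Lim_transform_eventually[OF tendsto_add[OF 2 1] this] show ?thesis by simp
qed

section \<open>Functions on the line with vanishing distributional derivative\<close>

lemma integral_pos_continuous:
  fixes f :: "'a::euclidean_space \<Rightarrow> real"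
  assumes cont: "continuous_on UNIV f" and int: "integrable lborel f" and nn: "\<And>x. 0 \<le> f x" and pos: "f x0 > 0"
  shows "(LINT x|lborel. f x) > 0"
proof (rule ccontr)
  assume "\<not> ?thesis"
  moreover have "(LINT x|lborel. f x) \<ge> 0" using nn by simp
  ultimately have "(LINT x|lborel. f x) = 0" by simp
  then have "AE x in lborel. f x = 0"
    using integral_nonneg_eq_0_iff_AE[OF int] nn by simp
  moreover have op: "open {x. f x \<noteq> 0}" by (intro open_Collect_neq cont continuous_intros)
  ultimately have "{x. f x \<noteq> 0} \<in> null_sets lborel"
    by (subst (asm) AE_iff_null) auto
  then have "negligible {x. f x \<noteq> 0}"
    by (simp add: negligible_iff_null_sets null_sets_completionI)
  moreover note op
  moreover have "{x. f x \<noteq> 0} \<noteq> {}" using pos by force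
  ultimately show False using open_not_negligible by blast
qed

lemma integrable_compact_support_real:
  fixes f :: "real \<Rightarrow> 'b::{banach, second_countable_topology}"
  assumes "continuous_on UNIV f" "\<And>t. \<bar>t\<bar> > R \<Longrightarrow> f t = 0"
  shows "integrable lborel f"
proof -
  have "integrable lborel (\<lambda>t. indicator {-R..R} t *\<^sub>R f t)"
    using assms(1) by (intro borel_integrable_compact) (auto intro: continuous_on_subset)
  moreover have "(\<lambda>t. indicator {-R..R} t *\<^sub>R f t) = f"
    using assms(2) by (force simp: fun_eq_iff indicator_def)
  ultimately show ?thesis by simp
qed

text \<open>The primitive \<theta> of a bump is a smooth step. A difference of two steps of width e
  at a and b is a test function whose derivative is a difference of mollifiers, so the mollified
  values of A at a and b agree; continuity lets e tend to 0.\<close>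

lemma du_bois_reymond:
  fixes A :: "real \<Rightarrow> complex"
  assumes A: "continuous_on UNIV A"
    and test: "\<And>\<tau> \<tau>' R. (\<And>k. C_k k \<tau>) \<Longrightarrow> (\<And>t. (\<tau> has_real_derivative \<tau>' t) (at t)) \<Longrightarrow> continuous_on UNIV \<tau>' \<Longrightarrow>
      (\<And>t. \<bar>t\<bar> > R \<Longrightarrow> \<tau> t = 0 \<and> \<tau>' t = 0) \<Longrightarrow> (LINT t|lborel. \<tau>' t *\<^sub>R A t) = 0"
  shows "A a = A b"
proof -
  define \<beta> where "\<beta> t = expinv 0 (1 + (- 1) * (norm t)\<^sup>2)" for t :: real
  have C\<beta>: "C_k k \<beta>" for k
    unfolding \<beta>_def[abs_def] by (rule C_k_compose_real[OF C_k_expinv C_k_dist_sq])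
  have cont\<beta>: "continuous_on UNIV \<beta>" using C\<beta> by (rule C_k_continuous)
  have \<beta>0: "\<beta> t = 0" if "\<bar>t\<bar> \<ge> 1" for t
  proof -
    have "1 \<le> \<bar>t\<bar>\<^sup>2" using that by (rule one_le_power)
    then show ?thesis unfolding \<beta>_def expinv_def by auto
  qed
  have \<beta>nn: "0 \<le> \<beta> t" for t unfolding \<beta>_def by (rule expinv_nonneg)
  have int\<beta>: "integrable lborel \<beta>" by (rule integrable_compact_support_real[OF cont\<beta>, of 1]) (use \<beta>0 in auto)
  have [measurable]: "\<beta> \<in> borel_measurable borel" "A \<in> borel_measurable borel"
    using cont\<beta> A by (auto intro: borel_measurable_continuous_onI)
  have pos: "(LINT t|lborel. \<beta> t) > 0"
    by (rule integral_pos_continuous[OF cont\<beta> int\<beta> \<beta>nn, of 0]) (simp add: \<beta>_def expinv_def)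
  let ?\<theta> = "primitive \<beta>"
  have \<theta>: "(?\<theta> has_real_derivative \<beta> t) (at t)" for t
    using primitive_has_vector_derivative[OF cont\<beta>] by (simp add: has_real_derivative_iff_has_vector_derivative)
  have C\<theta>: "C_k k ?\<theta>" for k
  proof (rule C_k_SucD, rule C_k_SucI)
    show "(?\<theta> has_derivative (\<lambda>v. \<beta> x * v)) (at x)" for x using \<theta>[of x] unfolding has_field_derivative_def .
    show "C_k k (\<lambda>x. \<beta> x * c)" if "c \<in> Basis" for c using that C\<beta> by simp
  qed
  have \<theta>_right: "?\<theta> x = ?\<theta> 1" if "x > 1" for x
  proof (rule DERIV_isconst_end[OF that])
    show "continuous_on {1..x} ?\<theta>" using C_k_continuous[OF C\<theta>] continuous_on_subset by blast
    show "(?\<theta> has_real_derivative 0) (at y)" if "1 < y" "y < x" for y using \<theta>[of y] \<beta>0[of y] that by simp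
  qed
  have \<theta>_left: "?\<theta> (-1) = ?\<theta> x" if "x < -1" for x
  proof (rule DERIV_isconst_end[OF that])
    show "continuous_on {x..-1} ?\<theta>" using C_k_continuous[OF C\<theta>] continuous_on_subset by blast
    show "(?\<theta> has_real_derivative 0) (at y)" if "x < y" "y < -1" for y using \<theta>[of y] \<beta>0[of y] that by simp
  qed
  let ?I = "\<lambda>c e. LINT s|lborel. \<beta> s *\<^sub>R A (c + e * s)"
  have eq: "?I a e = ?I b e" if e: "e > 0" for e
  proof -
    \<comment> \<open>Both steps take the same constant value far to the left and far to the right,
      so their difference has compact support; R = |a| + |b| + e contains both transition
      zones.\<close>
    define \<tau> where "\<tau> t = ?\<theta> ((1 / e) *\<^sub>R t + - a / e) - ?\<theta> ((1 / e) *\<^sub>R t + - b / e)" for t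
    define \<tau>' where "\<tau>' t = (\<beta> ((1 / e) *\<^sub>R t + - a / e) - \<beta> ((1 / e) *\<^sub>R t + - b / e)) / e" for t
    define R where "R = \<bar>a\<bar> + \<bar>b\<bar> + e"
    have Clin: "C_k k (\<lambda>t. (1 / e) *\<^sub>R t + c)" for k c
      by (intro C_k_add C_k_const C_k_linear bounded_linear_intros)
    have C1: "C_k k (\<lambda>t. ?\<theta> ((1 / e) *\<^sub>R t + c))" for k c by (rule C_k_compose_real[OF C\<theta> Clin])
    have C\<tau>: "C_k k \<tau>" for k
      using C_k_add[OF C1 C_k_scaleR[OF C_k_const C1], of k "- a / e" "- 1" "- b / e"]
      unfolding \<tau>_def[abs_def] by simp
    have D1: "((\<lambda>t. ?\<theta> ((1 / e) *\<^sub>R t + c)) has_real_derivative \<beta> ((1 / e) *\<^sub>R t + c) * (1 / e)) (at t)" for t c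
      by (rule DERIV_chain2[OF \<theta>]) (use e in \<open>auto intro!: derivative_eq_intros\<close>)
    have D\<tau>: "(\<tau> has_real_derivative \<tau>' t) (at t)" for t
      unfolding \<tau>_def[abs_def] \<tau>'_def
      by (rule DERIV_cong[OF DERIV_diff[OF D1 D1]]) (simp add: diff_divide_distrib)
    have cont\<tau>': "continuous_on UNIV \<tau>'"
      unfolding \<tau>'_def[abs_def] by (intro continuous_intros continuous_on_compose2[OF cont\<beta>]) (use e in auto)
    have supp: "\<tau> t = 0 \<and> \<tau>' t = 0" if "\<bar>t\<bar> > R" for t
    proof (cases "t > 0")
      case True
      then have "(1 / e) *\<^sub>R t + - a / e > 1" "(1 / e) *\<^sub>R t + - b / e > 1"
        using that e unfolding R_def by (auto simp: field_simps)
      then show ?thesis unfolding \<tau>_def \<tau>'_def using \<theta>_right \<beta>0 by simp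
    next
      case False
      then have lt: "(1 / e) *\<^sub>R t + - a / e < - 1" "(1 / e) *\<^sub>R t + - b / e < - 1"
        using that e unfolding R_def by (auto simp: field_simps)
      then have "\<beta> ((1 / e) *\<^sub>R t + - a / e) = 0" "\<beta> ((1 / e) *\<^sub>R t + - b / e) = 0"
        by (auto intro!: \<beta>0)
      then show ?thesis unfolding \<tau>_def \<tau>'_def using \<theta>_left[OF lt(1)] \<theta>_left[OF lt(2)] by simp
    qed
    have one: "(LINT t|lborel. (\<beta> ((1 / e) *\<^sub>R t + - c / e) / e) *\<^sub>R A t) = ?I c e"
      and inte: "integrable lborel (\<lambda>t. (\<beta> ((1 / e) *\<^sub>R t + - c / e) / e) *\<^sub>R A t)" for c
    proof -
      have "(LINT t|lborel. (\<beta> ((1 / e) *\<^sub>R t + - c / e) / e) *\<^sub>R A t) =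
        e ^ DIM(real) *\<^sub>R (LINT s|lborel. (\<beta> ((1 / e) *\<^sub>R (c + e *\<^sub>R s) + - c / e) / e) *\<^sub>R A (c + e *\<^sub>R s))"
        by (rule integral_lborel_scale) (use e in measurable)
      also have "\<dots> = (LINT s|lborel. e *\<^sub>R ((\<beta> ((1 / e) *\<^sub>R (c + e *\<^sub>R s) + - c / e) / e) *\<^sub>R A (c + e *\<^sub>R s)))"
        by (subst Bochner_Integration.integral_scaleR_right[symmetric]) (simp only: DIM_real power_one_right)
      also have "\<dots> = ?I c e"
      proof (rule Bochner_Integration.integral_cong[OF refl])
        fix s
        have "(1 / e) *\<^sub>R (c + e *\<^sub>R s) + - c / e = s" using e by (simp add: field_simps)
        then show "e *\<^sub>R ((\<beta> ((1 / e) *\<^sub>R (c + e *\<^sub>R s) + - c / e) / e) *\<^sub>R A (c + e *\<^sub>R s)) = \<beta> s *\<^sub>R A (c + e * s)"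
          using e by simp
      qed
      finally show "(LINT t|lborel. (\<beta> ((1 / e) *\<^sub>R t + - c / e) / e) *\<^sub>R A t) = ?I c e" .
      show "integrable lborel (\<lambda>t. (\<beta> ((1 / e) *\<^sub>R t + - c / e) / e) *\<^sub>R A t)"
      proof (rule integrable_compact_support_real[of _ "\<bar>c\<bar> + e"])
        show "continuous_on UNIV (\<lambda>t. (\<beta> ((1 / e) *\<^sub>R t + - c / e) / e) *\<^sub>R A t)"
          by (intro continuous_intros continuous_on_compose2[OF cont\<beta>] A) (use e in auto)
        fix t assume "\<bar>t\<bar> > \<bar>c\<bar> + e"
        then have "e \<le> \<bar>t - c\<bar>" by linarith
        then have "1 \<le> \<bar>(t - c) / e\<bar>" using e by (simp add: field_simps)
        then have "\<beta> ((t - c) / e) = 0" by (rule \<beta>0)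
        then show "(\<beta> ((1 / e) *\<^sub>R t + - c / e) / e) *\<^sub>R A t = 0" by (simp add: diff_divide_distrib)
      qed
    qed
    have "0 = (LINT t|lborel. \<tau>' t *\<^sub>R A t)" using test[OF C\<tau> D\<tau> cont\<tau>' supp] by simp
    also have "\<dots> = (LINT t|lborel. (\<beta> ((1 / e) *\<^sub>R t + - a / e) / e) *\<^sub>R A t - (\<beta> ((1 / e) *\<^sub>R t + - b / e) / e) *\<^sub>R A t)"
      unfolding \<tau>'_def by (simp only: diff_divide_distrib scaleR_diff_left)
    also have "\<dots> = ?I a e - ?I b e"
      unfolding Bochner_Integration.integral_diff[OF inte inte] one ..
    finally show ?thesis by simp
  qed
  define e where "e k = inverse (real (Suc k))" for k
  have e: "e k > 0" "e k \<le> 1" for k unfolding e_def by (auto simp: field_simps)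
  have e0: "e \<longlonglongrightarrow> 0" unfolding e_def by (rule LIMSEQ_inverse_real_of_nat)
  have lim: "(\<lambda>k. ?I c (e k)) \<longlonglongrightarrow> (LINT s|lborel. \<beta> s *\<^sub>R A c)" for c
  proof -
    have "bounded (A ` {c - 1..c + 1})"
      by (intro compact_imp_bounded compact_continuous_image continuous_on_subset[OF A]) auto
    then obtain B where B: "B > 0" "\<And>t. t \<in> {c - 1..c + 1} \<Longrightarrow> cmod (A t) \<le> B" unfolding bounded_pos by auto
    show ?thesis
    proof (rule integral_dominated_convergence)
      show "integrable lborel (\<lambda>s. B * \<beta> s)" using int\<beta> by simp
      show "AE s in lborel. norm (\<beta> s *\<^sub>R A (c + e k * s)) \<le> B * \<beta> s" for k
      proof (rule AE_I2)
        fix s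
        show "norm (\<beta> s *\<^sub>R A (c + e k * s)) \<le> B * \<beta> s"
        proof (cases "\<bar>s\<bar> \<ge> 1")
          case False
          have "\<bar>e k * s\<bar> \<le> 1" using False e[of k] mult_le_one[of "e k" "\<bar>s\<bar>"] by (simp add: abs_mult)
          then have "c + e k * s \<in> {c - 1..c + 1}" by auto
          then have "\<beta> s * cmod (A (c + e k * s)) \<le> \<beta> s * B" using B \<beta>nn by (intro mult_left_mono) auto
          then show ?thesis using \<beta>nn[of s] by (simp add: mult.commute)
        qed (simp add: \<beta>0)
      qed
      show "AE s in lborel. (\<lambda>k. \<beta> s *\<^sub>R A (c + e k * s)) \<longlonglongrightarrow> \<beta> s *\<^sub>R A c"
      proof (rule AE_I2)
        fix s
        have "(\<lambda>k. c + e k * s) \<longlonglongrightarrow> c + 0 * s" by (intro tendsto_intros e0)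
        then have "(\<lambda>k. A (c + e k * s)) \<longlonglongrightarrow> A (c + 0 * s)"
          by (rule continuous_on_tendsto_compose[OF A]) auto
        then show "(\<lambda>k. \<beta> s *\<^sub>R A (c + e k * s)) \<longlonglongrightarrow> \<beta> s *\<^sub>R A c" by (intro tendsto_intros) simp
      qed
    qed measurable
  qed
  have "(LINT s|lborel. \<beta> s *\<^sub>R A a) = (LINT s|lborel. \<beta> s *\<^sub>R A b)"
    by (rule LIMSEQ_unique[OF lim[of a]]) (use lim[of b] eq[OF e(1)] in simp)
  then have "(LINT s|lborel. \<beta> s) *\<^sub>R A a = (LINT s|lborel. \<beta> s) *\<^sub>R A b"
    using int\<beta> by simp
  then show ?thesis using pos by simp
qed

section \<open>Overlap of a solution with a moving wave packet\<close>

lemma dir_deriv_zero: "C_k (Suc k) f \<Longrightarrow> dir_deriv 0 f x = 0"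
  using linear_0[OF has_derivative_linear[OF C_k_has_derivative]] by blast

lemma C_k_snd:
  fixes f :: "'b::euclidean_space \<Rightarrow> 'c::real_normed_vector"
  shows "C_k k f \<Longrightarrow> C_k k (\<lambda>p :: 'a::euclidean_space \<times> 'b. f (snd p))"
proof (induction k arbitrary: f)
  case 0
  then show ?case by (auto intro!: continuous_on_compose2[of UNIV f] continuous_intros)
next
  case (Suc k)
  have "((\<lambda>p::'a \<times> 'b. snd p) has_derivative snd) (at x)" for x by (auto intro!: derivative_eq_intros)
  from has_derivative_compose[OF this C_k_has_derivative[OF Suc.prems]]
  show ?case
  proof (rule C_k_SucI)
    fix b :: "'a \<times> 'b" assume "b \<in> Basis"
    then consider "snd b \<in> Basis" | "snd b = 0" by (auto simp: Basis_prod_def)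
    then show "C_k k (\<lambda>x::'a \<times> 'b. dir_deriv (snd b) f (snd x))"
    proof cases
      case 1
      then show ?thesis using Suc.prems by (intro Suc.IH) auto
    next
      case 2
      then show ?thesis using dir_deriv_zero[OF Suc.prems] C_k_const[of k 0] by simp
    qed
  qed
qed

lemma C_k_mult:
  fixes f g :: "'a::euclidean_space \<Rightarrow> 'b::real_normed_algebra"
  shows "C_k k f \<Longrightarrow> C_k k g \<Longrightarrow> C_k k (\<lambda>x. f x * g x)"
proof (induction k arbitrary: f g)
  case (Suc k)
  have "C_k k (\<lambda>x. f x * dir_deriv b g x)" "C_k k (\<lambda>x. dir_deriv b f x * g x)" if "b \<in> Basis" for b
    using Suc.prems that by (auto intro!: Suc.IH intro: C_k_SucD simp del: C_k.simps(2)) auto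
  then show ?case
    by (intro C_k_SucI[OF has_derivative_mult[OF C_k_has_derivative[OF Suc.prems(1)] C_k_has_derivative[OF Suc.prems(2)]]] C_k_add)
qed (auto intro: continuous_intros)

lemma partial_scaleR:
  assumes "smooth f" shows "partial j (\<lambda>y. c *\<^sub>R f y) = (\<lambda>x. c *\<^sub>R partial j f x)"
proof
  fix x
  have "C_k (Suc 0) f" using assms unfolding smooth_def by blast
  from has_derivative_scaleR_right[OF C_k_has_derivative[OF this]]
  show "partial j (\<lambda>y. c *\<^sub>R f y) x = c *\<^sub>R partial j f x"
    unfolding partial_def by (rule dir_deriv_eq)
qed

lemma laplacian_scaleR:
  assumes "smooth f" shows "laplacian (\<lambda>y. c *\<^sub>R f y) x = c *\<^sub>R laplacian f x"
  unfolding laplacian_def partial_scaleR[OF assms] partial_scaleR[OF smooth_partial[OF assms]]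
  by (simp add: scaleR_sum_right)

lemma smooth_laplacian: "smooth f \<Longrightarrow> smooth (laplacian f)"
  unfolding smooth_def laplacian_def[abs_def]
  by (intro allI C_k_sum) (auto intro!: C_k_partial simp del: C_k.simps)

lemma bounded_compact_support:
  fixes f :: "'a::euclidean_space \<Rightarrow> complex"
  assumes "continuous_on UNIV f" "\<And>y. norm y > \<rho> \<Longrightarrow> f y = 0"
  obtains B where "B > 0" "\<And>y. cmod (f y) \<le> B * indicat_real (cball 0 \<rho>) y" "\<And>y. cmod (f y) \<le> B"
proof -
  have "compact (f ` cball 0 \<rho>)"
    using assms(1) by (intro compact_continuous_image) (auto intro: continuous_on_subset)
  then have "bounded (f ` cball 0 \<rho>)" by (rule compact_imp_bounded)
  then obtain B where B: "B > 0" "\<And>y. norm y \<le> \<rho> \<Longrightarrow> cmod (f y) \<le> B" unfolding bounded_pos by auto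
  have "cmod (f y) \<le> B * indicat_real (cball 0 \<rho>) y" for y
    using B(2)[of y] assms(2)[of y] by (cases "norm y \<le> \<rho>") auto
  moreover have "cmod (f y) \<le> B" for y
    using B(1) B(2)[of y] assms(2)[of y] by (cases "norm y \<le> \<rho>") auto
  ultimately show ?thesis using that B(1) by blast
qed

lemma test_function_tensor:
  fixes \<eta> :: "'a::euclidean_space \<Rightarrow> complex" and \<tau> :: "real \<Rightarrow> real"
  assumes \<tau>: "\<And>k. C_k k \<tau>" "\<And>t. \<bar>t\<bar> > R \<Longrightarrow> \<tau> t = 0"
    and \<eta>: "smooth \<eta>" "\<And>y. norm y > \<rho> \<Longrightarrow> \<eta> y = 0"
  shows "test_function (\<lambda>p. \<tau> (fst p) *\<^sub>R \<eta> (snd p))"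
  unfolding test_function_def
proof
  show "smooth (\<lambda>p. \<tau> (fst p) *\<^sub>R \<eta> (snd p))"
    unfolding smooth_def
  proof
    fix k
    show "C_k k (\<lambda>p. \<tau> (fst p) *\<^sub>R \<eta> (snd p))"
      using \<eta>(1) unfolding smooth_def
      by (intro C_k_scaleR C_k_snd C_k_compose_real[OF \<tau>(1) C_k_linear[OF bounded_linear_fst]]) blast
  qed
  have "{z. \<tau> (fst z) *\<^sub>R \<eta> (snd z) \<noteq> 0} \<subseteq> cball 0 R \<times> cball 0 \<rho>"
  proof
    fix z assume z: "z \<in> {z. \<tau> (fst z) *\<^sub>R \<eta> (snd z) \<noteq> 0}"
    then have "\<not> \<bar>fst z\<bar> > R" "\<not> norm (snd z) > \<rho>" using \<tau>(2) \<eta>(2) by auto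
    then show "z \<in> cball 0 R \<times> cball 0 \<rho>" by (cases z) auto
  qed
  moreover have "bounded (cball (0::real) R \<times> cball (0::'a) \<rho>)" by (intro bounded_Times bounded_cball)
  ultimately show "compact (closure {z. \<tau> (fst z) *\<^sub>R \<eta> (snd z) \<noteq> 0})"
    unfolding compact_closure by (rule bounded_subset[rotated])
qed

lemma vector_derivative_quotient:
  assumes "(f has_vector_derivative D) (at s)"
  shows "((\<lambda>r. (f r - f s) /\<^sub>R (r - s)) \<longlongrightarrow> D) (at s)"
proof -
  have "((\<lambda>r. norm (f r - f s - (r - s) *\<^sub>R D) / norm (r - s)) \<longlongrightarrow> 0) (at s)"
    using assms unfolding has_vector_derivative_def has_derivative_iff_norm by simp
  moreover have "\<forall>\<^sub>F r in at s. norm (f r - f s - (r - s) *\<^sub>R D) / norm (r - s) = norm ((f r - f s) /\<^sub>R (r - s) - D)"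
    unfolding eventually_at_filter
  proof (intro always_eventually allI impI)
    fix r assume "r \<noteq> s"
    then have "(f r - f s) /\<^sub>R (r - s) - D = (f r - f s - (r - s) *\<^sub>R D) /\<^sub>R (r - s)"
      by (simp add: scaleR_diff_right)
    then show "norm (f r - f s - (r - s) *\<^sub>R D) / norm (r - s) = norm ((f r - f s) /\<^sub>R (r - s) - D)"
      by (simp add: divide_inverse mult.commute)
  qed
  ultimately have "((\<lambda>r. norm ((f r - f s) /\<^sub>R (r - s) - D)) \<longlongrightarrow> 0) (at s)"
    by (rule Lim_transform_eventually)
  from LIM_zero_cancel[OF tendsto_norm_zero_cancel[OF this]] show ?thesis .
qed

text \<open>Mere continuity of Q at s suffices, as the factor r - s vanishes there. This replaces a
  product rule when u(r), which has no strong derivative, is paired with a moving packet.\<close>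

lemma has_vector_derivative_factor:
  assumes "(Q \<longlongrightarrow> Q s) (at s)"
  shows "((\<lambda>r. (r - s) *\<^sub>R Q r) has_vector_derivative Q s) (at (s::real))"
  unfolding has_vector_derivative_def has_derivative_iff_norm
proof
  show "bounded_linear (\<lambda>x. x *\<^sub>R Q s)" by (rule bounded_linear_scaleR_left)
  have "((\<lambda>r. norm (Q r - Q s)) \<longlongrightarrow> 0) (at s)"
    using tendsto_norm_zero[OF LIM_zero[OF assms]] .
  moreover have "\<forall>\<^sub>F r in at s. norm (Q r - Q s) = norm ((r - s) *\<^sub>R Q r - (s - s) *\<^sub>R Q s - (r - s) *\<^sub>R Q s) / norm (r - s)"
    unfolding eventually_at_filter
    by (intro always_eventually) (auto simp: scaleR_diff_right[symmetric])
  ultimately show "((\<lambda>r. norm ((r - s) *\<^sub>R Q r - (s - s) *\<^sub>R Q s - (r - s) *\<^sub>R Q s) / norm (r - s)) \<longlongrightarrow> 0) (at s)"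
    by (rule Lim_transform_eventually)
qed

lemma vector_derivative_lipschitz_at:
  assumes "(f has_vector_derivative D) (at s)"
  shows "\<forall>\<^sub>F r in at s. norm (f r - f s) \<le> (norm D + 1) * \<bar>r - s\<bar>"
proof -
  have "\<forall>\<^sub>F r in at s. norm ((f r - f s) /\<^sub>R (r - s)) < norm D + 1"
    using tendsto_norm[OF vector_derivative_quotient[OF assms]] by (rule order_tendstoD) simp
  then have "\<forall>\<^sub>F r in at s. r \<noteq> s \<longrightarrow> norm ((f r - f s) /\<^sub>R (r - s)) < norm D + 1"
    by eventually_elim simp
  then show ?thesis
    unfolding eventually_at_filter
    by eventually_elim (auto simp: divide_inverse[symmetric] divide_less_eq mult.commute[of "inverse _"])
qed

lemma partial_of_real:
  assumes "smooth f"
  shows "partial j (\<lambda>y. complex_of_real (f y)) = (\<lambda>y. complex_of_real (partial j f y))"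
proof
  fix y
  have "C_k (Suc 0) f" using assms unfolding smooth_def by blast
  from bounded_linear.has_derivative[OF bounded_linear_of_real C_k_has_derivative[OF this]]
  show "partial j (\<lambda>y. complex_of_real (f y)) y = complex_of_real (partial j f y)"
    unfolding partial_def by (rule dir_deriv_eq)
qed

lemma smooth_bump: "smooth bump" "smooth bumpc"
  unfolding smooth_def using C_k_bump C_k_bumpc by blast+

lemma cnj_laplacian_bumpc: "cnj (laplacian bumpc y) = laplacian bumpc y"
  unfolding laplacian_def bumpc_def[abs_def] partial_of_real[OF smooth_bump(1)]
    partial_of_real[OF smooth_partial[OF smooth_bump(1)]] by simp

lemma partial_eqI:
  assumes "\<And>x. F differentiable (at x)" "pd j F F'" shows "partial j F = F'"
  using pd_partial[OF assms(1), of j] assms(2) vector_derivative_unique_at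
  unfolding pd_def by blast

lemma smooth_modulated:
  fixes f :: "real^'n::finite \<Rightarrow> complex"
  assumes "smooth f" shows "smooth (\<lambda>y. f (y - x) * cis (- (y \<bullet> \<xi>)))"
  unfolding smooth_def
proof
  fix k
  have "C_k k (\<lambda>y::real^'n. 1 * cis (- (y \<bullet> \<xi>)))"
    by (intro C_k_compose_real[OF C_k_cis] C_k_linear bounded_linear_minus bounded_linear_inner_left)
  then show "C_k k (\<lambda>y. f (y - x) * cis (- (y \<bullet> \<xi>)))"
    using assms unfolding smooth_def by (intro C_k_mult C_k_translate) auto
qed

lemma partial_modulated:
  fixes f :: "real^'n::finite \<Rightarrow> complex"
  assumes "smooth f"
  shows "partial j (\<lambda>y. f (y - x) * cis (- (y \<bullet> \<xi>))) =
    (\<lambda>y. (partial j f (y - x) - \<i> * complex_of_real (\<xi> $ j) * f (y - x)) * cis (- (y \<bullet> \<xi>)))"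
proof (rule partial_eqI)
  show "(\<lambda>y. f (y - x) * cis (- (y \<bullet> \<xi>))) differentiable (at z)" for z
    by (rule smooth_differentiable[OF smooth_modulated[OF assms]])
  have "pd j (\<lambda>y. f (y - x) * cis (- (y \<bullet> \<xi>)))
    (\<lambda>y. f (y - x) * (- \<i> * complex_of_real (\<xi> $ j) * cis (- (y \<bullet> \<xi>))) + partial j f (y - x) * cis (- (y \<bullet> \<xi>)))"
    by (intro pd_mult pd_translate pd_partial pd_cis smooth_differentiable[OF assms])
  then show "pd j (\<lambda>y. f (y - x) * cis (- (y \<bullet> \<xi>)))
    (\<lambda>y. (partial j f (y - x) - \<i> * complex_of_real (\<xi> $ j) * f (y - x)) * cis (- (y \<bullet> \<xi>)))"
    by (simp add: algebra_simps)
qed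

text \<open>The cross term in \<xi> and the gradient of f is the transport term, later cancelled by
  the motion of the centre; the term |\<xi>|^2 goes into the phase.\<close>

lemma laplacian_modulated:
  fixes f :: "real^'n::finite \<Rightarrow> complex"
  assumes "smooth f"
  shows "laplacian (\<lambda>y. f (y - x) * cis (- (y \<bullet> \<xi>))) y =
    (laplacian f (y - x) - 2 * \<i> * (\<Sum>j\<in>UNIV. complex_of_real (\<xi> $ j) * partial j f (y - x))
      - complex_of_real ((norm \<xi>)\<^sup>2) * f (y - x)) * cis (- (y \<bullet> \<xi>))"
proof -
  have 2: "partial j (\<lambda>y. (partial j f (y - x) - \<i> * complex_of_real (\<xi> $ j) * f (y - x)) * cis (- (y \<bullet> \<xi>))) y =
    (partial j (partial j f) (y - x) - 2 * \<i> * (complex_of_real (\<xi> $ j) * partial j f (y - x)) - complex_of_real ((\<xi> $ j)\<^sup>2) * f (y - x)) * cis (- (y \<bullet> \<xi>))" for j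
  proof -
    let ?g = "\<lambda>y. partial j f y - \<i> * complex_of_real (\<xi> $ j) * f y"
    have "C_k k (\<lambda>y. partial j f y + (- \<i> * complex_of_real (\<xi> $ j)) * f y)" for k
      using assms smooth_partial[OF assms, of j] unfolding smooth_def
      by (intro C_k_add C_k_mult C_k_const) auto
    then have g: "smooth ?g" unfolding smooth_def by simp
    have "pd j ?g (\<lambda>y. partial j (partial j f) y + ((- \<i> * complex_of_real (\<xi> $ j)) * partial j f y + 0 * f y))"
      using pd_add[OF pd_partial[OF smooth_differentiable[OF smooth_partial[OF assms]]]
          pd_mult[OF pd_const[of _ "- \<i> * complex_of_real (\<xi> $ j)"] pd_partial[OF smooth_differentiable[OF assms]]], of j j]
      by simp
    then have "partial j ?g = (\<lambda>y. partial j (partial j f) y + ((- \<i> * complex_of_real (\<xi> $ j)) * partial j f y + 0 * f y))"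
      by (rule partial_eqI[OF smooth_differentiable[OF g]])
    then show ?thesis
      unfolding partial_modulated[OF g] by (simp add: algebra_simps power2_eq_square)
  qed
  have norm: "complex_of_real ((norm \<xi>)\<^sup>2) = (\<Sum>j\<in>UNIV. complex_of_real ((\<xi> $ j)\<^sup>2))"
    unfolding power2_norm_eq_inner inner_vec_def by (simp add: power2_eq_square)
  show ?thesis
    unfolding laplacian_def partial_modulated[OF assms] 2 norm
    by (simp add: sum_subtractf sum_distrib_left sum_distrib_right left_diff_distrib)
qed

lemma bumpc_lipschitz:
  obtains B where "B > 0" "\<And>x y. cmod (bumpc x - bumpc (y::real^'n::finite)) \<le> B * norm (x - y)" "\<And>y::real^'n. cmod (bumpc y) \<le> B"
proof -
  have sup: "bumpc y = 0" if "norm y > 1" for y :: "real^'n" using that by (simp add: bumpc_def bump_eq_0)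
  have "\<exists>C. \<forall>x. cmod (partial j bumpc (x::real^'n)) \<le> C" for j
  proof -
    have "continuous_on UNIV (partial j bumpc :: real^'n \<Rightarrow> complex)"
      using smooth_partial[OF smooth_bump(2), of j] unfolding smooth_def by (blast intro: C_k_continuous)
    moreover have "partial j bumpc y = 0" if "norm y > 1" for y :: "real^'n"
      by (rule partial_zero_outside[OF sup that])
    ultimately
    show ?thesis using bounded_compact_support[of "partial j bumpc" 1] by metis
  qed
  then obtain C where C: "\<And>j (x::real^'n). cmod (partial j bumpc x) \<le> C j" by metis
  obtain B where B: "B > 0" "\<And>y::real^'n. cmod (bumpc y) \<le> B"
    using bounded_compact_support[OF C_k_continuous[OF C_k_bumpc] sup] by metis
  show ?thesis
  proof (rule that[of "max B (sum C UNIV)"])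
    show "max B (sum C UNIV) > 0" using B(1) by simp
    fix x y :: "real^'n"
    have "cmod (bumpc x - bumpc y) \<le> sum C UNIV * norm (x - y)"
      using C by (intro lipschitz_of_partial_bounds[OF C_k_bumpc])
    also have "\<dots> \<le> max B (sum C UNIV) * norm (x - y)" by (intro mult_right_mono) auto
    finally show "cmod (bumpc x - bumpc y) \<le> max B (sum C UNIV) * norm (x - y)" .
    show "cmod (bumpc y) \<le> max B (sum C UNIV)"
      using B(2)[of y] by simp
  qed
qed

context subquadratic_potential
begin

text \<open>Tested with products \<tau>(t) \<eta>(y), the equation says that the pairing f has
  distributional derivative - i h. As h is continuous, the du Bois-Reymond lemma upgrades this to an
  ordinary derivative at every time.\<close>

lemma weak_derivative:
  fixes u :: "real \<Rightarrow> real^'n \<Rightarrow> complex"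
  assumes u: "continuous_L2 u"
    and weak: "\<And>\<psi> :: real \<times> (real^'n) \<Rightarrow> complex. test_function \<psi> \<Longrightarrow>
      (LINT t|lborel. LINT x|lborel. u t x * (- \<i> * dir_deriv (1, 0) \<psi> (t, x))) =
      (LINT t|lborel. LINT x|lborel.
         u t x * (- (1/2) * laplacian (\<lambda>y. \<psi> (t, y)) x + complex_of_real (V t x) * \<psi> (t, x)))"
    and \<eta>: "smooth \<eta>" "\<And>y. norm y > \<rho> \<Longrightarrow> \<eta> y = 0"
  shows "((\<lambda>s. LINT y|lborel. u s y * \<eta> y) has_vector_derivative
     - \<i> * (LINT y|lborel. u s y * (- (1/2) * laplacian \<eta> y + complex_of_real (V s y) * \<eta> y))) (at s)"
proof -
  have c\<eta>: "continuous_on UNIV \<eta>" using \<eta>(1) unfolding smooth_def by (blast intro: C_k_continuous)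
  have cL: "continuous_on UNIV (laplacian \<eta>)"
    using smooth_laplacian[OF \<eta>(1)] unfolding smooth_def by (blast intro: C_k_continuous)
  have cV: "continuous_on UNIV (V t)" for t using C_k_V by (rule C_k_continuous)
  have [measurable]: "\<eta> \<in> borel_measurable borel" "laplacian \<eta> \<in> borel_measurable borel" "V t \<in> borel_measurable borel" for t
    using c\<eta> cL cV by (auto intro: borel_measurable_continuous_onI)
  obtain B1 where B1: "B1 > 0" "\<And>y. cmod (\<eta> y) \<le> B1 * indicat_real (cball 0 \<rho>) y"
    using bounded_compact_support[OF c\<eta> \<eta>(2)] by metis
  have Lz: "laplacian \<eta> y = 0" if "norm y > \<rho>" for y
    by (rule laplacian_zero_outside[OF \<eta>(2) that])
  obtain B2 where B2: "B2 > 0" "\<And>y. cmod (laplacian \<eta> y) \<le> B2 * indicat_real (cball 0 \<rho>) y"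
    using bounded_compact_support[OF cL Lz] by metis
  define f where "f s = (LINT y|lborel. u s y * \<eta> y)" for s
  define \<zeta> where "\<zeta> s y = - (1/2) * laplacian \<eta> y + complex_of_real (V s y) * \<eta> y" for s y
  define h where "h s = (LINT y|lborel. u s y * \<zeta> s y)" for s
  have contf: "continuous_on UNIV f"
  proof (intro continuous_at_imp_continuous_on ballI)
    fix t
    show "isCont f t" unfolding isCont_def f_def
      by (rule weak_L2_limit[OF u, where M = B1 and \<rho> = \<rho>]) (use B1 in auto)
  qed
  have conth: "continuous_on UNIV h"
  proof (intro continuous_at_imp_continuous_on ballI)
    fix t
    \<comment> \<open>V itself may be unbounded, but only its values near time t and on the support
      of \<eta> enter.\<close>
    have "bounded ((\<lambda>(t, x). V t x) ` ({t - 1..t + 1} \<times> cball 0 \<rho>))"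
      by (intro compact_imp_bounded compact_continuous_image continuous_on_subset[OF continuous_on_V] compact_Times) auto
    then obtain BV where BV: "BV > 0" "\<And>s y. s \<in> {t - 1..t + 1} \<Longrightarrow> norm y \<le> \<rho> \<Longrightarrow> \<bar>V s y\<bar> \<le> BV"
      unfolding bounded_pos by auto
    have bnd: "cmod (\<zeta> s y) \<le> (B2 + BV * B1) * indicat_real (cball 0 \<rho>) y" if s: "s \<in> {t - 1..t + 1}" for s y
    proof (cases "norm y \<le> \<rho>")
      case True
      have "cmod (\<zeta> s y) \<le> cmod (- (1/2) * laplacian \<eta> y) + cmod (complex_of_real (V s y) * \<eta> y)"
        unfolding \<zeta>_def by (rule norm_triangle_ineq)
      also have "\<dots> = (1/2) * cmod (laplacian \<eta> y) + \<bar>V s y\<bar> * cmod (\<eta> y)"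
        by (simp add: norm_mult)
      also have "\<dots> \<le> B2 + BV * B1"
        using B2(2)[of y] B1(2)[of y] True BV(1) B2(1)
        by (intro add_mono mult_mono BV(2)[OF s]) auto
      finally show ?thesis using True by simp
    next
      case False
      then show ?thesis unfolding \<zeta>_def using \<eta>(2)[of y] Lz[of y] by simp
    qed
    show "isCont h t" unfolding isCont_def h_def
    proof (rule weak_L2_limit[OF u, where M = "B2 + BV * B1" and \<rho> = \<rho>])
      show "\<zeta> s \<in> borel_measurable borel" for s unfolding \<zeta>_def[abs_def] by measurable
      show "\<forall>\<^sub>F s in at t. \<forall>y. cmod (\<zeta> s y) \<le> (B2 + BV * B1) * indicat_real (cball 0 \<rho>) y"
        unfolding eventually_at
      proof (intro exI[of _ 1] conjI ballI impI allI)
        fix s y assume "s \<noteq> t \<and> dist s t < 1"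
        then have "s \<in> {t - 1..t + 1}" by (auto simp: dist_real_def)
        then show "cmod (\<zeta> s y) \<le> (B2 + BV * B1) * indicat_real (cball 0 \<rho>) y" by (rule bnd)
      qed simp
      show "cmod (\<zeta> t y) \<le> (B2 + BV * B1) * indicat_real (cball 0 \<rho>) y" for y by (rule bnd) simp
      fix y
      have "continuous_on UNIV (\<lambda>s. (\<lambda>(t, x). V t x) (s, y))"
        by (rule continuous_on_compose2[OF continuous_on_V]) (auto intro!: continuous_intros)
      then have "((\<lambda>s. V s y) \<longlongrightarrow> V t y) (at t)" by (simp add: continuous_on_def)
      then show "((\<lambda>s. \<zeta> s y) \<longlongrightarrow> \<zeta> t y) (at t)" unfolding \<zeta>_def by (intro tendsto_intros)
    qed
  qed
  define H where "H = primitive h"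
  have H: "(H has_vector_derivative h t) (at t)" for t
    unfolding H_def by (rule primitive_has_vector_derivative[OF conth])
  have contH: "continuous_on UNIV H"
    using H by (meson continuous_at_imp_continuous_on has_vector_derivative_continuous)
  \<comment> \<open>f' = - i h is equivalent to (H - i f)' = 0, the form in which the du
    Bois-Reymond lemma applies.\<close>
  define A where "A t = H t - \<i> * f t" for t
  have const: "A a = A b" for a b
  proof (rule du_bois_reymond)
    show "continuous_on UNIV A" unfolding A_def[abs_def] by (intro continuous_intros contH contf)
    fix \<tau> \<tau>' R
    assume C\<tau>: "\<And>k. C_k k \<tau>" and D\<tau>: "\<And>t. (\<tau> has_real_derivative \<tau>' t) (at t)"
      and cont\<tau>': "continuous_on UNIV \<tau>'" and supp: "\<And>t. \<bar>t\<bar> > R \<Longrightarrow> \<tau> t = 0 \<and> \<tau>' t = 0"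
    have cont\<tau>: "continuous_on UNIV \<tau>" using C\<tau> by (rule C_k_continuous)
    have int: "integrable lborel (\<lambda>t. \<tau>' t *\<^sub>R g t)" "integrable lborel (\<lambda>t. \<tau> t *\<^sub>R g t)"
      if "continuous_on UNIV g" for g :: "real \<Rightarrow> complex"
      by (rule integrable_compact_support_real[of _ R]; use supp cont\<tau> cont\<tau>' that in \<open>auto intro!: continuous_intros\<close>)+
    have T: "test_function (\<lambda>p. \<tau> (fst p) *\<^sub>R \<eta> (snd p))"
      using supp by (intro test_function_tensor[OF C\<tau> _ \<eta>]) auto
    have dd: "dir_deriv (1, 0) (\<lambda>p. \<tau> (fst p) *\<^sub>R \<eta> (snd p)) (t, x) = \<tau>' t *\<^sub>R \<eta> x" for t x
    proof -
      have "C_k (Suc 0) \<eta>" using \<eta>(1) unfolding smooth_def by blast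
      note d\<eta> = C_k_has_derivative[OF this] and d0 = dir_deriv_zero[OF this]
      have "((\<lambda>p::real \<times> (real^'n). snd p) has_derivative snd) (at (t, x))" by (auto intro!: derivative_eq_intros)
      from has_derivative_compose[OF this] d\<eta>[of x]
      have 1: "((\<lambda>p. \<eta> (snd p)) has_derivative (\<lambda>v. dir_deriv (snd v) \<eta> x)) (at (t, x))" by simp
      have "((\<lambda>p::real \<times> (real^'n). fst p) has_derivative fst) (at (t, x))" by (auto intro!: derivative_eq_intros)
      from has_derivative_compose[OF this] D\<tau>[of t]
      have 2: "((\<lambda>p. \<tau> (fst p)) has_derivative (\<lambda>v. \<tau>' t * fst v)) (at (t, x))"
        unfolding has_field_derivative_def by simp
      show ?thesis
        using dir_deriv_eq[OF has_derivative_scaleR[OF 2 1], of "(1, 0)"] by (simp add: d0)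
    qed
    have "(LINT t|lborel. \<tau>' t *\<^sub>R (- \<i> * f t)) =
       (LINT t|lborel. LINT x|lborel. u t x * (- \<i> * dir_deriv (1, 0) (\<lambda>p. \<tau> (fst p) *\<^sub>R \<eta> (snd p)) (t, x)))"
    proof (rule Bochner_Integration.integral_cong[OF refl])
      fix t
      have "(LINT x|lborel. u t x * (- \<i> * dir_deriv (1, 0) (\<lambda>p. \<tau> (fst p) *\<^sub>R \<eta> (snd p)) (t, x)))
        = (LINT x|lborel. complex_of_real (\<tau>' t) * - \<i> * (u t x * \<eta> x))"
        unfolding dd by (intro Bochner_Integration.integral_cong refl) (simp add: scaleR_conv_of_real)
      also have "\<dots> = complex_of_real (\<tau>' t) * - \<i> * f t"
        unfolding f_def by (rule integral_mult_right_zero)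
      finally show "\<tau>' t *\<^sub>R (- \<i> * f t) = (LINT x|lborel. u t x * (- \<i> * dir_deriv (1, 0) (\<lambda>p. \<tau> (fst p) *\<^sub>R \<eta> (snd p)) (t, x)))"
        by (simp add: scaleR_conv_of_real)
    qed
    also have "\<dots> = (LINT t|lborel. LINT x|lborel. u t x * (- (1/2) * laplacian (\<lambda>y. \<tau> (fst (t, y)) *\<^sub>R \<eta> (snd (t, y))) x
       + complex_of_real (V t x) * (\<tau> (fst (t, x)) *\<^sub>R \<eta> (snd (t, x)))))"
      by (rule weak[OF T])
    also have "\<dots> = (LINT t|lborel. \<tau> t *\<^sub>R h t)"
    proof (rule Bochner_Integration.integral_cong[OF refl])
      fix t
      have "(LINT x|lborel. u t x * (- (1/2) * laplacian (\<lambda>y. \<tau> (fst (t, y)) *\<^sub>R \<eta> (snd (t, y))) x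
         + complex_of_real (V t x) * (\<tau> (fst (t, x)) *\<^sub>R \<eta> (snd (t, x)))))
        = (LINT x|lborel. complex_of_real (\<tau> t) * (u t x * \<zeta> t x))"
        unfolding fst_conv snd_conv laplacian_scaleR[OF \<eta>(1)] \<zeta>_def
        by (intro Bochner_Integration.integral_cong refl) (simp add: scaleR_conv_of_real algebra_simps)
      also have "\<dots> = complex_of_real (\<tau> t) * h t"
        unfolding h_def by (rule integral_mult_right_zero)
      finally show "(LINT x|lborel. u t x * (- (1/2) * laplacian (\<lambda>y. \<tau> (fst (t, y)) *\<^sub>R \<eta> (snd (t, y))) x
         + complex_of_real (V t x) * (\<tau> (fst (t, x)) *\<^sub>R \<eta> (snd (t, x))))) = \<tau> t *\<^sub>R h t"
        by (simp add: scaleR_conv_of_real)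
    qed
    finally have e1: "(LINT t|lborel. \<tau>' t *\<^sub>R (- \<i> * f t)) = (LINT t|lborel. \<tau> t *\<^sub>R h t)" .
    \<comment> \<open>R need not be nonnegative; this choice gives a genuine interval whose end
      points lie strictly outside the support, so the boundary terms vanish.\<close>
    define S where "S = \<bar>R\<bar> + 1"
    have "(LINT t|lborel. indicator {-S..S} t *\<^sub>R (\<tau> t *\<^sub>R h t + \<tau>' t *\<^sub>R H t)) = \<tau> S *\<^sub>R H S - \<tau> (-S) *\<^sub>R H (-S)"
    proof (rule integral_FTC_Icc)
      show "- S \<le> S" unfolding S_def by simp
      show "((\<lambda>t. \<tau> t *\<^sub>R H t) has_vector_derivative \<tau> t *\<^sub>R h t + \<tau>' t *\<^sub>R H t) (at t within {-S..S})" for t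
        by (intro has_vector_derivative_scaleR has_vector_derivative_at_within[OF H])
          (rule has_field_derivative_at_within[OF D\<tau>])
      show "continuous_on {-S..S} (\<lambda>t. \<tau> t *\<^sub>R h t + \<tau>' t *\<^sub>R H t)"
        by (rule continuous_on_subset[of UNIV])
          (auto intro!: continuous_intros cont\<tau> cont\<tau>' conth contH)
    qed
    moreover have "(\<lambda>t. indicator {-S..S} t *\<^sub>R (\<tau> t *\<^sub>R h t + \<tau>' t *\<^sub>R H t)) = (\<lambda>t. \<tau> t *\<^sub>R h t + \<tau>' t *\<^sub>R H t)"
    proof
      fix t
      show "indicator {-S..S} t *\<^sub>R (\<tau> t *\<^sub>R h t + \<tau>' t *\<^sub>R H t) = \<tau> t *\<^sub>R h t + \<tau>' t *\<^sub>R H t"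
      proof (cases "t \<in> {-S..S}")
        case False
        then have "\<bar>t\<bar> > R" unfolding S_def by auto
        then show ?thesis using supp by simp
      qed simp
    qed
    moreover have "\<tau> S = 0" "\<tau> (-S) = 0" using supp unfolding S_def by auto
    ultimately have "(LINT t|lborel. \<tau> t *\<^sub>R h t + \<tau>' t *\<^sub>R H t) = 0" by simp
    then have e2: "(LINT t|lborel. \<tau> t *\<^sub>R h t) + (LINT t|lborel. \<tau>' t *\<^sub>R H t) = 0"
      using Bochner_Integration.integral_add[OF int(2)[OF conth] int(1)[OF contH]] by simp
    have "(LINT t|lborel. \<tau>' t *\<^sub>R A t) = (LINT t|lborel. \<tau>' t *\<^sub>R H t + \<tau>' t *\<^sub>R (- \<i> * f t))"
      unfolding A_def by (simp add: algebra_simps)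
    also have "\<dots> = (LINT t|lborel. \<tau>' t *\<^sub>R H t) + (LINT t|lborel. \<tau>' t *\<^sub>R (- \<i> * f t))"
      by (rule Bochner_Integration.integral_add) (auto intro!: int contH contf continuous_intros)
    finally show "(LINT t|lborel. \<tau>' t *\<^sub>R A t) = 0" unfolding e1 using e2 by (simp only: add.commute)
  qed
  have f_eq: "f = (\<lambda>t. - \<i> * (H t - A 0))"
  proof
    fix t
    have "H t - \<i> * f t = A 0" using const[of t 0] unfolding A_def[of t] .
    then have "H t - A 0 = \<i> * f t" by (simp add: algebra_simps)
    then show "f t = - \<i> * (H t - A 0)" by (simp add: mult.assoc[symmetric])
  qed
  have "((\<lambda>t. - \<i> * (H t - A 0)) has_vector_derivative - \<i> * (h s - 0)) (at s)"
    by (intro has_vector_derivative_mult_right has_vector_derivative_diff H has_vector_derivative_const)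
  then show ?thesis unfolding f_eq[symmetric] unfolding f_def[abs_def] h_def \<zeta>_def by simp
qed

text \<open>The conjugated wave packet. The window is real, so its conjugation is invisible, and the
  overlap becomes a bilinear pairing of u with a compactly supported smooth function.\<close>

definition packet :: "(real^'n) \<times> (real^'n) \<Rightarrow> real^'n \<Rightarrow> complex"
  where "packet z y = bumpc (y - fst z) * cis (- (y \<bullet> snd z))"

lemma wave_packet_bumpc: "wave_packet bumpc f (fst z) (snd z) = (LINT y|lborel. f y * packet z y)"
  unfolding wave_packet_def packet_def by (simp add: mult_ac)

lemma smooth_packet: "smooth (packet z)"
  unfolding packet_def[abs_def] by (rule smooth_modulated[OF smooth_bump(2)])

lemma packet_zero: "norm y > norm (fst z) + 1 \<Longrightarrow> packet z y = 0"
proof -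
  assume "norm y > norm (fst z) + 1"
  then have "norm (y - fst z) \<ge> 1" using norm_triangle_ineq2[of y "fst z"] by linarith
  then show ?thesis unfolding packet_def bumpc_def by (simp add: bump_eq_0)
qed

lemma laplacian_packet:
  "laplacian (packet z) y = (laplacian bumpc (y - fst z) - 2 * \<i> * (\<Sum>j\<in>UNIV. complex_of_real (snd z $ j) * partial j bumpc (y - fst z))
      - complex_of_real ((norm (snd z))\<^sup>2) * bumpc (y - fst z)) * cis (- (y \<bullet> snd z))"
  unfolding packet_def[abs_def] by (rule laplacian_modulated[OF smooth_bump(2)])

text \<open>The time derivative of the packet when its centre obeys Hamilton's equations: the moving
  position differentiates the bump along \<xi>, the moving frequency contributes i y . grad
  V.\<close>

definition packet_dot :: "real \<Rightarrow> (real^'n) \<times> (real^'n) \<Rightarrow> real^'n \<Rightarrow> complex"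
  where "packet_dot s z y = (- (\<Sum>j\<in>UNIV. complex_of_real (snd z $ j) * partial j bumpc (y - fst z))
     + \<i> * complex_of_real (y \<bullet> grad s (fst z)) * bumpc (y - fst z)) * cis (- (y \<bullet> snd z))"

lemma packet_has_vector_derivative:
  assumes "(\<gamma> has_vector_derivative field s (\<gamma> s)) (at s)"
  shows "((\<lambda>r. packet (\<gamma> r) y) has_vector_derivative packet_dot s (\<gamma> s) y) (at s)"
proof -
  let ?x = "fst (\<gamma> s)" and ?\<xi> = "snd (\<gamma> s)"
  have fs: "((\<lambda>r. fst (\<gamma> r)) has_vector_derivative ?\<xi>) (at s)"
    using bounded_linear.has_vector_derivative[OF bounded_linear_fst assms] by (simp add: field_def)
  have sn: "((\<lambda>r. snd (\<gamma> r)) has_vector_derivative - grad s ?x) (at s)"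
    using bounded_linear.has_vector_derivative[OF bounded_linear_snd assms] by (simp add: field_def)
  have 1: "((\<lambda>r. bumpc (y - fst (\<gamma> r))) has_vector_derivative - (\<Sum>j\<in>UNIV. complex_of_real (?\<xi> $ j) * partial j bumpc (y - ?x))) (at s)"
  proof -
    have "((\<lambda>r. y - fst (\<gamma> r)) has_vector_derivative 0 - ?\<xi>) (at s)"
      by (intro has_vector_derivative_diff fs has_vector_derivative_const)
    from vector_derivative_diff_chain_within[OF this, of bumpc "\<lambda>v. dir_deriv v bumpc (y - ?x)"]
      C_k_has_derivative[OF C_k_bumpc[of "Suc 0"], of "y - ?x"]
    have "((\<lambda>r. bumpc (y - fst (\<gamma> r))) has_vector_derivative dir_deriv (0 - ?\<xi>) bumpc (y - ?x)) (at s)"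
      by (auto simp: o_def intro: has_derivative_at_withinI)
    then show ?thesis
      unfolding dir_deriv_eq_sum_partial[OF C_k_bumpc[of "Suc 0"]]
      by (simp add: scaleR_conv_of_real sum_negf)
  qed
  have 2: "((\<lambda>r. cis (- (y \<bullet> snd (\<gamma> r)))) has_vector_derivative \<i> * complex_of_real (y \<bullet> grad s ?x) * cis (- (y \<bullet> ?\<xi>))) (at s)"
  proof -
    have "((\<lambda>r. - (y \<bullet> snd (\<gamma> r))) has_vector_derivative - (y \<bullet> - grad s ?x)) (at s)"
      by (intro has_vector_derivative_minus bounded_linear.has_vector_derivative[OF bounded_linear_inner_right sn])
    from vector_diff_chain_at[OF this, of cis "\<i> * cis (- (y \<bullet> ?\<xi>))"] cis_has_vector_derivative[of 0 1 "- (y \<bullet> ?\<xi>)"]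
    show ?thesis by (simp add: o_def scaleR_conv_of_real mult_ac)
  qed
  have "((\<lambda>r. bumpc (y - fst (\<gamma> r)) * cis (- (y \<bullet> snd (\<gamma> r)))) has_vector_derivative
     bumpc (y - ?x) * (\<i> * complex_of_real (y \<bullet> grad s ?x) * cis (- (y \<bullet> ?\<xi>)))
     + (- (\<Sum>j\<in>UNIV. complex_of_real (?\<xi> $ j) * partial j bumpc (y - ?x))) * cis (- (y \<bullet> ?\<xi>))) (at s)"
    by (rule has_vector_derivative_mult[OF 1 2])
  then show ?thesis unfolding packet_def packet_dot_def
    by (simp add: algebra_simps)
qed

text \<open>The rate of the scalar phase, that is, the Hamiltonian minus x . grad V(x). The extra
  term is the constant part of grad V(x) . (y - x), whose y-dependent part is absorbed by the moving
  frequency.\<close>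

definition energy :: "real \<Rightarrow> (real^'n) \<times> (real^'n) \<Rightarrow> real"
  where "energy s z = (norm (snd z))\<^sup>2 / 2 + V s (fst z) - fst z \<bullet> grad s (fst z)"

text \<open>The transport terms cancel because the centre of the packet moves along the Hamiltonian flow;
  what is left is a scalar phase and a packet whose amplitude involves only second-order
  information about the potential.\<close>

lemma packet_identity:
  "- \<i> * (- (1/2) * laplacian (packet z) y + complex_of_real (V s y) * packet z y) + packet_dot s z y
    = - \<i> * complex_of_real (energy s z) * packet z y
      - \<i> * (cnj (packet_rem (s, fst z) (y - fst z)) * cis (- (y \<bullet> snd z)))"
proof -
  \<comment> \<open>With these abbreviations the claim is polynomial. S cancels between the
    Laplacian and \<open>packet_dot\<close>, and G matches the linear term inside the Taylor
    remainder.\<close>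
  define S where "S = (\<Sum>j\<in>UNIV. complex_of_real (snd z $ j) * partial j bumpc (y - fst z))"
  define L where "L = laplacian bumpc (y - fst z)"
  define b where "b = bumpc (y - fst z)"
  define c where "c = cis (- (y \<bullet> snd z))"
  define G where "G = complex_of_real (y \<bullet> grad s (fst z))"
  define N2 where "N2 = complex_of_real ((norm (snd z))\<^sup>2)"
  define xG where "xG = complex_of_real (fst z \<bullet> grad s (fst z))"
  have E: "complex_of_real (energy s z) = N2 / 2 + complex_of_real (V s (fst z)) - xG"
    unfolding energy_def N2_def xG_def by simp
  have "cnj (packet_rem (s, fst z) (y - fst z)) = - (1/2) * L + b * complex_of_real (taylor_rem s (fst z) (y - fst z))"
    unfolding packet_rem_def L_def b_def by (simp add: cnj_laplacian_bumpc)
  also have "taylor_rem s (fst z) (y - fst z) = V s y - V s (fst z) - (y \<bullet> grad s (fst z) - fst z \<bullet> grad s (fst z))"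
    unfolding taylor_rem_def
    by (simp add: inner_diff_right inner_commute[of "grad s (fst z)"])
  finally have R: "cnj (packet_rem (s, fst z) (y - fst z)) = - (1/2) * L + b * (complex_of_real (V s y) - complex_of_real (V s (fst z)) - (G - xG))"
    unfolding G_def xG_def by simp
  have ii: "\<i> * (\<i> * x) = - x" for x by (simp add: mult.assoc[symmetric])
  show ?thesis
    unfolding E R laplacian_packet packet_dot_def packet_def
    unfolding S_def[symmetric] L_def[symmetric] b_def[symmetric] c_def[symmetric] G_def[symmetric] N2_def[symmetric]
    by (simp add: algebra_simps ii)
qed

end

lemma L2_bounded_integrable:
  fixes f \<zeta> :: "'a::euclidean_space \<Rightarrow> complex"
  assumes "L2_function f" "\<zeta> \<in> borel_measurable borel" "\<And>y. cmod (\<zeta> y) \<le> M * indicat_real (cball 0 \<rho>) y"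
  shows "integrable lborel (\<lambda>y. f y * \<zeta> y)"
proof -
  obtain A where A: "A \<ge> 0" "(\<integral>\<^sup>+x. ennreal (cmod (f x)) ^ 2 \<partial>lborel) = ennreal A"
    using L2_functionD(2)[OF assms(1)] by (cases "\<integral>\<^sup>+x. ennreal (cmod (f x)) ^ 2 \<partial>lborel") auto
  show ?thesis
    by (rule L2_Cauchy_Schwarz(2)[OF L2_functionD(1)[OF assms(1)] assms(2) _ A(1) indicator_L2[OF assms(3)]])
      (use A in auto)
qed

lemma L2_continuous_compact_integrable:
  fixes f \<zeta> :: "'a::euclidean_space \<Rightarrow> complex"
  assumes "L2_function f" "continuous_on UNIV \<zeta>" "\<And>y. norm y > \<rho> \<Longrightarrow> \<zeta> y = 0"
  shows "integrable lborel (\<lambda>y. f y * \<zeta> y)"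
proof -
  obtain M where "\<And>y. cmod (\<zeta> y) \<le> M * indicat_real (cball 0 \<rho>) y"
    using bounded_compact_support[OF assms(2,3)] by metis
  then show ?thesis
    by (intro L2_bounded_integrable[OF assms(1)] borel_measurable_continuous_onI assms(2))
qed

context subquadratic_potential
begin

definition is_weak_solution :: "(real \<Rightarrow> real^'n \<Rightarrow> complex) \<Rightarrow> bool"
  where "is_weak_solution u \<longleftrightarrow> continuous_L2 u \<and>
    (\<forall>\<psi> :: real \<times> (real^'n) \<Rightarrow> complex. test_function \<psi> \<longrightarrow>
      (LINT t|lborel. LINT x|lborel. u t x * (- \<i> * dir_deriv (1, 0) \<psi> (t, x))) =
      (LINT t|lborel. LINT x|lborel.
         u t x * (- (1/2) * laplacian (\<lambda>y. \<psi> (t, y)) x + complex_of_real (V t x) * \<psi> (t, x))))"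

text \<open>The overlap is the pairing of u(r) with the packet frozen at time s plus r - s times a
  pairing with the difference quotient of the packet. The weak equation differentiates the former,
  continuity of Q at s the latter, and \<open>packet_identity\<close> collects the result.\<close>

lemma overlap_has_vector_derivative:
  assumes sol: "is_weak_solution u" and \<gamma>: "(\<gamma> has_vector_derivative field s (\<gamma> s)) (at s)"
  shows "((\<lambda>r. wave_packet bumpc (u r) (fst (\<gamma> r)) (snd (\<gamma> r))) has_vector_derivative
     - \<i> * complex_of_real (energy s (\<gamma> s)) * wave_packet bumpc (u s) (fst (\<gamma> s)) (snd (\<gamma> s))
     - \<i> * wave_packet (packet_rem (s, fst (\<gamma> s))) (u s) (fst (\<gamma> s)) (snd (\<gamma> s))) (at s)"
proof -
  have u: "continuous_L2 u" using sol unfolding is_weak_solution_def by blast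
  have uL2: "L2_function (u r)" for r using u unfolding continuous_L2_def by blast
  have cp: "continuous_on UNIV (packet z)" for z
    using smooth_packet unfolding smooth_def by (blast intro: C_k_continuous)
  have [measurable]: "packet z \<in> borel_measurable borel" for z
    using cp by (rule borel_measurable_continuous_onI)
  have intp: "integrable lborel (\<lambda>y. u r y * packet z y)" for r z
    by (rule L2_continuous_compact_integrable[OF uL2 cp packet_zero])
  let ?z = "\<gamma> s"
  \<comment> \<open>One unit is the radius of the bump, the other allows the centre to move by less
    than 1, so nearby packets all vanish outside this ball.\<close>
  define \<rho> where "\<rho> = norm (fst ?z) + 2"
  \<comment> \<open>The value at r = s is the limit of the quotients, which makes Q continuous
    there.\<close>
  define \<zeta> where "\<zeta> r y = (if r = s then packet_dot s ?z y else (packet (\<gamma> r) y - packet ?z y) /\<^sub>R (r - s))" for r y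
  define Q where "Q r = (LINT y|lborel. u r y * \<zeta> r y)" for r
  have cd: "continuous_on UNIV (packet_dot s ?z)"
  proof -
    have 1: "continuous_on UNIV (\<lambda>y. partial j bumpc (y - fst ?z))" for j
      using smooth_partial[OF smooth_bump(2), of j] unfolding smooth_def
      by (blast intro: C_k_continuous[OF C_k_translate])
    have 2: "continuous_on UNIV (\<lambda>y. bumpc (y - fst ?z))"
      by (rule C_k_continuous[OF C_k_translate[OF C_k_bumpc]])
    show ?thesis unfolding packet_dot_def[abs_def] by (intro continuous_intros 1 2)
  qed
  have [measurable]: "\<zeta> r \<in> borel_measurable borel" for r
    unfolding \<zeta>_def[abs_def] using cd by (cases "r = s") (auto intro: borel_measurable_continuous_onI)
  obtain B where B: "B > 0" "\<And>x y. cmod (bumpc x - bumpc (y::real^'n)) \<le> B * norm (x - y)" "\<And>y::real^'n. cmod (bumpc y) \<le> B"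
    using bumpc_lipschitz by blast
  define K where "K = norm (field s ?z) + 1"
  have K: "K > 0" unfolding K_def by (simp add: add_nonneg_pos)
  have lip: "cmod (packet w y - packet z y) \<le> (B + B * \<rho>) * norm (w - z)" if "norm y \<le> \<rho>" for w z y
  proof -
    have f: "norm (fst w - fst z) \<le> norm (w - z)" by (cases w; cases z) (simp add: norm_fst_le)
    have g: "norm (snd w - snd z) \<le> norm (w - z)" by (cases w; cases z) (simp add: norm_snd_le)
    have "packet w y - packet z y = (bumpc (y - fst w) - bumpc (y - fst z)) * cis (- (y \<bullet> snd w))
       + bumpc (y - fst z) * (cis (- (y \<bullet> snd w)) - cis (- (y \<bullet> snd z)))"
      unfolding packet_def by (simp add: algebra_simps)
    also have "cmod \<dots> \<le> cmod (bumpc (y - fst w) - bumpc (y - fst z)) + cmod (bumpc (y - fst z)) * cmod (cis (- (y \<bullet> snd w)) - cis (- (y \<bullet> snd z)))"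
      by (rule order_trans[OF norm_triangle_ineq]) (simp add: norm_mult)
    also have "\<dots> \<le> B * norm (w - z) + B * (\<rho> * norm (w - z))"
    proof (intro add_mono mult_mono B(3))
      have "cmod (bumpc (y - fst w) - bumpc (y - fst z)) \<le> B * norm (fst w - fst z)"
        using B(2)[of "y - fst w" "y - fst z"] by (simp add: norm_minus_commute)
      also have "\<dots> \<le> B * norm (w - z)" using f B(1) by (intro mult_left_mono) auto
      finally show "cmod (bumpc (y - fst w) - bumpc (y - fst z)) \<le> B * norm (w - z)" .
      have "cmod (cis (- (y \<bullet> snd w)) - cis (- (y \<bullet> snd z))) \<le> \<bar>y \<bullet> (snd w - snd z)\<bar>"
        using cis_diff_le[of "- (y \<bullet> snd w)" "- (y \<bullet> snd z)"] by (simp add: inner_diff_right)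
      also have "\<dots> \<le> norm y * norm (snd w - snd z)" by (rule Cauchy_Schwarz_ineq2)
      also have "\<dots> \<le> \<rho> * norm (w - z)" using that g by (intro mult_mono) (auto intro: order_trans[OF norm_ge_zero])
      finally show "cmod (cis (- (y \<bullet> snd w)) - cis (- (y \<bullet> snd z))) \<le> \<rho> * norm (w - z)" .
    qed (use B(1) in auto)
    finally show ?thesis by (simp add: algebra_simps)
  qed
  define M where "M = (B + B * \<rho>) * K"
  have BM: "B + B * \<rho> \<ge> 0" unfolding \<rho>_def using B(1) by simp
  have "(\<gamma> \<longlongrightarrow> ?z) (at s)"
    using has_vector_derivative_continuous[OF \<gamma>] by (simp add: isCont_def)
  from tendstoD[OF this, of 1] have near: "\<forall>\<^sub>F r in at s. dist (\<gamma> r) ?z < 1" by simp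
  have bnd: "\<forall>\<^sub>F r in at s. \<forall>y. cmod (\<zeta> r y) \<le> M * indicat_real (cball 0 \<rho>) y"
  proof -
    have ne: "\<forall>\<^sub>F r in at s. r \<noteq> s" by (simp add: eventually_at_filter)
    show ?thesis using near vector_derivative_lipschitz_at[OF \<gamma>] ne
    proof eventually_elim
      case (elim r)
      show ?case
      proof
        fix y :: "real^'n"
        show "cmod (\<zeta> r y) \<le> M * indicat_real (cball 0 \<rho>) y"
        proof (cases "norm y \<le> \<rho>")
          case True
          have "cmod (\<zeta> r y) = cmod (packet (\<gamma> r) y - packet ?z y) / \<bar>r - s\<bar>"
            unfolding \<zeta>_def using elim by (simp add: divide_inverse mult.commute)
          also have "\<dots> \<le> ((B + B * \<rho>) * (K * \<bar>r - s\<bar>)) / \<bar>r - s\<bar>"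
            using lip[OF True, of "\<gamma> r" ?z] mult_left_mono[OF elim(2)[folded K_def] BM]
            by (intro divide_right_mono) auto
          also have "\<dots> = M" unfolding M_def using elim by simp
          finally show ?thesis using True by simp
        next
          case False
          have "norm (fst (\<gamma> r)) \<le> norm (fst ?z) + norm (fst (\<gamma> r) - fst ?z)" by (simp add: norm_triangle_sub)
          moreover have "norm (fst (\<gamma> r) - fst ?z) \<le> dist (\<gamma> r) ?z"
            by (cases "\<gamma> r"; cases ?z) (simp add: norm_fst_le dist_norm)
          ultimately have "norm y > norm (fst (\<gamma> r)) + 1" using False elim(1) unfolding \<rho>_def by linarith
          moreover have "norm y > norm (fst ?z) + 1" using False unfolding \<rho>_def by linarith
          ultimately show ?thesis unfolding \<zeta>_def using elim False by (simp add: packet_zero)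
        qed
      qed
    qed
  qed
  have lim: "((\<lambda>r. \<zeta> r y) \<longlongrightarrow> \<zeta> s y) (at s)" for y
  proof -
    have "((\<lambda>r. (packet (\<gamma> r) y - packet ?z y) /\<^sub>R (r - s)) \<longlongrightarrow> packet_dot s ?z y) (at s)"
      by (rule vector_derivative_quotient[OF packet_has_vector_derivative[OF \<gamma>]])
    moreover have "\<forall>\<^sub>F r in at s. (packet (\<gamma> r) y - packet ?z y) /\<^sub>R (r - s) = \<zeta> r y"
      unfolding eventually_at_filter by (intro always_eventually) (simp add: \<zeta>_def)
    ultimately have "((\<lambda>r. \<zeta> r y) \<longlongrightarrow> packet_dot s ?z y) (at s)"
      by (rule Lim_transform_eventually)
    then show ?thesis by (simp add: \<zeta>_def)
  qed
  \<comment> \<open>The majorant passes to r = s by taking the pointwise limit of the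
    quotients.\<close>
  have bnd0: "cmod (\<zeta> s y) \<le> M * indicat_real (cball 0 \<rho>) y" for y
  proof (rule tendsto_upperbound[OF tendsto_norm[OF lim]])
    show "\<forall>\<^sub>F r in at s. cmod (\<zeta> r y) \<le> M * indicat_real (cball 0 \<rho>) y"
      using bnd by eventually_elim blast
  qed simp
  have "(Q \<longlongrightarrow> Q s) (at s)"
    unfolding Q_def by (rule weak_L2_limit[OF u _ bnd bnd0 lim]) measurable
  then have Q: "((\<lambda>r. (r - s) *\<^sub>R Q r) has_vector_derivative Q s) (at s)"
    by (rule has_vector_derivative_factor)
  have split: "wave_packet bumpc (u r) (fst (\<gamma> r)) (snd (\<gamma> r)) = (LINT y|lborel. u r y * packet ?z y) + (r - s) *\<^sub>R Q r" for r
  proof (cases "r = s")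
    case False
    have "(r - s) *\<^sub>R Q r = (LINT y|lborel. (r - s) *\<^sub>R (u r y * \<zeta> r y))" unfolding Q_def by simp
    also have "\<dots> = (LINT y|lborel. u r y * packet (\<gamma> r) y - u r y * packet ?z y)"
      using False by (intro Bochner_Integration.integral_cong refl)
        (simp add: \<zeta>_def scaleR_conv_of_real right_diff_distrib[symmetric])
    also have "\<dots> = (LINT y|lborel. u r y * packet (\<gamma> r) y) - (LINT y|lborel. u r y * packet ?z y)"
      by (rule Bochner_Integration.integral_diff[OF intp intp])
    finally show ?thesis unfolding wave_packet_bumpc by simp
  qed (simp add: wave_packet_bumpc)
  define D where "D y = - (1/2) * laplacian (packet ?z) y + complex_of_real (V s y) * packet ?z y" for y
  define R where "R y = cnj (packet_rem (s, fst ?z) (y - fst ?z)) * cis (- (y \<bullet> snd ?z))" for y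
  have D1: "((\<lambda>r. LINT y|lborel. u r y * packet ?z y) has_vector_derivative - \<i> * (LINT y|lborel. u s y * D y)) (at s)"
    unfolding D_def using sol unfolding is_weak_solution_def
    by (intro weak_derivative[OF _ _ smooth_packet packet_zero]) auto
  have intD: "integrable lborel (\<lambda>y. u s y * D y)"
  proof (rule L2_continuous_compact_integrable[OF uL2, where \<rho> = "norm (fst ?z) + 1"])
    have "continuous_on UNIV (laplacian (packet ?z))"
      using smooth_laplacian[OF smooth_packet] unfolding smooth_def by (blast intro: C_k_continuous)
    then show "continuous_on UNIV D"
      unfolding D_def[abs_def] by (intro continuous_intros C_k_continuous[OF C_k_V] cp)
    show "D y = 0" if "norm y > norm (fst ?z) + 1" for y
      unfolding D_def using packet_zero[OF that] laplacian_zero_outside[OF packet_zero that] by simp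
  qed
  have intd: "integrable lborel (\<lambda>y. u s y * packet_dot s ?z y)"
    using bnd0 cd by (intro L2_bounded_integrable[OF uL2]) (auto simp: \<zeta>_def intro: borel_measurable_continuous_onI)
  have ident: "- \<i> * D y + packet_dot s ?z y = - \<i> * complex_of_real (energy s ?z) * packet ?z y - \<i> * R y" for y
    unfolding D_def R_def by (rule packet_identity)
  \<comment> \<open>Solving the identity for R makes its pairing with u integrable as a combination
    of pairings already known to be integrable.\<close>
  have R_eq: "R y = D y + \<i> * packet_dot s ?z y - complex_of_real (energy s ?z) * packet ?z y" for y
  proof -
    have "\<i> * (- \<i> * D y + packet_dot s ?z y) = \<i> * (- \<i> * complex_of_real (energy s ?z) * packet ?z y - \<i> * R y)"
      unfolding ident ..
    then have "D y + \<i> * packet_dot s ?z y = complex_of_real (energy s ?z) * packet ?z y + R y"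
      by (simp add: right_diff_distrib distrib_left mult.assoc[symmetric] add.commute)
    then show ?thesis by (simp add: algebra_simps)
  qed
  have intR: "integrable lborel (\<lambda>y. u s y * R y)"
  proof -
    have "integrable lborel (\<lambda>y. u s y * D y + \<i> * (u s y * packet_dot s ?z y) - complex_of_real (energy s ?z) * (u s y * packet ?z y))"
      by (intro Bochner_Integration.integrable_add Bochner_Integration.integrable_diff integrable_mult_right intD intd intp)
    then show ?thesis unfolding R_eq by (simp add: algebra_simps)
  qed
  have "- \<i> * (LINT y|lborel. u s y * D y) + Q s = (LINT y|lborel. - \<i> * (u s y * D y) + u s y * packet_dot s ?z y)"
    unfolding Q_def \<zeta>_def using Bochner_Integration.integral_add[OF integrable_mult_right[OF intD, of "- \<i>"] intd] by simp
  also have "\<dots> = (LINT y|lborel. (- \<i> * complex_of_real (energy s ?z)) * (u s y * packet ?z y) - \<i> * (u s y * R y))"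
  proof (rule Bochner_Integration.integral_cong[OF refl])
    fix y
    have "- \<i> * (u s y * D y) + u s y * packet_dot s ?z y = u s y * (- \<i> * D y + packet_dot s ?z y)"
      by (simp add: algebra_simps)
    also have "\<dots> = (- \<i> * complex_of_real (energy s ?z)) * (u s y * packet ?z y) - \<i> * (u s y * R y)"
      unfolding ident by (simp add: algebra_simps)
    finally show "- \<i> * (u s y * D y) + u s y * packet_dot s ?z y = (- \<i> * complex_of_real (energy s ?z)) * (u s y * packet ?z y) - \<i> * (u s y * R y)" .
  qed
  also have "\<dots> = (- \<i> * complex_of_real (energy s ?z)) * (LINT y|lborel. u s y * packet ?z y) - \<i> * (LINT y|lborel. u s y * R y)"
    by (subst Bochner_Integration.integral_diff[OF integrable_mult_right[OF intp] integrable_mult_right[OF intR]])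
      (simp only: integral_mult_right_zero)
  also have "(LINT y|lborel. u s y * R y) = wave_packet (packet_rem (s, fst ?z)) (u s) (fst ?z) (snd ?z)"
    unfolding wave_packet_def R_def by (simp add: mult_ac)
  finally have "- \<i> * (LINT y|lborel. u s y * D y) + Q s = - \<i> * complex_of_real (energy s ?z) * wave_packet bumpc (u s) (fst ?z) (snd ?z)
     - \<i> * wave_packet (packet_rem (s, fst ?z)) (u s) (fst ?z) (snd ?z)"
    unfolding wave_packet_bumpc .
  then show ?thesis
    unfolding split using has_vector_derivative_add[OF D1 Q] by (simp only: wave_packet_bumpc)
qed

text \<open>The phase rate is real, so the integrating factor \<open>cis (primitive c r)\<close> is
  unimodular and removes that term without changing absolute values. What remains is the integral of
  the remainder overlap, estimated with the weight exp(lam |s|).\<close>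

lemma duhamel_bound:
  assumes sol: "is_weak_solution u" and t: "t \<in> {-T..T}"
    and \<gamma>: "\<And>s. s \<in> {-T..T} \<Longrightarrow> (\<gamma> has_vector_derivative field s (\<gamma> s)) (at s)"
    and lam: "lam > 0"
    and bnd: "\<And>s. s \<in> closed_segment 0 t \<Longrightarrow>
      cmod (wave_packet (packet_rem (s, fst (\<gamma> s))) (u s) (fst (\<gamma> s)) (snd (\<gamma> s))) \<le> K * exp (lam * \<bar>s\<bar>)"
  shows "cmod (wave_packet bumpc (u t) (fst (\<gamma> t)) (snd (\<gamma> t))) \<le>
    cmod (wave_packet bumpc (u 0) (fst (\<gamma> 0)) (snd (\<gamma> 0))) + K / lam * exp (lam * \<bar>t\<bar>)"
proof -
  have T: "T \<ge> 0" using t by auto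
  \<comment> \<open>The curve is controlled only on [-T, T], whereas \<open>primitive\<close>
    requires an integrand continuous on the whole line.\<close>
  define cl where "cl r = max (- T) (min T r)" for r :: real
  have cl_in: "cl r \<in> {-T..T}" for r unfolding cl_def using T by auto
  define c where "c r = energy (cl r) (\<gamma> (cl r))" for r
  have cont\<gamma>: "continuous_on {-T..T} \<gamma>"
    using \<gamma> by (meson continuous_at_imp_continuous_on has_vector_derivative_continuous)
  have cont_cl: "continuous_on UNIV cl" unfolding cl_def[abs_def] by (intro continuous_intros)
  have c1: "continuous_on UNIV (\<lambda>r. \<gamma> (cl r))"
    by (rule continuous_on_compose2[OF cont\<gamma> cont_cl]) (use cl_in in auto)
  have "continuous_on UNIV (\<lambda>r. (\<lambda>(t, x). V t x) (cl r, fst (\<gamma> (cl r))))"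
    by (rule continuous_on_compose2[OF continuous_on_V]) (auto intro!: continuous_intros c1 cont_cl)
  then have c2: "continuous_on UNIV (\<lambda>r. V (cl r) (fst (\<gamma> (cl r))))" by simp
  have "continuous_on UNIV (\<lambda>r. (\<lambda>(t, x). grad t x) (cl r, fst (\<gamma> (cl r))))"
    by (rule continuous_on_compose2[OF continuous_on_grad]) (auto intro!: continuous_intros c1 cont_cl)
  then have c3: "continuous_on UNIV (\<lambda>r. grad (cl r) (fst (\<gamma> (cl r))))" by simp
  have contc: "continuous_on UNIV c"
    unfolding c_def[abs_def] energy_def by (intro continuous_intros c1 c2 c3) auto
  let ?F = "\<lambda>r. wave_packet bumpc (u r) (fst (\<gamma> r)) (snd (\<gamma> r))"
  let ?W = "\<lambda>r. wave_packet (packet_rem (r, fst (\<gamma> r))) (u r) (fst (\<gamma> r)) (snd (\<gamma> r))"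
  define g where "g r = cis (primitive c r) * ?F r" for r
  have seg: "s \<in> {-T..T}" if "s \<in> closed_segment 0 t" for s
    using that t by (auto simp: closed_segment_eq_real_ivl split: if_splits)
  have g': "(g has_vector_derivative cis (primitive c s) * (- \<i> * ?W s)) (at s)" if "s \<in> closed_segment 0 t" for s
  proof -
    have s: "s \<in> {-T..T}" by (rule seg[OF that])
    have "cl s = s" using s unfolding cl_def by auto
    then have cs: "c s = energy s (\<gamma> s)" unfolding c_def by simp
    have "(primitive c has_vector_derivative c s) (at s)" by (rule primitive_has_vector_derivative[OF contc])
    from vector_diff_chain_at[OF this, of cis "\<i> * cis (primitive c s)"] cis_has_vector_derivative[of 0 1 "primitive c s"]
    have 1: "((\<lambda>r. cis (primitive c r)) has_vector_derivative c s *\<^sub>R (\<i> * cis (primitive c s))) (at s)"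
      by (simp add: o_def)
    from has_vector_derivative_mult[OF 1 overlap_has_vector_derivative[OF sol \<gamma>[OF s]]]
    show ?thesis unfolding g_def[abs_def] cs by (simp add: algebra_simps scaleR_conv_of_real)
  qed
  have "norm (g t - g 0) \<le> K / lam * exp (lam * \<bar>t\<bar>)"
    by (rule exp_weighted_bound[OF lam g']) (use bnd in \<open>auto simp: norm_mult\<close>)
  moreover have "norm (g t) \<le> norm (g 0) + norm (g t - g 0)" using norm_triangle_sub by blast
  ultimately show ?thesis unfolding g_def by (simp add: norm_mult)
qed

end

section \<open>Kernel estimates along the flow\<close>

abbreviation ambiguity :: "(real^'n::finite \<Rightarrow> complex) \<Rightarrow> (real^'n \<Rightarrow> complex) \<Rightarrow> (real^'n) \<times> (real^'n) \<Rightarrow> ennreal"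
  where "ambiguity \<psi> f z \<equiv> ennreal (cmod (wave_packet \<psi> f (fst z) (snd z)))"

text \<open>The mass of w at v is moved to \<Phi> v before it is spread by the kernel; with the
  identity for \<Phi> this is convolution with the kernel.\<close>

definition smear :: "nat \<Rightarrow> ('a \<Rightarrow> 'a) \<Rightarrow> ('a \<Rightarrow> ennreal) \<Rightarrow> 'a::euclidean_space \<Rightarrow> ennreal"
  where "smear N \<Phi> w z = (\<integral>\<^sup>+v. ennreal (kern N (z - \<Phi> v)) * w v \<partial>lborel)"

lemma borel_measurable_smear [measurable]:
  assumes [measurable]: "\<Phi> \<in> borel_measurable borel" "w \<in> borel_measurable borel"
  shows "smear N \<Phi> w \<in> borel_measurable borel"
proof -
  have "(\<lambda>(z, v). ennreal (kern N (z - \<Phi> v)) * w v) \<in> borel_measurable (borel \<Otimes>\<^sub>M lborel)" by measurable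
  then show ?thesis unfolding smear_def[abs_def] by (intro lborel.borel_measurable_nn_integral)
qed

text \<open>Tonelli brings the two kernels together and \<open>nn_integral_kern_conv\<close> merges
  them, so a further convolution costs only a constant.\<close>

lemma smear_smear:
  fixes z :: "'a::euclidean_space"
  assumes N: "2 * DIM('a) \<le> N" and [measurable]: "\<Phi> \<in> borel_measurable borel" "w \<in> borel_measurable borel"
  shows "smear N (\<lambda>x. x) (smear N \<Phi> w) z \<le> ennreal (2 ^ (N + 1) * kern_mass N TYPE('a)) * smear N \<Phi> w z"
proof -
  have "smear N (\<lambda>x. x) (smear N \<Phi> w) z =
     (\<integral>\<^sup>+x. \<integral>\<^sup>+v. ennreal (kern N (z - x)) * (ennreal (kern N (x - \<Phi> v)) * w v) \<partial>lborel \<partial>lborel)"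
    unfolding smear_def by (intro nn_integral_cong nn_integral_cmult[symmetric]) measurable
  also have "\<dots> = (\<integral>\<^sup>+v. \<integral>\<^sup>+x. ennreal (kern N (z - x)) * (ennreal (kern N (x - \<Phi> v)) * w v) \<partial>lborel \<partial>lborel)"
    by (rule lborel_pair.Fubini') measurable
  also have "\<dots> = (\<integral>\<^sup>+v. (\<integral>\<^sup>+x. ennreal (kern N (z - x)) * ennreal (kern N (x - \<Phi> v)) \<partial>lborel) * w v \<partial>lborel)"
    by (intro nn_integral_cong) (simp add: nn_integral_multc mult.assoc[symmetric])
  also have "\<dots> \<le> (\<integral>\<^sup>+v. (ennreal (2 ^ (N + 1) * kern_mass N TYPE('a)) * ennreal (kern N (z - \<Phi> v))) * w v \<partial>lborel)"
    by (intro nn_integral_mono mult_right_mono nn_integral_kern_conv N) auto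
  also have "\<dots> = ennreal (2 ^ (N + 1) * kern_mass N TYPE('a)) * smear N \<Phi> w z"
    unfolding smear_def by (simp add: mult.assoc nn_integral_cmult)
  finally show ?thesis .
qed

text \<open>The estimate is carried from one time to another along a trajectory: if the distances to
  the transported points are comparable, so are the smeared values, up to L^N.\<close>

lemma smear_scale:
  assumes "\<And>v. norm (b - \<Psi> v) \<le> L * norm (a - \<Phi> v)" "L \<ge> 1" and [measurable]: "\<Psi> \<in> borel_measurable borel" "w \<in> borel_measurable borel"
  shows "smear N \<Phi> w a \<le> ennreal (L ^ N) * smear N \<Psi> w b"
proof -
  have "smear N \<Phi> w a \<le> (\<integral>\<^sup>+v. ennreal (L ^ N) * (ennreal (kern N (b - \<Psi> v)) * w v) \<partial>lborel)"
    unfolding smear_def mult.assoc[symmetric]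
    using kern_scale[OF assms(1,2), of N] assms(2)
    by (intro nn_integral_mono mult_right_mono) (auto simp: ennreal_mult[symmetric] intro!: ennreal_leI)
  also have "\<dots> = ennreal (L ^ N) * smear N \<Psi> w b" unfolding smear_def by (rule nn_integral_cmult) measurable
  finally show ?thesis .
qed

lemma ennreal_divide_cancel_le:
  assumes "ennreal (a * x) \<le> ennreal C * I" "a > 0" "C \<ge> 0" "x \<ge> 0"
  shows "ennreal x \<le> ennreal (C / a) * I"
proof -
  have "ennreal x = ennreal (1 / a) * ennreal (a * x)"
    using assms by (simp add: ennreal_mult[symmetric])
  also have "\<dots> \<le> ennreal (1 / a) * (ennreal C * I)" by (intro mult_left_mono assms(1)) auto
  also have "\<dots> = ennreal (C / a) * I" using assms by (simp add: mult.assoc[symmetric] ennreal_mult[symmetric])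
  finally show ?thesis .
qed

text \<open>The normalising factor is positive because \<psi> is continuous and nonzero at some
  point; dividing by it gives a constant uniform in p and u.\<close>

lemma change_window:
  fixes \<psi> :: "real^'n::finite \<Rightarrow> complex" and r :: "'p \<Rightarrow> real^'n \<Rightarrow> complex"
  assumes \<psi>: "decays UNIV (\<lambda>_::unit. \<psi>)" "\<psi> x0 \<noteq> 0"
    and r: "\<And>p. p \<in> P \<Longrightarrow> continuous_on UNIV (r p)" "\<And>p y. p \<in> P \<Longrightarrow> cmod (r p y) \<le> B"
    and W: "\<And>p x \<xi>. p \<in> P \<Longrightarrow> cmod (wave_packet \<psi> (r p) x \<xi>) \<le> C * kern N (x, \<xi>)" "C > 0"
    and N: "4 * CARD('n) \<le> N"
  shows "\<exists>C>0. \<forall>p\<in>P. \<forall>u z. L2_function u \<longrightarrow>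
     ambiguity (r p) u z \<le> ennreal C * smear N (\<lambda>x. x) (ambiguity \<psi> u) z"
proof -
  define a where "a = inv_const TYPE('n) * (LINT y|lborel. (cmod (\<psi> y))\<^sup>2)"
  have "continuous_on UNIV \<psi>" using decays_cont[OF \<psi>(1)] by blast
  then have "(LINT y|lborel. (cmod (\<psi> y))\<^sup>2) > 0"
    by (intro integral_pos_continuous[OF _ decays_square(1)[OF \<psi>(1)], of x0] continuous_intros)
      (use \<psi>(2) in auto)
  then have a: "a > 0" unfolding a_def using inv_const_pos[where 'n='n] by simp
  have "ambiguity (r p) u z \<le> ennreal (C / a) * smear N (\<lambda>x. x) (ambiguity \<psi> u) z"
    if p: "p \<in> P" and u: "L2_function u" for p u z
  proof (rule ennreal_divide_cancel_le[OF _ a])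
    show "ennreal (a * cmod (wave_packet (r p) u (fst z) (snd z))) \<le> ennreal C * smear N (\<lambda>x. x) (ambiguity \<psi> u) z"
      using wave_packet_change_window[OF \<psi>(1) r(1)[OF p] r(2)[OF p] W(1)[OF p] N L2_functionD[OF u], of "fst z" "snd z"]
      unfolding a_def smear_def by simp
  qed (use W(2) in auto)
  then show ?thesis using W(2) a by (intro exI[of _ "C / a"]) simp
qed

context subquadratic_potential
begin

lemma packet_rem_change_window:
  assumes N: "4 * CARD('n) \<le> N"
  shows "\<exists>C>0. \<forall>p u z. L2_function u \<longrightarrow>
     ambiguity (packet_rem p) u z \<le> ennreal C * smear N (\<lambda>x. x) (ambiguity bumpc u) z"
proof -
  obtain C where C: "C > 0" "\<And>p x \<xi>. cmod (wave_packet bumpc (packet_rem p) x \<xi>) \<le> C * kern N (x, \<xi>)"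
    using wave_packet_decay[OF RD_bumpc RD_packet_rem, of N] by (metis UNIV_I)
  have c: "continuous_on UNIV (packet_rem p)" for p
    using decays_cont[OF RD_decays[OF RD_packet_rem]] by blast
  have "\<exists>B. \<forall>p y. cmod (packet_rem p y) \<le> B"
    by (rule decaysD[OF RD_decays[OF RD_packet_rem], of 0]) auto
  then obtain B where B: "\<And>p y. cmod (packet_rem p y) \<le> B" by blast
  have "bump (0 :: real^'n) > 0" by (rule bump_0)
  then have "bumpc (0 :: real^'n) \<noteq> 0" unfolding bumpc_def by simp
  from change_window[where r = packet_rem and P = UNIV, OF RD_decays[OF RD_bumpc] this c B C(2,1) N]
  show ?thesis by blast
qed

text \<open>A crude bound by Cauchy-Schwarz, using that modulation and translation do not change the
  norm of the window. It is not related to the initial data and only starts the bootstrap.\<close>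

lemma overlap_bounded:
  fixes u :: "real \<Rightarrow> real^'n \<Rightarrow> complex"
  assumes "continuous_L2 u"
  obtains B where "B > 0" "\<And>t z. t \<in> {-T..T} \<Longrightarrow> cmod (wave_packet bumpc (u t) (fst z) (snd z)) \<le> B"
proof -
  obtain A where A: "A \<ge> 0" "\<And>t. t \<in> {-T..T} \<Longrightarrow> (\<integral>\<^sup>+x. ennreal (cmod (u t x)) ^ 2 \<partial>lborel) \<le> ennreal A"
    using L2_integral_bound_compact[OF assms] by metis
  have db: "decays UNIV (\<lambda>_::unit. bumpc :: real^'n \<Rightarrow> complex)" using RD_decays[OF RD_bumpc] .
  define I where "I = (LINT y|lborel. (cmod (bumpc (y::real^'n)))\<^sup>2)"
  have I0: "0 \<le> I" unfolding I_def by simp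
  have "cmod (wave_packet bumpc (u t) (fst z) (snd z)) \<le> sqrt (A * I) + 1"
    if t: "t \<in> {-T..T}" for t and z :: "(real^'n) \<times> (real^'n)"
  proof -
    have m: "u t \<in> borel_measurable borel" using assms L2_functionD(1) unfolding continuous_L2_def by blast
    have m': "packet z \<in> borel_measurable borel"
      using smooth_packet unfolding smooth_def by (blast intro: C_k_continuous borel_measurable_continuous_onI)
    have "(\<integral>\<^sup>+y. ennreal (cmod (packet z y)) ^ 2 \<partial>lborel) \<le> ennreal I"
      using decays_square(2)[OF db, of "fst z"] unfolding packet_def I_def by (simp add: norm_mult)
    from L2_Cauchy_Schwarz(3)[OF m m' A(2)[OF t] A(1) this I0]
    show ?thesis unfolding wave_packet_bumpc by simp
  qed
  then show ?thesis using that[of "sqrt (A * I) + 1"] A(1) I0 by (simp add: add_nonneg_pos)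
qed

text \<open>The trajectory through z at time t is supplied together with its comparison to all
  trajectories \<Phi>(., v). It thereby plays the role of the inverse flow, its value at time 0
  being the preimage of z.\<close>

lemma flow_exists:
  assumes "T > 0"
  obtains \<Phi> L where "L \<ge> 1" "\<And>v. \<Phi> 0 v = v"
    "\<And>s. s \<in> {-T..T} \<Longrightarrow> \<Phi> s \<in> borel_measurable borel"
    "\<And>t z. t \<in> {-T..T} \<Longrightarrow> \<exists>\<gamma>. \<gamma> t = z \<and>
       (\<forall>s\<in>{-T..T}. (\<gamma> has_vector_derivative field s (\<gamma> s)) (at s)) \<and>
       (\<forall>s\<in>{-T..T}. \<forall>r\<in>{-T..T}. \<forall>v. norm (\<gamma> s - \<Phi> s v) \<le> L * norm (\<gamma> r - \<Phi> r v))"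
proof -
  obtain L where L: "L \<ge> 0" "\<And>t z w. norm (field t z - field t w) \<le> L * norm (z - w)"
    using field_lipschitz by blast
  have "\<exists>\<gamma>. \<gamma> 0 = v \<and> (\<forall>s\<in>{-T..T}. (\<gamma> has_vector_derivative field s (\<gamma> s)) (at s))" for v
    using assms by (intro ode_exists[OF continuous_on_field L(2)]) auto
  then obtain \<gamma>0 where \<gamma>0: "\<And>v. \<gamma>0 v 0 = v"
    "\<And>v s. s \<in> {-T..T} \<Longrightarrow> (\<gamma>0 v has_vector_derivative field s (\<gamma>0 v s)) (at s)" by metis
  define \<Phi> where "\<Phi> s v = \<gamma>0 v s" for s v
  \<comment> \<open>Two times in [-T, T] differ by at most 2T, so one constant serves for every pair
    and in both directions.\<close>
  define \<Lambda> where "\<Lambda> = exp (L * (2 * T))"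
  have \<Lambda>1: "\<Lambda> \<ge> 1" unfolding \<Lambda>_def using L(1) assms by simp
  have comp: "norm (\<gamma> s - \<beta> s) \<le> \<Lambda> * norm (\<gamma> r - \<beta> r)"
    if "\<And>s. s \<in> {-T..T} \<Longrightarrow> (\<gamma> has_vector_derivative field s (\<gamma> s)) (at s)"
      "\<And>s. s \<in> {-T..T} \<Longrightarrow> (\<beta> has_vector_derivative field s (\<beta> s)) (at s)"
      "s \<in> {-T..T}" "r \<in> {-T..T}" for \<gamma> \<beta> s r
  proof -
    have "norm (\<gamma> s - \<beta> s) \<le> exp (L * \<bar>s - r\<bar>) * norm (\<gamma> r - \<beta> r)"
      by (rule ode_gronwall[OF L(2) that])
    also have "\<dots> \<le> \<Lambda> * norm (\<gamma> r - \<beta> r)"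
      unfolding \<Lambda>_def using that(3,4) L(1) by (intro mult_right_mono) (auto intro!: mult_left_mono)
    finally show ?thesis .
  qed
  show ?thesis
  proof (rule that[of \<Lambda> \<Phi>])
    show "\<Lambda> \<ge> 1" by (rule \<Lambda>1)
    show "\<Phi> 0 v = v" for v unfolding \<Phi>_def by (rule \<gamma>0)
    show "\<Phi> s \<in> borel_measurable borel" if s: "s \<in> {-T..T}" for s
    proof (rule borel_measurable_continuous_onI)
      have "norm (\<Phi> s v - \<Phi> s w) \<le> \<Lambda> * norm (v - w)" for v w
        using comp[of "\<gamma>0 v" "\<gamma>0 w" s 0] \<gamma>0 s assms unfolding \<Phi>_def by simp
      then have "\<Lambda>-lipschitz_on UNIV (\<Phi> s)" using \<Lambda>1 by (intro lipschitz_onI) (auto simp: dist_norm)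
      then show "continuous_on UNIV (\<Phi> s)" by (rule lipschitz_on_continuous_on)
    qed
    fix t z assume t: "t \<in> {-T..T}"
    obtain \<gamma> where \<gamma>: "\<gamma> t = z" "\<And>s. s \<in> {-T..T} \<Longrightarrow> (\<gamma> has_vector_derivative field s (\<gamma> s)) (at s)"
      using ode_exists[OF continuous_on_field L(2) t] by blast
    show "\<exists>\<gamma>. \<gamma> t = z \<and> (\<forall>s\<in>{-T..T}. (\<gamma> has_vector_derivative field s (\<gamma> s)) (at s)) \<and>
       (\<forall>s\<in>{-T..T}. \<forall>r\<in>{-T..T}. \<forall>v. norm (\<gamma> s - \<Phi> s v) \<le> \<Lambda> * norm (\<gamma> r - \<Phi> r v))"
      using \<gamma> comp[OF \<gamma>(2) \<gamma>0(2)] unfolding \<Phi>_def by (intro exI[of _ \<gamma>]) auto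
  qed
qed

text \<open>Gronwall's inequality for a whole function on phase space. A bound with constant A,
  inserted into the remainder of \<open>duhamel_bound\<close>, is convolved once and carried back to
  the point (t, z); with a large weight lam the outcome is the same bound with constant C' +
  A/2.\<close>

lemma overlap_kernel_bound:
  assumes T: "T > 0" and N: "4 * CARD('n) \<le> N" and C1: "C1 > 0"
    and \<Phi>: "L \<ge> 1" "\<And>v. \<Phi> 0 v = v" "\<And>s. s \<in> {-T..T} \<Longrightarrow> \<Phi> s \<in> borel_measurable borel"
      "\<And>t z. t \<in> {-T..T} \<Longrightarrow> \<exists>\<gamma>. \<gamma> t = z \<and>
       (\<forall>s\<in>{-T..T}. (\<gamma> has_vector_derivative field s (\<gamma> s)) (at s)) \<and>
       (\<forall>s\<in>{-T..T}. \<forall>r\<in>{-T..T}. \<forall>v. norm (\<gamma> s - \<Phi> s v) \<le> L * norm (\<gamma> r - \<Phi> r v))"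
  obtains D where "D > 0" "\<And>u w t z. is_weak_solution u \<Longrightarrow> w \<in> borel_measurable borel \<Longrightarrow>
      (\<And>z. ambiguity bumpc (u 0) z \<le> ennreal C1 * smear N (\<lambda>x. x) w z) \<Longrightarrow>
      t \<in> {-T..T} \<Longrightarrow> ambiguity bumpc (u t) z \<le> ennreal D * smear N (\<Phi> t) w z"
proof -
  have N2: "2 * DIM((real^'n) \<times> (real^'n)) \<le> N" using N by simp
  obtain C2 where C2: "C2 > 0" "\<And>p u z. L2_function u \<Longrightarrow>
     ambiguity (packet_rem p) u z \<le> ennreal C2 * smear N (\<lambda>x. x) (ambiguity bumpc u) z"
    using packet_rem_change_window[OF N] by blast
  define \<kappa> where "\<kappa> = kern_mass N TYPE((real^'n) \<times> (real^'n))"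
  have \<kappa>0: "\<kappa> \<ge> 0" unfolding \<kappa>_def by simp
  define K2 where "K2 = 2 ^ (N + 1) * \<kappa> * L ^ N"
  have K20: "K2 \<ge> 0" unfolding K2_def using \<kappa>0 \<Phi>(1) by simp
  \<comment> \<open>\<kappa> is the cost of convolving the constant eps, K2 that of convolving the
    smeared function and moving it along the flow; the 1 gives strict positivity.\<close>
  define K3 where "K3 = C2 * (\<kappa> + K2 + 1)"
  have K3: "K3 > 0" unfolding K3_def using C2(1) \<kappa>0 K20 by (intro mult_pos_pos) auto
  \<comment> \<open>The gain K3 / lam = 1/2 from the weighted integral is the contraction
    factor.\<close>
  define lam where "lam = 2 * K3"
  have lam: "lam > 0" unfolding lam_def using K3 by simp
  define C' where "C' = C1 * L ^ N"
  have C': "C' > 0" unfolding C'_def using C1 \<Phi>(1) by simp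
  \<comment> \<open>2 C' is the fixed point of A -> C' + A/2, and the 1 bounds what is left of the
    starting error after finitely many passes.\<close>
  define D where "D = (2 * C' + 1) * exp (lam * T)"
  have D: "D > 0" unfolding D_def using C' by (simp add: add_pos_pos)
  have main: "ambiguity bumpc (u t) z \<le> ennreal D * smear N (\<Phi> t) w z"
    if sol: "is_weak_solution u" and w[measurable]: "w \<in> borel_measurable borel"
      and init: "\<And>z. ambiguity bumpc (u 0) z \<le> ennreal C1 * smear N (\<lambda>x. x) w z"
      and t: "t \<in> {-T..T}" for u w t z
  proof -
    have u: "continuous_L2 u" using sol unfolding is_weak_solution_def by blast
    have uL2: "L2_function (u r)" for r using u unfolding continuous_L2_def by blast
    have m\<Phi>[measurable]: "s \<in> {-T..T} \<Longrightarrow> \<Phi> s \<in> borel_measurable borel" for s by (rule \<Phi>(3))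
    obtain B where B: "B > 0" "\<And>t z. t \<in> {-T..T} \<Longrightarrow> cmod (wave_packet bumpc (u t) (fst z) (snd z)) \<le> B"
      using overlap_bounded[OF u] by blast
    \<comment> \<open>The smeared function may be arbitrarily small, so the crude bound cannot be
      compared with it directly; adding eps makes the finite constant B / eps admissible.\<close>
    define P where "P eps A \<longleftrightarrow> (\<forall>t\<in>{-T..T}. \<forall>z. ambiguity bumpc (u t) z \<le> ennreal (A * exp (lam * \<bar>t\<bar>)) * (ennreal eps + smear N (\<Phi> t) w z))"
      for eps A
    have start: "P eps (B / eps)" if eps: "eps > 0" for eps
      unfolding P_def
    proof (intro ballI allI)
      fix t z assume t: "t \<in> {-T..T}"
      have "ambiguity bumpc (u t) z \<le> ennreal ((B / eps) * eps)"
        using B(2)[OF t, of z] eps by (intro ennreal_leI) simp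
      also have "\<dots> \<le> ennreal ((B / eps) * exp (lam * \<bar>t\<bar>) * eps)"
      proof (intro ennreal_leI mult_right_mono)
        have "(B / eps) * 1 \<le> (B / eps) * exp (lam * \<bar>t\<bar>)"
          using B(1) eps lam by (intro mult_left_mono) auto
        then show "B / eps \<le> (B / eps) * exp (lam * \<bar>t\<bar>)" by simp
      qed (use eps in simp)
      also have "\<dots> = ennreal ((B / eps) * exp (lam * \<bar>t\<bar>)) * ennreal eps"
        using B(1) eps by (intro ennreal_mult) auto
      also have "\<dots> \<le> ennreal ((B / eps) * exp (lam * \<bar>t\<bar>)) * (ennreal eps + smear N (\<Phi> t) w z)"
        by (intro mult_left_mono) auto
      finally show "ambiguity bumpc (u t) z \<le> \<dots>" .
    qed
    have step: "P eps (C' + A / 2)" if P: "P eps A" and A: "A \<ge> 0" and eps: "eps > 0" for eps A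
      unfolding P_def
    proof (intro ballI allI)
      fix t z assume t: "t \<in> {-T..T}"
      obtain \<gamma> where \<gamma>: "\<gamma> t = z" "\<And>s. s \<in> {-T..T} \<Longrightarrow> (\<gamma> has_vector_derivative field s (\<gamma> s)) (at s)"
        "\<And>s r v. s \<in> {-T..T} \<Longrightarrow> r \<in> {-T..T} \<Longrightarrow> norm (\<gamma> s - \<Phi> s v) \<le> L * norm (\<gamma> r - \<Phi> r v)"
        using \<Phi>(4)[OF t, of z] by blast
      \<comment> \<open>All estimates along the trajectory are referred to its end point (t, z), so
        a single number \<mu> controls the whole time integral.\<close>
      have move: "smear N (\<Phi> s) w (\<gamma> s) \<le> ennreal (L ^ N) * smear N (\<Phi> t) w z" if s: "s \<in> {-T..T}" for s
        unfolding \<gamma>(1)[symmetric] by (rule smear_scale[OF \<gamma>(3)[OF t s] \<Phi>(1) m\<Phi>[OF t] w])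
      show "ambiguity bumpc (u t) z \<le> ennreal ((C' + A / 2) * exp (lam * \<bar>t\<bar>)) * (ennreal eps + smear N (\<Phi> t) w z)"
      proof (cases "smear N (\<Phi> t) w z")
        case top
        have "C' + A / 2 > 0" using C' A by simp
        then show ?thesis unfolding top by (simp add: ennreal_mult_top)
      next
        case (real \<mu>)
        let ?\<mu> = "eps + \<mu>"
        have \<mu>0: "?\<mu> > 0" using eps real by simp
        have \<mu>: "ennreal eps + smear N (\<Phi> t) w z = ennreal ?\<mu>" using real eps by simp
        have rem: "cmod (wave_packet (packet_rem (s, fst (\<gamma> s))) (u s) (fst (\<gamma> s)) (snd (\<gamma> s))) \<le> (K3 * A * ?\<mu>) * exp (lam * \<bar>s\<bar>)"
          if "s \<in> closed_segment 0 t" for s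
        proof -
          have s: "s \<in> {-T..T}" using that t by (auto simp: closed_segment_eq_real_ivl split: if_splits)
          let ?e = "ennreal (A * exp (lam * \<bar>s\<bar>))"
          have "smear N (\<lambda>x. x) (ambiguity bumpc (u s)) (\<gamma> s) \<le>
             (\<integral>\<^sup>+v. ?e * (ennreal (kern N (\<gamma> s - v)) * ennreal eps + ennreal (kern N (\<gamma> s - v)) * smear N (\<Phi> s) w v) \<partial>lborel)"
            unfolding smear_def[of N "\<lambda>x. x"]
          proof (rule nn_integral_mono)
            fix v
            have "ambiguity bumpc (u s) v \<le> ?e * (ennreal eps + smear N (\<Phi> s) w v)"
              using P s unfolding P_def by blast
            then have "ennreal (kern N (\<gamma> s - v)) * ambiguity bumpc (u s) v \<le> ennreal (kern N (\<gamma> s - v)) * (?e * (ennreal eps + smear N (\<Phi> s) w v))"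
              by (rule mult_left_mono) simp
            also have "\<dots> = ?e * (ennreal (kern N (\<gamma> s - v)) * ennreal eps + ennreal (kern N (\<gamma> s - v)) * smear N (\<Phi> s) w v)"
              by (simp add: distrib_left mult_ac)
            finally show "ennreal (kern N (\<gamma> s - v)) * ambiguity bumpc (u s) v \<le> \<dots>" .
          qed
          also have "\<dots> = ?e * ((\<integral>\<^sup>+v. ennreal (kern N (\<gamma> s - v)) \<partial>lborel) * ennreal eps + smear N (\<lambda>x. x) (smear N (\<Phi> s) w) (\<gamma> s))"
            unfolding smear_def[of N "\<lambda>x. x"] using s
            by (simp add: nn_integral_cmult nn_integral_add nn_integral_multc)
          also have "\<dots> \<le> ?e * (ennreal \<kappa> * ennreal eps + ennreal (2 ^ (N + 1) * \<kappa>) * (ennreal (L ^ N) * smear N (\<Phi> t) w z))"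
            unfolding nn_integral_kern(2)[OF N2] \<kappa>_def[symmetric]
            using order_trans[OF smear_smear[OF N2 m\<Phi>[OF s] w] mult_left_mono[OF move[OF s]]]
            by (intro mult_left_mono add_mono) (auto simp: \<kappa>_def)
          also have "\<dots> = ennreal (A * exp (lam * \<bar>s\<bar>) * (\<kappa> * eps + K2 * \<mu>))"
            using real eps \<kappa>0 K20 A \<Phi>(1) unfolding K2_def
            by (simp add: ennreal_mult mult.assoc)
          finally have sm: "smear N (\<lambda>x. x) (ambiguity bumpc (u s)) (\<gamma> s) \<le> ennreal (A * exp (lam * \<bar>s\<bar>) * (\<kappa> * eps + K2 * \<mu>))" .
          have "ambiguity (packet_rem (s, fst (\<gamma> s))) (u s) (\<gamma> s) \<le> ennreal C2 * smear N (\<lambda>x. x) (ambiguity bumpc (u s)) (\<gamma> s)"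
            by (rule C2(2)[OF uL2])
          also have "\<dots> \<le> ennreal C2 * ennreal (A * exp (lam * \<bar>s\<bar>) * (\<kappa> * eps + K2 * \<mu>))"
            by (rule mult_left_mono[OF sm]) simp
          also have "\<dots> = ennreal (C2 * (A * exp (lam * \<bar>s\<bar>) * (\<kappa> * eps + K2 * \<mu>)))"
            using C2(1) A \<kappa>0 K20 eps real by (intro ennreal_mult[symmetric]) auto
          finally have "cmod (wave_packet (packet_rem (s, fst (\<gamma> s))) (u s) (fst (\<gamma> s)) (snd (\<gamma> s))) \<le> C2 * (A * exp (lam * \<bar>s\<bar>) * (\<kappa> * eps + K2 * \<mu>))"
            using C2(1) A \<kappa>0 K20 eps real by (subst (asm) ennreal_le_iff) (auto intro!: mult_nonneg_nonneg add_nonneg_nonneg)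
          also have "\<dots> \<le> C2 * (A * exp (lam * \<bar>s\<bar>) * ((\<kappa> + K2 + 1) * ?\<mu>))"
          proof -
            have "\<kappa> * eps + K2 * \<mu> \<le> (\<kappa> + K2 + 1) * ?\<mu>"
              using \<kappa>0 K20 eps real by (simp add: distrib_left distrib_right)
            then show ?thesis using C2(1) A by (intro mult_left_mono) auto
          qed
          also have "\<dots> = (K3 * A * ?\<mu>) * exp (lam * \<bar>s\<bar>)" unfolding K3_def by (simp add: mult_ac)
          finally show ?thesis .
        qed
        have eq: "(K3 * A * ?\<mu>) / lam = A / 2 * ?\<mu>" unfolding lam_def using K3 by simp
        have "cmod (wave_packet bumpc (u t) (fst (\<gamma> t)) (snd (\<gamma> t))) \<le>
           cmod (wave_packet bumpc (u 0) (fst (\<gamma> 0)) (snd (\<gamma> 0))) + (K3 * A * ?\<mu>) / lam * exp (lam * \<bar>t\<bar>)"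
          by (rule duhamel_bound[OF sol t \<gamma>(2) lam rem])
        moreover have "cmod (wave_packet bumpc (u 0) (fst (\<gamma> 0)) (snd (\<gamma> 0))) \<le> C' * \<mu>"
        proof -
          have 0: "0 \<in> {-T..T}" using T by simp
          have "\<Phi> 0 = (\<lambda>x. x)" using \<Phi>(2) by blast
          then have "ambiguity bumpc (u 0) (\<gamma> 0) \<le> ennreal C1 * smear N (\<Phi> 0) w (\<gamma> 0)" using init by simp
          also have "\<dots> \<le> ennreal C1 * (ennreal (L ^ N) * smear N (\<Phi> t) w z)"
            by (intro mult_left_mono move 0) simp
          also have "\<dots> = ennreal (C' * \<mu>)"
            unfolding C'_def using C1 \<Phi>(1) real by (simp add: ennreal_mult mult.assoc)
          finally show ?thesis using C' real by (subst (asm) ennreal_le_iff) auto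
        qed
        moreover have "C' * \<mu> \<le> C' * ?\<mu> * exp (lam * \<bar>t\<bar>)"
        proof -
          have "C' * \<mu> * 1 \<le> C' * ?\<mu> * exp (lam * \<bar>t\<bar>)"
            using C' eps real lam by (intro mult_mono) auto
          then show ?thesis by simp
        qed
        moreover have "(C' + A / 2) * exp (lam * \<bar>t\<bar>) * ?\<mu> = C' * ?\<mu> * exp (lam * \<bar>t\<bar>) + A / 2 * ?\<mu> * exp (lam * \<bar>t\<bar>)"
          by (simp add: algebra_simps)
        ultimately have "cmod (wave_packet bumpc (u t) (fst z) (snd z)) \<le> (C' + A / 2) * exp (lam * \<bar>t\<bar>) * ?\<mu>"
          unfolding \<gamma>(1) eq by linarith
        then have "ambiguity bumpc (u t) z \<le> ennreal ((C' + A / 2) * exp (lam * \<bar>t\<bar>) * ?\<mu>)" by (rule ennreal_leI)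
        also have "\<dots> = ennreal ((C' + A / 2) * exp (lam * \<bar>t\<bar>)) * ennreal ?\<mu>"
          using C' A \<mu>0 by (intro ennreal_mult) auto
        finally show ?thesis unfolding \<mu> .
      qed
    qed
    \<comment> \<open>Iterating A -> C' + A/2 from 2 C' + B / eps leaves the fixed point 2 C' and
      halves the rest in every pass.\<close>
    have all: "P eps (2 * C' + B / eps / 2 ^ n)" if eps: "eps > 0" for eps n
    proof (induction n)
      case 0
      have "P eps (B / eps)" by (rule start[OF eps])
      then show ?case
        unfolding P_def
      proof (intro ballI allI)
        fix t z
        assume P: "\<forall>t\<in>{- T..T}. \<forall>z. ambiguity bumpc (u t) z \<le> ennreal (B / eps * exp (lam * \<bar>t\<bar>)) * (ennreal eps + smear N (\<Phi> t) w z)"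
          and t: "t \<in> {- T..T}"
        have "ambiguity bumpc (u t) z \<le> ennreal (B / eps * exp (lam * \<bar>t\<bar>)) * (ennreal eps + smear N (\<Phi> t) w z)"
          using P t by blast
        also have "\<dots> \<le> ennreal ((2 * C' + B / eps / 2 ^ 0) * exp (lam * \<bar>t\<bar>)) * (ennreal eps + smear N (\<Phi> t) w z)"
          using C' by (intro mult_right_mono ennreal_leI) auto
        finally show "ambiguity bumpc (u t) z \<le> \<dots>" .
      qed
    next
      case (Suc n)
      have "P eps (C' + (2 * C' + B / eps / 2 ^ n) / 2)"
        using C' B(1) eps by (intro step[OF Suc _ eps]) auto
      moreover have "C' + (2 * C' + B / eps / 2 ^ n) / 2 = 2 * C' + B / eps / 2 ^ Suc n"
        by (simp add: add_divide_distrib)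
      ultimately show ?case by (simp only:)
    qed
    have eps_bound: "ambiguity bumpc (u t) z \<le> ennreal D * (ennreal eps + smear N (\<Phi> t) w z)" if eps: "eps > 0" for eps
    proof -
      \<comment> \<open>The number of passes depends on eps, but the resulting constant D does not,
        so eps can be sent to 0 afterwards.\<close>
      obtain n where "B / eps < 2 ^ n" using real_arch_pow[of 2 "B / eps"] by auto
      then have "B / eps / 2 ^ n \<le> 1" by (subst pos_divide_le_eq) auto
      then have n: "2 * C' + B / eps / 2 ^ n \<le> 2 * C' + 1" by linarith
      have "ambiguity bumpc (u t) z \<le> ennreal ((2 * C' + B / eps / 2 ^ n) * exp (lam * \<bar>t\<bar>)) * (ennreal eps + smear N (\<Phi> t) w z)"
        using all[OF eps, of n] t unfolding P_def by blast
      also have "\<dots> \<le> ennreal D * (ennreal eps + smear N (\<Phi> t) w z)"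
        unfolding D_def using n t lam C' B(1) eps
        by (intro mult_right_mono ennreal_leI mult_mono) auto
      finally show ?thesis .
    qed
    show ?thesis
    proof (cases "smear N (\<Phi> t) w z")
      case top
      then show ?thesis using D by (simp add: ennreal_mult_top)
    next
      case (real \<mu>)
      have "cmod (wave_packet bumpc (u t) (fst z) (snd z)) \<le> D * \<mu> + e" if e: "e > 0" for e
      proof -
        have "ambiguity bumpc (u t) z \<le> ennreal D * (ennreal (e / D) + smear N (\<Phi> t) w z)"
          using e D by (intro eps_bound) simp
        also have "\<dots> = ennreal (D * (e / D + \<mu>))"
          using e D real by (simp add: ennreal_mult)
        finally have "cmod (wave_packet bumpc (u t) (fst z) (snd z)) \<le> D * (e / D + \<mu>)"
          using e D real by (subst (asm) ennreal_le_iff) auto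
        also have "\<dots> = D * \<mu> + e" using D by (simp add: distrib_left)
        finally show ?thesis .
      qed
      then have "cmod (wave_packet bumpc (u t) (fst z) (snd z)) \<le> D * \<mu>" by (rule field_le_epsilon)
      then have "ambiguity bumpc (u t) z \<le> ennreal (D * \<mu>)" by (rule ennreal_leI)
      then show ?thesis using real D by (simp add: ennreal_mult)
    qed
  qed
  show ?thesis using that[OF D] main by blast
qed

end

section \<open>Mixed Lebesgue norms and the Schur test\<close>

text \<open>Young's inequality with the second factor 1, rescaled by y. It expresses that t^q lies
  above its tangent at t = 1; q = 1 is separate because its conjugate exponent is infinite.\<close>

lemma powr_tangent_le:
  fixes q x y :: real
  assumes "q \<ge> 1" "y > 0" "x \<ge> 0"
  shows "x \<le> y * ((x / y) powr q / q + (1 - 1 / q))"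
proof (cases "q = 1")
  case False
  then have q: "q > 1" using assms(1) by linarith
  define r where "r = q / (q - 1)"
  have r: "r > 1" "1 / q + 1 / r = 1" unfolding r_def using q by (auto simp: field_simps)
  have "(x / y) * 1 \<le> (x / y) powr q / q + 1 powr r / r"
    by (rule Youngs_inequality[OF q r]) (use assms in auto)
  also have "1 powr r / r = 1 - 1 / q" using r(2) by simp
  finally have "y * (x / y) \<le> y * ((x / y) powr q / q + (1 - 1 / q))" using assms by (intro mult_left_mono) auto
  then show ?thesis using assms by simp
qed (use assms in auto)

lemma ennreal_powr_ennreal: "ennreal_powr (ennreal x) a = ennreal (x powr a)" if "x \<ge> 0"
  using that unfolding ennreal_powr_def by simp

lemma ennreal_powr_mono: "x \<le> y \<Longrightarrow> a > 0 \<Longrightarrow> ennreal_powr x a \<le> ennreal_powr y a"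
  by (cases x; cases y) (auto simp: ennreal_powr_def top_unique intro!: ennreal_leI powr_mono2)

lemma ennreal_powr_cmult:
  assumes "c > 0" "a > 0"
  shows "ennreal_powr (ennreal c * x) a = ennreal (c powr a) * ennreal_powr x a"
proof (cases x)
  case (real r)
  have eq: "ennreal c * x = ennreal (c * r)" using real assms by (simp add: ennreal_mult)
  have "ennreal_powr (ennreal c * x) a = ennreal (c powr a * r powr a)"
    unfolding eq using real assms by (simp add: ennreal_powr_ennreal powr_mult)
  also have "\<dots> = ennreal (c powr a) * ennreal_powr x a"
    using real by (simp add: ennreal_powr_ennreal ennreal_mult)
  finally show ?thesis .
next
  case top
  then show ?thesis using assms by (simp add: ennreal_powr_def ennreal_mult_top)
qed

lemma ennreal_powr_inverse: "ennreal_powr (ennreal_powr x (1 / q)) q = x" "ennreal_powr (ennreal_powr x q) (1 / q) = x" if "q > 0"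
  using that by (cases x; auto simp: ennreal_powr_def powr_powr)+

lemma borel_measurable_ennreal_powr [measurable]:
  "(\<lambda>x. ennreal_powr x a) \<in> borel_measurable borel"
  unfolding ennreal_powr_def by measurable

text \<open>Jensen's inequality for a measure K of mass at most a, obtained by integrating one
  tangent bound. If the integral j of h^q is 0 there is no positive tangent point, but then h
  vanishes almost everywhere for K.\<close>

lemma nn_integral_Jensen_powr:
  fixes h :: "'a \<Rightarrow> real"
  assumes q: "q \<ge> 1" and a: "a > 0" and [measurable]: "K \<in> borel_measurable M" "h \<in> borel_measurable M"
    and h: "\<And>v. h v \<ge> 0" and K: "(\<integral>\<^sup>+v. K v \<partial>M) \<le> ennreal a"
  shows "ennreal_powr (\<integral>\<^sup>+v. K v * ennreal (h v) \<partial>M) q \<le>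
    ennreal (a powr (q - 1)) * (\<integral>\<^sup>+v. K v * ennreal (h v powr q) \<partial>M)"
proof (cases "\<integral>\<^sup>+v. K v * ennreal (h v powr q) \<partial>M")
  case top
  then show ?thesis using a by (simp add: ennreal_mult_top)
next
  case (real j)
  show ?thesis
  proof (cases "j = 0")
    case True
    then have "AE v in M. K v * ennreal (h v powr q) = 0"
      using real nn_integral_0_iff_AE[of "\<lambda>v. K v * ennreal (h v powr q)" M] by simp
    then have "AE v in M. K v * ennreal (h v) = 0"
    proof eventually_elim
      case (elim v)
      have "0 < h v powr q" if "h v \<noteq> 0" using that by simp
      then show ?case using elim h[of v] by (cases "h v = 0") (auto simp: ennreal_eq_0_iff)
    qed
    then have "(\<integral>\<^sup>+v. K v * ennreal (h v) \<partial>M) = 0"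
      using nn_integral_0_iff_AE[of "\<lambda>v. K v * ennreal (h v)" M] by simp
    then show ?thesis using q by (simp add: ennreal_powr_def)
  next
    case False
    then have j: "j > 0" using real by simp
    \<comment> \<open>The mean of order q of h. With this tangent point the integrated bound
      collapses to y * a, and (y a)^q = a^(q - 1) j.\<close>
    define y where "y = (j / a) powr (1 / q)"
    have y: "y > 0" unfolding y_def using j a by simp
    have yq: "y powr q = j / a" unfolding y_def using q j a by (simp add: powr_powr)
    have pt: "K v * ennreal (h v) \<le> ennreal (y * a / (j * q)) * (K v * ennreal (h v powr q)) + ennreal (y * (1 - 1 / q)) * K v" for v
    proof -
      have "h v \<le> y * ((h v / y) powr q / q + (1 - 1 / q))" by (rule powr_tangent_le[OF q y h])
      also have "(h v / y) powr q = h v powr q * a / j"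
        using h[of v] y yq by (simp add: powr_divide)
      also have "y * (h v powr q * a / j / q + (1 - 1 / q)) = (y * a / (j * q)) * h v powr q + y * (1 - 1 / q)"
        by (simp add: algebra_simps)
      finally have "ennreal (h v) \<le> ennreal ((y * a / (j * q)) * h v powr q + y * (1 - 1 / q))" by (rule ennreal_leI)
      also have "\<dots> = ennreal (y * a / (j * q)) * ennreal (h v powr q) + ennreal (y * (1 - 1 / q))"
      proof -
        have A: "0 \<le> y * a / (j * q)" "0 \<le> y * (1 - 1 / q)" using y a j q by auto
        show ?thesis
          unfolding ennreal_mult[OF A(1) powr_ge_zero, symmetric]
          by (rule ennreal_plus[OF mult_nonneg_nonneg[OF A(1) powr_ge_zero] A(2)])
      qed
      finally have "K v * ennreal (h v) \<le> K v * (ennreal (y * a / (j * q)) * ennreal (h v powr q) + ennreal (y * (1 - 1 / q)))"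
        by (rule mult_left_mono) simp
      then show ?thesis by (simp add: distrib_left mult_ac)
    qed
    have "(\<integral>\<^sup>+v. K v * ennreal (h v) \<partial>M) \<le>
      (\<integral>\<^sup>+v. ennreal (y * a / (j * q)) * (K v * ennreal (h v powr q)) + ennreal (y * (1 - 1 / q)) * K v \<partial>M)"
      by (intro nn_integral_mono pt)
    also have "\<dots> = ennreal (y * a / (j * q)) * ennreal j + ennreal (y * (1 - 1 / q)) * (\<integral>\<^sup>+v. K v \<partial>M)"
      using real by (simp add: nn_integral_add nn_integral_cmult)
    also have "\<dots> \<le> ennreal (y * a / (j * q)) * ennreal j + ennreal (y * (1 - 1 / q)) * ennreal a"
      by (intro add_mono mult_left_mono K) auto
    also have "\<dots> = ennreal (y * a / (j * q) * j + y * (1 - 1 / q) * a)"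
      using y a j q by (simp add: ennreal_mult[symmetric])
    also have "y * a / (j * q) * j + y * (1 - 1 / q) * a = y * a" using j q by (simp add: field_simps)
    finally have "ennreal_powr (\<integral>\<^sup>+v. K v * ennreal (h v) \<partial>M) q \<le> ennreal_powr (ennreal (y * a)) q"
      using q by (intro ennreal_powr_mono) auto
    also have "\<dots> = ennreal (a powr (q - 1) * j)"
    proof -
      have "(y * a) powr q = a powr (q - 1) * j"
        using y a j yq by (simp add: powr_mult powr_diff)
      then show ?thesis using y a by (simp add: ennreal_powr_ennreal)
    qed
    finally show ?thesis using real by (simp add: ennreal_mult)
  qed
qed

lemma esssup_le_AE:
  fixes f :: "'a \<Rightarrow> ennreal"
  assumes "f \<in> borel_measurable M" "AE x in M. f x \<le> c" shows "esssup M f \<le> c"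
  using assms esssup_eq_AE[OF assms(1)] by (auto intro: Inf_lower)

lemma pair_measurable_slice:
  "(\<lambda>x. (x, y)) \<in> borel_measurable (borel :: 'a::euclidean_space measure)" for y :: "'b::euclidean_space"
  by (intro borel_measurable_continuous_onI continuous_intros)

text \<open>The essential supremum of a slice exceeds c exactly when the slice of {g > c} has
  positive measure, and the measure of slices depends measurably on the parameter.\<close>

lemma borel_measurable_esssup_slice:
  fixes g :: "'a::euclidean_space \<times> 'b::euclidean_space \<Rightarrow> ennreal"
  assumes [measurable]: "g \<in> borel_measurable borel"
  shows "(\<lambda>y. esssup lborel (\<lambda>x. g (x, y))) \<in> borel_measurable borel"
proof (rule borel_measurableI_greater)
  fix c :: ennreal
  have gs[measurable]: "(\<lambda>x. g (x, y)) \<in> borel_measurable borel" for y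
    by (rule measurable_compose[OF pair_measurable_slice assms])
  have "{z. c < g z} \<in> sets borel" using borel_measurable_less[of "\<lambda>_. c" borel g] by simp
  then have Q: "{z. c < g z} \<in> sets (lborel \<Otimes>\<^sub>M lborel)" by (simp only: lborel_prod sets_lborel)
  have "(c < esssup lborel (\<lambda>x. g (x, y))) = (emeasure lborel ((\<lambda>x. (x, y)) -` {z. c < g z}) \<noteq> 0)" for y
  proof -
    have "emeasure lborel {x. c < g (x, y)} = 0 \<longleftrightarrow> (AE x in lborel. g (x, y) \<le> c)"
      by (subst AE_iff_measurable[of "{x. c < g (x, y)}"]) (auto simp: not_le)
    moreover have "(AE x in lborel. g (x, y) \<le> c) \<longleftrightarrow> esssup lborel (\<lambda>x. g (x, y)) \<le> c"
    proof
      assume "esssup lborel (\<lambda>x. g (x, y)) \<le> c"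
      moreover have "AE x in lborel. g (x, y) \<le> esssup lborel (\<lambda>x. g (x, y))" by (rule esssup_AE)
      ultimately show "AE x in lborel. g (x, y) \<le> c" by (auto elim!: eventually_mono)
    qed (use gs in \<open>auto intro: esssup_le_AE\<close>)
    ultimately show ?thesis by (simp add: not_le[symmetric] vimage_def)
  qed
  moreover have "(\<lambda>y. emeasure lborel ((\<lambda>x. (x, y)) -` {z. c < g z})) \<in> borel_measurable borel"
    using lborel_pair.measurable_emeasure_Pair2[OF Q] by simp
  ultimately show "{y \<in> space borel. c < esssup lborel (\<lambda>x. g (x, y))} \<in> sets borel"
    by simp
qed

text \<open>The exponent is the same in both variables, so the mixed norm is the norm on the product.\<close>

lemma Lp_norm_iterated:
  fixes g :: "'a::euclidean_space \<times> 'b::euclidean_space \<Rightarrow> ennreal"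
  assumes [measurable]: "g \<in> borel_measurable borel" and p: "1 \<le> p" "p \<noteq> \<infinity>"
  shows "Lp_norm p (\<lambda>y. Lp_norm p (\<lambda>x. g (x, y))) =
    ennreal_powr (\<integral>\<^sup>+z. ennreal_powr (g z) (enn2real p) \<partial>lborel) (1 / enn2real p)"
proof -
  have q: "enn2real p > 0" using p by (cases p) (auto simp: ennreal_1[symmetric] simp del: ennreal_1)
  have "(\<lambda>z. ennreal_powr (g z) (enn2real p)) \<in> borel_measurable (lborel \<Otimes>\<^sub>M lborel)"
    unfolding lborel_prod by measurable
  from lborel_pair.nn_integral_snd[OF this]
  show ?thesis unfolding Lp_norm_def using p q by (simp add: ennreal_powr_inverse lborel_prod)
qed

text \<open>For finite p, Jensen with the row bound gives a^(q - 1), and Tonelli with the column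
  bound gives the missing factor a. For p infinite the row bound multiplies the supremum of
  H.\<close>

lemma Schur_test:
  fixes G H :: "'a::euclidean_space \<times> 'b::euclidean_space \<Rightarrow> real" and K :: "'a \<times> 'b \<Rightarrow> 'a \<times> 'b \<Rightarrow> ennreal"
  assumes p: "1 \<le> p" and [measurable]: "G \<in> borel_measurable borel" "H \<in> borel_measurable borel"
    and Km[measurable]: "(\<lambda>(z, v). K z v) \<in> borel_measurable (borel \<Otimes>\<^sub>M borel)"
    and nn: "\<And>z. 0 \<le> G z" "\<And>z. 0 \<le> H z" and c: "c > 0" and a: "a > 0"
    and le: "\<And>z. ennreal (G z) \<le> ennreal c * (\<integral>\<^sup>+v. K z v * ennreal (H v) \<partial>lborel)"
    and K1: "\<And>z. (\<integral>\<^sup>+v. K z v \<partial>lborel) \<le> ennreal a" and K2: "\<And>v. (\<integral>\<^sup>+z. K z v \<partial>lborel) \<le> ennreal a"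
  shows "Lp_norm p (\<lambda>y. Lp_norm p (\<lambda>x. ennreal (G (x, y)))) \<le>
    ennreal (c * a) * Lp_norm p (\<lambda>y. Lp_norm p (\<lambda>x. ennreal (H (x, y))))"
proof -
  have Kv[measurable]: "K z \<in> borel_measurable borel" for z
    using measurable_compose[OF measurable_Pair1' Km, of z] by simp
  have Gs[measurable]: "(\<lambda>x. ennreal (G (x, y))) \<in> borel_measurable borel" for y
    by (rule measurable_compose[OF pair_measurable_slice]) measurable
  have Hs[measurable]: "(\<lambda>x. ennreal (H (x, y))) \<in> borel_measurable borel" for y
    by (rule measurable_compose[OF pair_measurable_slice]) measurable
  show ?thesis
  proof (cases "p = \<infinity>")
    case False
    define q where "q = enn2real p"
    have q: "q \<ge> 1" unfolding q_def using p False by (cases p) (auto simp: ennreal_1[symmetric] simp del: ennreal_1)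
    have "ennreal_powr (ennreal (G z)) q \<le> ennreal (c powr q * a powr (q - 1)) * (\<integral>\<^sup>+v. K z v * ennreal (H v powr q) \<partial>lborel)" for z
    proof -
      have "ennreal_powr (ennreal (G z)) q \<le> ennreal_powr (ennreal c * (\<integral>\<^sup>+v. K z v * ennreal (H v) \<partial>lborel)) q"
        using q by (intro ennreal_powr_mono le) simp
      also have "\<dots> = ennreal (c powr q) * ennreal_powr (\<integral>\<^sup>+v. K z v * ennreal (H v) \<partial>lborel) q"
        using c q by (intro ennreal_powr_cmult) auto
      also have "\<dots> \<le> ennreal (c powr q) * (ennreal (a powr (q - 1)) * (\<integral>\<^sup>+v. K z v * ennreal (H v powr q) \<partial>lborel))"
        by (intro mult_left_mono nn_integral_Jensen_powr q a nn K1) auto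
      finally show ?thesis by (simp add: ennreal_mult mult.assoc)
    qed
    then have "(\<integral>\<^sup>+z. ennreal_powr (ennreal (G z)) q \<partial>lborel) \<le>
      (\<integral>\<^sup>+z. ennreal (c powr q * a powr (q - 1)) * (\<integral>\<^sup>+v. K z v * ennreal (H v powr q) \<partial>lborel) \<partial>lborel)"
      by (intro nn_integral_mono)
    also have "\<dots> = ennreal (c powr q * a powr (q - 1)) * (\<integral>\<^sup>+z. \<integral>\<^sup>+v. K z v * ennreal (H v powr q) \<partial>lborel \<partial>lborel)"
      by (intro nn_integral_cmult) measurable
    also have "(\<integral>\<^sup>+z. \<integral>\<^sup>+v. K z v * ennreal (H v powr q) \<partial>lborel \<partial>lborel) = (\<integral>\<^sup>+v. \<integral>\<^sup>+z. K z v * ennreal (H v powr q) \<partial>lborel \<partial>lborel)"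
      by (rule lborel_pair.Fubini') measurable
    also have "\<dots> = (\<integral>\<^sup>+v. (\<integral>\<^sup>+z. K z v \<partial>lborel) * ennreal (H v powr q) \<partial>lborel)"
      by (intro nn_integral_cong nn_integral_multc) measurable
    also have "\<dots> \<le> (\<integral>\<^sup>+v. ennreal a * ennreal (H v powr q) \<partial>lborel)"
      by (intro nn_integral_mono mult_right_mono K2) simp
    also have "\<dots> = ennreal a * (\<integral>\<^sup>+v. ennreal_powr (ennreal (H v)) q \<partial>lborel)"
      unfolding ennreal_powr_ennreal[OF nn(2)] by (rule nn_integral_cmult) measurable
    finally have "(\<integral>\<^sup>+z. ennreal_powr (ennreal (G z)) q \<partial>lborel) \<le>
       ennreal (c powr q * a powr (q - 1)) * (ennreal a * (\<integral>\<^sup>+v. ennreal_powr (ennreal (H v)) q \<partial>lborel))"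
      by (simp add: mult_left_mono)
    also have "\<dots> = ennreal ((c * a) powr q) * (\<integral>\<^sup>+v. ennreal_powr (ennreal (H v)) q \<partial>lborel)"
      using a c by (simp add: mult.assoc[symmetric] ennreal_mult[symmetric] powr_mult powr_diff)
    finally have "ennreal_powr (\<integral>\<^sup>+z. ennreal_powr (ennreal (G z)) q \<partial>lborel) (1 / q) \<le>
       ennreal_powr (ennreal ((c * a) powr q) * (\<integral>\<^sup>+v. ennreal_powr (ennreal (H v)) q \<partial>lborel)) (1 / q)"
      using q by (intro ennreal_powr_mono) auto
    also have "\<dots> = ennreal (c * a) * ennreal_powr (\<integral>\<^sup>+v. ennreal_powr (ennreal (H v)) q \<partial>lborel) (1 / q)"
      using q a c by (subst ennreal_powr_cmult) (auto simp: powr_powr)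
    finally show ?thesis
      unfolding q_def using p False
      by (subst (1 2) Lp_norm_iterated) auto
  next
    case True
    define M where "M = Lp_norm p (\<lambda>y. Lp_norm p (\<lambda>x. ennreal (H (x, y))))"
    have M: "M = esssup lborel (\<lambda>y. esssup lborel (\<lambda>x. ennreal (H (x, y))))"
      unfolding M_def Lp_norm_def using True by simp
    \<comment> \<open>The nested essential supremum bounds H along almost every slice, which Tonelli
      accepts under the iterated integral; the conclusion for G holds at every point z.\<close>
    have GM: "ennreal (G z) \<le> ennreal (c * a) * M" for z
    proof -
      have "(\<lambda>v. K z v * ennreal (H v)) \<in> borel_measurable (lborel \<Otimes>\<^sub>M lborel)" unfolding lborel_prod by measurable
      from lborel_pair.nn_integral_snd[OF this]
      have "(\<integral>\<^sup>+v. K z v * ennreal (H v) \<partial>lborel) = (\<integral>\<^sup>+y. \<integral>\<^sup>+x. K z (x, y) * ennreal (H (x, y)) \<partial>lborel \<partial>lborel)"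
        by (simp add: lborel_prod)
      also have "\<dots> \<le> (\<integral>\<^sup>+y. \<integral>\<^sup>+x. K z (x, y) * M \<partial>lborel \<partial>lborel)"
      proof (rule nn_integral_mono_AE)
        have "AE y in lborel. esssup lborel (\<lambda>x. ennreal (H (x, y))) \<le> M" unfolding M by (rule esssup_AE)
        then show "AE y in lborel. (\<integral>\<^sup>+x. K z (x, y) * ennreal (H (x, y)) \<partial>lborel) \<le> (\<integral>\<^sup>+x. K z (x, y) * M \<partial>lborel)"
        proof eventually_elim
          case (elim y)
          have "AE x in lborel. ennreal (H (x, y)) \<le> esssup lborel (\<lambda>x. ennreal (H (x, y)))" by (rule esssup_AE)
          then show ?case
            by (intro nn_integral_mono_AE) (auto elim!: eventually_mono intro!: mult_left_mono order_trans[OF _ elim])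
        qed
      qed
      also have "\<dots> = (\<integral>\<^sup>+v. K z v * M \<partial>lborel)"
      proof -
        have "(\<lambda>v. K z v * M) \<in> borel_measurable (lborel \<Otimes>\<^sub>M lborel)" unfolding lborel_prod by measurable
        from lborel_pair.nn_integral_snd[OF this] show ?thesis by (simp add: lborel_prod)
      qed
      also have "\<dots> = (\<integral>\<^sup>+v. K z v \<partial>lborel) * M" by (rule nn_integral_multc) measurable
      also have "\<dots> \<le> ennreal a * M" by (intro mult_right_mono K1) simp
      finally have "ennreal c * (\<integral>\<^sup>+v. K z v * ennreal (H v) \<partial>lborel) \<le> ennreal c * (ennreal a * M)"
        by (rule mult_left_mono) simp
      with le[of z] show ?thesis using c a by (simp add: ennreal_mult mult.assoc)
    qed
    have "esssup lborel (\<lambda>y. esssup lborel (\<lambda>x. ennreal (G (x, y)))) \<le> ennreal (c * a) * M"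
    proof (rule esssup_le_AE)
      show "(\<lambda>y. esssup lborel (\<lambda>x. ennreal (G (x, y)))) \<in> borel_measurable lborel"
        using borel_measurable_esssup_slice[of "\<lambda>z. ennreal (G z)"] by simp
      show "AE y in lborel. esssup lborel (\<lambda>x. ennreal (G (x, y))) \<le> ennreal (c * a) * M"
        using GM by (intro AE_I2 esssup_le_AE) auto
    qed
    then show ?thesis using True by (simp add: M Lp_norm_def)
  qed
qed

section \<open>The freely evolving window\<close>

lemma PG_bounded_const:
  assumes "\<And>p. p \<in> P \<Longrightarrow> cmod (c p) \<le> B" shows "PG k j P (\<lambda>p y. c p)"
proof -
  have g: "grows P (\<lambda>p y. c p)"
    unfolding grows_def using assms by (auto intro!: exI[of _ 0] exI[of _ B])
  show ?thesis
  proof (cases k)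
    case (Suc m)
    show ?thesis unfolding Suc
      by (rule PG_SucI[OF g _ PG_const]) (rule pd_const)
  qed (use g in simp)
qed

lemma pd_schroedinger_multiplier:
  "pd j (\<lambda>\<xi>. cis (- (t * (norm \<xi>)\<^sup>2 / 2)))
    (\<lambda>\<xi>. cis (- (t * (norm \<xi>)\<^sup>2 / 2)) * ((- \<i> * complex_of_real t) * complex_of_real (\<xi> $ j)))"
  unfolding pd_def
proof
  fix \<xi> :: "real^'a"
  have n: "(norm (\<xi> + s *\<^sub>R axis j 1))\<^sup>2 = (norm \<xi>)\<^sup>2 + 2 * s * (\<xi> $ j) + s\<^sup>2" for s
    unfolding power2_norm_eq_inner
    by (simp add: inner_add_left inner_add_right inner_axis inner_commute[of "axis j 1"] power2_eq_square algebra_simps)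
  define g where "g s = - (t * ((norm \<xi>)\<^sup>2 + 2 * s * (\<xi> $ j) + s\<^sup>2) / 2)" for s
  have g: "(g has_vector_derivative - (t * \<xi> $ j)) (at 0)"
    unfolding g_def[abs_def] has_real_derivative_iff_has_vector_derivative[symmetric]
    by (auto intro!: derivative_eq_intros)
  have "(cis has_vector_derivative \<i> * cis (g 0)) (at (g 0))"
    using cis_has_vector_derivative[of 0 1] by simp
  from vector_diff_chain_at[OF g this]
  have "((\<lambda>s. cis (g s)) has_vector_derivative - (t * \<xi> $ j) *\<^sub>R (\<i> * cis (g 0))) (at 0)" by (simp add: o_def)
  moreover have "- (t * \<xi> $ j) *\<^sub>R (\<i> * cis (g 0)) =
      cis (- (t * (norm \<xi>)\<^sup>2 / 2)) * ((- \<i> * complex_of_real t) * complex_of_real (\<xi> $ j))"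
    unfolding g_def by (simp add: scaleR_conv_of_real mult_ac)
  ultimately show "((\<lambda>s. cis (- (t * (norm (\<xi> + s *\<^sub>R axis j 1))\<^sup>2 / 2))) has_vector_derivative
      cis (- (t * (norm \<xi>)\<^sup>2 / 2)) * ((- \<i> * complex_of_real t) * complex_of_real (\<xi> $ j))) (at 0)"
    unfolding n g_def by simp
qed

text \<open>Differentiation reproduces the multiplier times - i t \<xi>_j, a product of growing
  factors, so the induction feeds on itself; |t| <= T makes the bounds uniform.\<close>

lemma PG_schroedinger_multiplier:
  "PG k j {-T..T} (\<lambda>t \<xi>. cis (- (t * (norm \<xi>)\<^sup>2 / 2)))"
proof (induction k)
  case 0
  show ?case unfolding PG.simps grows_def
    by (intro conjI ballI exI[of _ 0] exI[of _ 1] continuous_intros) auto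
next
  case (Suc k)
  have "PG k j {-T..T} (\<lambda>t \<xi>. - \<i> * complex_of_real t)"
    by (rule PG_bounded_const[of _ _ T]) (auto simp: norm_mult)
  from PG_mult[OF Suc PG_mult[OF this PG_coord[of k j _ j]]]
  show ?case
    by (rule PG_SucI[OF PG_grows[OF Suc] pd_schroedinger_multiplier])
qed

lemma inv_fourier_eq_fourier:
  fixes r :: "real^'n::finite \<Rightarrow> complex"
  shows "inv_fourier r y = complex_of_real (inverse ((2 * pi) ^ CARD('n))) * fourier r (- y)"
  unfolding inv_fourier_def fourier_def by (simp add: inner_commute)

text \<open>The Fourier transform acts on phase space as the rotation (x, \<xi>) -> (\<xi>, -x), up
  to a unimodular factor and with the window transformed as well. Decay in phase space can thus be
  checked on the Fourier side.\<close>

lemma wave_packet_inv_fourier: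
  fixes \<psi> r :: "real^'n::finite \<Rightarrow> complex"
  assumes \<psi>: "integrable lborel \<psi>" and r: "integrable lborel r"
  shows "wave_packet \<psi> (inv_fourier r) x \<xi> = complex_of_real (inverse ((2 * pi) ^ CARD('n))) *
    (cis (- (x \<bullet> \<xi>)) * wave_packet (\<lambda>w. cnj (fourier (\<lambda>y. cnj (\<psi> y)) (- w))) r \<xi> (- x))"
proof -
  define F where "F y \<eta> = cnj (\<psi> (y - x)) * (r \<eta> * cis (y \<bullet> \<eta>)) * cis (- (y \<bullet> \<xi>))" for y \<eta>
  have \<psi>x: "integrable lborel (\<lambda>y. \<psi> (y - x))" using integrable_lborel_translate(1)[OF \<psi>, of "- x"] by simp
  have c\<psi>: "integrable lborel (\<lambda>y. cnj (\<psi> (y - x)))" using \<psi>x by simp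
  have [measurable]: "\<psi> \<in> borel_measurable borel" "r \<in> borel_measurable borel"
    using borel_measurable_integrable[OF \<psi>] borel_measurable_integrable[OF r] by simp_all
  have int: "integrable (lborel \<Otimes>\<^sub>M lborel) (\<lambda>(y, \<eta>). F y \<eta>)"
  proof (rule lborel_pair.Fubini_integrable)
    show "(\<lambda>(y, \<eta>). F y \<eta>) \<in> borel_measurable (lborel \<Otimes>\<^sub>M lborel)" unfolding F_def by measurable
    show "integrable lborel (\<lambda>y. LINT \<eta>|lborel. norm (case (y, \<eta>) of (y, \<eta>) \<Rightarrow> F y \<eta>))"
      unfolding F_def using integrable_norm[OF \<psi>x] by (simp add: norm_mult)
    show "AE y in lborel. integrable lborel (\<lambda>\<eta>. case (y, \<eta>) of (y, \<eta>) \<Rightarrow> F y \<eta>)"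
      unfolding F_def prod.case
      by (intro AE_I2 integrable_mult_left integrable_mult_right integrable_mult_cis r) measurable
  qed
  have inner: "(LINT y|lborel. F y \<eta>) = cis (- (x \<bullet> \<xi>)) * (fourier (\<lambda>y. cnj (\<psi> y)) (\<xi> - \<eta>) * r \<eta> * cis (- (\<eta> \<bullet> (- x))))" for \<eta>
  proof -
    have "F y \<eta> = r \<eta> * (cnj (\<psi> (y + - x)) * cis (- ((y + - x + x) \<bullet> (\<xi> - \<eta>))))" for y
    proof -
      have "cis (y \<bullet> \<eta>) * cis (- (y \<bullet> \<xi>)) = cis (- ((y + - x + x) \<bullet> (\<xi> - \<eta>)))"
        by (simp add: cis_mult inner_diff_right)
      then show ?thesis unfolding F_def by (simp add: mult_ac)
    qed
    then have "(LINT y|lborel. F y \<eta>) = r \<eta> * (LINT y|lborel. cnj (\<psi> (y + - x)) * cis (- ((y + - x + x) \<bullet> (\<xi> - \<eta>))))"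
      by simp
    also have "(LINT y|lborel. cnj (\<psi> (y + - x)) * cis (- ((y + - x + x) \<bullet> (\<xi> - \<eta>)))) =
        (LINT y|lborel. cnj (\<psi> y) * cis (- ((y + x) \<bullet> (\<xi> - \<eta>))))"
      by (rule integral_lborel_translate(1)[where f = "\<lambda>y. cnj (\<psi> y) * cis (- ((y + x) \<bullet> (\<xi> - \<eta>)))"]) measurable
    also have "\<dots> = (LINT y|lborel. cis (- (x \<bullet> (\<xi> - \<eta>))) * (cnj (\<psi> y) * cis (- (y \<bullet> (\<xi> - \<eta>)))))"
    proof (rule Bochner_Integration.integral_cong[OF refl])
      fix y
      have "cis (- ((y + x) \<bullet> (\<xi> - \<eta>))) = cis (- (x \<bullet> (\<xi> - \<eta>))) * cis (- (y \<bullet> (\<xi> - \<eta>)))"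
        unfolding cis_mult by (rule arg_cong[where f = cis]) (simp add: inner_add_left)
      then show "cnj (\<psi> y) * cis (- ((y + x) \<bullet> (\<xi> - \<eta>))) = cis (- (x \<bullet> (\<xi> - \<eta>))) * (cnj (\<psi> y) * cis (- (y \<bullet> (\<xi> - \<eta>))))"
        by (simp only: mult_ac)
    qed
    also have "\<dots> = cis (- (x \<bullet> (\<xi> - \<eta>))) * fourier (\<lambda>y. cnj (\<psi> y)) (\<xi> - \<eta>)"
      unfolding fourier_def by simp
    also have "cis (- (x \<bullet> (\<xi> - \<eta>))) = cis (- (x \<bullet> \<xi>)) * cis (- (\<eta> \<bullet> (- x)))"
      by (simp add: cis_mult inner_diff_right inner_commute)
    finally show ?thesis by (simp only: mult_ac)
  qed
  have "wave_packet \<psi> (inv_fourier r) x \<xi> =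
    (LINT y|lborel. complex_of_real (inverse ((2 * pi) ^ CARD('n))) * (LINT \<eta>|lborel. F y \<eta>))"
    unfolding wave_packet_def inv_fourier_def
  proof (rule Bochner_Integration.integral_cong[OF refl])
    fix y
    have "(LINT \<eta>|lborel. F y \<eta>) = cnj (\<psi> (y - x)) * (LINT \<eta>|lborel. r \<eta> * cis (y \<bullet> \<eta>)) * cis (- (y \<bullet> \<xi>))"
      unfolding F_def by simp
    then show "cnj (\<psi> (y - x)) * (complex_of_real (inverse ((2 * pi) ^ CARD('n))) * (LINT \<eta>|lborel. r \<eta> * cis (y \<bullet> \<eta>))) * cis (- (y \<bullet> \<xi>))
      = complex_of_real (inverse ((2 * pi) ^ CARD('n))) * (LINT \<eta>|lborel. F y \<eta>)"
      by (simp only: mult_ac)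
  qed
  also have "\<dots> = complex_of_real (inverse ((2 * pi) ^ CARD('n))) * (LINT y|lborel. LINT \<eta>|lborel. F y \<eta>)"
    by (rule Bochner_Integration.integral_mult_right_zero)
  also have "(LINT y|lborel. LINT \<eta>|lborel. F y \<eta>) = (LINT \<eta>|lborel. LINT y|lborel. F y \<eta>)"
    using lborel_pair.Fubini_integral[OF int] by simp
  also have "\<dots> = cis (- (x \<bullet> \<xi>)) * wave_packet (\<lambda>w. cnj (fourier (\<lambda>y. cnj (\<psi> y)) (- w))) r \<xi> (- x)"
    unfolding inner wave_packet_def by simp
  finally show ?thesis .
qed

lemma kern_swap: "kern N (\<xi>, - x) = kern N (x, \<xi>)"
  unfolding kern_def norm_Pair by (simp add: add.commute)

text \<open>On the Fourier side the evolution is multiplication by a member of the growing class, so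
  the transformed family decays uniformly for |t| <= T. The rotation of phase space carries this
  back, as \<open>kern\<close> depends only on the norm.\<close>

lemma free_propagator_decay:
  fixes \<phi>0 :: "real^'n::finite \<Rightarrow> complex"
  assumes "schwartz \<phi>0"
  shows "\<exists>B C. C > 0 \<and> (\<forall>t\<in>{-T..T}. continuous_on UNIV (free_propagator t \<phi>0) \<and>
    (\<forall>y. cmod (free_propagator t \<phi>0 y) \<le> B) \<and>
    (\<forall>x \<xi>. cmod (wave_packet bumpc (free_propagator t \<phi>0) x \<xi>) \<le> C * kern N (x, \<xi>)))"
proof -
  define c where "c = inverse ((2 * pi) ^ CARD('n))"
  have c: "c > 0" unfolding c_def by simp
  define r where "r t \<xi> = fourier \<phi>0 \<xi> * cis (- (t * (norm \<xi>)\<^sup>2 / 2))" for t and \<xi> :: "real^'n"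
  have "RD k j UNIV (\<lambda>_::unit. fourier \<phi>0)" for k j
    by (rule RD_fourier[OF RD_schwartz[OF assms]])
  from RD_reindex[OF this, of "\<lambda>_. ()" "{-T..T}"]
  have "RD k j {-T..T} (\<lambda>_. fourier \<phi>0)" for k j by simp
  from RD_mult[OF this PG_schroedinger_multiplier]
  have rRD: "RD k j {-T..T} r" for k j unfolding r_def .
  have fp: "free_propagator t \<phi>0 = inv_fourier (r t)" for t
    unfolding free_propagator_def r_def by (simp add: mult.commute)
  obtain B where B: "B > 0" "\<And>t \<xi>. t \<in> {-T..T} \<Longrightarrow> (1 + norm \<xi>) ^ 0 * cmod (fourier (r t) \<xi>) \<le> B"
    using fourier_decay[OF rRD, of 0] by blast
  have "RD k j UNIV (\<lambda>_::unit. fourier bumpc)" for k and j :: 'n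
    by (rule RD_fourier[OF RD_bumpc])
  from RD_cnj[OF RD_uminus[OF this]]
  have "RD k j UNIV (\<lambda>(_::unit) w. cnj (fourier bumpc (- w)))" for k and j :: 'n .
  then obtain C where C: "C > 0" "\<And>t x \<xi>. t \<in> {-T..T} \<Longrightarrow>
     cmod (wave_packet (\<lambda>w. cnj (fourier bumpc (- w))) (r t) x \<xi>) \<le> C * kern N (x, \<xi>)"
    using wave_packet_decay[OF _ rRD, where N = N] by blast
  have ib: "integrable lborel (bumpc :: real^'n \<Rightarrow> complex)"
    using decays_integrable0[OF RD_decays[OF RD_bumpc[of 0 undefined "UNIV :: unit set"]], of "()"] by simp
  show ?thesis
  proof (rule exI[of _ "c * B"], rule exI[of _ "c * C"], intro conjI ballI allI)
    show "c * C > 0" using c C(1) by simp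
    fix t assume t: "t \<in> {-T..T}"
    have "continuous_on UNIV (fourier (r t))" by (rule continuous_on_fourier[OF RD_decays[OF rRD[of 0 undefined]] t])
    then have "continuous_on UNIV (\<lambda>y. fourier (r t) (- y))"
      by (rule continuous_on_compose2) (auto intro!: continuous_intros)
    then show "continuous_on UNIV (free_propagator t \<phi>0)"
      unfolding fp inv_fourier_eq_fourier[abs_def] by (intro continuous_on_mult continuous_on_const)
    show "cmod (free_propagator t \<phi>0 y) \<le> c * B" for y
      using B(2)[OF t, of "- y"] c unfolding fp inv_fourier_eq_fourier c_def[symmetric] by (simp add: norm_mult)
    have "integrable lborel (r t)" by (rule decays_integrable0[OF RD_decays[OF rRD[of 0 undefined]] t])
    from wave_packet_inv_fourier[OF ib this]
    show "cmod (wave_packet bumpc (free_propagator t \<phi>0) x \<xi>) \<le> c * C * kern N (x, \<xi>)" for x \<xi>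
      using C(2)[OF t, of \<xi> "- x"] c unfolding fp c_def[symmetric] by (simp add: norm_mult kern_swap mult.assoc)
  qed
qed

lemma schwartz_decays: "schwartz f \<Longrightarrow> decays UNIV (\<lambda>_::unit. f)"
  by (rule RD_decays[OF RD_schwartz[of f 0 undefined]])

lemma wave_packet_cong_AE:
  assumes [measurable]: "\<psi> \<in> borel_measurable borel" "f \<in> borel_measurable borel" "g \<in> borel_measurable borel"
    and "AE y in lborel. f y = g y"
  shows "wave_packet \<psi> f x \<xi> = wave_packet \<psi> g x \<xi>"
  unfolding wave_packet_def
  by (rule integral_cong_AE) (measurable, use assms(4) in \<open>auto elim!: eventually_mono\<close>)

text \<open>Schur's test for the kernel at z - \<Phi> v. Integration in z is a translation; for
  integration in v the point z0, the origin of z under the flow, replaces \<Phi> v by v at the cost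
  L^N. The constant \<open>?a\<close> dominates both integrals and is positive because of its
  summand 1.\<close>

lemma modulation_norm_le:
  fixes f u0 :: "real^'n::finite \<Rightarrow> complex" and \<Phi> :: "(real^'n) \<times> (real^'n) \<Rightarrow> (real^'n) \<times> (real^'n)"
  assumes p: "1 \<le> p" and N: "2 * DIM((real^'n) \<times> (real^'n)) \<le> N" and L: "L \<ge> 1" and c: "c > 0"
    and [measurable]: "\<Phi> \<in> borel_measurable borel" "\<psi> \<in> borel_measurable borel" "\<psi>0 \<in> borel_measurable borel"
      "f \<in> borel_measurable borel" "u0 \<in> borel_measurable borel"
    and \<Phi>: "\<And>z. \<exists>z0. \<forall>v. norm (z0 - v) \<le> L * norm (z - \<Phi> v)"
    and le: "\<And>z. ambiguity \<psi> f z \<le> ennreal c * smear N \<Phi> (ambiguity \<psi>0 u0) z"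
  shows "modulation_norm p p \<psi> f \<le>
    ennreal (c * (L ^ N * kern_mass N TYPE((real^'n) \<times> (real^'n)) + 1)) * modulation_norm p p \<psi>0 u0"
proof -
  define \<kappa> where "\<kappa> = kern_mass N TYPE((real^'n) \<times> (real^'n))"
  have \<kappa>: "\<kappa> \<ge> 0" unfolding \<kappa>_def by simp
  have L1: "L ^ N \<ge> 1" using L by simp
  let ?a = "L ^ N * \<kappa> + 1"
  have a1: "\<kappa> \<le> ?a" using mult_right_mono[OF L1 \<kappa>] by simp
  have a0: "?a > 0" using L1 \<kappa> by (simp add: add_nonneg_pos)
  have "(\<integral>\<^sup>+v. ennreal (kern N (z - \<Phi> v)) \<partial>lborel) \<le> ennreal ?a" for z
  proof -
    obtain z0 where z0: "\<And>v. norm (z0 - v) \<le> L * norm (z - \<Phi> v)" using \<Phi> by blast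
    have "(\<integral>\<^sup>+v. ennreal (kern N (z - \<Phi> v)) \<partial>lborel) \<le> (\<integral>\<^sup>+v. ennreal (L ^ N) * ennreal (kern N (z0 - v)) \<partial>lborel)"
      using kern_scale[OF z0 L, of N] L1
      by (intro nn_integral_mono) (auto simp: ennreal_mult[symmetric] intro!: ennreal_leI)
    also have "\<dots> = ennreal (L ^ N * \<kappa>)"
      using nn_integral_kern(2)[OF N] L1 \<kappa> by (simp add: nn_integral_cmult \<kappa>_def ennreal_mult)
    also have "\<dots> \<le> ennreal ?a" by (intro ennreal_leI) simp
    finally show ?thesis .
  qed
  moreover have "(\<integral>\<^sup>+z. ennreal (kern N (z - \<Phi> v)) \<partial>lborel) \<le> ennreal ?a" for v
    unfolding nn_integral_kern(3)[OF N] \<kappa>_def[symmetric] using a1 by (rule ennreal_leI)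
  ultimately show ?thesis
    unfolding modulation_norm_def \<kappa>_def[symmetric]
    using Schur_test[OF p, of "\<lambda>z. cmod (wave_packet \<psi> f (fst z) (snd z))"
      "\<lambda>z. cmod (wave_packet \<psi>0 u0 (fst z) (snd z))" "\<lambda>z v. ennreal (kern N (z - \<Phi> v))" c ?a]
      le c a0 unfolding smear_def by simp
qed

context subquadratic_potential begin

text \<open>The evolved window is dominated by the bump at time t, the bump at time t by the
  transported data, and the bump at time 0 by \<phi>0. Each link is a smear of the previous one, and
  \<open>smear_smear\<close> collapses the chain to a single kernel.\<close>

lemma modulation_norm_bound:
  fixes \<phi>0 :: "real^'n \<Rightarrow> complex"
  assumes p: "1 \<le> p" and \<phi>0: "schwartz \<phi>0" "\<phi>0 \<noteq> (\<lambda>x. 0)" and T: "T > 0"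
  shows "\<exists>C>0. \<forall>u0 u t. schwartz u0 \<longrightarrow> schroedinger_solution V u0 u \<longrightarrow> t \<in> {-T..T} \<longrightarrow>
    modulation_norm p p (free_propagator t \<phi>0) (u t) \<le> ennreal C * modulation_norm p p \<phi>0 u0"
proof -
  define N where "N = 4 * CARD('n)"
  have N: "4 * CARD('n) \<le> N" and N2: "2 * DIM((real^'n) \<times> (real^'n)) \<le> N" unfolding N_def by simp_all
  define \<kappa> where "\<kappa> = kern_mass N TYPE((real^'n) \<times> (real^'n))"
  have \<kappa>: "\<kappa> \<ge> 0" unfolding \<kappa>_def by simp
  obtain B C where C: "C > 0" and fp: "\<And>t. t \<in> {-T..T} \<Longrightarrow> continuous_on UNIV (free_propagator t \<phi>0)"
    "\<And>t y. t \<in> {-T..T} \<Longrightarrow> cmod (free_propagator t \<phi>0 y) \<le> B"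
    "\<And>t x \<xi>. t \<in> {-T..T} \<Longrightarrow> cmod (wave_packet bumpc (free_propagator t \<phi>0) x \<xi>) \<le> C * kern N (x, \<xi>)"
    using free_propagator_decay[OF \<phi>0(1), of T N] by blast
  have db: "decays UNIV (\<lambda>_::unit. bumpc :: real^'n \<Rightarrow> complex)" by (rule RD_decays[OF RD_bumpc[of 0 undefined]])
  have cb: "continuous_on UNIV (bumpc :: real^'n \<Rightarrow> complex)" using decays_cont[OF db] by blast
  have [measurable]: "(bumpc :: real^'n \<Rightarrow> complex) \<in> borel_measurable borel" using cb by (rule borel_measurable_continuous_onI)
  have b0: "bumpc (0 :: real^'n) \<noteq> 0" by (simp add: bumpc_def less_imp_neq[OF bump_0, symmetric])
  have "\<exists>C>0. \<forall>t\<in>{-T..T}. \<forall>u z. L2_function u \<longrightarrow>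
     ambiguity (free_propagator t \<phi>0) u z \<le> ennreal C * smear N (\<lambda>x. x) (ambiguity bumpc u) z"
    by (rule change_window[OF db b0 fp C N])
  then obtain C3 where C3: "C3 > 0" "\<And>t u z. t \<in> {-T..T} \<Longrightarrow> L2_function u \<Longrightarrow>
     ambiguity (free_propagator t \<phi>0) u z \<le> ennreal C3 * smear N (\<lambda>x. x) (ambiguity bumpc u) z"
    by blast
  have c\<phi>0: "continuous_on UNIV \<phi>0" using decays_cont[OF schwartz_decays[OF \<phi>0(1)]] by blast
  have m\<phi>0[measurable]: "\<phi>0 \<in> borel_measurable borel" using c\<phi>0 by (rule borel_measurable_continuous_onI)
  obtain x0 where x0: "\<phi>0 x0 \<noteq> 0" using \<phi>0(2) by blast
  obtain Bb where Bb: "\<And>y :: real^'n. cmod (bumpc y) \<le> Bb" using decays_bound[OF db, of 0] by auto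
  obtain Cb where Cb: "Cb > 0" "\<And>p x \<xi>. p \<in> (UNIV :: unit set) \<Longrightarrow>
      cmod (wave_packet \<phi>0 bumpc x \<xi>) \<le> Cb * kern N (x, \<xi>)"
    by (rule wave_packet_decay[where N = N and P = "UNIV :: unit set", OF RD_schwartz[OF \<phi>0(1)] RD_bumpc]) (rule that; blast)
  have "\<exists>C>0. \<forall>p\<in>(UNIV :: unit set). \<forall>u z. L2_function u \<longrightarrow>
     ambiguity bumpc u z \<le> ennreal C * smear N (\<lambda>x. x) (ambiguity \<phi>0 u) z"
    by (rule change_window[OF schwartz_decays[OF \<phi>0(1)] x0 cb Bb Cb(2,1) N])
  then obtain C1 where C1: "C1 > 0" "\<And>u z. L2_function u \<Longrightarrow>
     ambiguity bumpc u z \<le> ennreal C1 * smear N (\<lambda>x. x) (ambiguity \<phi>0 u) z"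
    by blast
  obtain \<Phi> L where L: "L \<ge> 1" and \<Phi>: "\<And>v. \<Phi> 0 v = v"
    "\<And>s. s \<in> {-T..T} \<Longrightarrow> \<Phi> s \<in> borel_measurable borel"
    "\<And>t z. t \<in> {-T..T} \<Longrightarrow> \<exists>\<gamma>. \<gamma> t = z \<and>
       (\<forall>s\<in>{-T..T}. (\<gamma> has_vector_derivative field s (\<gamma> s)) (at s)) \<and>
       (\<forall>s\<in>{-T..T}. \<forall>r\<in>{-T..T}. \<forall>v. norm (\<gamma> s - \<Phi> s v) \<le> L * norm (\<gamma> r - \<Phi> r v))"
    apply (rule flow_exists[OF T])
    subgoal premises prems by (rule prems(1)[OF prems(2-)])
    done
  obtain D where D: "D > 0" "\<And>u w t z. is_weak_solution u \<Longrightarrow> w \<in> borel_measurable borel \<Longrightarrow>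
      (\<And>z. ambiguity bumpc (u 0) z \<le> ennreal C1 * smear N (\<lambda>x. x) w z) \<Longrightarrow>
      t \<in> {-T..T} \<Longrightarrow> ambiguity bumpc (u t) z \<le> ennreal D * smear N (\<Phi> t) w z"
    apply (rule overlap_kernel_bound[OF T N C1(1) L \<Phi>], assumption+)
    subgoal premises prems for D by (rule prems(1)[of D, OF prems(2)]) (fact prems(3))
    done
  \<comment> \<open>C3 is the change to the evolved window, D the propagation, and the bracket the
    cost of merging two kernels; the added 1 gives positivity, since \<kappa> is only known to be
    nonnegative.\<close>
  define c where "c = C3 * D * (2 ^ (N + 1) * \<kappa>) + 1"
  have c: "c > 0" unfolding c_def using C3(1) D(1) \<kappa> by (simp add: add_nonneg_pos)
  define a where "a = c * (L ^ N * \<kappa> + 1)"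
  have "a > 0" unfolding a_def using c L \<kappa> by (simp add: add_nonneg_pos)
  moreover have "modulation_norm p p (free_propagator t \<phi>0) (u t) \<le> ennreal a * modulation_norm p p \<phi>0 u0"
    if u0: "schwartz u0" and u: "schroedinger_solution V u0 u" and t: "t \<in> {-T..T}" for u0 u t
  proof -
    have sol: "is_weak_solution u" using u unfolding schroedinger_solution_def is_weak_solution_def by blast
    have L2: "L2_function (u s)" for s using sol unfolding is_weak_solution_def continuous_L2_def by blast
    have um[measurable]: "u s \<in> borel_measurable borel" for s by (rule L2_functionD(1)[OF L2])
    have "continuous_on UNIV u0" using decays_cont[OF schwartz_decays[OF u0]] by blast
    then have u0m[measurable]: "u0 \<in> borel_measurable borel" by (rule borel_measurable_continuous_onI)
    have \<Phi>m[measurable]: "\<Phi> t \<in> borel_measurable borel" by (rule \<Phi>(2)[OF t])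
    \<comment> \<open>The initial condition holds only almost everywhere, but the transform is an
      integral and does not see null sets.\<close>
    have "AE x in lborel. u 0 x = u0 x" using u unfolding schroedinger_solution_def by blast
    then have W0: "ambiguity \<phi>0 (u 0) = ambiguity \<phi>0 u0"
      using wave_packet_cong_AE[OF m\<phi>0 um u0m] by auto
    have wm[measurable]: "ambiguity \<phi>0 u0 \<in> borel_measurable borel" by measurable
    have i0: "ambiguity bumpc (u 0) z \<le> ennreal C1 * smear N (\<lambda>x. x) (ambiguity \<phi>0 u0) z" for z
      using C1(2)[OF L2, of 0 z] unfolding W0 .
    have step: "ambiguity bumpc (u t) z \<le> ennreal D * smear N (\<Phi> t) (ambiguity \<phi>0 u0) z" for z
      by (rule D(2)[OF sol wm i0 t])
    have "ambiguity (free_propagator t \<phi>0) (u t) z \<le> ennreal c * smear N (\<Phi> t) (ambiguity \<phi>0 u0) z" for z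
    proof -
      have "ambiguity (free_propagator t \<phi>0) (u t) z \<le> ennreal C3 * smear N (\<lambda>x. x) (ambiguity bumpc (u t)) z"
        by (rule C3(2)[OF t L2])
      also have "\<dots> \<le> ennreal C3 * smear N (\<lambda>x. x) (\<lambda>z. ennreal D * smear N (\<Phi> t) (ambiguity \<phi>0 u0) z) z"
        unfolding smear_def[of N "\<lambda>x. x"] by (intro mult_left_mono nn_integral_mono step) auto
      also have "smear N (\<lambda>x. x) (\<lambda>z. ennreal D * smear N (\<Phi> t) (ambiguity \<phi>0 u0) z) z =
          ennreal D * smear N (\<lambda>x. x) (smear N (\<Phi> t) (ambiguity \<phi>0 u0)) z"
        unfolding smear_def[of N "\<lambda>x. x"]
        by (subst nn_integral_cmult[symmetric]) (auto simp: mult_ac intro!: nn_integral_cong)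
      also have "ennreal C3 * (ennreal D * smear N (\<lambda>x. x) (smear N (\<Phi> t) (ambiguity \<phi>0 u0)) z) \<le>
          ennreal C3 * (ennreal D * (ennreal (2 ^ (N + 1) * \<kappa>) * smear N (\<Phi> t) (ambiguity \<phi>0 u0) z))"
        unfolding \<kappa>_def by (intro mult_left_mono smear_smear[OF N2 \<Phi>m wm]) auto
      also have "\<dots> = ennreal (C3 * D * (2 ^ (N + 1) * \<kappa>)) * smear N (\<Phi> t) (ambiguity \<phi>0 u0) z"
        using C3(1) D(1) \<kappa> by (simp add: ennreal_mult mult.assoc)
      also have "\<dots> \<le> ennreal c * smear N (\<Phi> t) (ambiguity \<phi>0 u0) z"
        unfolding c_def by (intro mult_right_mono ennreal_leI) auto
      finally show ?thesis .
    qed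
    \<comment> \<open>z0 is the position at time 0 of the trajectory that reaches z at time
      t.\<close>
    moreover have "\<exists>z0. \<forall>v. norm (z0 - v) \<le> L * norm (z - \<Phi> t v)" for z
    proof -
      obtain \<gamma> where \<gamma>: "\<gamma> t = z" "\<forall>s\<in>{-T..T}. \<forall>r\<in>{-T..T}. \<forall>v. norm (\<gamma> s - \<Phi> s v) \<le> L * norm (\<gamma> r - \<Phi> r v)"
        using \<Phi>(3)[OF t, of z] by blast
      have "0 \<in> {-T..T}" using T by simp
      then have "norm (\<gamma> 0 - \<Phi> 0 v) \<le> L * norm (\<gamma> t - \<Phi> t v)" for v using \<gamma>(2) t by blast
      then show ?thesis unfolding \<Phi>(1) \<gamma>(1) by blast
    qed
    ultimately show ?thesis
      unfolding a_def \<kappa>_def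
      by (intro modulation_norm_le[OF p N2 L c \<Phi>m borel_measurable_continuous_onI[OF fp(1)[OF t]] m\<phi>0 um u0m])
  qed
  ultimately show ?thesis by blast
qed

end

theorem theorem1p1:
  fixes p :: ennreal
    and \<phi>0 :: "real^'n::finite \<Rightarrow> complex"
    and \<phi> :: "real \<Rightarrow> real^'n \<Rightarrow> complex"
    and T :: real
    and V :: "real \<Rightarrow> real^'n \<Rightarrow> real"
  assumes "1 \<le> p"
    and "schwartz \<phi>0" and "\<phi>0 \<noteq> (\<lambda>x. 0)"
    and "T > 0"
    and "\<And>t x. \<phi> t x = free_propagator t \<phi>0 x"
    and "smooth (\<lambda>(t, x). V t x)"
    and "\<And>\<alpha> :: 'n multi_index. mi_order \<alpha> \<ge> 2 \<Longrightarrow>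
           \<exists>C>0. \<forall>t x. \<bar>mi_deriv \<alpha> (V t) x\<bar> \<le> C"
  shows "\<exists>C\<^sub>T::real. C\<^sub>T > 0 \<and>
    (\<forall>u0 u. schwartz u0 \<longrightarrow> schroedinger_solution V u0 u \<longrightarrow>
      (\<forall>t\<in>{-T..T}.
        modulation_norm p p (\<phi> t) (u t) \<le> ennreal C\<^sub>T * modulation_norm p p \<phi>0 u0))"
proof -
  interpret subquadratic_potential V
    by unfold_locales (use assms(6,7) in auto)
  have "\<phi> t = free_propagator t \<phi>0" for t using assms(5) by blast
  then show ?thesis using modulation_norm_bound[OF assms(1-4)] by auto
qed

end
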